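(* Let $(\mathcal C,\mathbb E,\mathfrak s)$ be an extriangulated category with weak-kernels, and let $E_{\mathcal C}:=Q\circ\mathbb Y:\mathcal C\to \frac{\operatorname{mod}\mathcal C}{\mathsf{def}\,\mathcal C}$ be the composition of the Yoneda embedding $\mathbb Y:\mathcal C\to\operatorname{mod}\mathcal C$, $X\mapsto \mathcal C(-,X)$, with the Serre quotient functor $Q:\operatorname{mod}\mathcal C\to\frac{\operatorname{mod}\mathcal C}{\mathsf{def}\,\mathcal C}$. Then the following hold. (1) The functor $E_{\mathcal C}$ is exact and fully faithful if and only if $\mathcal C$ is an exact category. (2) The functor $E_{\mathcal C}$ is an exact equivalence if and only if $\mathcal C$ is an abelian category. If this is the case, there is an equivalence $\mathcal C\simeq \mathsf{lex}\,\mathcal C$.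
   Context: All categories and functors are additive; subcategories are full, additive and closed under isomorphisms. Extriangulated category (Nakaoka–Palu). Let $\mathcal C$ be an additive category and $\mathbb E:\mathcal C^{op}\times\mathcal C\to\mathsf{Ab}$ a biadditive functor. An element $\delta\in\mathbb E(X,Z)$ is an $\mathbb E$-extension; for $z:Z\to Z'$ and $x:X'\to X$ put $z_*\delta=\mathbb E(X,z)(\delta)$, $x^*\delta=\mathbb E(x,Z)(\delta)$. A morphism $(z,x):\delta\to\delta'$ from $\delta\in\mathbb E(X,Z)$ to $\delta'\in\mathbb E(X',Z')$ is a pair $z:Z\to Z'$, $x:X\to X'$ with $z_*\delta=x^*\delta'$. Two sequences $Z\to Y\to X$, $Z\to Y'\to X$ are equivalent if there is an isomorphism $Y\cong Y'$ compatible with the maps from $Z$ and to $X$. A realization $\mathfrak s$ assigns to each $\delta\in\mathbb E(X,Z)$ an equivalence class $\mathfrak s(\delta)=[Z\xrightarrow{g}Y\xrightarrow{f}X]$ such that every morphism $(z,x):\delta\to\delta'$ extends to a commutative diagram $(z,y,x)$ between representing sequences. It is additive if $\mathfrak s(0)=[Z\to Z\oplus X\to X]$ (split) and $\mathfrak s(\delta\oplus\delta')=\mathfrak s(\delta)\oplus\mathfrak s(\delta')$. The triple $(\mathcal C,\mathbb E,\mathfrak s)$ is extriangulated if $\mathbb E$ is biadditive (ET1), $\mathfrak s$ is an additive realization (ET2), and: (ET3) if $\mathfrak s(\delta)=[Z\xrightarrow{g}Y\xrightarrow{f}X]$, $\mathfrak s(\delta')=[Z'\xrightarrow{g'}Y'\xrightarrow{f'}X']$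 and $yg=g'z$, there is $x:X\to X'$ with $xf=f'y$ and $(z,x):\delta\to\delta'$ a morphism; (ET4) if $\delta\in\mathbb E(X,Z)$, $\delta'\in\mathbb E(A,Y)$ with $\mathfrak s(\delta)=[Z\xrightarrow{g}Y\xrightarrow{f}X]$, $\mathfrak s(\delta')=[Y\xrightarrow{b}B\xrightarrow{a}A]$, there are an object $C$, morphisms $g'=bg:Z\to B$, $f':B\to C$, $b':X\to C$, $a':C\to A$ with $b'f=f'b$, $a'f'=a$, and $\delta''\in\mathbb E(C,Z)$ with $\mathfrak s(\delta'')=[Z\xrightarrow{g'}B\xrightarrow{f'}C]$, such that $X\xrightarrow{b'}C\xrightarrow{a'}A$ realizes $f_*\delta'$, $b'^*\delta''=\delta$ and $g_*\delta''=a'^*\delta'$; (ET3)$^{op}$, (ET4)$^{op}$: the duals of (ET3), (ET4). A conflation is a sequence $Z\xrightarrow{g}Y\xrightarrow{f}X$ realizing some $\delta\in\mathbb E(X,Z)$; then $g$ is an inflation and $f$ a deflation. "$\mathcal C$ is an exact category" means that the extriangulated structure is the one given by a Quillen exact structure on $\mathcal C$ (i.e. the conflations form a Quillen exact structure). "$\mathcal C$ is an abelian category" means that the underlying category is abelian and the extriangulated structure is the one given by all short exact sequences. $\operatorname{mod}\mathcal C$ is the category of finitely presented contravariant functors $F:\mathcal C\to\mathsf{Ab}$, i.e. those with an exact sequence $\mathcal C(-,X_1)\to\mathcal C(-,X_0)\to F\to0$. $\mathcal C$ has weak-kernels if for each $f:X\to Y$ there is $g:W\to X$ with $\mathcal C(-,W)\to\mathcal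 C(-,X)\to\mathcal C(-,Y)$ exact; then $\operatorname{mod}\mathcal C$ is abelian with exact inclusion into the category of all contravariant functors $\mathcal C\to\mathsf{Ab}$. $\mathsf{def}\,\mathcal C\subseteq\operatorname{mod}\mathcal C$ is the full subcategory of functors isomorphic to defects, i.e. to $\operatorname{Cok}(\mathcal C(-,Y)\xrightarrow{f\circ-}\mathcal C(-,X))$ for some conflation $Z\to Y\xrightarrow{f}X$; it is a Serre subcategory of $\operatorname{mod}\mathcal C$. $\mathsf{lex}\,\mathcal C\subseteq\operatorname{mod}\mathcal C$ is the full subcategory of left exact functors, i.e. those $F$ with $0\to F(X)\to F(Y)\to F(Z)$ exact for every conflation $Z\to Y\to X$. A covariant functor from $\mathcal C$ to an abelian category is exact if it sends each conflation $Z\to Y\to X$ to a short exact sequence $0\to FZ\to FY\to FX\to0$. An exact equivalence is an equivalence of categories that is exact in this sense. *)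

theory Defs
  imports "HOL-Algebra.Coset"
begin

section \<open>Preadditive, additive and abelian categories\<close>

text \<open>Abelian groups are commutative groups in the sense of HOL-Algebra, so the group law
  \<open>\<otimes>\<close> on hom-sets, extension groups and values of functors is the \<^emph>\<open>addition\<close> and
  \<open>\<one>\<close> is the zero element. Every arrow determines its domain and codomain.\<close>

record ('o, 'm) acat =
  Obj :: "'o set"
  Hom :: "'o \<Rightarrow> 'o \<Rightarrow> 'm monoid"
  Dom :: "'m \<Rightarrow> 'o"
  Cod :: "'m \<Rightarrow> 'o"
  Ident :: "'o \<Rightarrow> 'm"
  Comp :: "'m \<Rightarrow> 'm \<Rightarrow> 'm"  (infixl "\<cdot>\<index>" 70)

abbreviation arr :: "('o, 'm, 'z) acat_scheme \<Rightarrow> 'o \<Rightarrow> 'o \<Rightarrow> 'm set" where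
  "arr C X Y \<equiv> carrier (Hom C X Y)"

abbreviation zero_arr :: "('o, 'm, 'z) acat_scheme \<Rightarrow> 'o \<Rightarrow> 'o \<Rightarrow> 'm" where
  "zero_arr C X Y \<equiv> \<one>\<^bsub>Hom C X Y\<^esub>"

definition preadditive :: "('o, 'm, 'z) acat_scheme \<Rightarrow> bool" where
  "preadditive C \<longleftrightarrow>
     (\<forall>X\<in>Obj C. \<forall>Y\<in>Obj C. comm_group (Hom C X Y)) \<and>
     (\<forall>X\<in>Obj C. \<forall>Y\<in>Obj C. \<forall>f\<in>arr C X Y. Dom C f = X \<and> Cod C f = Y) \<and>
     (\<forall>X\<in>Obj C. Ident C X \<in> arr C X X) \<and>
     (\<forall>X\<in>Obj C. \<forall>Y\<in>Obj C. \<forall>f\<in>arr C X Y. f \<cdot>\<^bsub>C\<^esub> Ident C X = f \<and> Ident C Y \<cdot>\<^bsub>C\<^esub> f = f) \<and>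
     (\<forall>X\<in>Obj C. \<forall>Y\<in>Obj C. \<forall>Z\<in>Obj C. \<forall>f\<in>arr C X Y. \<forall>g\<in>arr C Y Z. g \<cdot>\<^bsub>C\<^esub> f \<in> arr C X Z) \<and>
     (\<forall>W\<in>Obj C. \<forall>X\<in>Obj C. \<forall>Y\<in>Obj C. \<forall>Z\<in>Obj C.
        \<forall>f\<in>arr C W X. \<forall>g\<in>arr C X Y. \<forall>h\<in>arr C Y Z.
          (h \<cdot>\<^bsub>C\<^esub> g) \<cdot>\<^bsub>C\<^esub> f = h \<cdot>\<^bsub>C\<^esub> (g \<cdot>\<^bsub>C\<^esub> f)) \<and>
     (\<forall>X\<in>Obj C. \<forall>Y\<in>Obj C. \<forall>Z\<in>Obj C. \<forall>f\<in>arr C X Y. \<forall>f'\<in>arr C X Y. \<forall>g\<in>arr C Y Z. \<forall>g'\<in>arr C Y Z.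
        g \<cdot>\<^bsub>C\<^esub> (f \<otimes>\<^bsub>Hom C X Y\<^esub> f') = (g \<cdot>\<^bsub>C\<^esub> f) \<otimes>\<^bsub>Hom C X Z\<^esub> (g \<cdot>\<^bsub>C\<^esub> f') \<and>
        (g \<otimes>\<^bsub>Hom C Y Z\<^esub> g') \<cdot>\<^bsub>C\<^esub> f = (g \<cdot>\<^bsub>C\<^esub> f) \<otimes>\<^bsub>Hom C X Z\<^esub> (g' \<cdot>\<^bsub>C\<^esub> f))"

definition zero_object :: "('o, 'm, 'z) acat_scheme \<Rightarrow> 'o \<Rightarrow> bool" where
  "zero_object C N \<longleftrightarrow> N \<in> Obj C \<and> (\<forall>X\<in>Obj C. (\<exists>!f. f \<in> arr C X N) \<and> (\<exists>!f. f \<in> arr C N X))"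

definition biproduct ::
  "('o, 'm, 'z) acat_scheme \<Rightarrow> 'o \<Rightarrow> 'o \<Rightarrow> 'o \<Rightarrow> 'm \<Rightarrow> 'm \<Rightarrow> 'm \<Rightarrow> 'm \<Rightarrow> bool" where
  "biproduct C X Y P i j p q \<longleftrightarrow>
     P \<in> Obj C \<and> i \<in> arr C X P \<and> j \<in> arr C Y P \<and> p \<in> arr C P X \<and> q \<in> arr C P Y \<and>
     p \<cdot>\<^bsub>C\<^esub> i = Ident C X \<and> q \<cdot>\<^bsub>C\<^esub> j = Ident C Y \<and>
     p \<cdot>\<^bsub>C\<^esub> j = zero_arr C Y X \<and> q \<cdot>\<^bsub>C\<^esub> i = zero_arr C X Y \<and>
     (i \<cdot>\<^bsub>C\<^esub> p) \<otimes>\<^bsub>Hom C P P\<^esub> (j \<cdot>\<^bsub>C\<^esub> q) = Ident C P"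

definition additive_category :: "('o, 'm, 'z) acat_scheme \<Rightarrow> bool" where
  "additive_category C \<longleftrightarrow> preadditive C \<and> (\<exists>N. zero_object C N) \<and>
     (\<forall>X\<in>Obj C. \<forall>Y\<in>Obj C. \<exists>P i j p q. biproduct C X Y P i j p q)"

definition iso_arr :: "('o, 'm, 'z) acat_scheme \<Rightarrow> 'o \<Rightarrow> 'o \<Rightarrow> 'm \<Rightarrow> bool" where
  "iso_arr C X Y f \<longleftrightarrow> f \<in> arr C X Y \<and> (\<exists>g\<in>arr C Y X. g \<cdot>\<^bsub>C\<^esub> f = Ident C X \<and> f \<cdot>\<^bsub>C\<^esub> g = Ident C Y)"

definition monic :: "('o, 'm, 'z) acat_scheme \<Rightarrow> 'o \<Rightarrow> 'o \<Rightarrow> 'm \<Rightarrow> bool" where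
  "monic C X Y f \<longleftrightarrow> f \<in> arr C X Y \<and>
     (\<forall>T\<in>Obj C. \<forall>u\<in>arr C T X. \<forall>v\<in>arr C T X. f \<cdot>\<^bsub>C\<^esub> u = f \<cdot>\<^bsub>C\<^esub> v \<longrightarrow> u = v)"

definition epic :: "('o, 'm, 'z) acat_scheme \<Rightarrow> 'o \<Rightarrow> 'o \<Rightarrow> 'm \<Rightarrow> bool" where
  "epic C X Y f \<longleftrightarrow> f \<in> arr C X Y \<and>
     (\<forall>T\<in>Obj C. \<forall>u\<in>arr C Y T. \<forall>v\<in>arr C Y T. u \<cdot>\<^bsub>C\<^esub> f = v \<cdot>\<^bsub>C\<^esub> f \<longrightarrow> u = v)"

definition is_kernel :: "('o, 'm, 'z) acat_scheme \<Rightarrow> 'o \<Rightarrow> 'o \<Rightarrow> 'o \<Rightarrow> 'm \<Rightarrow> 'm \<Rightarrow> bool" where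
  "is_kernel C K X Y k f \<longleftrightarrow>
     K \<in> Obj C \<and> X \<in> Obj C \<and> Y \<in> Obj C \<and> k \<in> arr C K X \<and> f \<in> arr C X Y \<and>
     f \<cdot>\<^bsub>C\<^esub> k = zero_arr C K Y \<and>
     (\<forall>T\<in>Obj C. \<forall>t\<in>arr C T X. f \<cdot>\<^bsub>C\<^esub> t = zero_arr C T Y \<longrightarrow> (\<exists>!u. u \<in> arr C T K \<and> k \<cdot>\<^bsub>C\<^esub> u = t))"

definition is_cokernel :: "('o, 'm, 'z) acat_scheme \<Rightarrow> 'o \<Rightarrow> 'o \<Rightarrow> 'o \<Rightarrow> 'm \<Rightarrow> 'm \<Rightarrow> bool" where
  "is_cokernel C X Y Q f c \<longleftrightarrow>
     X \<in> Obj C \<and> Y \<in> Obj C \<and> Q \<in> Obj C \<and> f \<in> arr C X Y \<and> c \<in> arr C Y Q \<and>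
     c \<cdot>\<^bsub>C\<^esub> f = zero_arr C X Q \<and>
     (\<forall>T\<in>Obj C. \<forall>t\<in>arr C Y T. t \<cdot>\<^bsub>C\<^esub> f = zero_arr C X T \<longrightarrow> (\<exists>!u. u \<in> arr C Q T \<and> u \<cdot>\<^bsub>C\<^esub> c = t))"

text \<open>Exactness of \<open>0 \<rightarrow> Z \<rightarrow> Y \<rightarrow> X \<rightarrow> 0\<close>: the sequence is a kernel-cokernel pair.\<close>

definition short_exact :: "('o, 'm, 'z) acat_scheme \<Rightarrow> 'o \<Rightarrow> 'o \<Rightarrow> 'o \<Rightarrow> 'm \<Rightarrow> 'm \<Rightarrow> bool" where
  "short_exact C Z Y X g f \<longleftrightarrow> is_kernel C Z Y X g f \<and> is_cokernel C Z Y X g f"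

definition abelian_category :: "('o, 'm, 'z) acat_scheme \<Rightarrow> bool" where
  "abelian_category C \<longleftrightarrow> additive_category C \<and>
     (\<forall>X\<in>Obj C. \<forall>Y\<in>Obj C. \<forall>f\<in>arr C X Y.
        (\<exists>K k. is_kernel C K X Y k f) \<and> (\<exists>Q c. is_cokernel C X Y Q f c)) \<and>
     (\<forall>X\<in>Obj C. \<forall>Y\<in>Obj C. \<forall>f. monic C X Y f \<longrightarrow> (\<exists>W h. is_kernel C X Y W f h)) \<and>
     (\<forall>X\<in>Obj C. \<forall>Y\<in>Obj C. \<forall>f. epic C X Y f \<longrightarrow> (\<exists>W h. is_cokernel C W X Y h f))"

definition is_pullback ::
  "('o, 'm, 'z) acat_scheme \<Rightarrow> 'o \<Rightarrow> 'o \<Rightarrow> 'o \<Rightarrow> 'o \<Rightarrow> 'm \<Rightarrow> 'm \<Rightarrow> 'm \<Rightarrow> 'm \<Rightarrow> bool" where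
  "is_pullback C P A B D p q a b \<longleftrightarrow>
     P \<in> Obj C \<and> p \<in> arr C P A \<and> q \<in> arr C P B \<and> a \<in> arr C A D \<and> b \<in> arr C B D \<and>
     a \<cdot>\<^bsub>C\<^esub> p = b \<cdot>\<^bsub>C\<^esub> q \<and>
     (\<forall>T\<in>Obj C. \<forall>u\<in>arr C T A. \<forall>v\<in>arr C T B. a \<cdot>\<^bsub>C\<^esub> u = b \<cdot>\<^bsub>C\<^esub> v \<longrightarrow>
        (\<exists>!w. w \<in> arr C T P \<and> p \<cdot>\<^bsub>C\<^esub> w = u \<and> q \<cdot>\<^bsub>C\<^esub> w = v))"

definition is_pushout ::
  "('o, 'm, 'z) acat_scheme \<Rightarrow> 'o \<Rightarrow> 'o \<Rightarrow> 'o \<Rightarrow> 'o \<Rightarrow> 'm \<Rightarrow> 'm \<Rightarrow> 'm \<Rightarrow> 'm \<Rightarrow> bool" where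
  "is_pushout C D A B P a b p q \<longleftrightarrow>
     P \<in> Obj C \<and> a \<in> arr C D A \<and> b \<in> arr C D B \<and> p \<in> arr C A P \<and> q \<in> arr C B P \<and>
     p \<cdot>\<^bsub>C\<^esub> a = q \<cdot>\<^bsub>C\<^esub> b \<and>
     (\<forall>T\<in>Obj C. \<forall>u\<in>arr C A T. \<forall>v\<in>arr C B T. u \<cdot>\<^bsub>C\<^esub> a = v \<cdot>\<^bsub>C\<^esub> b \<longrightarrow>
        (\<exists>!w. w \<in> arr C P T \<and> w \<cdot>\<^bsub>C\<^esub> p = u \<and> w \<cdot>\<^bsub>C\<^esub> q = v))"


section \<open>Quillen exact structures\<close>

text \<open>The axioms are those of Buehler (Exact categories, Expo. Math. 2010). A class of sequences
  \<open>Z \<rightarrow> Y \<rightarrow> X\<close> with maps \<open>g\<close>, \<open>f\<close> is given by the predicate \<open>K Z Y X g f\<close>.\<close>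

definition adm_monic :: "('o \<Rightarrow> 'o \<Rightarrow> 'o \<Rightarrow> 'm \<Rightarrow> 'm \<Rightarrow> bool) \<Rightarrow> 'o \<Rightarrow> 'o \<Rightarrow> 'm \<Rightarrow> bool" where
  "adm_monic K Z Y g \<longleftrightarrow> (\<exists>X f. K Z Y X g f)"

definition adm_epic :: "('o \<Rightarrow> 'o \<Rightarrow> 'o \<Rightarrow> 'm \<Rightarrow> 'm \<Rightarrow> bool) \<Rightarrow> 'o \<Rightarrow> 'o \<Rightarrow> 'm \<Rightarrow> bool" where
  "adm_epic K Y X f \<longleftrightarrow> (\<exists>Z g. K Z Y X g f)"

definition quillen_exact ::
  "('o, 'm, 'z) acat_scheme \<Rightarrow> ('o \<Rightarrow> 'o \<Rightarrow> 'o \<Rightarrow> 'm \<Rightarrow> 'm \<Rightarrow> bool) \<Rightarrow> bool" where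
  "quillen_exact C K \<longleftrightarrow>
     additive_category C \<and>
     (\<forall>Z Y X g f. K Z Y X g f \<longrightarrow> short_exact C Z Y X g f) \<and>
     (\<forall>Z Y X g f. \<forall>Z'\<in>Obj C. \<forall>Y'\<in>Obj C. \<forall>X'\<in>Obj C. \<forall>g'\<in>arr C Z' Y'. \<forall>f'\<in>arr C Y' X'. \<forall>z y x.
        K Z Y X g f \<and> iso_arr C Z Z' z \<and> iso_arr C Y Y' y \<and> iso_arr C X X' x \<and>
        y \<cdot>\<^bsub>C\<^esub> g = g' \<cdot>\<^bsub>C\<^esub> z \<and> x \<cdot>\<^bsub>C\<^esub> f = f' \<cdot>\<^bsub>C\<^esub> y \<longrightarrow> K Z' Y' X' g' f') \<and>
     (\<forall>X\<in>Obj C. adm_monic K X X (Ident C X) \<and> adm_epic K X X (Ident C X)) \<and>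
     (\<forall>X Y Z f g. adm_monic K X Y f \<and> adm_monic K Y Z g \<longrightarrow> adm_monic K X Z (g \<cdot>\<^bsub>C\<^esub> f)) \<and>
     (\<forall>X Y Z f g. adm_epic K X Y f \<and> adm_epic K Y Z g \<longrightarrow> adm_epic K X Z (g \<cdot>\<^bsub>C\<^esub> f)) \<and>
     (\<forall>Z Y g. \<forall>Z'\<in>Obj C. \<forall>z\<in>arr C Z Z'. adm_monic K Z Y g \<longrightarrow>
        (\<exists>P g' y. is_pushout C Z Y Z' P g z y g' \<and> adm_monic K Z' P g')) \<and>
     (\<forall>Y X f. \<forall>X'\<in>Obj C. \<forall>x\<in>arr C X' X. adm_epic K Y X f \<longrightarrow>
        (\<exists>P f' y. is_pullback C P Y X' X y f' f x \<and> adm_epic K P X' f'))"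


section \<open>Extriangulated categories\<close>

text \<open>\<open>EMap C x z\<close> is the map \<open>E(X,Z) \<rightarrow> E(X',Z')\<close> induced by \<open>x : X' \<rightarrow> X\<close> and
  \<open>z : Z \<rightarrow> Z'\<close>. For \<open>\<delta> \<in> E(X,Z)\<close>, \<open>Rlz C X Z \<delta>\<close> is the equivalence class
  of sequences realizing \<open>\<delta>\<close>; it consists of triples \<open>(Y, g, f)\<close> standing for
  \<open>Z \<rightarrow> Y \<rightarrow> X\<close> with maps \<open>g\<close> and \<open>f\<close>.\<close>

record ('o, 'm, 'e) extri = "('o, 'm) acat" +
  Ext :: "'o \<Rightarrow> 'o \<Rightarrow> 'e monoid"
  EMap :: "'m \<Rightarrow> 'm \<Rightarrow> 'e \<Rightarrow> 'e"
  Rlz :: "'o \<Rightarrow> 'o \<Rightarrow> 'e \<Rightarrow> ('o \<times> 'm \<times> 'm) set"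

definition pushf :: "('o, 'm, 'e) extri \<Rightarrow> 'o \<Rightarrow> 'm \<Rightarrow> 'e \<Rightarrow> 'e" where
  "pushf C X z \<delta> = EMap C (Ident C X) z \<delta>"

definition pullb :: "('o, 'm, 'e) extri \<Rightarrow> 'o \<Rightarrow> 'm \<Rightarrow> 'e \<Rightarrow> 'e" where
  "pullb C Z x \<delta> = EMap C x (Ident C Z) \<delta>"

definition ext_morphism ::
  "('o, 'm, 'e) extri \<Rightarrow> 'o \<Rightarrow> 'o \<Rightarrow> 'e \<Rightarrow> 'o \<Rightarrow> 'o \<Rightarrow> 'e \<Rightarrow> 'm \<Rightarrow> 'm \<Rightarrow> bool" where
  "ext_morphism C X Z \<delta> X' Z' \<delta>' z x \<longleftrightarrow>
     z \<in> arr C Z Z' \<and> x \<in> arr C X X' \<and> pushf C X z \<delta> = pullb C Z' x \<delta>'"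

definition sequences :: "('o, 'm, 'z) acat_scheme \<Rightarrow> 'o \<Rightarrow> 'o \<Rightarrow> ('o \<times> 'm \<times> 'm) set" where
  "sequences C X Z = {(Y, g, f). Y \<in> Obj C \<and> g \<in> arr C Z Y \<and> f \<in> arr C Y X}"

definition seq_equiv ::
  "('o, 'm, 'z) acat_scheme \<Rightarrow> 'o \<Rightarrow> 'o \<Rightarrow> (('o \<times> 'm \<times> 'm) \<times> ('o \<times> 'm \<times> 'm)) set" where
  "seq_equiv C X Z = {((Y, g, f), (Y', g', f')).
     (Y, g, f) \<in> sequences C X Z \<and> (Y', g', f') \<in> sequences C X Z \<and>
     (\<exists>y. iso_arr C Y Y' y \<and> y \<cdot>\<^bsub>C\<^esub> g = g' \<and> f' \<cdot>\<^bsub>C\<^esub> y = f)}"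

definition biadditive_functor :: "('o, 'm, 'e) extri \<Rightarrow> bool" where
  "biadditive_functor C \<longleftrightarrow>
     (\<forall>X\<in>Obj C. \<forall>Z\<in>Obj C. comm_group (Ext C X Z)) \<and>
     (\<forall>X\<in>Obj C. \<forall>X'\<in>Obj C. \<forall>Z\<in>Obj C. \<forall>Z'\<in>Obj C. \<forall>x\<in>arr C X' X. \<forall>z\<in>arr C Z Z'.
        EMap C x z \<in> hom (Ext C X Z) (Ext C X' Z')) \<and>
     (\<forall>X\<in>Obj C. \<forall>Z\<in>Obj C. \<forall>\<delta>\<in>carrier (Ext C X Z). EMap C (Ident C X) (Ident C Z) \<delta> = \<delta>) \<and>
     (\<forall>X\<in>Obj C. \<forall>X'\<in>Obj C. \<forall>X''\<in>Obj C. \<forall>Z\<in>Obj C. \<forall>Z'\<in>Obj C. \<forall>Z''\<in>Obj C.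
        \<forall>x\<in>arr C X' X. \<forall>x'\<in>arr C X'' X'. \<forall>z\<in>arr C Z Z'. \<forall>z'\<in>arr C Z' Z''.
        \<forall>\<delta>\<in>carrier (Ext C X Z).
          EMap C (x \<cdot>\<^bsub>C\<^esub> x') (z' \<cdot>\<^bsub>C\<^esub> z) \<delta> = EMap C x' z' (EMap C x z \<delta>)) \<and>
     (\<forall>X\<in>Obj C. \<forall>X'\<in>Obj C. \<forall>Z\<in>Obj C. \<forall>Z'\<in>Obj C.
        \<forall>x\<in>arr C X' X. \<forall>y\<in>arr C X' X. \<forall>z\<in>arr C Z Z'. \<forall>w\<in>arr C Z Z'. \<forall>\<delta>\<in>carrier (Ext C X Z).
          EMap C (x \<otimes>\<^bsub>Hom C X' X\<^esub> y) z \<delta> = EMap C x z \<delta> \<otimes>\<^bsub>Ext C X' Z'\<^esub> EMap C y z \<delta> \<and>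
          EMap C x (z \<otimes>\<^bsub>Hom C Z Z'\<^esub> w) \<delta> = EMap C x z \<delta> \<otimes>\<^bsub>Ext C X' Z'\<^esub> EMap C x w \<delta>)"

definition realization :: "('o, 'm, 'e) extri \<Rightarrow> bool" where
  "realization C \<longleftrightarrow>
     (\<forall>X\<in>Obj C. \<forall>Z\<in>Obj C. \<forall>\<delta>\<in>carrier (Ext C X Z).
        Rlz C X Z \<delta> \<in> sequences C X Z // seq_equiv C X Z) \<and>
     (\<forall>X\<in>Obj C. \<forall>Z\<in>Obj C. \<forall>X'\<in>Obj C. \<forall>Z'\<in>Obj C.
        \<forall>\<delta>\<in>carrier (Ext C X Z). \<forall>\<delta>'\<in>carrier (Ext C X' Z'). \<forall>z x Y g f Y' g' f'.
          ext_morphism C X Z \<delta> X' Z' \<delta>' z x \<and>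
          (Y, g, f) \<in> Rlz C X Z \<delta> \<and> (Y', g', f') \<in> Rlz C X' Z' \<delta>' \<longrightarrow>
          (\<exists>y\<in>arr C Y Y'. y \<cdot>\<^bsub>C\<^esub> g = g' \<cdot>\<^bsub>C\<^esub> z \<and> x \<cdot>\<^bsub>C\<^esub> f = f' \<cdot>\<^bsub>C\<^esub> y))"

text \<open>In the second clause below, \<open>\<delta> \<oplus> \<delta>'\<close> is the element
  \<open>i\<^sub>* p\<^sup>* \<delta> + j\<^sub>* q\<^sup>* \<delta>'\<close> of \<open>E(X \<oplus> X', Z \<oplus> Z')\<close>, that is, the element with
  components \<open>(\<delta>, 0, 0, \<delta>')\<close>, and the direct sum of two maps is formed likewise.\<close>

definition additive_realization :: "('o, 'm, 'e) extri \<Rightarrow> bool" where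
  "additive_realization C \<longleftrightarrow> realization C \<and>
     (\<forall>X\<in>Obj C. \<forall>Z\<in>Obj C. \<forall>P i j p q. biproduct C Z X P i j p q \<longrightarrow>
        (P, i, q) \<in> Rlz C X Z \<one>\<^bsub>Ext C X Z\<^esub>) \<and>
     (\<forall>X\<in>Obj C. \<forall>Z\<in>Obj C. \<forall>X'\<in>Obj C. \<forall>Z'\<in>Obj C.
        \<forall>\<delta>\<in>carrier (Ext C X Z). \<forall>\<delta>'\<in>carrier (Ext C X' Z').
        \<forall>Y g f Y' g' f' PX iX jX pX qX PY iY jY pY qY PZ iZ jZ pZ qZ.
          (Y, g, f) \<in> Rlz C X Z \<delta> \<and> (Y', g', f') \<in> Rlz C X' Z' \<delta>' \<and>
          biproduct C X X' PX iX jX pX qX \<and> biproduct C Y Y' PY iY jY pY qY \<and>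
          biproduct C Z Z' PZ iZ jZ pZ qZ \<longrightarrow>
          (PY,
           (iY \<cdot>\<^bsub>C\<^esub> g \<cdot>\<^bsub>C\<^esub> pZ) \<otimes>\<^bsub>Hom C PZ PY\<^esub> (jY \<cdot>\<^bsub>C\<^esub> g' \<cdot>\<^bsub>C\<^esub> qZ),
           (iX \<cdot>\<^bsub>C\<^esub> f \<cdot>\<^bsub>C\<^esub> pY) \<otimes>\<^bsub>Hom C PY PX\<^esub> (jX \<cdot>\<^bsub>C\<^esub> f' \<cdot>\<^bsub>C\<^esub> qY))
          \<in> Rlz C PX PZ (EMap C pX iZ \<delta> \<otimes>\<^bsub>Ext C PX PZ\<^esub> EMap C qX jZ \<delta>'))"

definition ET3 :: "('o, 'm, 'e) extri \<Rightarrow> bool" where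
  "ET3 C \<longleftrightarrow>
     (\<forall>X\<in>Obj C. \<forall>Z\<in>Obj C. \<forall>X'\<in>Obj C. \<forall>Z'\<in>Obj C.
        \<forall>\<delta>\<in>carrier (Ext C X Z). \<forall>\<delta>'\<in>carrier (Ext C X' Z').
        \<forall>Y g f Y' g' f'. \<forall>z\<in>arr C Z Z'. \<forall>y\<in>arr C Y Y'.
          (Y, g, f) \<in> Rlz C X Z \<delta> \<and> (Y', g', f') \<in> Rlz C X' Z' \<delta>' \<and> y \<cdot>\<^bsub>C\<^esub> g = g' \<cdot>\<^bsub>C\<^esub> z \<longrightarrow>
          (\<exists>x\<in>arr C X X'. x \<cdot>\<^bsub>C\<^esub> f = f' \<cdot>\<^bsub>C\<^esub> y \<and> ext_morphism C X Z \<delta> X' Z' \<delta>' z x))"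

definition ET4 :: "('o, 'm, 'e) extri \<Rightarrow> bool" where
  "ET4 C \<longleftrightarrow>
     (\<forall>X\<in>Obj C. \<forall>Z\<in>Obj C. \<forall>Y\<in>Obj C. \<forall>A\<in>Obj C.
        \<forall>\<delta>\<in>carrier (Ext C X Z). \<forall>\<delta>'\<in>carrier (Ext C A Y). \<forall>g f B b a.
          (Y, g, f) \<in> Rlz C X Z \<delta> \<and> (B, b, a) \<in> Rlz C A Y \<delta>' \<longrightarrow>
          (\<exists>D\<in>Obj C. \<exists>f'\<in>arr C B D. \<exists>b'\<in>arr C X D. \<exists>a'\<in>arr C D A. \<exists>\<delta>''\<in>carrier (Ext C D Z).
             b' \<cdot>\<^bsub>C\<^esub> f = f' \<cdot>\<^bsub>C\<^esub> b \<and> a' \<cdot>\<^bsub>C\<^esub> f' = a \<and>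
             (B, b \<cdot>\<^bsub>C\<^esub> g, f') \<in> Rlz C D Z \<delta>'' \<and>
             (D, b', a') \<in> Rlz C A X (pushf C A f \<delta>') \<and>
             pullb C Z b' \<delta>'' = \<delta> \<and>
             pushf C D g \<delta>'' = pullb C Y a' \<delta>'))"

definition op_extri :: "('o, 'm, 'e) extri \<Rightarrow> ('o, 'm, 'e) extri" where
  "op_extri C = \<lparr>
     Obj = Obj C,
     Hom = (\<lambda>X Y. Hom C Y X),
     Dom = Cod C,
     Cod = Dom C,
     Ident = Ident C,
     Comp = (\<lambda>g f. f \<cdot>\<^bsub>C\<^esub> g),
     Ext = (\<lambda>X Z. Ext C Z X),
     EMap = (\<lambda>x z. EMap C z x),
     Rlz = (\<lambda>X Z \<delta>. {(Y, g, f). (Y, f, g) \<in> Rlz C Z X \<delta>})\<rparr>"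

definition extriangulated :: "('o, 'm, 'e) extri \<Rightarrow> bool" where
  "extriangulated C \<longleftrightarrow>
     additive_category C \<and> biadditive_functor C \<and> additive_realization C \<and>
     ET3 C \<and> ET4 C \<and> ET3 (op_extri C) \<and> ET4 (op_extri C)"

definition conflation :: "('o, 'm, 'e) extri \<Rightarrow> 'o \<Rightarrow> 'o \<Rightarrow> 'o \<Rightarrow> 'm \<Rightarrow> 'm \<Rightarrow> bool" where
  "conflation C Z Y X g f \<longleftrightarrow>
     Z \<in> Obj C \<and> X \<in> Obj C \<and> (\<exists>\<delta>\<in>carrier (Ext C X Z). (Y, g, f) \<in> Rlz C X Z \<delta>)"

definition is_exact_category :: "('o, 'm, 'e) extri \<Rightarrow> bool" where
  "is_exact_category C \<longleftrightarrow> quillen_exact C (conflation C)"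

definition is_abelian_category :: "('o, 'm, 'e) extri \<Rightarrow> bool" where
  "is_abelian_category C \<longleftrightarrow> abelian_category C \<and>
     (\<forall>Z Y X g f. conflation C Z Y X g f \<longleftrightarrow> short_exact C Z Y X g f)"

definition has_weak_kernels :: "('o, 'm, 'z) acat_scheme \<Rightarrow> bool" where
  "has_weak_kernels C \<longleftrightarrow>
     (\<forall>X\<in>Obj C. \<forall>Y\<in>Obj C. \<forall>f\<in>arr C X Y. \<exists>W\<in>Obj C. \<exists>g\<in>arr C W X. \<forall>V\<in>Obj C.
        (\<lambda>h. g \<cdot>\<^bsub>C\<^esub> h) ` arr C V W = {k \<in> arr C V X. f \<cdot>\<^bsub>C\<^esub> k = zero_arr C V Y})"


section \<open>Functors and equivalences\<close>

record ('o, 'm, 'p, 'n) fctr =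
  FOb :: "'o \<Rightarrow> 'p"
  FAr :: "'m \<Rightarrow> 'n"

definition additive_functor ::
  "('o, 'm, 'z) acat_scheme \<Rightarrow> ('p, 'n, 'y) acat_scheme \<Rightarrow> ('o, 'm, 'p, 'n) fctr \<Rightarrow> bool" where
  "additive_functor C D F \<longleftrightarrow>
     (\<forall>X\<in>Obj C. FOb F X \<in> Obj D) \<and>
     (\<forall>X\<in>Obj C. \<forall>Y\<in>Obj C. FAr F \<in> hom (Hom C X Y) (Hom D (FOb F X) (FOb F Y))) \<and>
     (\<forall>X\<in>Obj C. FAr F (Ident C X) = Ident D (FOb F X)) \<and>
     (\<forall>X\<in>Obj C. \<forall>Y\<in>Obj C. \<forall>Z\<in>Obj C. \<forall>f\<in>arr C X Y. \<forall>g\<in>arr C Y Z.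
        FAr F (g \<cdot>\<^bsub>C\<^esub> f) = FAr F g \<cdot>\<^bsub>D\<^esub> FAr F f)"

definition fctr_id :: "('o, 'm, 'o, 'm) fctr" where
  "fctr_id = \<lparr>FOb = (\<lambda>X. X), FAr = (\<lambda>f. f)\<rparr>"

definition fctr_comp ::
  "('p, 'n, 'q, 'l) fctr \<Rightarrow> ('o, 'm, 'p, 'n) fctr \<Rightarrow> ('o, 'm, 'q, 'l) fctr" where
  "fctr_comp G F = \<lparr>FOb = (\<lambda>X. FOb G (FOb F X)), FAr = (\<lambda>f. FAr G (FAr F f))\<rparr>"

definition naturally_isomorphic ::
  "('o, 'm, 'z) acat_scheme \<Rightarrow> ('p, 'n, 'y) acat_scheme \<Rightarrow>
   ('o, 'm, 'p, 'n) fctr \<Rightarrow> ('o, 'm, 'p, 'n) fctr \<Rightarrow> bool" where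
  "naturally_isomorphic C D F G \<longleftrightarrow>
     (\<exists>\<eta>. (\<forall>X\<in>Obj C. iso_arr D (FOb F X) (FOb G X) (\<eta> X)) \<and>
          (\<forall>X\<in>Obj C. \<forall>Y\<in>Obj C. \<forall>f\<in>arr C X Y. \<eta> Y \<cdot>\<^bsub>D\<^esub> FAr F f = FAr G f \<cdot>\<^bsub>D\<^esub> \<eta> X))"

definition is_equivalence ::
  "('o, 'm, 'z) acat_scheme \<Rightarrow> ('p, 'n, 'y) acat_scheme \<Rightarrow> ('o, 'm, 'p, 'n) fctr \<Rightarrow> bool" where
  "is_equivalence C D F \<longleftrightarrow> additive_functor C D F \<and>
     (\<exists>G. additive_functor D C G \<and>
          naturally_isomorphic C C (fctr_comp G F) fctr_id \<and>
          naturally_isomorphic D D (fctr_comp F G) fctr_id)"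

definition equivalent_categories ::
  "('o, 'm, 'z) acat_scheme \<Rightarrow> ('p, 'n, 'y) acat_scheme \<Rightarrow> bool" where
  "equivalent_categories C D \<longleftrightarrow> (\<exists>F. is_equivalence C D F)"

definition fully_faithful ::
  "('o, 'm, 'z) acat_scheme \<Rightarrow> ('p, 'n, 'y) acat_scheme \<Rightarrow> ('o, 'm, 'p, 'n) fctr \<Rightarrow> bool" where
  "fully_faithful C D F \<longleftrightarrow> additive_functor C D F \<and>
     (\<forall>X\<in>Obj C. \<forall>Y\<in>Obj C. bij_betw (FAr F) (arr C X Y) (arr D (FOb F X) (FOb F Y)))"

definition exact_functor ::
  "('o, 'm, 'e) extri \<Rightarrow> ('p, 'n, 'y) acat_scheme \<Rightarrow> ('o, 'm, 'p, 'n) fctr \<Rightarrow> bool" where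
  "exact_functor C D F \<longleftrightarrow> additive_functor C D F \<and>
     (\<forall>Z Y X g f. conflation C Z Y X g f \<longrightarrow>
        short_exact D (FOb F Z) (FOb F Y) (FOb F X) (FAr F g) (FAr F f))"

definition exact_equivalence ::
  "('o, 'm, 'e) extri \<Rightarrow> ('p, 'n, 'y) acat_scheme \<Rightarrow> ('o, 'm, 'p, 'n) fctr \<Rightarrow> bool" where
  "exact_equivalence C D F \<longleftrightarrow> is_equivalence C D F \<and> exact_functor C D F"


section \<open>Contravariant functors to abelian groups\<close>

type_synonym ('o, 'm, 'g) presheaf = "('o, 'm, 'g monoid, 'g \<Rightarrow> 'g) fctr"

definition is_presheaf :: "('o, 'm, 'z) acat_scheme \<Rightarrow> ('o, 'm, 'g) presheaf \<Rightarrow> bool" where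
  "is_presheaf C F \<longleftrightarrow>
     (\<forall>X\<in>Obj C. comm_group (FOb F X)) \<and>
     (\<forall>X\<in>Obj C. \<forall>Y\<in>Obj C. \<forall>f\<in>arr C X Y. FAr F f \<in> hom (FOb F Y) (FOb F X)) \<and>
     (\<forall>X\<in>Obj C. \<forall>a\<in>carrier (FOb F X). FAr F (Ident C X) a = a) \<and>
     (\<forall>X\<in>Obj C. \<forall>Y\<in>Obj C. \<forall>Z\<in>Obj C. \<forall>f\<in>arr C X Y. \<forall>g\<in>arr C Y Z. \<forall>a\<in>carrier (FOb F Z).
        FAr F (g \<cdot>\<^bsub>C\<^esub> f) a = FAr F f (FAr F g a)) \<and>
     (\<forall>X\<in>Obj C. \<forall>Y\<in>Obj C. \<forall>f\<in>arr C X Y. \<forall>g\<in>arr C X Y. \<forall>a\<in>carrier (FOb F Y).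
        FAr F (f \<otimes>\<^bsub>Hom C X Y\<^esub> g) a = FAr F f a \<otimes>\<^bsub>FOb F X\<^esub> FAr F g a)"

text \<open>Natural transformations are extensional in both arguments, so that equality of
  transformations is equality of their components.\<close>

definition nat_trans ::
  "('o, 'm, 'z) acat_scheme \<Rightarrow> ('o, 'm, 'g) presheaf \<Rightarrow> ('o, 'm, 'h) presheaf \<Rightarrow>
   ('o \<Rightarrow> 'g \<Rightarrow> 'h) set" where
  "nat_trans C F G = {\<eta>. \<eta> \<in> extensional (Obj C) \<and>
     (\<forall>X\<in>Obj C. \<eta> X \<in> hom (FOb F X) (FOb G X) \<inter> extensional (carrier (FOb F X))) \<and>
     (\<forall>X\<in>Obj C. \<forall>Y\<in>Obj C. \<forall>f\<in>arr C X Y. \<forall>a\<in>carrier (FOb F Y).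
        \<eta> X (FAr F f a) = FAr G f (\<eta> Y a))}"

definition presheaf_iso ::
  "('o, 'm, 'z) acat_scheme \<Rightarrow> ('o, 'm, 'g) presheaf \<Rightarrow> ('o, 'm, 'h) presheaf \<Rightarrow> bool" where
  "presheaf_iso C F G \<longleftrightarrow>
     (\<exists>\<eta>\<in>nat_trans C F G. \<forall>X\<in>Obj C. \<eta> X \<in> iso (FOb F X) (FOb G X))"

definition representable :: "('o, 'm, 'z) acat_scheme \<Rightarrow> 'o \<Rightarrow> ('o, 'm, 'm) presheaf" where
  "representable C X = \<lparr>FOb = (\<lambda>W. Hom C W X), FAr = (\<lambda>w h. h \<cdot>\<^bsub>C\<^esub> w)\<rparr>"

definition representable_map ::
  "('o, 'm, 'z) acat_scheme \<Rightarrow> 'm \<Rightarrow> 'o \<Rightarrow> 'm \<Rightarrow> 'm" where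
  "representable_map C f = (\<lambda>W\<in>Obj C. \<lambda>h\<in>arr C W (Dom C f). f \<cdot>\<^bsub>C\<^esub> h)"

definition presheaf_cok ::
  "('o, 'm, 'z) acat_scheme \<Rightarrow> ('o, 'm, 'g) presheaf \<Rightarrow> ('o, 'm, 'h) presheaf \<Rightarrow>
   ('o \<Rightarrow> 'g \<Rightarrow> 'h) \<Rightarrow> ('o, 'm, 'h set) presheaf" where
  "presheaf_cok C F G \<eta> = \<lparr>
     FOb = (\<lambda>W. FOb G W Mod (\<eta> W ` carrier (FOb F W))),
     FAr = (\<lambda>w B. (\<eta> (Dom C w) ` carrier (FOb F (Dom C w))) <#>\<^bsub>FOb G (Dom C w)\<^esub> (FAr G w ` B))\<rparr>"

definition finitely_presented ::
  "('o, 'm, 'z) acat_scheme \<Rightarrow> ('o, 'm, 'g) presheaf \<Rightarrow> bool" where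
  "finitely_presented C F \<longleftrightarrow> is_presheaf C F \<and>
     (\<exists>X1\<in>Obj C. \<exists>X0\<in>Obj C.
      \<exists>\<alpha>\<in>nat_trans C (representable C X1) (representable C X0).
      \<exists>\<pi>\<in>nat_trans C (representable C X0) F.
        \<forall>W\<in>Obj C. \<alpha> W ` arr C W X1 = kernel (Hom C W X0) (FOb F W) (\<pi> W) \<and>
                  \<pi> W ` arr C W X0 = carrier (FOb F W))"

text \<open>The full subcategory of presheaves on a given set of objects. An arrow carries its
  source and target along with the transformation.\<close>

definition presheaf_cat ::
  "('o, 'm, 'z) acat_scheme \<Rightarrow> ('o, 'm, 'g) presheaf set \<Rightarrow>
   (('o, 'm, 'g) presheaf,
    ('o, 'm, 'g) presheaf \<times> ('o \<Rightarrow> 'g \<Rightarrow> 'g) \<times> ('o, 'm, 'g) presheaf) acat" where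
  "presheaf_cat C \<P> = \<lparr>
     Obj = \<P>,
     Hom = (\<lambda>F G. \<lparr>
       carrier = {(F, \<eta>, G) | \<eta>. \<eta> \<in> nat_trans C F G},
       mult = (\<lambda>(_, \<eta>, _) (_, \<theta>, _).
         (F, \<lambda>X\<in>Obj C. \<lambda>a\<in>carrier (FOb F X). \<eta> X a \<otimes>\<^bsub>FOb G X\<^esub> \<theta> X a, G)),
       one = (F, \<lambda>X\<in>Obj C. \<lambda>a\<in>carrier (FOb F X). \<one>\<^bsub>FOb G X\<^esub>, G)\<rparr>),
     Dom = (\<lambda>(F, _, _). F),
     Cod = (\<lambda>(_, _, G). G),
     Ident = (\<lambda>F. (F, \<lambda>X\<in>Obj C. \<lambda>a\<in>carrier (FOb F X). a, F)),
     Comp = (\<lambda>(_, \<theta>, H) (F, \<eta>, _).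
       (F, \<lambda>X\<in>Obj C. \<lambda>a\<in>carrier (FOb F X). \<theta> X (\<eta> X a), H))\<rparr>"

text \<open>The values of the functors in \<open>mod C\<close> are groups on sets of arrows. This loses nothing:
  a cokernel of a map between representable functors has cosets of arrows as elements, so
  every finitely presented functor, whatever the type of its values, is isomorphic to one of
  this form. In \<open>yoneda\<close>, the element \<open>h\<close> of \<open>C(W,X)\<close> accordingly appears as \<open>{h}\<close>.\<close>

definition mod_objects :: "('o, 'm, 'z) acat_scheme \<Rightarrow> ('o, 'm, 'm set) presheaf set" where
  "mod_objects C = {F. finitely_presented C F}"

definition def_objects :: "('o, 'm, 'e) extri \<Rightarrow> ('o, 'm, 'm set) presheaf set" where
  "def_objects C = {F \<in> mod_objects C. \<exists>Z Y X g f. conflation C Z Y X g f \<and>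
     presheaf_iso C F
       (presheaf_cok C (representable C Y) (representable C X) (representable_map C f))}"

definition lex_objects :: "('o, 'm, 'e) extri \<Rightarrow> ('o, 'm, 'm set) presheaf set" where
  "lex_objects C = {F \<in> mod_objects C. \<forall>Z Y X g f. conflation C Z Y X g f \<longrightarrow>
     inj_on (FAr F f) (carrier (FOb F X)) \<and>
     FAr F f ` carrier (FOb F X) = kernel (FOb F Y) (FOb F Z) (FAr F g)}"

type_synonym ('o, 'm) mod_arrow =
  "('o, 'm, 'm set) presheaf \<times> ('o \<Rightarrow> 'm set \<Rightarrow> 'm set) \<times> ('o, 'm, 'm set) presheaf"

definition mod_cat ::
  "('o, 'm, 'z) acat_scheme \<Rightarrow> (('o, 'm, 'm set) presheaf, ('o, 'm) mod_arrow) acat" where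
  "mod_cat C = presheaf_cat C (mod_objects C)"

definition lex_cat ::
  "('o, 'm, 'e) extri \<Rightarrow> (('o, 'm, 'm set) presheaf, ('o, 'm) mod_arrow) acat" where
  "lex_cat C = presheaf_cat C (lex_objects C)"

definition yoneda_ob :: "('o, 'm, 'z) acat_scheme \<Rightarrow> 'o \<Rightarrow> ('o, 'm, 'm set) presheaf" where
  "yoneda_ob C X = \<lparr>
     FOb = (\<lambda>W. \<lparr>carrier = (\<lambda>h. {h}) ` arr C W X,
                 mult = (\<lambda>A B. A <#>\<^bsub>Hom C W X\<^esub> B),
                 one = {zero_arr C W X}\<rparr>),
     FAr = (\<lambda>w A. (\<lambda>h. h \<cdot>\<^bsub>C\<^esub> w) ` A)\<rparr>"

definition yoneda ::
  "('o, 'm, 'z) acat_scheme \<Rightarrow>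
   ('o, 'm, ('o, 'm, 'm set) presheaf, ('o, 'm) mod_arrow) fctr" where
  "yoneda C = \<lparr>
     FOb = yoneda_ob C,
     FAr = (\<lambda>f. (yoneda_ob C (Dom C f),
                 \<lambda>W\<in>Obj C. \<lambda>A\<in>carrier (FOb (yoneda_ob C (Dom C f)) W). (\<lambda>h. f \<cdot>\<^bsub>C\<^esub> h) ` A,
                 yoneda_ob C (Cod C f)))\<rparr>"


section \<open>Serre quotients\<close>

text \<open>\<open>A/S\<close> is the localization of \<open>A\<close> at the arrows whose kernel and cokernel lie in \<open>S\<close>,
  constructed by calculus of fractions. An arrow from \<open>X\<close> to \<open>Y\<close> is an equivalence class of
  roofs \<open>(H, s, f)\<close>, where \<open>s : H \<rightarrow> X\<close> is such an arrow and \<open>f : H \<rightarrow> Y\<close>; the class is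
  accompanied by \<open>X\<close> and \<open>Y\<close>.\<close>

type_synonym ('o, 'm) quot_arrow = "'o \<times> ('o \<times> 'm \<times> 'm) set \<times> 'o"

definition serre_iso :: "('o, 'm, 'z) acat_scheme \<Rightarrow> 'o set \<Rightarrow> 'o \<Rightarrow> 'o \<Rightarrow> 'm \<Rightarrow> bool" where
  "serre_iso A S X Y s \<longleftrightarrow>
     (\<exists>K\<in>S. \<exists>k. is_kernel A K X Y k s) \<and> (\<exists>Q\<in>S. \<exists>c. is_cokernel A X Y Q s c)"

definition roofs :: "('o, 'm, 'z) acat_scheme \<Rightarrow> 'o set \<Rightarrow> 'o \<Rightarrow> 'o \<Rightarrow> ('o \<times> 'm \<times> 'm) set" where
  "roofs A S X Y = {(H, s, f). H \<in> Obj A \<and> serre_iso A S H X s \<and> f \<in> arr A H Y}"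

definition roof_equiv ::
  "('o, 'm, 'z) acat_scheme \<Rightarrow> 'o set \<Rightarrow> 'o \<Rightarrow> 'o \<Rightarrow>
   (('o \<times> 'm \<times> 'm) \<times> ('o \<times> 'm \<times> 'm)) set" where
  "roof_equiv A S X Y = {((H, s, f), (H', s', f')).
     (H, s, f) \<in> roofs A S X Y \<and> (H', s', f') \<in> roofs A S X Y \<and>
     (\<exists>L\<in>Obj A. \<exists>u\<in>arr A L H. \<exists>u'\<in>arr A L H'.
        s \<cdot>\<^bsub>A\<^esub> u = s' \<cdot>\<^bsub>A\<^esub> u' \<and> f \<cdot>\<^bsub>A\<^esub> u = f' \<cdot>\<^bsub>A\<^esub> u' \<and> serre_iso A S L X (s \<cdot>\<^bsub>A\<^esub> u))}"

definition roof_class ::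
  "('o, 'm, 'z) acat_scheme \<Rightarrow> 'o set \<Rightarrow> 'o \<Rightarrow> 'o \<Rightarrow> ('o \<times> 'm \<times> 'm) \<Rightarrow> ('o \<times> 'm \<times> 'm) set" where
  "roof_class A S X Y \<rho> = roof_equiv A S X Y `` {\<rho>}"

text \<open>Sums and composites are formed on representatives: two classes are added via a common
  denominator, and composed by completing \<open>H \<rightarrow> Y \<leftarrow> K\<close> to a commutative square. The union over all
  choices of representatives is a single class, as the result does not depend on them.\<close>

definition serre_quotient ::
  "('o, 'm, 'z) acat_scheme \<Rightarrow> 'o set \<Rightarrow> ('o, ('o, 'm) quot_arrow) acat" where
  "serre_quotient A S = \<lparr>
     Obj = Obj A,
     Hom = (\<lambda>X Y. \<lparr>
       carrier = {(X, \<phi>, Y) | \<phi>. \<phi> \<in> roofs A S X Y // roof_equiv A S X Y},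
       mult = (\<lambda>(_, \<phi>, _) (_, \<psi>, _).
         (X, \<Union>{roof_class A S X Y (H, s, f \<otimes>\<^bsub>Hom A H Y\<^esub> g) | H s f g.
               (H, s, f) \<in> \<phi> \<and> (H, s, g) \<in> \<psi>}, Y)),
       one = (X, roof_class A S X Y (X, Ident A X, zero_arr A X Y), Y)\<rparr>),
     Dom = (\<lambda>(X, _, _). X),
     Cod = (\<lambda>(_, _, Y). Y),
     Ident = (\<lambda>X. (X, roof_class A S X X (X, Ident A X, Ident A X), X)),
     Comp = (\<lambda>(_, \<psi>, Z) (X, \<phi>, _).
       (X, \<Union>{roof_class A S X Z (L, s \<cdot>\<^bsub>A\<^esub> t', g \<cdot>\<^bsub>A\<^esub> f') | H s f K t g L t' f'.
             (H, s, f) \<in> \<phi> \<and> (K, t, g) \<in> \<psi> \<and> L \<in> Obj A \<and>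
             serre_iso A S L H t' \<and> f' \<in> arr A L K \<and> f \<cdot>\<^bsub>A\<^esub> t' = t \<cdot>\<^bsub>A\<^esub> f'}, Z))\<rparr>"

definition serre_quotient_functor ::
  "('o, 'm, 'z) acat_scheme \<Rightarrow> 'o set \<Rightarrow> ('o, 'm, 'o, ('o, 'm) quot_arrow) fctr" where
  "serre_quotient_functor A S = \<lparr>
     FOb = (\<lambda>X. X),
     FAr = (\<lambda>f. (Dom A f,
                 roof_class A S (Dom A f) (Cod A f) (Dom A f, Ident A (Dom A f), f),
                 Cod A f))\<rparr>"

definition mod_quotient ::
  "('o, 'm, 'e) extri \<Rightarrow>
   (('o, 'm, 'm set) presheaf, (('o, 'm, 'm set) presheaf, ('o, 'm) mod_arrow) quot_arrow) acat" where
  "mod_quotient C = serre_quotient (mod_cat C) (def_objects C)"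

definition E_functor ::
  "('o, 'm, 'e) extri \<Rightarrow>
   ('o, 'm, ('o, 'm, 'm set) presheaf,
    (('o, 'm, 'm set) presheaf, ('o, 'm) mod_arrow) quot_arrow) fctr" where
  "E_functor C = fctr_comp (serre_quotient_functor (mod_cat C) (def_objects C)) (yoneda C)"

end

theory Submission
  imports Defs
begin

text \<open>Call a functor in \<open>mod C\<close> locally zero if each of its elements is killed by a deflation. These are
  the functors in \<open>def C\<close>, so with deflations as coverings the arrows inverted in the Serre quotient are
  those which are locally injective and locally surjective. A roof \<open>(H, s, f)\<close> is determined up to
  equivalence by its graph, the relation formed by the pairs that locally are \<open>(s h, f h)\<close>; sums and
  composites of roofs are computed on graphs, and sequences that are locally exact become kernels and
  cokernels in the quotient.

  If the conflations are kernel-cokernel pairs, then representable functors are separated, so \<open>E\<close> is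
  faithful; a roof starting at \<open>C(-,X)\<close> is defined on a deflation \<open>V \<rightarrow> X\<close> and descends to \<open>X\<close>, because
  a deflation is a cokernel, so \<open>E\<close> is full. Conversely, an exact fully faithful \<open>E\<close> reflects kernels
  and cokernels, so the conflations are kernel-cokernel pairs, and the axioms of an extriangulated
  category then yield a Quillen exact structure.

  If \<open>E\<close> is an exact equivalence, kernels, cokernels and normality of monics and epics are transported
  from the quotient, where an epic \<open>f\<close> is locally surjective. Thus \<open>f h\<close> is a deflation for some \<open>h\<close>, and
  pushing out its conflation shows that every short exact sequence ending in \<open>f\<close> is a conflation. If
  \<open>C\<close> is abelian, the cokernel of \<open>C(-,r)\<close> is locally isomorphic to the functor represented by the
  cokernel of \<open>r\<close>, and isomorphic to it when it is left exact.\<close>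

section \<open>Preadditive and additive categories\<close>

text \<open>In the quotient, sums and composites are unions over all choices of representatives, so
  independence of these choices is the first obstacle. Graphs remove it: each admissible choice has
  the same graph, and a class is determined by its graph. A graph is in effect the graph of a map
  between associated sheaves, but no sheaf is constructed, so all functors stay in
  \<open>mod C\<close>.

  Arguments use elements \<open>a\<close> of \<open>F W\<close>, that is, maps from representable
  functors. Because of weak kernels the relations between such elements are covered by a
  representable functor, so kernels, cokernels and pullbacks can be formed pointwise and are again
  finitely presented.

  That locally zero functors are defects rests on the deflation \<open>(r, e)\<close> obtained from
  a deflation \<open>e\<close> and an arbitrary arrow \<open>r\<close> with the same target.

  The quotient is treated only as a category with bilinear composition and zero arrows. Its kernels
  and cokernels are constructed just for the images of maps in \<open>mod C\<close>; they are moved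
  along isomorphisms to representable functors.\<close>

locale preadd_cat =
  fixes C :: "('o, 'm, 'z) acat_scheme" (structure)
  assumes preadditive: "preadditive C"
begin

text \<open>The axioms say nothing about hom-sets between things that are not objects, so the object
  conditions travel with each arrow; typing facts can then be chained by \<open>OF\<close>.\<close>

definition ar :: "'m \<Rightarrow> 'o \<Rightarrow> 'o \<Rightarrow> bool" where
  "ar f X Y \<longleftrightarrow> X \<in> Obj C \<and> Y \<in> Obj C \<and> f \<in> arr C X Y"

abbreviation add :: "'o \<Rightarrow> 'o \<Rightarrow> 'm \<Rightarrow> 'm \<Rightarrow> 'm" where
  "add X Y f g \<equiv> f \<otimes>\<^bsub>Hom C X Y\<^esub> g"

abbreviation neg :: "'o \<Rightarrow> 'o \<Rightarrow> 'm \<Rightarrow> 'm" where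
  "neg X Y f \<equiv> inv\<^bsub>Hom C X Y\<^esub> f"

abbreviation zr :: "'o \<Rightarrow> 'o \<Rightarrow> 'm" where
  "zr X Y \<equiv> zero_arr C X Y"

lemma hom_group: "X \<in> Obj C \<Longrightarrow> Y \<in> Obj C \<Longrightarrow> comm_group (Hom C X Y)"
  using preadditive unfolding preadditive_def by auto

lemma arD: "ar f X Y \<Longrightarrow> X \<in> Obj C" "ar f X Y \<Longrightarrow> Y \<in> Obj C" "ar f X Y \<Longrightarrow> f \<in> arr C X Y"
  by (auto simp: ar_def)

lemma arI: "X \<in> Obj C \<Longrightarrow> Y \<in> Obj C \<Longrightarrow> f \<in> arr C X Y \<Longrightarrow> ar f X Y"
  by (auto simp: ar_def)

lemma ar_dom: "ar f X Y \<Longrightarrow> Dom C f = X" and ar_cod: "ar f X Y \<Longrightarrow> Cod C f = Y"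
  using preadditive unfolding preadditive_def ar_def by auto

lemma ar_id: "X \<in> Obj C \<Longrightarrow> ar (Ident C X) X X"
  using preadditive unfolding preadditive_def ar_def by auto

lemma comp_id: "ar f X Y \<Longrightarrow> f \<cdot> Ident C X = f" "ar f X Y \<Longrightarrow> Ident C Y \<cdot> f = f"
  using preadditive unfolding preadditive_def ar_def by auto

lemma ar_comp: "ar f X Y \<Longrightarrow> ar g Y Z \<Longrightarrow> ar (g \<cdot> f) X Z"
  using preadditive unfolding preadditive_def ar_def by auto

lemma comp_assoc: "ar f W X \<Longrightarrow> ar g X Y \<Longrightarrow> ar h Y Z \<Longrightarrow> (h \<cdot> g) \<cdot> f = h \<cdot> (g \<cdot> f)"
  using preadditive unfolding preadditive_def ar_def by auto

lemma comp_add_right: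
  "ar f X Y \<Longrightarrow> ar f' X Y \<Longrightarrow> ar g Y Z \<Longrightarrow> g \<cdot> add X Y f f' = add X Z (g \<cdot> f) (g \<cdot> f')"
  and comp_add_left:
  "ar f X Y \<Longrightarrow> ar g Y Z \<Longrightarrow> ar g' Y Z \<Longrightarrow> add Y Z g g' \<cdot> f = add X Z (g \<cdot> f) (g' \<cdot> f)"
  using preadditive unfolding preadditive_def ar_def by auto

lemma ar_add: "ar f X Y \<Longrightarrow> ar g X Y \<Longrightarrow> ar (add X Y f g) X Y"
  unfolding ar_def using hom_group[of X Y] by (simp add: comm_group_def monoid.m_closed group.is_monoid)

lemma ar_zr: "X \<in> Obj C \<Longrightarrow> Y \<in> Obj C \<Longrightarrow> ar (zr X Y) X Y"
  unfolding ar_def using hom_group[of X Y] by (simp add: comm_group_def monoid.one_closed group.is_monoid)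

lemma ar_neg: "ar f X Y \<Longrightarrow> ar (neg X Y f) X Y"
  unfolding ar_def using hom_group[of X Y] by (simp add: comm_group_def group.inv_closed)

lemma add_zr: "ar f X Y \<Longrightarrow> add X Y f (zr X Y) = f" "ar f X Y \<Longrightarrow> add X Y (zr X Y) f = f"
  unfolding ar_def using hom_group[of X Y]
  by (simp_all add: comm_group_def monoid.l_one monoid.r_one group.is_monoid)

lemma add_neg: "ar f X Y \<Longrightarrow> add X Y f (neg X Y f) = zr X Y" "ar f X Y \<Longrightarrow> add X Y (neg X Y f) f = zr X Y"
  unfolding ar_def using hom_group[of X Y]
  by (simp_all add: comm_group_def group.l_inv group.r_inv)

lemma add_comm: "ar f X Y \<Longrightarrow> ar g X Y \<Longrightarrow> add X Y f g = add X Y g f"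
  unfolding ar_def using hom_group[of X Y]
  by (metis comm_group_def comm_monoid.m_comm)

lemma add_assoc:
  "ar f X Y \<Longrightarrow> ar g X Y \<Longrightarrow> ar h X Y \<Longrightarrow> add X Y (add X Y f g) h = add X Y f (add X Y g h)"
  unfolding ar_def using hom_group[of X Y]
  by (metis comm_group_def comm_monoid_def monoid.m_assoc)

lemma add_left_cancel: "ar f X Y \<Longrightarrow> ar g X Y \<Longrightarrow> ar h X Y \<Longrightarrow> add X Y f g = add X Y f h \<Longrightarrow> g = h"
  by (metis add_assoc add_neg(2) add_zr(2) ar_neg)

lemma neg_unique: "ar f X Y \<Longrightarrow> ar g X Y \<Longrightarrow> add X Y f g = zr X Y \<Longrightarrow> g = neg X Y f"
  by (metis add_left_cancel add_neg(1) ar_neg)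

lemma sub_eq_zr: "ar f X Y \<Longrightarrow> ar g X Y \<Longrightarrow> add X Y f (neg X Y g) = zr X Y \<longleftrightarrow> f = g"
  by (metis add_assoc add_neg add_zr ar_neg)

lemma sub_add: "ar f X Y \<Longrightarrow> ar g X Y \<Longrightarrow> add X Y (add X Y f (neg X Y g)) g = f"
  by (metis add_assoc add_neg(2) add_zr(1) ar_neg)

lemma add_sub: "ar f X Y \<Longrightarrow> ar g X Y \<Longrightarrow> add X Y g (add X Y f (neg X Y g)) = f"
  by (metis add_comm sub_add ar_add ar_neg)

section \<open>Zero arrows, negatives and differences\<close>

lemma comp_zr:
  assumes f: "ar f X Y" and W: "W \<in> Obj C"
  shows "f \<cdot> zr W X = zr W Y"
proof -
  note z = ar_zr[OF W arD(1)[OF f]]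
  note fz = ar_comp[OF z f]
  \<comment> \<open>Since \<open>0 + 0 = 0\<close>, the composite equals its own double, and
    cancelling one copy leaves zero.\<close>
  have "add W Y (f \<cdot> zr W X) (f \<cdot> zr W X) = add W Y (f \<cdot> zr W X) (zr W Y)"
    using comp_add_right[OF z z f] by (simp add: add_zr[OF z] add_zr[OF fz])
  then show ?thesis by (rule add_left_cancel[OF fz fz ar_zr[OF W arD(2)[OF f]]])
qed

lemma zr_comp:
  assumes f: "ar f X Y" and Z: "Z \<in> Obj C"
  shows "zr Y Z \<cdot> f = zr X Z"
proof -
  note z = ar_zr[OF arD(2)[OF f] Z]
  note fz = ar_comp[OF f z]
  have "add X Z (zr Y Z \<cdot> f) (zr Y Z \<cdot> f) = add X Z (zr Y Z \<cdot> f) (zr X Z)"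
    using comp_add_left[OF f z z] by (simp add: add_zr[OF z] add_zr[OF fz])
  then show ?thesis by (rule add_left_cancel[OF fz fz ar_zr[OF arD(1)[OF f] Z]])
qed

lemma comp_neg:
  assumes f: "ar f X Y" and g: "ar g Y Z"
  shows "g \<cdot> neg X Y f = neg X Z (g \<cdot> f)"
proof -
  have "add X Z (g \<cdot> f) (g \<cdot> neg X Y f) = g \<cdot> add X Y f (neg X Y f)"
    by (rule comp_add_right[OF f ar_neg[OF f] g, symmetric])
  also have "\<dots> = zr X Z" by (simp add: add_neg[OF f] comp_zr[OF g] arD[OF f])
  finally show ?thesis by (rule neg_unique[OF ar_comp[OF f g] ar_comp[OF ar_neg[OF f] g]])
qed

lemma neg_comp:
  assumes f: "ar f X Y" and g: "ar g Y Z"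
  shows "neg Y Z g \<cdot> f = neg X Z (g \<cdot> f)"
proof -
  have "add X Z (g \<cdot> f) (neg Y Z g \<cdot> f) = add Y Z g (neg Y Z g) \<cdot> f"
    by (rule comp_add_left[OF f g ar_neg[OF g], symmetric])
  also have "\<dots> = zr X Z" by (simp add: add_neg[OF g] zr_comp[OF f] arD[OF g])
  finally show ?thesis by (rule neg_unique[OF ar_comp[OF f g] ar_comp[OF f ar_neg[OF g]]])
qed

lemma comp_sub:
  assumes f: "ar f X Y" "ar f' X Y" and g: "ar g Y Z"
  shows "g \<cdot> add X Y f (neg X Y f') = add X Z (g \<cdot> f) (neg X Z (g \<cdot> f'))"
  using comp_add_right[OF f(1) ar_neg[OF f(2)] g] by (simp add: comp_neg[OF f(2) g])

lemma sub_comp: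
  assumes f: "ar f X Y" and g: "ar g Y Z" "ar g' Y Z"
  shows "add Y Z g (neg Y Z g') \<cdot> f = add X Z (g \<cdot> f) (neg X Z (g' \<cdot> f))"
  using comp_add_left[OF f g(1) ar_neg[OF g(2)]] by (simp add: neg_comp[OF f g(2)])

lemma neg_zr: "X \<in> Obj C \<Longrightarrow> Y \<in> Obj C \<Longrightarrow> neg X Y (zr X Y) = zr X Y"
  by (metis add_zr(1) ar_zr neg_unique)

text \<open>Cancelling two arrows means that their difference vanishes, so a single test arrow
  suffices. Monics, epics and the uniqueness parts of kernels and cokernels are checked in this
  form.\<close>

lemma monic_iff_zr:
  assumes f: "ar f X Y"
  shows "monic C X Y f \<longleftrightarrow> (\<forall>T t. ar t T X \<longrightarrow> f \<cdot> t = zr T Y \<longrightarrow> t = zr T X)"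
proof
  assume m: "monic C X Y f"
  show "\<forall>T t. ar t T X \<longrightarrow> f \<cdot> t = zr T Y \<longrightarrow> t = zr T X"
  proof (intro allI impI)
    fix T t assume t: "ar t T X" and e: "f \<cdot> t = zr T Y"
    have "f \<cdot> t = f \<cdot> zr T X" using e comp_zr[OF f arD(1)[OF t]] by simp
    then show "t = zr T X" using m t ar_zr[OF arD(1)[OF t] arD(1)[OF f]]
      unfolding monic_def ar_def by blast
  qed
next
  assume *: "\<forall>T t. ar t T X \<longrightarrow> f \<cdot> t = zr T Y \<longrightarrow> t = zr T X"
  have "u = v" if u: "ar u T X" and v: "ar v T X" and e: "f \<cdot> u = f \<cdot> v" for T u v
  proof -
    have "f \<cdot> add T X u (neg T X v) = zr T Y"
      using comp_sub[OF u v f] sub_eq_zr[OF ar_comp[OF u f] ar_comp[OF v f]] e by simp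
    then show ?thesis using * ar_add[OF u ar_neg[OF v]] sub_eq_zr[OF u v] by blast
  qed
  then show "monic C X Y f" using f unfolding monic_def ar_def by blast
qed

lemma epic_iff_zr:
  assumes f: "ar f X Y"
  shows "epic C X Y f \<longleftrightarrow> (\<forall>T t. ar t Y T \<longrightarrow> t \<cdot> f = zr X T \<longrightarrow> t = zr Y T)"
proof
  assume m: "epic C X Y f"
  show "\<forall>T t. ar t Y T \<longrightarrow> t \<cdot> f = zr X T \<longrightarrow> t = zr Y T"
  proof (intro allI impI)
    fix T t assume t: "ar t Y T" and e: "t \<cdot> f = zr X T"
    have "t \<cdot> f = zr Y T \<cdot> f" using e zr_comp[OF f arD(2)[OF t]] by simp
    then show "t = zr Y T" using m t ar_zr[OF arD(2)[OF f] arD(2)[OF t]]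
      unfolding epic_def ar_def by blast
  qed
next
  assume *: "\<forall>T t. ar t Y T \<longrightarrow> t \<cdot> f = zr X T \<longrightarrow> t = zr Y T"
  have "u = v" if u: "ar u Y T" and v: "ar v Y T" and e: "u \<cdot> f = v \<cdot> f" for T u v
  proof -
    have "add Y T u (neg Y T v) \<cdot> f = zr X T"
      using sub_comp[OF f u v] sub_eq_zr[OF ar_comp[OF f u] ar_comp[OF f v]] e by simp
    then show ?thesis using * ar_add[OF u ar_neg[OF v]] sub_eq_zr[OF u v] by blast
  qed
  then show "epic C X Y f" using f unfolding epic_def ar_def by blast
qed

lemma kernelD:
  assumes "is_kernel C K X Y k f"
  shows "ar k K X" "ar f X Y" "f \<cdot> k = zr K Y"
    "\<And>T t. ar t T X \<Longrightarrow> f \<cdot> t = zr T Y \<Longrightarrow> \<exists>u. ar u T K \<and> k \<cdot> u = t"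
    "\<And>T u v. ar u T K \<Longrightarrow> ar v T K \<Longrightarrow> k \<cdot> u = k \<cdot> v \<Longrightarrow> u = v"
proof -
  show k: "ar k K X" and f: "ar f X Y" and fk: "f \<cdot> k = zr K Y"
    using assms unfolding is_kernel_def ar_def by auto
  show "\<exists>u. ar u T K \<and> k \<cdot> u = t" if "ar t T X" "f \<cdot> t = zr T Y" for T t
    using assms that unfolding is_kernel_def ar_def by blast
  show "u = v" if u: "ar u T K" and v: "ar v T K" and "k \<cdot> u = k \<cdot> v" for T u v
  proof -
    \<comment> \<open>The definition asserts uniqueness only for factorizations of arrows killed by
      \<open>f\<close>; the composite \<open>k \<cdot> u\<close> is such an arrow.\<close>
    have "f \<cdot> (k \<cdot> u) = zr T Y" by (metis u k f fk comp_assoc zr_comp arD(2))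
    moreover have "k \<cdot> u \<in> arr C T X" "T \<in> Obj C" using ar_comp[OF u k] by (auto simp: ar_def)
    ultimately have "\<exists>!w. w \<in> arr C T K \<and> k \<cdot> w = k \<cdot> u"
      using assms unfolding is_kernel_def by blast
    then show ?thesis using u v that by (auto simp: ar_def)
  qed
qed

lemma kernelI:
  assumes "ar k K X" "ar f X Y" "f \<cdot> k = zr K Y"
    "\<And>T t. ar t T X \<Longrightarrow> f \<cdot> t = zr T Y \<Longrightarrow> \<exists>u. ar u T K \<and> k \<cdot> u = t"
    "\<And>T u. ar u T K \<Longrightarrow> k \<cdot> u = zr T X \<Longrightarrow> u = zr T K"
  shows "is_kernel C K X Y k f"
proof -
  have "monic C K X k" using assms(5) monic_iff_zr[OF assms(1)] by blast
  then show ?thesis using assms(1-4) unfolding is_kernel_def monic_def ar_def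
    by (safe, blast, blast)
qed

lemma cokernelD:
  assumes "is_cokernel C X Y Q f c"
  shows "ar f X Y" "ar c Y Q" "c \<cdot> f = zr X Q"
    "\<And>T t. ar t Y T \<Longrightarrow> t \<cdot> f = zr X T \<Longrightarrow> \<exists>u. ar u Q T \<and> u \<cdot> c = t"
    "\<And>T u v. ar u Q T \<Longrightarrow> ar v Q T \<Longrightarrow> u \<cdot> c = v \<cdot> c \<Longrightarrow> u = v"
proof -
  show f: "ar f X Y" and c: "ar c Y Q" and cf: "c \<cdot> f = zr X Q"
    using assms unfolding is_cokernel_def ar_def by auto
  show "\<exists>u. ar u Q T \<and> u \<cdot> c = t" if "ar t Y T" "t \<cdot> f = zr X T" for T t
    using assms that unfolding is_cokernel_def ar_def by blast
  show "u = v" if u: "ar u Q T" and v: "ar v Q T" and "u \<cdot> c = v \<cdot> c" for T u v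
  proof -
    have "(u \<cdot> c) \<cdot> f = zr X T" by (metis u c f cf comp_assoc comp_zr arD(1))
    moreover have "u \<cdot> c \<in> arr C Y T" "T \<in> Obj C" using ar_comp[OF c u] by (auto simp: ar_def)
    ultimately have "\<exists>!w. w \<in> arr C Q T \<and> w \<cdot> c = u \<cdot> c"
      using assms unfolding is_cokernel_def by blast
    then show ?thesis using u v that by (auto simp: ar_def)
  qed
qed

lemma cokernelI:
  assumes "ar f X Y" "ar c Y Q" "c \<cdot> f = zr X Q"
    "\<And>T t. ar t Y T \<Longrightarrow> t \<cdot> f = zr X T \<Longrightarrow> \<exists>u. ar u Q T \<and> u \<cdot> c = t"
    "\<And>T u. ar u Q T \<Longrightarrow> u \<cdot> c = zr Y T \<Longrightarrow> u = zr Q T"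
  shows "is_cokernel C X Y Q f c"
proof -
  have "epic C Y Q c" using assms(5) epic_iff_zr[OF assms(2)] by blast
  then show ?thesis using assms(1-4) unfolding is_cokernel_def epic_def ar_def
    by (safe, blast, blast)
qed

lemma biproductD:
  assumes "biproduct C X Y P i j p q" "X \<in> Obj C" "Y \<in> Obj C"
  shows "ar i X P" "ar j Y P" "ar p P X" "ar q P Y"
    "p \<cdot> i = Ident C X" "q \<cdot> j = Ident C Y" "p \<cdot> j = zr Y X" "q \<cdot> i = zr X Y"
    "add P P (i \<cdot> p) (j \<cdot> q) = Ident C P"
  using assms unfolding biproduct_def ar_def by auto

lemma biproduct_pair:
  assumes "biproduct C X Y P i j p q" "ar f W X" "ar g W Y"
  shows "ar (add W P (i \<cdot> f) (j \<cdot> g)) W P"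
    "p \<cdot> add W P (i \<cdot> f) (j \<cdot> g) = f" "q \<cdot> add W P (i \<cdot> f) (j \<cdot> g) = g"
proof -
  note b = biproductD[OF assms(1) arD(2)[OF assms(2)] arD(2)[OF assms(3)]]
  note a = ar_comp[OF assms(2) b(1)] ar_comp[OF assms(3) b(2)]
  show "ar (add W P (i \<cdot> f) (j \<cdot> g)) W P" using a by (rule ar_add)
  have "p \<cdot> (i \<cdot> f) = f" "p \<cdot> (j \<cdot> g) = zr W X" "q \<cdot> (i \<cdot> f) = zr W Y" "q \<cdot> (j \<cdot> g) = g"
    unfolding comp_assoc[OF assms(2) b(1,3), symmetric] comp_assoc[OF assms(3) b(2,3), symmetric]
      comp_assoc[OF assms(2) b(1,4), symmetric] comp_assoc[OF assms(3) b(2,4), symmetric] b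
    using comp_id[OF assms(2)] comp_id[OF assms(3)] zr_comp[OF assms(2)] zr_comp[OF assms(3)]
      arD[OF assms(2)] arD[OF assms(3)] by simp_all
  then show "p \<cdot> add W P (i \<cdot> f) (j \<cdot> g) = f" "q \<cdot> add W P (i \<cdot> f) (j \<cdot> g) = g"
    using comp_add_right[OF a b(3)] comp_add_right[OF a b(4)]
    by (simp_all add: add_zr[OF assms(2)] add_zr[OF assms(3)])
qed

lemma iso_arrE:
  assumes "iso_arr C X Y f" "X \<in> Obj C" "Y \<in> Obj C"
  obtains g where "ar f X Y" "ar g Y X" "g \<cdot> f = Ident C X" "f \<cdot> g = Ident C Y"
  using assms unfolding iso_arr_def ar_def by blast

end

locale add_cat = preadd_cat C for C :: "('o, 'm, 'z) acat_scheme" (structure) +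
  assumes additive: "additive_category C"
begin

lemma zero_objectE:
  obtains N where "N \<in> Obj C" "\<And>X f. ar f X N \<Longrightarrow> f = zr X N" "\<And>X f. ar f N X \<Longrightarrow> f = zr N X"
proof -
  obtain N where N: "N \<in> Obj C" "\<forall>X\<in>Obj C. (\<exists>!f. f \<in> arr C X N) \<and> (\<exists>!f. f \<in> arr C N X)"
    using additive unfolding additive_category_def zero_object_def by blast
  have "f = zr X N" if "ar f X N" for X f
    using N that ar_zr[OF arD(1)[OF that] N(1)] unfolding ar_def by blast
  moreover have "f = zr N X" if "ar f N X" for X f
    using N that ar_zr[OF N(1) arD(2)[OF that]] unfolding ar_def by blast
  ultimately show ?thesis using that N(1) by blast
qed

lemma biproductE:
  assumes "X \<in> Obj C" "Y \<in> Obj C"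
  obtains P i j p q where "biproduct C X Y P i j p q" "P \<in> Obj C"
proof -
  obtain P i j p q where "biproduct C X Y P i j p q"
    using additive assms unfolding additive_category_def by blast
  then show thesis using that unfolding biproduct_def by blast
qed

end

section \<open>Presheaves and finite presentation\<close>

context preadd_cat
begin

abbreviation psh :: "('o, 'm, 'g) presheaf \<Rightarrow> bool" where
  "psh F \<equiv> is_presheaf C F"

abbreviation plus_at :: "('o, 'm, 'g) presheaf \<Rightarrow> 'o \<Rightarrow> 'g \<Rightarrow> 'g \<Rightarrow> 'g" where
  "plus_at F W a b \<equiv> a \<otimes>\<^bsub>FOb F W\<^esub> b"

abbreviation inv_at :: "('o, 'm, 'g) presheaf \<Rightarrow> 'o \<Rightarrow> 'g \<Rightarrow> 'g" where
  "inv_at F W a \<equiv> inv\<^bsub>FOb F W\<^esub> a"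

abbreviation zero_at :: "('o, 'm, 'g) presheaf \<Rightarrow> 'o \<Rightarrow> 'g" where
  "zero_at F W \<equiv> \<one>\<^bsub>FOb F W\<^esub>"

text \<open>The object \<open>W\<close> belongs to the predicate because one value may lie in
  \<open>F W\<close> for several \<open>W\<close>, and because by the Yoneda lemma an element at
  \<open>W\<close> is a map from \<open>C(-,W)\<close>.\<close>

definition el :: "('o, 'm, 'g) presheaf \<Rightarrow> 'o \<Rightarrow> 'g \<Rightarrow> bool" where
  "el F W a \<longleftrightarrow> W \<in> Obj C \<and> a \<in> carrier (FOb F W)"

lemma elD: "el F W a \<Longrightarrow> W \<in> Obj C" "el F W a \<Longrightarrow> a \<in> carrier (FOb F W)"
  by (auto simp: el_def)

lemma psh_group: "psh F \<Longrightarrow> W \<in> Obj C \<Longrightarrow> comm_group (FOb F W)"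
  unfolding is_presheaf_def by auto

lemma psh_groups: "psh F \<Longrightarrow> W \<in> Obj C \<Longrightarrow> group (FOb F W)"
  using psh_group comm_group.axioms(2) by blast

lemma act_hom: "psh F \<Longrightarrow> ar h X Y \<Longrightarrow> FAr F h \<in> hom (FOb F Y) (FOb F X)"
  unfolding is_presheaf_def ar_def by auto

lemma el_act: "psh F \<Longrightarrow> ar h X Y \<Longrightarrow> el F Y a \<Longrightarrow> el F X (FAr F h a)"
  using act_hom unfolding el_def ar_def hom_def by blast

lemma act_id: "psh F \<Longrightarrow> el F X a \<Longrightarrow> FAr F (Ident C X) a = a"
  unfolding is_presheaf_def el_def by auto

lemma act_comp:
  "psh F \<Longrightarrow> ar f X Y \<Longrightarrow> ar g Y Z \<Longrightarrow> el F Z a \<Longrightarrow> FAr F (g \<cdot> f) a = FAr F f (FAr F g a)"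
  unfolding is_presheaf_def ar_def el_def by auto

lemma act_add:
  "psh F \<Longrightarrow> ar f X Y \<Longrightarrow> ar g X Y \<Longrightarrow> el F Y a \<Longrightarrow>
   FAr F (add X Y f g) a = plus_at F X (FAr F f a) (FAr F g a)"
  unfolding is_presheaf_def ar_def el_def by auto

lemma act_plus:
  "psh F \<Longrightarrow> ar f X Y \<Longrightarrow> el F Y a \<Longrightarrow> el F Y b \<Longrightarrow>
   FAr F f (plus_at F Y a b) = plus_at F X (FAr F f a) (FAr F f b)"
  using act_hom unfolding el_def hom_def by blast

lemma el_plus: "psh F \<Longrightarrow> el F W a \<Longrightarrow> el F W b \<Longrightarrow> el F W (plus_at F W a b)"
  using psh_groups[of F W] unfolding el_def by (auto simp: group.is_monoid monoid.m_closed)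

lemma el_zero: "psh F \<Longrightarrow> W \<in> Obj C \<Longrightarrow> el F W (zero_at F W)"
  using psh_groups[of F W] unfolding el_def by (auto simp: group.is_monoid monoid.one_closed)

lemma el_inv: "psh F \<Longrightarrow> el F W a \<Longrightarrow> el F W (inv_at F W a)"
  using psh_groups[of F W] unfolding el_def by (auto simp: group.inv_closed)

lemma plus_zero: "psh F \<Longrightarrow> el F W a \<Longrightarrow> plus_at F W a (zero_at F W) = a"
  "psh F \<Longrightarrow> el F W a \<Longrightarrow> plus_at F W (zero_at F W) a = a"
  using psh_groups[of F W] unfolding el_def by (auto simp: group.is_monoid monoid.l_one monoid.r_one)

lemma plus_inv: "psh F \<Longrightarrow> el F W a \<Longrightarrow> plus_at F W a (inv_at F W a) = zero_at F W"
  "psh F \<Longrightarrow> el F W a \<Longrightarrow> plus_at F W (inv_at F W a) a = zero_at F W"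
  using psh_groups[of F W] unfolding el_def by (auto simp: group.l_inv group.r_inv)

lemma plus_assoc: "psh F \<Longrightarrow> el F W a \<Longrightarrow> el F W b \<Longrightarrow> el F W c \<Longrightarrow>
   plus_at F W (plus_at F W a b) c = plus_at F W a (plus_at F W b c)"
  using psh_groups[of F W] unfolding el_def by (auto simp: group.is_monoid monoid.m_assoc)

lemma sub_zero_iff: "psh F \<Longrightarrow> el F W a \<Longrightarrow> el F W b \<Longrightarrow>
   plus_at F W a (inv_at F W b) = zero_at F W \<longleftrightarrow> a = b"
  using plus_inv plus_assoc[of F W a "inv_at F W b" b] plus_zero el_inv[of F W b] by metis

lemma act_zero: "psh F \<Longrightarrow> ar f X Y \<Longrightarrow> FAr F f (zero_at F Y) = zero_at F X"
  using act_hom[of F f X Y] hom_one[of "FAr F f" "FOb F Y" "FOb F X"] psh_groups[of F]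
  by (auto simp: ar_def)

lemma act_inv: "psh F \<Longrightarrow> ar f X Y \<Longrightarrow> el F Y a \<Longrightarrow> FAr F f (inv_at F Y a) = inv_at F X (FAr F f a)"
  using act_hom[of F f X Y] psh_groups[of F]
  by (auto simp: ar_def el_def intro!: group_hom.hom_inv simp: group_hom_def group_hom_axioms_def)

lemma act_zr:
  assumes "psh F" "X \<in> Obj C" "el F Y a"
  shows "FAr F (zr X Y) a = zero_at F X"
proof -
  note z = ar_zr[OF assms(2) elD(1)[OF assms(3)]]
  note e = el_act[OF assms(1) z assms(3)]
  have "plus_at F X (FAr F (zr X Y) a) (FAr F (zr X Y) a) = FAr F (zr X Y) a"
    using act_add[OF assms(1) z z assms(3)] add_zr(1)[OF z] by simp
  then show ?thesis
    using e psh_groups[OF assms(1,2)] by (simp add: el_def group.l_cancel_one)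
qed

lemma act_neg:
  assumes "psh F" "ar f X Y" "el F Y a"
  shows "FAr F (neg X Y f) a = inv_at F X (FAr F f a)"
proof -
  note e = el_act[OF assms(1,2,3)] el_act[OF assms(1) ar_neg[OF assms(2)] assms(3)]
  have "plus_at F X (FAr F (neg X Y f) a) (FAr F f a) = zero_at F X"
    using act_add[OF assms(1) ar_neg[OF assms(2)] assms(2,3)] add_neg(2)[OF assms(2)]
      act_zr[OF assms(1) arD(1)[OF assms(2)] assms(3)] by simp
  then show ?thesis
    using e psh_groups[OF assms(1) arD(1)[OF assms(2)]] by (simp add: el_def group.inv_equality)
qed

lemma act_sub:
  "psh F \<Longrightarrow> ar f X Y \<Longrightarrow> ar g X Y \<Longrightarrow> el F Y a \<Longrightarrow>
   FAr F (add X Y f (neg X Y g)) a = plus_at F X (FAr F f a) (inv_at F X (FAr F g a))"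
  by (simp add: act_add ar_neg act_neg)

section \<open>Natural transformations\<close>

abbreviation nt :: "('o, 'm, 'g) presheaf \<Rightarrow> ('o, 'm, 'h) presheaf \<Rightarrow> ('o \<Rightarrow> 'g \<Rightarrow> 'h) \<Rightarrow> bool" where
  "nt F G \<eta> \<equiv> \<eta> \<in> nat_trans C F G"

lemma nt_hom: "nt F G \<eta> \<Longrightarrow> W \<in> Obj C \<Longrightarrow> \<eta> W \<in> hom (FOb F W) (FOb G W)"
  unfolding nat_trans_def by auto

lemma nt_el: "nt F G \<eta> \<Longrightarrow> el F W a \<Longrightarrow> el G W (\<eta> W a)"
  using nt_hom unfolding el_def hom_def by blast

lemma nt_nat: "nt F G \<eta> \<Longrightarrow> ar f X Y \<Longrightarrow> el F Y a \<Longrightarrow> \<eta> X (FAr F f a) = FAr G f (\<eta> Y a)"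
  unfolding nat_trans_def ar_def el_def by auto

lemma nt_plus:
  "nt F G \<eta> \<Longrightarrow> el F W a \<Longrightarrow> el F W b \<Longrightarrow> \<eta> W (plus_at F W a b) = plus_at G W (\<eta> W a) (\<eta> W b)"
  using nt_hom unfolding el_def hom_def by blast

lemma nt_group_hom: "nt F G \<eta> \<Longrightarrow> psh F \<Longrightarrow> psh G \<Longrightarrow> W \<in> Obj C \<Longrightarrow> group_hom (FOb F W) (FOb G W) (\<eta> W)"
  by (simp add: group_hom_def group_hom_axioms_def psh_groups nt_hom)

lemma nt_zero: "nt F G \<eta> \<Longrightarrow> psh F \<Longrightarrow> psh G \<Longrightarrow> W \<in> Obj C \<Longrightarrow> \<eta> W (zero_at F W) = zero_at G W"
  using nt_group_hom group_hom.hom_one by blast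

lemma nt_inv: "nt F G \<eta> \<Longrightarrow> psh F \<Longrightarrow> psh G \<Longrightarrow> el F W a \<Longrightarrow> \<eta> W (inv_at F W a) = inv_at G W (\<eta> W a)"
  using nt_group_hom[of \<eta> F G W] group_hom.hom_inv unfolding el_def by metis

lemma nt_sub: "nt F G \<eta> \<Longrightarrow> psh F \<Longrightarrow> psh G \<Longrightarrow> el F W a \<Longrightarrow> el F W b \<Longrightarrow>
   \<eta> W (plus_at F W a (inv_at F W b)) = plus_at G W (\<eta> W a) (inv_at G W (\<eta> W b))"
  by (simp add: nt_plus nt_inv el_inv)

lemma nt_ext:
  assumes "nt F G \<eta>" "nt F G \<theta>" "\<And>W a. el F W a \<Longrightarrow> \<eta> W a = \<theta> W a"
  shows "\<eta> = \<theta>"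
proof (rule extensionalityI[of _ "Obj C"])
  show "\<eta> \<in> extensional (Obj C)" "\<theta> \<in> extensional (Obj C)" using assms unfolding nat_trans_def by auto
  fix W assume W: "W \<in> Obj C"
  show "\<eta> W = \<theta> W"
  proof (rule extensionalityI[of _ "carrier (FOb F W)"])
    show "\<eta> W \<in> extensional (carrier (FOb F W))" "\<theta> W \<in> extensional (carrier (FOb F W))"
      using assms(1,2) W unfolding nat_trans_def by auto
  qed (use assms(3) W in \<open>auto simp: el_def\<close>)
qed

text \<open>Transformations must be extensional at the object and at the element. Restricting a
  formula in both arguments gives the normal form that identities, sums and composites have in
  \<open>presheaf_cat\<close>.\<close>

definition nat_mk :: "('o, 'm, 'g) presheaf \<Rightarrow> ('o \<Rightarrow> 'g \<Rightarrow> 'h) \<Rightarrow> 'o \<Rightarrow> 'g \<Rightarrow> 'h" where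
  "nat_mk F \<tau> = (\<lambda>W\<in>Obj C. \<lambda>a\<in>carrier (FOb F W). \<tau> W a)"

lemma nat_mk_app: "el F W a \<Longrightarrow> nat_mk F \<tau> W a = \<tau> W a"
  by (simp add: nat_mk_def el_def)

lemma nt_nat_mk:
  assumes F: "psh F"
    and "\<And>W a. el F W a \<Longrightarrow> el G W (\<tau> W a)"
    and "\<And>W a b. el F W a \<Longrightarrow> el F W b \<Longrightarrow> \<tau> W (plus_at F W a b) = plus_at G W (\<tau> W a) (\<tau> W b)"
    and "\<And>X Y f a. ar f X Y \<Longrightarrow> el F Y a \<Longrightarrow> \<tau> X (FAr F f a) = FAr G f (\<tau> Y a)"
  shows "nt F G (nat_mk F \<tau>)"
proof -
  have "nat_mk F \<tau> X (FAr F f a) = FAr G f (nat_mk F \<tau> Y a)"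
    if "X \<in> Obj C" "Y \<in> Obj C" "f \<in> arr C X Y" "a \<in> carrier (FOb F Y)" for X Y f a
  proof -
    have "ar f X Y" "el F Y a" using that by (auto simp: ar_def el_def)
    then show ?thesis using assms(4) el_act[OF F] by (simp add: nat_mk_app)
  qed
  moreover have "nat_mk F \<tau> W \<in> hom (FOb F W) (FOb G W) \<inter> extensional (carrier (FOb F W))"
    if W: "W \<in> Obj C" for W
  proof -
    have "nat_mk F \<tau> W \<in> extensional (carrier (FOb F W))" using W by (simp add: nat_mk_def)
    moreover have "nat_mk F \<tau> W \<in> hom (FOb F W) (FOb G W)"
      using assms(2,3) W el_plus[OF F] by (auto simp: hom_def nat_mk_app el_def)
    ultimately show ?thesis by blast
  qed
  moreover have "nat_mk F \<tau> \<in> extensional (Obj C)" by (simp add: nat_mk_def)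
  ultimately show ?thesis unfolding nat_trans_def by blast
qed

lemma nt_comp:
  assumes "psh F" "nt F G \<eta>" "nt G H \<theta>"
  shows "nt F H (nat_mk F (\<lambda>W a. \<theta> W (\<eta> W a)))"
  by (rule nt_nat_mk) (simp_all add: assms nt_el[OF assms(2)] nt_el[OF assms(3)] nt_plus[OF assms(2)]
      nt_plus[OF assms(3)] nt_nat[OF assms(2)] nt_nat[OF assms(3)])

lemma nt_id:
  assumes "psh F"
  shows "nt F F (nat_mk F (\<lambda>W a. a))"
  by (rule nt_nat_mk) (simp_all add: assms)

lemma nt_zero_map:
  assumes "psh F" "psh G"
  shows "nt F G (nat_mk F (\<lambda>W a. zero_at G W))"
  by (rule nt_nat_mk)
     (use assms in \<open>auto simp: el_def act_zero psh_groups group.is_monoid monoid.one_closed monoid.l_one\<close>)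

lemma plus_swap:
  assumes "psh F" "el F W a" "el F W b" "el F W c" "el F W d"
  shows "plus_at F W (plus_at F W a b) (plus_at F W c d) = plus_at F W (plus_at F W a c) (plus_at F W b d)"
proof -
  interpret G: comm_group "FOb F W" using assms by (simp add: psh_group elD)
  show ?thesis using assms by (simp add: el_def G.m_ac)
qed

lemma nt_add:
  assumes F: "psh F" and G: "psh G" and "nt F G \<eta>" "nt F G \<theta>"
  shows "nt F G (nat_mk F (\<lambda>W a. plus_at G W (\<eta> W a) (\<theta> W a)))"
proof (rule nt_nat_mk[OF F])
  show "el G W (plus_at G W (\<eta> W a) (\<theta> W a))" if "el F W a" for W a
    using that assms by (simp add: el_plus nt_el)
  show "plus_at G W (\<eta> W (plus_at F W a b)) (\<theta> W (plus_at F W a b)) =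
    plus_at G W (plus_at G W (\<eta> W a) (\<theta> W a)) (plus_at G W (\<eta> W b) (\<theta> W b))"
    if "el F W a" "el F W b" for W a b
    using that assms(3,4) by (simp add: nt_plus plus_swap[OF G] nt_el)
  show "plus_at G X (\<eta> X (FAr F f a)) (\<theta> X (FAr F f a)) = FAr G f (plus_at G Y (\<eta> Y a) (\<theta> Y a))"
    if "ar f X Y" "el F Y a" for X Y f a
    using that assms(3,4) by (simp add: nt_nat act_plus[OF G] nt_el)
qed

text \<open>By the Yoneda lemma \<open>x\<close> is a map from \<open>C(-,X)\<close> to
  \<open>F\<close>, and \<open>gen\<close> says that this map is surjective. The predicate
  \<open>ann\<close> says that \<open>r\<close> induces a map from \<open>C(-,R)\<close> onto its
  kernel. Together they are a presentation of \<open>F\<close>.\<close>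

definition gen :: "('o, 'm, 'g) presheaf \<Rightarrow> 'o \<Rightarrow> 'g \<Rightarrow> bool" where
  "gen F X x \<longleftrightarrow> el F X x \<and> (\<forall>W a. el F W a \<longrightarrow> (\<exists>h. ar h W X \<and> a = FAr F h x))"

definition ann :: "('o, 'm, 'g) presheaf \<Rightarrow> 'o \<Rightarrow> 'g \<Rightarrow> 'o \<Rightarrow> 'm \<Rightarrow> bool" where
  "ann F X x R r \<longleftrightarrow> ar r R X \<and> FAr F r x = zero_at F R \<and>
     (\<forall>W h. ar h W X \<longrightarrow> FAr F h x = zero_at F W \<longrightarrow> (\<exists>k. ar k W R \<and> h = r \<cdot> k))"

lemma genD: "gen F X x \<Longrightarrow> el F X x" "gen F X x \<Longrightarrow> el F W a \<Longrightarrow> \<exists>h. ar h W X \<and> a = FAr F h x"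
  by (auto simp: gen_def)

lemma annD: "ann F X x R r \<Longrightarrow> ar r R X" "ann F X x R r \<Longrightarrow> FAr F r x = zero_at F R"
  "ann F X x R r \<Longrightarrow> ar h W X \<Longrightarrow> FAr F h x = zero_at F W \<Longrightarrow> \<exists>k. ar k W R \<and> h = r \<cdot> k"
  by (auto simp: ann_def)

lemma ann_zero:
  assumes "psh F" "ann F X x R r" "el F X x" "ar k W R"
  shows "FAr F (r \<cdot> k) x = zero_at F W"
  using act_comp[OF assms(1,4) annD(1)[OF assms(2)] assms(3)] annD(2)[OF assms(2)] act_zero[OF assms(1,4)]
  by simp

section \<open>Representable functors and presentations by elements\<close>

lemma psh_representable: "X \<in> Obj C \<Longrightarrow> psh (representable C X)"
  unfolding is_presheaf_def representable_def using preadditive unfolding preadditive_def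
  by (auto simp: hom_def)

lemma el_representable: "el (representable C X) W h \<longleftrightarrow> W \<in> Obj C \<and> h \<in> arr C W X"
  by (simp add: el_def representable_def)

lemma nt_representable_map:
  assumes "ar r R X"
  shows "nt (representable C R) (representable C X) (representable_map C r)"
proof -
  have "representable_map C r = nat_mk (representable C R) (\<lambda>W h. r \<cdot> h)"
    by (simp add: representable_map_def nat_mk_def representable_def ar_dom[OF assms])
  moreover have "nt (representable C R) (representable C X) (nat_mk (representable C R) (\<lambda>W h. r \<cdot> h))"
  proof (rule nt_nat_mk[OF psh_representable[OF arD(1)[OF assms]]])
    show "el (representable C X) W (r \<cdot> h)" if "el (representable C R) W h" for W h
      using that ar_comp[OF _ assms, of h W] arD(1)[OF assms] by (simp add: el_representable ar_def)
    show "r \<cdot> plus_at (representable C R) W a b = plus_at (representable C X) W (r \<cdot> a) (r \<cdot> b)"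
      if "el (representable C R) W a" "el (representable C R) W b" for W a b
    proof -
      have "ar a W R" "ar b W R" using that arD(1)[OF assms] by (simp_all add: el_representable ar_def)
      then show ?thesis using comp_add_right[OF _ _ assms, of a W b] by (simp add: representable_def)
    qed
    show "r \<cdot> FAr (representable C R) f a = FAr (representable C X) f (r \<cdot> a)"
      if "ar f V W" "el (representable C R) W a" for V W f a
    proof -
      have "ar a W R" using that arD(1)[OF assms] by (simp_all add: el_representable ar_def)
      then show ?thesis using comp_assoc[OF that(1) _ assms, of a] by (simp add: representable_def)
    qed
  qed
  ultimately show ?thesis by simp
qed

text \<open>By the Yoneda lemma the two transformations of a presentation are determined by the
  images of identities. From here on a presentation is a generator together with an arrow covering
  its annihilator.\<close>

lemma fp_iff:
  "finitely_presented C F \<longleftrightarrow> psh F \<and> (\<exists>X x R r. gen F X x \<and> ann F X x R r)"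
proof
  assume fp: "finitely_presented C F"
  then obtain R X \<alpha> \<pi> where F: "psh F" and R: "R \<in> Obj C" and X: "X \<in> Obj C"
    and \<alpha>: "nt (representable C R) (representable C X) \<alpha>" and \<pi>: "nt (representable C X) F \<pi>"
    and ex: "\<forall>W\<in>Obj C. \<alpha> W ` arr C W R = kernel (Hom C W X) (FOb F W) (\<pi> W) \<and>
      \<pi> W ` arr C W X = carrier (FOb F W)"
    unfolding finitely_presented_def by (elim conjE bexE) (rule that; assumption)
  define r where "r = \<alpha> R (Ident C R)"
  define x where "x = \<pi> X (Ident C X)"
  have eR: "el (representable C R) R (Ident C R)" and eX: "el (representable C X) X (Ident C X)"
    using ar_id[OF R] ar_id[OF X] by (auto simp: el_representable ar_def)
  have r: "ar r R X" using nt_el[OF \<alpha> eR] R X by (simp add: r_def el_representable ar_def)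
  have x: "el F X x" using nt_el[OF \<pi> eX] by (simp add: x_def)
  have ra: "\<alpha> W k = r \<cdot> k" if "ar k W R" for W k
    using nt_nat[OF \<alpha> that eR] comp_id[OF that] by (simp add: representable_def r_def)
  have xa: "\<pi> W h = FAr F h x" if "ar h W X" for W h
    using nt_nat[OF \<pi> that eX] comp_id[OF that] by (simp add: representable_def x_def)
  have "gen F X x"
    unfolding gen_def
  proof (intro conjI x allI impI)
    fix W a assume "el F W a"
    then have "a \<in> \<pi> W ` arr C W X" using ex by (auto simp: el_def)
    then obtain h where "h \<in> arr C W X" "a = \<pi> W h" by blast
    then show "\<exists>h. ar h W X \<and> a = FAr F h x"
      using xa[of h W] arI[OF elD(1)[OF \<open>el F W a\<close>] X] by metis
  qed
  moreover have "ann F X x R r"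
    unfolding ann_def
  proof (intro conjI r allI impI)
    have "\<alpha> R (Ident C R) \<in> kernel (Hom C R X) (FOb F R) (\<pi> R)"
      using ex R eR by (auto simp: el_representable)
    then show "FAr F r x = zero_at F R" using xa[OF r] by (simp add: kernel_def r_def)
    fix W h assume h: "ar h W X" and z: "FAr F h x = zero_at F W"
    then have "h \<in> kernel (Hom C W X) (FOb F W) (\<pi> W)" using xa[OF h] by (simp add: kernel_def ar_def)
    then have "h \<in> \<alpha> W ` arr C W R" using ex arD(1)[OF h] by simp
    then obtain k where "k \<in> arr C W R" "h = \<alpha> W k" by blast
    then show "\<exists>k. ar k W R \<and> h = r \<cdot> k" using ra R arD(1)[OF h] by (auto simp: ar_def)
  qed
  ultimately show "psh F \<and> (\<exists>X x R r. gen F X x \<and> ann F X x R r)" using F by blast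
next
  assume "psh F \<and> (\<exists>X x R r. gen F X x \<and> ann F X x R r)"
  then obtain X x R r where F: "psh F" and g: "gen F X x" and a: "ann F X x R r" by blast
  note x = genD(1)[OF g] and r = annD(1)[OF a]
  define \<pi> where "\<pi> = nat_mk (representable C X) (\<lambda>W h. FAr F h x)"
  have X: "X \<in> Obj C" and R: "R \<in> Obj C" using r by (auto simp: ar_def)
  have \<pi>: "nt (representable C X) F \<pi>"
    unfolding \<pi>_def
  proof (rule nt_nat_mk[OF psh_representable[OF X]])
    show "el F W (FAr F h x)" if "el (representable C X) W h" for W h
      using that el_act[OF F _ x, of h W] X by (simp add: el_representable ar_def)
    show "FAr F (plus_at (representable C X) W h k) x = plus_at F W (FAr F h x) (FAr F k x)"
      if "el (representable C X) W h" "el (representable C X) W k" for W h k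
    proof -
      have "ar h W X" "ar k W X" using that X by (simp_all add: el_representable ar_def)
      then show ?thesis using act_add[OF F _ _ x, of h W k] by (simp add: representable_def)
    qed
    show "FAr F (FAr (representable C X) f h) x = FAr F f (FAr F h x)"
      if "ar f V W" "el (representable C X) W h" for V W f h
    proof -
      have "ar h W X" using that X by (simp_all add: el_representable ar_def)
      then show ?thesis using act_comp[OF F that(1) _ x, of h] by (simp add: representable_def)
    qed
  qed
  have app: "\<pi> W h = FAr F h x" if "W \<in> Obj C" "h \<in> arr C W X" for W h
    using that by (simp add: \<pi>_def nat_mk_app el_representable)
  have "\<forall>W\<in>Obj C. representable_map C r W ` arr C W R = kernel (Hom C W X) (FOb F W) (\<pi> W) \<and>
      \<pi> W ` arr C W X = carrier (FOb F W)"
  proof (intro ballI conjI)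
    fix W assume W: "W \<in> Obj C"
    have "y \<in> \<pi> W ` arr C W X \<longleftrightarrow> y \<in> carrier (FOb F W)" for y
    proof -
      have "y \<in> \<pi> W ` arr C W X \<longleftrightarrow> (\<exists>h. ar h W X \<and> y = FAr F h x)"
        using W X app[OF W] by (auto simp: ar_def)
      also have "\<dots> \<longleftrightarrow> el F W y" using genD(2)[OF g, of W y] el_act[OF F _ x, of _ W] by blast
      finally show ?thesis using W by (simp add: el_def)
    qed
    then show "\<pi> W ` arr C W X = carrier (FOb F W)" by blast
    have "y \<in> (\<lambda>k. r \<cdot> k) ` arr C W R \<longleftrightarrow> y \<in> {h \<in> arr C W X. FAr F h x = zero_at F W}" for y
      using W X R annD(3)[OF a, of y W] ann_zero[OF F a x, of _ W] ar_comp[OF _ r, of _ W]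
      by (auto simp: ar_def)
    then have "(\<lambda>k. r \<cdot> k) ` arr C W R = {h \<in> arr C W X. FAr F h x = zero_at F W}" by blast
    moreover have "representable_map C r W ` arr C W R = (\<lambda>k. r \<cdot> k) ` arr C W R"
      using W by (simp add: representable_map_def ar_dom[OF r] cong: image_cong)
    moreover have "kernel (Hom C W X) (FOb F W) (\<pi> W) = {h \<in> arr C W X. FAr F h x = zero_at F W}"
      using app[OF W] by (auto simp: kernel_def)
    ultimately show "representable_map C r W ` arr C W R = kernel (Hom C W X) (FOb F W) (\<pi> W)" by simp
  qed
  then show "finitely_presented C F"
    unfolding finitely_presented_def using F X R nt_representable_map[OF r] \<pi> by blast
qed

text \<open>Two multiples of the generator agree only if the difference of their coefficients is a
  multiple of the relation \<open>r\<close>, and \<open>r\<close> kills \<open>y\<close>. This is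
  what makes a map prescribed on a generator well defined.\<close>

lemma gen_eqD:
  assumes F: "psh F" and G: "psh G" and x: "el F X x" and a: "ann F X x R r"
    and y: "el G X y" and z: "FAr G r y = zero_at G R"
    and h: "ar h W X" and k: "ar k W X" and e: "FAr F h x = FAr F k x"
  shows "FAr G h y = FAr G k y"
proof -
  note r = annD(1)[OF a]
  have "FAr F (add W X h (neg W X k)) x = zero_at F W"
    using act_sub[OF F h k x] e sub_zero_iff[OF F el_act[OF F h x] el_act[OF F k x]] by simp
  then obtain l where l: "ar l W R" "add W X h (neg W X k) = r \<cdot> l"
    using annD(3)[OF a ar_add[OF h ar_neg[OF k]]] by blast
  have "FAr G (r \<cdot> l) y = zero_at G W"
    using act_comp[OF G l(1) r y] z act_zero[OF G l(1)] by simp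
  then show ?thesis
    using act_sub[OF G h k y] l sub_zero_iff[OF G el_act[OF G h y] el_act[OF G k y]] by simp
qed

text \<open>The universal property of a cokernel of representable functors: a map out of
  \<open>F\<close> is given by an element of \<open>G\<close> that the relation kills.\<close>

lemma fp_hom:
  assumes F: "psh F" and G: "psh G" and g: "gen F X x" and a: "ann F X x R r"
    and y: "el G X y" and z: "FAr G r y = zero_at G R"
  obtains \<tau> where "nt F G \<tau>" "\<And>W h. ar h W X \<Longrightarrow> \<tau> W (FAr F h x) = FAr G h y"
proof -
  note x = genD(1)[OF g]
  \<comment> \<open>A coefficient is chosen for every element of \<open>F\<close>; by
    \<open>gen_eqD\<close> the value does not depend on the choice.\<close>
  define \<tau> where "\<tau> W b = FAr G (SOME h. ar h W X \<and> b = FAr F h x) y" for W b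
  have t: "\<tau> W (FAr F h x) = FAr G h y" if h: "ar h W X" for W h
  proof -
    define k where "k = (SOME k. ar k W X \<and> FAr F h x = FAr F k x)"
    have "ar k W X \<and> FAr F h x = FAr F k x"
      unfolding k_def by (rule someI[of _ h]) (use h in blast)
    then show ?thesis unfolding \<tau>_def k_def[symmetric]
      using gen_eqD[OF F G x a y z h, of k] by simp
  qed
  have "nt F G (nat_mk F \<tau>)"
  proof (rule nt_nat_mk[OF F])
    show "el G W (\<tau> W b)" if "el F W b" for W b
      using genD(2)[OF g that] t el_act[OF G _ y] by auto
    show "\<tau> W (plus_at F W b c) = plus_at G W (\<tau> W b) (\<tau> W c)" if b: "el F W b" and c: "el F W c" for W b c
    proof -
      obtain h k where h: "ar h W X" "b = FAr F h x" and k: "ar k W X" "c = FAr F k x"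
        using genD(2)[OF g b] genD(2)[OF g c] by blast
      then show ?thesis
        using act_add[OF F h(1) k(1) x] act_add[OF G h(1) k(1) y] t[OF h(1)] t[OF k(1)] t[OF ar_add[OF h(1) k(1)]] by simp
    qed
    show "\<tau> V (FAr F f b) = FAr G f (\<tau> W b)" if f: "ar f V W" and b: "el F W b" for V W f b
    proof -
      obtain h where h: "ar h W X" "b = FAr F h x" using genD(2)[OF g b] by blast
      then show ?thesis
        using act_comp[OF F f h(1) x] act_comp[OF G f h(1) y] t[OF h(1)] t[OF ar_comp[OF f h(1)]] by simp
    qed
  qed
  moreover have "nat_mk F \<tau> W (FAr F h x) = FAr G h y" if "ar h W X" for W h
    using t[OF that] by (simp add: nat_mk_app el_act[OF F that x])
  ultimately show thesis by (rule that)
qed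

lemma nt_eq_gen:
  assumes F: "psh F" and g: "gen F X x" and "nt F G \<eta>" "nt F G \<theta>" "\<eta> X x = \<theta> X x"
  shows "\<eta> = \<theta>"
proof (rule nt_ext[OF assms(3,4)])
  fix W a assume "el F W a"
  then obtain h where "ar h W X" "a = FAr F h x" using genD(2)[OF g] by blast
  then show "\<eta> W a = \<theta> W a"
    using nt_nat[OF assms(3) _ genD(1)[OF g]] nt_nat[OF assms(4) _ genD(1)[OF g]] assms(5) by simp
qed

text \<open>Every finitely presented functor is isomorphic to some \<open>cokf r\<close>, whose values lie in the type used for
  \<open>mod C\<close>.\<close>

definition cokf :: "'m \<Rightarrow> ('o, 'm, 'm set) presheaf" where
  "cokf r = presheaf_cok C (representable C (Dom C r)) (representable C (Cod C r)) (representable_map C r)"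

definition cokcls :: "'m \<Rightarrow> 'o \<Rightarrow> 'm \<Rightarrow> 'm set" where
  "cokcls r W h = ((\<lambda>k. r \<cdot> k) ` arr C W (Dom C r)) #>\<^bsub>Hom C W (Cod C r)\<^esub> h"

text \<open>The class of the identity generates the cokernel, and \<open>r\<close> covers its
  annihilator by construction. The effort lies in showing that the operations on cosets can be
  computed on representatives.\<close>

lemma cokf_facts:
  assumes r: "ar r R X"
  shows "psh (cokf r)" "gen (cokf r) X (cokcls r X (Ident C X))"
    "ann (cokf r) X (cokcls r X (Ident C X)) R r"
    "\<And>W h. ar h W X \<Longrightarrow> FAr (cokf r) h (cokcls r X (Ident C X)) = cokcls r W h"
proof -
  have X: "X \<in> Obj C" and R: "R \<in> Obj C" using r by (auto simp: ar_def)
  define N where "N W = (\<lambda>k. r \<cdot> k) ` arr C W R" for W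
  have cls: "cokcls r W h = N W #>\<^bsub>Hom C W X\<^esub> h" for W h
    by (simp add: cokcls_def N_def ar_dom[OF r] ar_cod[OF r])
  have sub: "subgroup (N W) (Hom C W X)" if W: "W \<in> Obj C" for W
  proof (rule group.subgroupI)
    show "group (Hom C W X)" using hom_group[OF W X] by (rule comm_group.axioms)
    show "N W \<subseteq> arr C W X" using ar_comp[OF _ r, of _ W] W R by (auto simp: N_def ar_def)
    show "N W \<noteq> {}" using ar_zr[OF W R] by (auto simp: N_def ar_def)
    show "inv\<^bsub>Hom C W X\<^esub> a \<in> N W" if "a \<in> N W" for a
      using that comp_neg[OF _ r, of _ W] ar_neg[of _ W R] W R by (force simp: N_def ar_def)
    show "add W X a b \<in> N W" if a: "a \<in> N W" and b: "b \<in> N W" for a b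
    proof -
      obtain k l where "ar k W R" "a = r \<cdot> k" "ar l W R" "b = r \<cdot> l"
        using a b arI[OF W R] unfolding N_def by blast
      then have "add W X a b = r \<cdot> add W R k l" "ar (add W R k l) W R"
        using comp_add_right[OF _ _ r] ar_add by auto
      then show ?thesis by (auto simp: N_def ar_def)
    qed
  qed
  have nor: "N W \<lhd> Hom C W X" if "W \<in> Obj C" for W
    using comm_group.subgroup_imp_normal[OF hom_group[OF that X] sub[OF that]] .
  have Ob: "FOb (cokf r) W = Hom C W X Mod N W" if "W \<in> Obj C" for W
    using that by (simp add: cokf_def presheaf_cok_def N_def representable_def representable_map_def
        ar_dom[OF r] ar_cod[OF r] cong: image_cong)
  have car: "carrier (FOb (cokf r) W) = (\<lambda>h. cokcls r W h) ` arr C W X" if "W \<in> Obj C" for W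
    by (simp add: Ob[OF that] carrier_FactGroup cls)
  have elc: "el (cokf r) W a \<longleftrightarrow> (\<exists>h. ar h W X \<and> a = cokcls r W h)" if "W \<in> Obj C" for W a
    using car[OF that] that X by (auto simp: el_def ar_def)
  have mul: "plus_at (cokf r) W (cokcls r W h) (cokcls r W k) = cokcls r W (add W X h k)"
    if "ar h W X" "ar k W X" for W h k
  proof -
    have W: "W \<in> Obj C" using that by (auto simp: ar_def)
    show ?thesis using normal.rcos_sum[OF nor[OF W], of h k] that by (simp add: Ob[OF W] cls ar_def)
  qed
  have one: "zero_at (cokf r) W = N W" if "W \<in> Obj C" for W
    by (simp add: Ob[OF that])
  have act: "FAr (cokf r) w (cokcls r W h) = cokcls r V (h \<cdot> w)" if w: "ar w V W" and h: "ar h W X" for w V W h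
  proof -
    have V: "V \<in> Obj C" and W: "W \<in> Obj C" using w by (auto simp: ar_def)
    have hw: "ar (h \<cdot> w) V X" using ar_comp[OF w h] .
    \<comment> \<open>Precomposition with \<open>w\<close> maps a coset into a coset but perhaps not
      onto it. The action in \<open>presheaf_cok\<close> therefore adds the subgroup
      \<open>N V\<close> again, and the sum is shown to be the expected coset.\<close>
    have "FAr (cokf r) w (cokcls r W h) = N V <#>\<^bsub>Hom C V X\<^esub> ((\<lambda>g. g \<cdot> w) ` cokcls r W h)"
      using V by (simp add: cokf_def presheaf_cok_def representable_def representable_map_def N_def
          ar_dom[OF r] ar_cod[OF r] ar_dom[OF w] cong: image_cong)
    also have "\<dots> = N V #>\<^bsub>Hom C V X\<^esub> (h \<cdot> w)"
    proof
      have G: "group (Hom C V X)" using hom_group[OF V X] by (rule comm_group.axioms)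
      show "N V <#>\<^bsub>Hom C V X\<^esub> (\<lambda>g. g \<cdot> w) ` cokcls r W h \<subseteq> N V #>\<^bsub>Hom C V X\<^esub> (h \<cdot> w)"
      proof
        fix y assume "y \<in> N V <#>\<^bsub>Hom C V X\<^esub> (\<lambda>g. g \<cdot> w) ` cokcls r W h"
        then obtain n k where n: "n \<in> N V" and k: "k \<in> arr C W R"
          and y: "y = add V X n (add W X (r \<cdot> k) h \<cdot> w)"
          by (auto simp: set_mult_def cls r_coset_def N_def)
        have k': "ar k W R" using k W R by (simp add: ar_def)
        have n': "ar n V X" using n subgroup.subset[OF sub[OF V]] V X by (auto simp: ar_def)
        have e: "add W X (r \<cdot> k) h \<cdot> w = add V X (r \<cdot> (k \<cdot> w)) (h \<cdot> w)"
          using comp_add_left[OF w ar_comp[OF k' r] h] comp_assoc[OF w k' r] by simp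
        have m: "r \<cdot> (k \<cdot> w) \<in> N V" using ar_comp[OF w k'] by (auto simp: N_def ar_def)
        have m': "ar (r \<cdot> (k \<cdot> w)) V X" using ar_comp[OF ar_comp[OF w k'] r] .
        have "y = add V X (add V X n (r \<cdot> (k \<cdot> w))) (h \<cdot> w)"
          unfolding y e using add_assoc[OF n' m' hw] by simp
        moreover have "add V X n (r \<cdot> (k \<cdot> w)) \<in> N V" using subgroup.m_closed[OF sub[OF V] n m] .
        ultimately show "y \<in> N V #>\<^bsub>Hom C V X\<^esub> (h \<cdot> w)" by (auto simp: r_coset_def)
      qed
      show "N V #>\<^bsub>Hom C V X\<^esub> (h \<cdot> w) \<subseteq> N V <#>\<^bsub>Hom C V X\<^esub> (\<lambda>g. g \<cdot> w) ` cokcls r W h"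
      proof -
        have "h \<in> cokcls r W h"
          unfolding cls using group.rcos_self[OF _ _ sub[OF W], of h] hom_group[OF W X] h
          by (simp add: comm_group_def ar_def)
        then show ?thesis by (auto simp: set_mult_def r_coset_def)
      qed
    qed
    finally show ?thesis by (simp add: cls)
  qed
  show P: "psh (cokf r)"
    unfolding is_presheaf_def
  proof (intro conjI ballI)
    fix W assume W: "W \<in> Obj C"
    show "comm_group (FOb (cokf r) W)"
      unfolding Ob[OF W] by (rule comm_group.abelian_FactGroup[OF hom_group[OF W X] sub[OF W]])
    show "FAr (cokf r) (Ident C W) a = a" if a: "a \<in> carrier (FOb (cokf r) W)" for a
    proof -
      obtain h where "ar h W X" "a = cokcls r W h" using a iffD1[OF elc[OF W, of a]] W by (auto simp: el_def)
      then show ?thesis using act[OF ar_id[OF W]] comp_id by simp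
    qed
    fix Y f assume Y: "Y \<in> Obj C" and f: "f \<in> arr C W Y"
    have f': "ar f W Y" using f W Y by (simp add: ar_def)
    show "FAr (cokf r) f \<in> hom (FOb (cokf r) Y) (FOb (cokf r) W)"
    proof (rule homI)
      fix a assume "a \<in> carrier (FOb (cokf r) Y)"
      then obtain h where h: "ar h Y X" "a = cokcls r Y h" using iffD1[OF elc[OF Y, of a]] Y by (auto simp: el_def)
      then show "FAr (cokf r) f a \<in> carrier (FOb (cokf r) W)"
        using act[OF f' h(1)] ar_comp[OF f' h(1)] iffD2[OF elc[OF W, of "cokcls r W (h \<cdot> f)"]] h(2)
        by (auto simp: el_def)
      fix b assume "b \<in> carrier (FOb (cokf r) Y)"
      then obtain k where k: "ar k Y X" "b = cokcls r Y k" using iffD1[OF elc[OF Y, of b]] Y by (auto simp: el_def)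
      show "FAr (cokf r) f (plus_at (cokf r) Y a b) = plus_at (cokf r) W (FAr (cokf r) f a) (FAr (cokf r) f b)"
        using h k act[OF f'] mul ar_comp[OF f'] ar_add comp_add_left[OF f'] by simp
    qed
    show "FAr (cokf r) (add W Y f g) a = plus_at (cokf r) W (FAr (cokf r) f a) (FAr (cokf r) g a)"
      if "g \<in> arr C W Y" and a: "a \<in> carrier (FOb (cokf r) Y)" for g a
    proof -
      have g: "ar g W Y" using that W Y by (simp add: ar_def)
      obtain h where h: "ar h Y X" "a = cokcls r Y h" using a iffD1[OF elc[OF Y, of a]] Y by (auto simp: el_def)
      show ?thesis
        using h act[OF f'] act[OF g] act[OF ar_add[OF f' g]] mul ar_comp[OF f'] ar_comp[OF g]
          comp_add_right[OF f' g] by simp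
    qed
    fix Z g a assume Z: "Z \<in> Obj C" and "g \<in> arr C Y Z" and "a \<in> carrier (FOb (cokf r) Z)"
    then have g: "ar g Y Z" using Y by (simp add: ar_def)
    obtain h where h: "ar h Z X" "a = cokcls r Z h"
      using \<open>a \<in> carrier (FOb (cokf r) Z)\<close> iffD1[OF elc[OF Z, of a]] Z by (auto simp: el_def)
    show "FAr (cokf r) (g \<cdot> f) a = FAr (cokf r) f (FAr (cokf r) g a)"
      using h act[OF ar_comp[OF f' g]] act[OF g] act[OF f'] ar_comp[OF g] comp_assoc[OF f' g] by simp
  qed
  show acti: "FAr (cokf r) h (cokcls r X (Ident C X)) = cokcls r W h" if "ar h W X" for W h
    using act[OF that ar_id[OF X]] comp_id[OF that] by simp
  show "gen (cokf r) X (cokcls r X (Ident C X))"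
    unfolding gen_def using elc X ar_id[OF X] acti elD(1) by metis
  show "ann (cokf r) X (cokcls r X (Ident C X)) R r"
    unfolding ann_def
  proof (intro conjI r allI impI)
    have G: "group (Hom C W X)" if "W \<in> Obj C" for W using hom_group[OF that X] by (rule comm_group.axioms)
    have "r \<in> N R" using ar_id[OF R] comp_id[OF r] unfolding N_def ar_def by force
    then have "cokcls r R r = N R"
      unfolding cls by (intro group.coset_join2 G R sub) (use r in \<open>auto simp: ar_def\<close>)
    then show "FAr (cokf r) r (cokcls r X (Ident C X)) = zero_at (cokf r) R"
      by (simp add: acti[OF r] one[OF R])
    fix W h assume h: "ar h W X" and "FAr (cokf r) h (cokcls r X (Ident C X)) = zero_at (cokf r) W"
    then have "N W #>\<^bsub>Hom C W X\<^esub> h = N W" using acti[OF h] one arD(1)[OF h] by (simp add: cls)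
    then have "h \<in> N W" using group.coset_join1[OF G _ _ sub] h by (metis ar_def subgroup.subset sub)
    then show "\<exists>k. ar k W R \<and> h = r \<cdot> k" using arD(1)[OF h] R by (auto simp: N_def ar_def)
  qed
qed

lemma fp_cokf: "ar r R X \<Longrightarrow> finitely_presented C (cokf r)"
  using cokf_facts fp_iff by blast

text \<open>Both functors have a generator whose annihilator is covered by the same
  \<open>r\<close>. The comparison map exists by \<open>fp_hom\<close>, and \<open>gen_eqD\<close>
  in the opposite direction makes it injective.\<close>

lemma presheaf_iso_cokf:
  assumes F: "psh F" and g: "gen F X x" and a: "ann F X x R r"
  shows "presheaf_iso C F (cokf r)"
proof -
  note r = annD(1)[OF a] and x = genD(1)[OF g]
  note c = cokf_facts[OF r]
  obtain \<tau> where \<tau>: "nt F (cokf r) \<tau>" "\<And>W h. ar h W X \<Longrightarrow> \<tau> W (FAr F h x) = FAr (cokf r) h (cokcls r X (Ident C X))"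
    using fp_hom[OF F c(1) g a genD(1)[OF c(2)] annD(2)[OF c(3)]] by blast
  have "\<tau> W \<in> iso (FOb F W) (FOb (cokf r) W)" if W: "W \<in> Obj C" for W
  proof -
    have "inj_on (\<tau> W) (carrier (FOb F W))"
    proof (rule inj_onI)
      fix b d assume "b \<in> carrier (FOb F W)" "d \<in> carrier (FOb F W)" and e: "\<tau> W b = \<tau> W d"
      then obtain h k where h: "ar h W X" "b = FAr F h x" and k: "ar k W X" "d = FAr F k x"
        using genD(2)[OF g] W by (meson el_def)
      have "FAr (cokf r) h (cokcls r X (Ident C X)) = FAr (cokf r) k (cokcls r X (Ident C X))"
        using e h k \<tau>(2) by simp
      then show "b = d"
        using gen_eqD[OF c(1) F genD(1)[OF c(2)] c(3) x annD(2)[OF a] h(1) k(1)] h k by simp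
    qed
    moreover have "carrier (FOb (cokf r) W) \<subseteq> \<tau> W ` carrier (FOb F W)"
    proof
      fix b assume "b \<in> carrier (FOb (cokf r) W)"
      then obtain h where "ar h W X" "b = FAr (cokf r) h (cokcls r X (Ident C X))"
        using genD(2)[OF c(2)] W by (meson el_def)
      then show "b \<in> \<tau> W ` carrier (FOb F W)" using \<tau>(2) el_act[OF F _ x] by (metis elD(2) imageI)
    qed
    ultimately show ?thesis
      using nt_hom[OF \<tau>(1) W] by (auto simp: iso_def bij_betw_def hom_def)
  qed
  then show ?thesis unfolding presheaf_iso_def using \<tau>(1) by blast
qed

end

section \<open>Kernels, cokernels and pullbacks of finitely presented functors\<close>

locale wk_cat = add_cat C for C :: "('o, 'm, 'z) acat_scheme" (structure) +
  assumes weak_kernels: "has_weak_kernels C"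
begin

lemma weak_kernelE:
  assumes f: "ar f X Y"
  obtains g W where "ar g W X" "f \<cdot> g = zr W Y"
    "\<And>V k. ar k V X \<Longrightarrow> f \<cdot> k = zr V Y \<Longrightarrow> \<exists>h. ar h V W \<and> k = g \<cdot> h"
proof -
  have "\<exists>W\<in>Obj C. \<exists>g\<in>arr C W X. \<forall>V\<in>Obj C.
      (\<lambda>h. g \<cdot> h) ` arr C V W = {k \<in> arr C V X. f \<cdot> k = zr V Y}"
    using weak_kernels f unfolding has_weak_kernels_def ar_def by simp
  then obtain W g where W: "W \<in> Obj C" and g: "g \<in> arr C W X"
    and im: "\<And>V. V \<in> Obj C \<Longrightarrow> (\<lambda>h. g \<cdot> h) ` arr C V W = {k \<in> arr C V X. f \<cdot> k = zr V Y}" by blast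
  have g': "ar g W X" using W g f by (simp add: ar_def)
  \<comment> \<open>Through the identity of \<open>W\<close> the condition on images puts
    \<open>g\<close> itself among the arrows killed by \<open>f\<close>.\<close>
  have "g \<cdot> Ident C W \<in> (\<lambda>h. g \<cdot> h) ` arr C W W" using ar_id[OF W] by (simp add: ar_def)
  then have "f \<cdot> g = zr W Y" using im[OF W] comp_id[OF g'] by simp
  moreover have "\<exists>h. ar h V W \<and> k = g \<cdot> h" if k: "ar k V X" and z: "f \<cdot> k = zr V Y" for V k
  proof -
    have "k \<in> (\<lambda>h. g \<cdot> h) ` arr C V W" using im[of V] k z by (simp add: ar_def)
    then show ?thesis using W k by (auto simp: ar_def)
  qed
  ultimately show thesis using that[OF g'] by blast
qed

text \<open>A pair \<open>(h, k)\<close> satisfies \<open>m h = r k\<close> exactly when the induced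
  arrow into the biproduct of \<open>Y\<close> and \<open>R\<close> is killed by
  \<open>m p - r q\<close>. A weak kernel of this difference is the weak pullback.\<close>

lemma weak_pullbackE:
  assumes m: "ar m Y X" and r: "ar r R X"
  obtains n N n' where "ar n N Y" "ar n' N R" "m \<cdot> n = r \<cdot> n'"
    "\<And>W h k. ar h W Y \<Longrightarrow> ar k W R \<Longrightarrow> m \<cdot> h = r \<cdot> k \<Longrightarrow> \<exists>l. ar l W N \<and> h = n \<cdot> l \<and> k = n' \<cdot> l"
proof -
  have Y: "Y \<in> Obj C" and R: "R \<in> Obj C" using m r by (auto simp: ar_def)
  obtain P i j p q where b: "biproduct C Y R P i j p q" and P: "P \<in> Obj C"
    using biproductE[OF Y R] .
  note bp = biproductD[OF b Y R]
  note mp = ar_comp[OF bp(3) m] and rq = ar_comp[OF bp(4) r]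
  define \<phi> where "\<phi> = add P X (m \<cdot> p) (neg P X (r \<cdot> q))"
  have \<phi>: "ar \<phi> P X" unfolding \<phi>_def by (rule ar_add[OF mp ar_neg[OF rq]])
  have \<phi>t: "\<phi> \<cdot> t = add W X (m \<cdot> (p \<cdot> t)) (neg W X (r \<cdot> (q \<cdot> t)))" if t: "ar t W P" for t W
    unfolding \<phi>_def using sub_comp[OF t mp rq] comp_assoc[OF t bp(3) m] comp_assoc[OF t bp(4) r] by simp
  obtain N g where g: "ar g N P" "\<phi> \<cdot> g = zr N X"
    and u: "\<And>V k. ar k V P \<Longrightarrow> \<phi> \<cdot> k = zr V X \<Longrightarrow> \<exists>h. ar h V N \<and> k = g \<cdot> h"
    by (rule weak_kernelE[OF \<phi>]) (rule that; assumption)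
  note n = ar_comp[OF g(1) bp(3)] ar_comp[OF g(1) bp(4)]
  have "m \<cdot> (p \<cdot> g) = r \<cdot> (q \<cdot> g)"
    using \<phi>t[OF g(1)] g(2) sub_eq_zr[OF ar_comp[OF n(1) m] ar_comp[OF n(2) r]] by simp
  moreover have "\<exists>l. ar l W N \<and> h = (p \<cdot> g) \<cdot> l \<and> k = (q \<cdot> g) \<cdot> l"
    if h: "ar h W Y" and k: "ar k W R" and e: "m \<cdot> h = r \<cdot> k" for W h k
  proof -
    note t = biproduct_pair[OF b h k]
    have "\<phi> \<cdot> add W P (i \<cdot> h) (j \<cdot> k) = zr W X"
      using \<phi>t[OF t(1)] t(2,3) e sub_eq_zr[OF ar_comp[OF h m] ar_comp[OF k r]] by simp
    then obtain l where l: "ar l W N" "add W P (i \<cdot> h) (j \<cdot> k) = g \<cdot> l" using u[OF t(1)] by blast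
    then show ?thesis
      using t(2,3) comp_assoc[OF l(1) g(1) bp(3)] comp_assoc[OF l(1) g(1) bp(4)]
      by (intro exI[of _ l]) simp
  qed
  ultimately show thesis using that[OF n] by blast
qed

abbreviation fp :: "('o, 'm, 'g) presheaf \<Rightarrow> bool" where
  "fp F \<equiv> finitely_presented C F"

lemma fp_psh: "fp F \<Longrightarrow> psh F"
  by (simp add: fp_iff)

lemma fp_genE:
  assumes "fp F" obtains X x where "gen F X x"
  using assms[unfolded fp_iff] by blast

text \<open>Finitely presented functors are coherent: by the Yoneda lemma this lemma says that the pullback of two
  maps from representables into \<open>G\<close> is covered by a representable. All finite limits and the cokernels
  below are obtained from it.\<close>

lemma element_relationE:
  assumes G: "fp G" and y: "el G Y y" and z: "el G Z z"
  obtains n N n' where "ar n N Y" "ar n' N Z" "FAr G n y = FAr G n' z"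
    "\<And>W h k. ar h W Y \<Longrightarrow> ar k W Z \<Longrightarrow> FAr G h y = FAr G k z \<Longrightarrow> \<exists>l. ar l W N \<and> h = n \<cdot> l \<and> k = n' \<cdot> l"
proof -
  obtain X x R r where psh: "psh G" and g: "gen G X x" and a: "ann G X x R r" using G[unfolded fp_iff] by blast
  note x = genD(1)[OF g] and r = annD(1)[OF a]
  obtain m where m: "ar m Y X" "y = FAr G m x" using genD(2)[OF g y] by blast
  obtain m' where m': "ar m' Z X" "z = FAr G m' x" using genD(2)[OF g z] by blast
  have Y: "Y \<in> Obj C" and Z: "Z \<in> Obj C" using y z by (auto simp: el_def)
  obtain P i j p q where b: "biproduct C Y Z P i j p q" and "P \<in> Obj C" using biproductE[OF Y Z] .
  note bp = biproductD[OF b Y Z]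
  note mp = ar_comp[OF bp(3) m(1)] and mq = ar_comp[OF bp(4) m'(1)]
  define u where "u = add P X (m \<cdot> p) (neg P X (m' \<cdot> q))"
  have u: "ar u P X" unfolding u_def by (rule ar_add[OF mp ar_neg[OF mq]])
  have ut: "FAr G (u \<cdot> t) x = zero_at G W \<longleftrightarrow> FAr G (p \<cdot> t) y = FAr G (q \<cdot> t) z" if t: "ar t W P" for t W
  proof -
    note pt = ar_comp[OF t bp(3)] and qt = ar_comp[OF t bp(4)]
    have "u \<cdot> t = add W X (m \<cdot> (p \<cdot> t)) (neg W X (m' \<cdot> (q \<cdot> t)))"
      unfolding u_def using sub_comp[OF t mp mq] comp_assoc[OF t bp(3) m(1)] comp_assoc[OF t bp(4) m'(1)] by simp
    then show ?thesis
      using act_sub[OF psh ar_comp[OF pt m(1)] ar_comp[OF qt m'(1)] x]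
        act_comp[OF psh pt m(1) x] act_comp[OF psh qt m'(1) x] m(2) m'(2)
        sub_zero_iff[OF psh el_act[OF psh pt y] el_act[OF psh qt z]] by simp
  qed
  \<comment> \<open>Two elements agree exactly when the difference of their coefficients at the
    generator \<open>x\<close> is a multiple of \<open>r\<close>; hence the weak pullback of
    \<open>u\<close> along \<open>r\<close>.\<close>
  obtain N n n' where n: "ar n N P" "ar n' N R" "u \<cdot> n = r \<cdot> n'"
    and univ: "\<And>W h k. ar h W P \<Longrightarrow> ar k W R \<Longrightarrow> u \<cdot> h = r \<cdot> k \<Longrightarrow> \<exists>l. ar l W N \<and> h = n \<cdot> l \<and> k = n' \<cdot> l"
    by (rule weak_pullbackE[OF u r]) (rule that; assumption)
  show thesis
  proof (rule that[OF ar_comp[OF n(1) bp(3)] ar_comp[OF n(1) bp(4)]])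
    show "FAr G (p \<cdot> n) y = FAr G (q \<cdot> n) z"
      using ut[OF n(1)] n(3) ann_zero[OF psh a x n(2)] by simp
    fix W h k assume h: "ar h W Y" and k: "ar k W Z" and e: "FAr G h y = FAr G k z"
    note t = biproduct_pair[OF b h k]
    have "FAr G (u \<cdot> add W P (i \<cdot> h) (j \<cdot> k)) x = zero_at G W" using ut[OF t(1)] t(2,3) e by simp
    then obtain s where s: "ar s W R" "u \<cdot> add W P (i \<cdot> h) (j \<cdot> k) = r \<cdot> s"
      using annD(3)[OF a ar_comp[OF t(1) u]] by blast
    then obtain l where l: "ar l W N" "add W P (i \<cdot> h) (j \<cdot> k) = n \<cdot> l" using univ[OF t(1)] by blast
    then show "\<exists>l. ar l W N \<and> h = (p \<cdot> n) \<cdot> l \<and> k = (q \<cdot> n) \<cdot> l"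
      using t(2,3) comp_assoc[OF l(1) n(1) bp(3)] comp_assoc[OF l(1) n(1) bp(4)]
      by (intro exI[of _ l]) simp
  qed
qed

lemma annE:
  assumes G: "fp G" and y: "el G Y y"
  obtains N n where "ann G Y y N n"
proof -
  note psh = fp_psh[OF G]
  have Y: "Y \<in> Obj C" using y by (simp add: el_def)
  \<comment> \<open>With the zero element as partner the relation becomes the annihilator of
    \<open>y\<close>.\<close>
  obtain N n n' where n: "ar n N Y" "ar n' N Y" "FAr G n y = FAr G n' (zero_at G Y)"
    and u: "\<And>W h k. ar h W Y \<Longrightarrow> ar k W Y \<Longrightarrow> FAr G h y = FAr G k (zero_at G Y) \<Longrightarrow> \<exists>l. ar l W N \<and> h = n \<cdot> l \<and> k = n' \<cdot> l"
    by (rule element_relationE[OF G y el_zero[OF psh Y]]) (rule that; assumption)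
  have "\<exists>k. ar k W N \<and> h = n \<cdot> k" if h: "ar h W Y" "FAr G h y = zero_at G W" for W h
    using u[OF h(1) h(1)] act_zero[OF psh h(1)] h(2) by auto
  then have "ann G Y y N n"
    unfolding ann_def using n act_zero[OF psh n(2)] by simp
  then show thesis by (rule that)
qed

text \<open>\<open>P\<close> is the image of \<open>C(-,X)\<close> in the direct sum of
  \<open>F\<close> and \<open>G\<close> under \<open>(x, y)\<close>. Its relations are the common
  ones of \<open>x\<close> and \<open>y\<close>, and the weak pullback of the two annihilators
  covers them. Joint injectivity of \<open>p\<close> and \<open>q\<close> says that \<open>P\<close>
  is a subfunctor of the sum.\<close>

lemma image_pairE:
  assumes F: "fp F" and G: "fp G" and x: "el F X x" and y: "el G X y"
  obtains P c p q where "P \<in> mod_objects C" "gen P X c" "nt P F p" "nt P G q" "p X c = x" "q X c = y"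
    "\<And>W a b. el P W a \<Longrightarrow> el P W b \<Longrightarrow> p W a = p W b \<Longrightarrow> q W a = q W b \<Longrightarrow> a = b"
proof -
  note pF = fp_psh[OF F] and pG = fp_psh[OF G]
  obtain N1 n1 where n1: "ann F X x N1 n1" using annE[OF F x] .
  obtain N2 n2 where n2: "ann G X y N2 n2" using annE[OF G y] .
  obtain N n n' where n: "ar n N N1" "ar n' N N2" "n1 \<cdot> n = n2 \<cdot> n'"
    and univ: "\<And>W h k. ar h W N1 \<Longrightarrow> ar k W N2 \<Longrightarrow> n1 \<cdot> h = n2 \<cdot> k \<Longrightarrow> \<exists>l. ar l W N \<and> h = n \<cdot> l \<and> k = n' \<cdot> l"
    by (rule weak_pullbackE[OF annD(1)[OF n1] annD(1)[OF n2]]) (rule that; assumption)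
  define r where "r = n1 \<cdot> n"
  have r: "ar r N X" unfolding r_def using ar_comp[OF n(1) annD(1)[OF n1]] .
  note c = cokf_facts[OF r]
  let ?c = "cokcls r X (Ident C X)"
  have X: "X \<in> Obj C" using x by (simp add: el_def)
  have zx: "FAr F r x = zero_at F N" unfolding r_def by (rule ann_zero[OF pF n1 x n(1)])
  have zy: "FAr G r y = zero_at G N" unfolding r_def n(3) by (rule ann_zero[OF pG n2 y n(2)])
  obtain p where p: "nt (cokf r) F p" "\<And>W h. ar h W X \<Longrightarrow> p W (FAr (cokf r) h ?c) = FAr F h x"
    by (rule fp_hom[OF c(1) pF c(2,3) x zx]) (rule that; assumption)
  obtain q where q: "nt (cokf r) G q" "\<And>W h. ar h W X \<Longrightarrow> q W (FAr (cokf r) h ?c) = FAr G h y"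
    by (rule fp_hom[OF c(1) pG c(2,3) y zy]) (rule that; assumption)
  show thesis
  proof (rule that[OF _ c(2) p(1) q(1)])
    show "cokf r \<in> mod_objects C" using fp_cokf[OF r] by (simp add: mod_objects_def)
    show "p X ?c = x" using p(2)[OF ar_id[OF X]] act_id[OF c(1) genD(1)[OF c(2)]] act_id[OF pF x] by simp
    show "q X ?c = y" using q(2)[OF ar_id[OF X]] act_id[OF c(1) genD(1)[OF c(2)]] act_id[OF pG y] by simp
    fix W a b assume a: "el (cokf r) W a" and b: "el (cokf r) W b" and ep: "p W a = p W b" and eq: "q W a = q W b"
    let ?d = "plus_at (cokf r) W a (inv_at (cokf r) W b)"
    have d: "el (cokf r) W ?d" using a b by (simp add: el_plus el_inv c(1))
    have pd: "p W ?d = zero_at F W"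
      using nt_sub[OF p(1) c(1) pF a b] ep sub_zero_iff[OF pF nt_el[OF p(1) a] nt_el[OF p(1) b]] by simp
    have qd: "q W ?d = zero_at G W"
      using nt_sub[OF q(1) c(1) pG a b] eq sub_zero_iff[OF pG nt_el[OF q(1) a] nt_el[OF q(1) b]] by simp
    \<comment> \<open>The difference is a multiple of the generator. Its coefficient annihilates
      both \<open>x\<close> and \<open>y\<close>, hence is a multiple of \<open>r\<close>.\<close>
    obtain h where h: "ar h W X" "?d = FAr (cokf r) h ?c" using genD(2)[OF c(2) d] by blast
    obtain k where k: "ar k W N1" "h = n1 \<cdot> k" using annD(3)[OF n1 h(1)] p(2)[OF h(1)] h(2) pd by auto
    obtain k' where k': "ar k' W N2" "h = n2 \<cdot> k'" using annD(3)[OF n2 h(1)] q(2)[OF h(1)] h(2) qd by auto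
    obtain l where l: "ar l W N" "k = n \<cdot> l" using univ[OF k(1) k'(1)] k(2) k'(2) by auto
    have "h = r \<cdot> l" unfolding r_def k(2) l(2) using comp_assoc[OF l(1) n(1) annD(1)[OF n1]] by simp
    then have "?d = zero_at (cokf r) W" using h(2) ann_zero[OF c(1,3) genD(1)[OF c(2)] l(1)] by simp
    then show "a = b" using sub_zero_iff[OF c(1) a b] by simp
  qed
qed

text \<open>Two conditions are imposed at once because two roofs are compared along both legs. The
  first is solved on generators by \<open>element_relationE\<close>, the second by an annihilator in
  \<open>H'\<close>; the result only covers the limit, and \<open>image_pairE\<close> turns it into
  a jointly injective pair.\<close>

lemma pullback_pairE:
  assumes F: "fp F" and G: "fp G" and H: "fp H" and H': "fp H'"
    and \<alpha>: "nt F H \<alpha>" and \<beta>: "nt G H \<beta>" and \<alpha>': "nt F H' \<alpha>'" and \<beta>': "nt G H' \<beta>'"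
  obtains P p q where "P \<in> mod_objects C" "nt P F p" "nt P G q"
    "\<And>W c. el P W c \<Longrightarrow> \<alpha> W (p W c) = \<beta> W (q W c) \<and> \<alpha>' W (p W c) = \<beta>' W (q W c)"
    "\<And>W a b. el F W a \<Longrightarrow> el G W b \<Longrightarrow> \<alpha> W a = \<beta> W b \<Longrightarrow> \<alpha>' W a = \<beta>' W b \<Longrightarrow>
       \<exists>c. el P W c \<and> p W c = a \<and> q W c = b"
    "\<And>W a b. el P W a \<Longrightarrow> el P W b \<Longrightarrow> p W a = p W b \<Longrightarrow> q W a = q W b \<Longrightarrow> a = b"
proof -
  note pF = fp_psh[OF F] and pG = fp_psh[OF G] and pH' = fp_psh[OF H']
  obtain X x where gx: "gen F X x" using fp_genE[OF F] .
  obtain Y y where gy: "gen G Y y" using fp_genE[OF G] .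
  note x = genD(1)[OF gx] and y = genD(1)[OF gy]
  obtain N n n' where n: "ar n N X" "ar n' N Y" "FAr H n (\<alpha> X x) = FAr H n' (\<beta> Y y)"
    and nu: "\<And>W h k. ar h W X \<Longrightarrow> ar k W Y \<Longrightarrow> FAr H h (\<alpha> X x) = FAr H k (\<beta> Y y) \<Longrightarrow> \<exists>l. ar l W N \<and> h = n \<cdot> l \<and> k = n' \<cdot> l"
    by (rule element_relationE[OF H nt_el[OF \<alpha> x] nt_el[OF \<beta> y]]) (rule that; assumption)
  define a0 where "a0 = FAr F n x"
  define b0 where "b0 = FAr G n' y"
  have a0: "el F N a0" and b0: "el G N b0" unfolding a0_def b0_def by (rule el_act[OF pF n(1) x], rule el_act[OF pG n(2) y])
  note e0 = nt_el[OF \<alpha>' a0] nt_el[OF \<beta>' b0]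
  \<comment> \<open>A multiple of the pair \<open>(a0, b0)\<close> satisfies the second condition
    exactly when its coefficient annihilates this difference in \<open>H'\<close>.\<close>
  obtain M m where m: "ann H' N (plus_at H' N (\<alpha>' N a0) (inv_at H' N (\<beta>' N b0))) M m"
    using annE[OF H' el_plus[OF pH' e0(1) el_inv[OF pH' e0(2)]]] .
  have kill: "FAr H' h (plus_at H' N (\<alpha>' N a0) (inv_at H' N (\<beta>' N b0))) = zero_at H' W \<longleftrightarrow>
      \<alpha>' W (FAr F h a0) = \<beta>' W (FAr G h b0)" if h: "ar h W N" for h W
    using act_plus[OF pH' h e0(1) el_inv[OF pH' e0(2)]] act_inv[OF pH' h e0(2)] nt_nat[OF \<alpha>' h a0] nt_nat[OF \<beta>' h b0]
      sub_zero_iff[OF pH' el_act[OF pH' h e0(1)] el_act[OF pH' h e0(2)]] by simp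
  define a1 where "a1 = FAr F m a0"
  define b1 where "b1 = FAr G m b0"
  note mm = annD(1)[OF m]
  have a1: "el F M a1" and b1: "el G M b1" unfolding a1_def b1_def by (rule el_act[OF pF mm a0], rule el_act[OF pG mm b0])
  obtain P c p q where P: "P \<in> mod_objects C" "gen P M c" "nt P F p" "nt P G q" "p M c = a1" "q M c = b1"
    and inj: "\<And>W a b. el P W a \<Longrightarrow> el P W b \<Longrightarrow> p W a = p W b \<Longrightarrow> q W a = q W b \<Longrightarrow> a = b"
    by (rule image_pairE[OF F G a1 b1]) (rule that; assumption)
  have al0: "\<alpha> N a0 = \<beta> N b0" unfolding a0_def b0_def using nt_nat[OF \<alpha> n(1) x] nt_nat[OF \<beta> n(2) y] n(3) by simp
  have al1: "\<alpha> M a1 = \<beta> M b1" unfolding a1_def b1_def using nt_nat[OF \<alpha> mm a0] nt_nat[OF \<beta> mm b0] al0 by simp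
  have al1': "\<alpha>' M a1 = \<beta>' M b1" unfolding a1_def b1_def using kill[OF mm] annD(2)[OF m] by simp
  have pc: "p W (FAr P h c) = FAr F h a1" "q W (FAr P h c) = FAr G h b1" if "ar h W M" for W h
    using nt_nat[OF P(3) that genD(1)[OF P(2)]] nt_nat[OF P(4) that genD(1)[OF P(2)]] P(5,6) by auto
  show thesis
  proof (rule that[OF P(1,3,4) _ _ inj])
    fix W d assume "el P W d"
    then obtain h where h: "ar h W M" "d = FAr P h c" using genD(2)[OF P(2)] by blast
    then show "\<alpha> W (p W d) = \<beta> W (q W d) \<and> \<alpha>' W (p W d) = \<beta>' W (q W d)"
      using pc[OF h(1)] nt_nat[OF \<alpha> h(1) a1] nt_nat[OF \<beta> h(1) b1] nt_nat[OF \<alpha>' h(1) a1] nt_nat[OF \<beta>' h(1) b1]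
        al1 al1' by simp
  next
    fix W a b assume a: "el F W a" and b: "el G W b" and e: "\<alpha> W a = \<beta> W b" and e': "\<alpha>' W a = \<beta>' W b"
    obtain h where h: "ar h W X" "a = FAr F h x" using genD(2)[OF gx a] by blast
    obtain k where k: "ar k W Y" "b = FAr G k y" using genD(2)[OF gy b] by blast
    have "FAr H h (\<alpha> X x) = FAr H k (\<beta> Y y)" using nt_nat[OF \<alpha> h(1) x] nt_nat[OF \<beta> k(1) y] h(2) k(2) e by simp
    then obtain l where l: "ar l W N" "h = n \<cdot> l" "k = n' \<cdot> l" using nu[OF h(1) k(1)] by blast
    have al: "a = FAr F l a0" and bl: "b = FAr G l b0"
      unfolding a0_def b0_def h(2) k(2) l(2,3) by (rule act_comp[OF pF l(1) n(1) x], rule act_comp[OF pG l(1) n(2) y])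
    then obtain t where t: "ar t W M" "l = m \<cdot> t" using annD(3)[OF m l(1)] kill[OF l(1)] e' by auto
    have "a = FAr F t a1" "b = FAr G t b1"
      unfolding a1_def b1_def al bl t(2) by (rule act_comp[OF pF t(1) mm a0], rule act_comp[OF pG t(1) mm b0])
    then show "\<exists>c. el P W c \<and> p W c = a \<and> q W c = b"
      using pc[OF t(1)] el_act[OF fp_psh t(1) genD(1)[OF P(2)]] P(1) by (auto simp: mod_objects_def)
  qed
qed

lemma pullbackE:
  assumes "fp F" "fp G" "fp H" "nt F H \<alpha>" "nt G H \<beta>"
  obtains P p q where "P \<in> mod_objects C" "nt P F p" "nt P G q"
    "\<And>W c. el P W c \<Longrightarrow> \<alpha> W (p W c) = \<beta> W (q W c)"
    "\<And>W a b. el F W a \<Longrightarrow> el G W b \<Longrightarrow> \<alpha> W a = \<beta> W b \<Longrightarrow> \<exists>c. el P W c \<and> p W c = a \<and> q W c = b"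
    "\<And>W a b. el P W a \<Longrightarrow> el P W b \<Longrightarrow> p W a = p W b \<Longrightarrow> q W a = q W b \<Longrightarrow> a = b"
proof -
  obtain P p q where P: "P \<in> mod_objects C" "nt P F p" "nt P G q"
    "\<And>W c. el P W c \<Longrightarrow> \<alpha> W (p W c) = \<beta> W (q W c) \<and> \<alpha> W (p W c) = \<beta> W (q W c)"
    "\<And>W a b. el F W a \<Longrightarrow> el G W b \<Longrightarrow> \<alpha> W a = \<beta> W b \<Longrightarrow> \<alpha> W a = \<beta> W b \<Longrightarrow>
       \<exists>c. el P W c \<and> p W c = a \<and> q W c = b"
    "\<And>W a b. el P W a \<Longrightarrow> el P W b \<Longrightarrow> p W a = p W b \<Longrightarrow> q W a = q W b \<Longrightarrow> a = b"
    by (rule pullback_pairE[OF assms(1-3,3,4,5,4,5)]) (rule that; assumption)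
  have "\<alpha> W (p W c) = \<beta> W (q W c)" if "el P W c" for W c
    using P(4)[OF that] by (rule conjunct1)
  moreover have "\<exists>c. el P W c \<and> p W c = a \<and> q W c = b"
    if "el F W a" "el G W b" "\<alpha> W a = \<beta> W b" for W a b
    by (rule P(5)[OF that(1,2,3,3)])
  ultimately show thesis by (rule that[OF P(1-3) _ _ P(6)])
qed

text \<open>The annihilator \<open>n\<close> of \<open>\<sigma> x\<close> covers the coefficients of
  all elements of the kernel, so the kernel is the subfunctor of \<open>F\<close> generated by
  \<open>FAr F n x\<close>.\<close>

lemma kernelE:
  assumes F: "fp F" and G: "fp G" and \<sigma>: "nt F G \<sigma>"
  obtains K k where "K \<in> mod_objects C" "nt K F k"
    "\<And>W c. el K W c \<Longrightarrow> \<sigma> W (k W c) = zero_at G W"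
    "\<And>W a. el F W a \<Longrightarrow> \<sigma> W a = zero_at G W \<Longrightarrow> \<exists>c. el K W c \<and> k W c = a"
    "\<And>W a b. el K W a \<Longrightarrow> el K W b \<Longrightarrow> k W a = k W b \<Longrightarrow> a = b"
proof -
  note pF = fp_psh[OF F] and pG = fp_psh[OF G]
  obtain X x where gx: "gen F X x" using fp_genE[OF F] .
  note x = genD(1)[OF gx]
  obtain N n where n: "ann G X (\<sigma> X x) N n" using annE[OF G nt_el[OF \<sigma> x]] .
  note nn = annD(1)[OF n]
  note xn = el_act[OF pF nn x]
  \<comment> \<open>The subfunctor generated by one element is the image of the pair with two equal
    entries; both projections agree on the generator and therefore coincide.\<close>
  obtain K c p q where K: "K \<in> mod_objects C" "gen K N c" "nt K F p" "nt K F q" "p N c = FAr F n x" "q N c = FAr F n x"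
    and inj: "\<And>W a b. el K W a \<Longrightarrow> el K W b \<Longrightarrow> p W a = p W b \<Longrightarrow> q W a = q W b \<Longrightarrow> a = b"
    by (rule image_pairE[OF F F xn xn]) (rule that; assumption)
  have pK: "psh K" using K(1) by (simp add: mod_objects_def fp_psh)
  have pq: "p = q" using nt_eq_gen[OF pK K(2,3,4)] K(5,6) by simp
  have pc: "p W (FAr K h c) = FAr F h (FAr F n x)" if "ar h W N" for W h
    using nt_nat[OF K(3) that genD(1)[OF K(2)]] K(5) by simp
  show thesis
  proof (rule that[OF K(1,3)])
    show "\<sigma> W (p W d) = zero_at G W" if d: "el K W d" for W d
    proof -
      obtain h where h: "ar h W N" "d = FAr K h c" using genD(2)[OF K(2) d] by blast
      then show ?thesis
        using pc[OF h(1)] nt_nat[OF \<sigma> h(1) xn] nt_nat[OF \<sigma> nn x] annD(2)[OF n] act_zero[OF pG h(1)] by simp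
    qed
    show "\<exists>c. el K W c \<and> p W c = a" if a: "el F W a" and z: "\<sigma> W a = zero_at G W" for W a
    proof -
      obtain h where h: "ar h W X" "a = FAr F h x" using genD(2)[OF gx a] by blast
      then obtain l where l: "ar l W N" "h = n \<cdot> l" using annD(3)[OF n h(1)] nt_nat[OF \<sigma> h(1) x] z by auto
      then have "a = p W (FAr K l c)" using pc[OF l(1)] act_comp[OF pF l(1) nn x] h(2) by simp
      then show ?thesis using el_act[OF pK l(1) genD(1)[OF K(2)]] by blast
    qed
    show "a = b" if "el K W a" "el K W b" "p W a = p W b" for W a b
      using inj that pq by blast
  qed
qed

text \<open>The quotient keeps the generator \<open>y\<close> of \<open>G\<close>; its relations are
  the coefficients \<open>h\<close> for which \<open>h y\<close> comes from \<open>F\<close>. The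
  arrow \<open>n\<close> covers them.\<close>

lemma cokernelE:
  assumes F: "fp F" and G: "fp G" and \<sigma>: "nt F G \<sigma>"
  obtains Q c where "Q \<in> mod_objects C" "nt G Q c"
    "\<And>W a. el F W a \<Longrightarrow> c W (\<sigma> W a) = zero_at Q W"
    "\<And>W b. el G W b \<Longrightarrow> c W b = zero_at Q W \<Longrightarrow> \<exists>a. el F W a \<and> \<sigma> W a = b"
    "\<And>W d. el Q W d \<Longrightarrow> \<exists>b. el G W b \<and> c W b = d"
proof -
  note pF = fp_psh[OF F] and pG = fp_psh[OF G]
  obtain X x where gx: "gen F X x" using fp_genE[OF F] .
  obtain Y y R r where gy: "gen G Y y" and ay: "ann G Y y R r" using G[unfolded fp_iff] by blast
  note x = genD(1)[OF gx] and y = genD(1)[OF gy]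
  obtain N n n' where n: "ar n N Y" "ar n' N X" "FAr G n y = FAr G n' (\<sigma> X x)"
    and nu: "\<And>W h k. ar h W Y \<Longrightarrow> ar k W X \<Longrightarrow> FAr G h y = FAr G k (\<sigma> X x) \<Longrightarrow> \<exists>l. ar l W N \<and> h = n \<cdot> l \<and> k = n' \<cdot> l"
    by (rule element_relationE[OF G y nt_el[OF \<sigma> x]]) (rule that; assumption)
  note c = cokf_facts[OF n(1)]
  let ?c = "cokcls n Y (Ident C Y)"
  note cc = genD(1)[OF c(2)]
  have rel: "FAr (cokf n) h ?c = zero_at (cokf n) W"
    if h: "ar h W Y" and k: "ar k W X" and e: "FAr G h y = FAr G k (\<sigma> X x)" for W h k
    using nu[OF h k e] ann_zero[OF c(1,3) cc] by auto
  \<comment> \<open>The old relation \<open>r\<close> is among the new ones, because the zero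
    multiple of \<open>\<sigma> x\<close> comes from \<open>F\<close>. This allows
    \<open>fp_hom\<close> to define the projection.\<close>
  have "FAr G r y = FAr G (zr R X) (\<sigma> X x)"
    using annD(2)[OF ay] act_zr[OF pG arD(1)[OF annD(1)[OF ay]] nt_el[OF \<sigma> x]] by simp
  then have "FAr (cokf n) r ?c = zero_at (cokf n) R"
    using rel[OF annD(1)[OF ay] ar_zr[OF arD(1)[OF annD(1)[OF ay]] elD(1)[OF x]]] by simp
  then obtain \<tau> where \<tau>: "nt G (cokf n) \<tau>" "\<And>W h. ar h W Y \<Longrightarrow> \<tau> W (FAr G h y) = FAr (cokf n) h ?c"
    by (rule fp_hom[OF pG c(1) gy ay cc]) (rule that; assumption)
  show thesis
  proof (rule that[OF _ \<tau>(1)])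
    show "cokf n \<in> mod_objects C" using fp_cokf[OF n(1)] by (simp add: mod_objects_def)
    show "\<tau> W (\<sigma> W a) = zero_at (cokf n) W" if a: "el F W a" for W a
    proof -
      obtain k where k: "ar k W X" "a = FAr F k x" using genD(2)[OF gx a] by blast
      obtain h where h: "ar h W Y" "\<sigma> W a = FAr G h y" using genD(2)[OF gy nt_el[OF \<sigma> a]] by blast
      show ?thesis using rel[OF h(1) k(1)] h(2) k(2) nt_nat[OF \<sigma> k(1) x] \<tau>(2)[OF h(1)] by simp
    qed
    show "\<exists>a. el F W a \<and> \<sigma> W a = b" if b: "el G W b" and z: "\<tau> W b = zero_at (cokf n) W" for W b
    proof -
      obtain h where h: "ar h W Y" "b = FAr G h y" using genD(2)[OF gy b] by blast
      then obtain l where l: "ar l W N" "h = n \<cdot> l" using annD(3)[OF c(3) h(1)] \<tau>(2)[OF h(1)] z by auto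
      have "b = FAr G l (FAr G n' (\<sigma> X x))" using h(2) l(2) act_comp[OF pG l(1) n(1) y] n(3) by simp
      also have "\<dots> = \<sigma> W (FAr F l (FAr F n' x))"
        using nt_nat[OF \<sigma> n(2) x] nt_nat[OF \<sigma> l(1) el_act[OF pF n(2) x]] by simp
      finally show ?thesis using el_act[OF pF l(1) el_act[OF pF n(2) x]] by blast
    qed
    show "\<exists>b. el G W b \<and> \<tau> W b = d" if d: "el (cokf n) W d" for W d
      using genD(2)[OF c(2) d] \<tau>(2) el_act[OF pG _ y] by metis
  qed
qed

end

section \<open>The Yoneda embedding\<close>

context add_cat
begin

abbreviation yo :: "'o \<Rightarrow> ('o, 'm, 'm set) presheaf" where
  "yo X \<equiv> yoneda_ob C X"

lemma el_yo: "X \<in> Obj C \<Longrightarrow> el (yo X) W A \<longleftrightarrow> (\<exists>h. ar h W X \<and> A = {h})"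
  by (auto simp: el_def yoneda_ob_def ar_def)

lemma el_yoI: "ar h W X \<Longrightarrow> el (yo X) W {h}"
  using el_yo[OF arD(2)] by blast

lemma yo_act: "FAr (yo X) w {h} = {h \<cdot> w}"
  by (simp add: yoneda_ob_def)

lemma yo_plus: "plus_at (yo X) W {h} {k} = {add W X h k}"
  by (simp add: yoneda_ob_def set_mult_def)

lemma yo_zero: "zero_at (yo X) W = {zr W X}"
  by (simp add: yoneda_ob_def)

lemma psh_yo:
  assumes X: "X \<in> Obj C"
  shows "psh (yo X)"
  unfolding is_presheaf_def
proof (intro conjI ballI)
  have E: "(a \<in> carrier (FOb (yo X) W)) = (\<exists>h. ar h W X \<and> a = {h})" if "W \<in> Obj C" for W a
    using el_yo[OF X, of W a] that by (simp add: el_def)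
  fix W assume W: "W \<in> Obj C"
  show "comm_group (FOb (yo X) W)"
  proof (rule comm_groupI)
    show "zero_at (yo X) W \<in> carrier (FOb (yo X) W)"
      using ar_zr[OF W X] by (auto simp: E[OF W] yo_zero)
    fix a assume "a \<in> carrier (FOb (yo X) W)"
    then obtain h where h: "ar h W X" "a = {h}" using E[OF W] by blast
    show "plus_at (yo X) W (zero_at (yo X) W) a = a" using h by (simp add: yo_zero yo_plus add_zr)
    show "\<exists>b\<in>carrier (FOb (yo X) W). plus_at (yo X) W b a = zero_at (yo X) W"
      using h ar_neg[OF h(1)] by (auto simp: E[OF W] yo_zero yo_plus add_neg intro!: bexI[of _ "{neg W X h}"])
    fix b assume "b \<in> carrier (FOb (yo X) W)"
    then obtain k where k: "ar k W X" "b = {k}" using E[OF W] by blast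
    show "plus_at (yo X) W a b \<in> carrier (FOb (yo X) W)" using h k by (auto simp: E[OF W] yo_plus intro: ar_add)
    show "plus_at (yo X) W a b = plus_at (yo X) W b a" using h k add_comm[OF h(1) k(1)] by (simp add: yo_plus)
    fix c assume "c \<in> carrier (FOb (yo X) W)"
    then obtain l where "ar l W X" "c = {l}" using E[OF W] by blast
    then show "plus_at (yo X) W (plus_at (yo X) W a b) c = plus_at (yo X) W a (plus_at (yo X) W b c)"
      using h k by (simp add: yo_plus add_assoc)
  qed
  show "FAr (yo X) (Ident C W) a = a" if a: "a \<in> carrier (FOb (yo X) W)" for a
  proof -
    obtain h where "ar h W X" "a = {h}" using a E[OF W] by blast
    then show ?thesis by (simp add: yo_act comp_id)
  qed
  fix Y f assume Y: "Y \<in> Obj C" and "f \<in> arr C W Y"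
  then have f: "ar f W Y" using W by (simp add: ar_def)
  show "FAr (yo X) f \<in> hom (FOb (yo X) Y) (FOb (yo X) W)"
  proof (rule homI)
    fix a assume "a \<in> carrier (FOb (yo X) Y)"
    then obtain h where h: "ar h Y X" "a = {h}" using E[OF Y] by blast
    show "FAr (yo X) f a \<in> carrier (FOb (yo X) W)" using h ar_comp[OF f] by (auto simp: E[OF W] yo_act)
    fix b assume "b \<in> carrier (FOb (yo X) Y)"
    then obtain k where k: "ar k Y X" "b = {k}" using E[OF Y] by blast
    show "FAr (yo X) f (plus_at (yo X) Y a b) = plus_at (yo X) W (FAr (yo X) f a) (FAr (yo X) f b)"
      using h k comp_add_left[OF f h(1) k(1)] by (simp add: yo_act yo_plus)
  qed
  show "FAr (yo X) (add W Y f g) a = plus_at (yo X) W (FAr (yo X) f a) (FAr (yo X) g a)"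
    if g: "g \<in> arr C W Y" and a: "a \<in> carrier (FOb (yo X) Y)" for g a
  proof -
    obtain h where "ar h Y X" "a = {h}" using a E[OF Y] by blast
    then show ?thesis using comp_add_right[OF f, of g h X] g W Y by (simp add: yo_act yo_plus ar_def)
  qed
  fix Z g a assume Z: "Z \<in> Obj C" and g: "g \<in> arr C Y Z" and a: "a \<in> carrier (FOb (yo X) Z)"
  obtain h where "ar h Z X" "a = {h}" using a E[OF Z] by blast
  then show "FAr (yo X) (g \<cdot> f) a = FAr (yo X) f (FAr (yo X) g a)"
    using comp_assoc[OF f, of g Z h X] g Y Z by (simp add: yo_act ar_def)
qed

lemma gen_yo:
  assumes X: "X \<in> Obj C"
  shows "gen (yo X) X {Ident C X}"
  unfolding gen_def using el_yoI[OF ar_id[OF X]] el_yo[OF X] comp_id by (auto simp: yo_act)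

text \<open>Only zero arrows annihilate the identity, and these are the arrows that factor through a
  zero object \<open>N\<close>.\<close>

lemma ann_yo:
  assumes X: "X \<in> Obj C"
  obtains N where "ann (yo X) X {Ident C X} N (zr N X)"
proof -
  obtain N where N: "N \<in> Obj C" "\<And>X f. ar f X N \<Longrightarrow> f = zr X N" "\<And>X f. ar f N X \<Longrightarrow> f = zr N X"
    by (rule zero_objectE) (rule that; assumption)
  note z = ar_zr[OF N(1) X]
  have "ann (yo X) X {Ident C X} N (zr N X)"
    unfolding ann_def
  proof (intro conjI allI impI z)
    show "FAr (yo X) (zr N X) {Ident C X} = zero_at (yo X) N" using comp_id[OF z] by (simp add: yo_act yo_zero)
    fix W h assume h: "ar h W X" and "FAr (yo X) h {Ident C X} = zero_at (yo X) W"
    then have "h = zr W X" using comp_id[OF h] by (simp add: yo_act yo_zero)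
    then have "h = zr N X \<cdot> zr W N" using comp_zr[OF z arD(1)[OF h]] by simp
    then show "\<exists>k. ar k W N \<and> h = zr N X \<cdot> k" using ar_zr[OF arD(1)[OF h] N(1)] by blast
  qed
  then show thesis by (rule that)
qed

lemma yo_mod:
  assumes X: "X \<in> Obj C"
  shows "yo X \<in> mod_objects C"
proof -
  obtain N where "ann (yo X) X {Ident C X} N (zr N X)" using ann_yo[OF X] .
  then have "finitely_presented C (yo X)"
    unfolding fp_iff using psh_yo[OF X] gen_yo[OF X] by (intro conjI exI)
  then show ?thesis by (simp add: mod_objects_def)
qed

text \<open>The Yoneda lemma, obtained from the presentation of a representable functor by a zero
  relation. It turns elements into maps, so that universal properties in \<open>mod C\<close> can be
  tested on elements.\<close>

lemma yo_homE:
  assumes X: "X \<in> Obj C" and F: "psh F" and a: "el F X a"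
  obtains \<tau> where "nt (yo X) F \<tau>" "\<And>W h. ar h W X \<Longrightarrow> \<tau> W {h} = FAr F h a"
proof -
  obtain N where N: "ann (yo X) X {Ident C X} N (zr N X)" using ann_yo[OF X] .
  have "FAr F (zr N X) a = zero_at F N" using act_zr[OF F _ a] arD(1)[OF annD(1)[OF N]] by blast
  then obtain \<tau> where t: "nt (yo X) F \<tau>"
    "\<And>W h. ar h W X \<Longrightarrow> \<tau> W (FAr (yo X) h {Ident C X}) = FAr F h a"
    by (rule fp_hom[OF psh_yo[OF X] F gen_yo[OF X] N a]) (rule that; assumption)
  have "\<tau> W {h} = FAr F h a" if "ar h W X" for W h
    using t(2)[OF that] comp_id[OF that] by (simp add: yo_act)
  then show thesis using that[OF t(1)] by blast
qed

text \<open>The middle component of \<open>FAr (yoneda C) f\<close>, named in order to be used apart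
  from its source and target.\<close>

definition ymap :: "'m \<Rightarrow> 'o \<Rightarrow> 'm set \<Rightarrow> 'm set" where
  "ymap f = (\<lambda>W\<in>Obj C. \<lambda>A\<in>carrier (FOb (yo (Dom C f)) W). (\<lambda>h. f \<cdot> h) ` A)"

lemma ymap_app: "ar f X Y \<Longrightarrow> ar h W X \<Longrightarrow> ymap f W {h} = {f \<cdot> h}"
  using el_yoI[of h W X] by (simp add: ymap_def ar_dom el_def)

lemma nt_ymap:
  assumes f: "ar f X Y"
  shows "nt (yo X) (yo Y) (ymap f)"
proof -
  note E = el_yo[OF arD(1)[OF f]]
  have "nt (yo X) (yo Y) (nat_mk (yo X) (\<lambda>W A. (\<lambda>h. f \<cdot> h) ` A))"
  proof (rule nt_nat_mk[OF psh_yo[OF arD(1)[OF f]]])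
    fix W a assume a: "el (yo X) W a"
    obtain h where h: "ar h W X" "a = {h}" using iffD1[OF E a] by blast
    show "el (yo Y) W ((\<lambda>h. f \<cdot> h) ` a)" using h el_yoI[OF ar_comp[OF h(1) f]] by simp
    fix b assume b: "el (yo X) W b"
    obtain k where k: "ar k W X" "b = {k}" using iffD1[OF E b] by blast
    show "(\<lambda>h. f \<cdot> h) ` plus_at (yo X) W a b = plus_at (yo Y) W ((\<lambda>h. f \<cdot> h) ` a) ((\<lambda>h. f \<cdot> h) ` b)"
      using h k comp_add_right[OF h(1) k(1) f] by (simp add: yo_plus)
  next
    fix V W g a assume g: "ar g V W" and a: "el (yo X) W a"
    obtain h where h: "ar h W X" "a = {h}" using iffD1[OF E a] by blast
    show "(\<lambda>h. f \<cdot> h) ` FAr (yo X) g a = FAr (yo Y) g ((\<lambda>h. f \<cdot> h) ` a)"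
      using h comp_assoc[OF g h(1) f] by (simp add: yo_act)
  qed
  moreover have "ymap f = nat_mk (yo X) (\<lambda>W A. (\<lambda>h. f \<cdot> h) ` A)"
    by (simp add: ymap_def nat_mk_def ar_dom[OF f])
  ultimately show ?thesis by simp
qed

lemma yo_fullE:
  assumes X: "X \<in> Obj C" and Y: "Y \<in> Obj C" and \<eta>: "nt (yo X) (yo Y) \<eta>"
  obtains f where "ar f X Y" "\<eta> = ymap f"
proof -
  have i: "el (yo X) X {Ident C X}" using el_yoI[OF ar_id[OF X]] .
  obtain f where f: "ar f X Y" "\<eta> X {Ident C X} = {f}" using iffD1[OF el_yo[OF Y] nt_el[OF \<eta> i]] by blast
  have "\<eta> = ymap f"
    by (rule nt_eq_gen[OF psh_yo[OF X] gen_yo[OF X] \<eta> nt_ymap[OF f(1)]])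
       (simp add: f(2) ymap_app[OF f(1) ar_id[OF X]] comp_id[OF f(1)])
  then show thesis using that f(1) by blast
qed

lemma ymap_inj:
  assumes "ar f X Y" "ar g X Y" "ymap f = ymap g"
  shows "f = g"
proof -
  have "ymap f X {Ident C X} = ymap g X {Ident C X}" using assms by simp
  then show ?thesis
    using ymap_app[OF assms(1) ar_id[OF arD(1)[OF assms(1)]]] ymap_app[OF assms(2) ar_id[OF arD(1)[OF assms(2)]]]
      comp_id(1)[OF assms(1)] comp_id(1)[OF assms(2)] by simp
qed

end

section \<open>Local isomorphisms\<close>

text \<open>\<open>cov e V W\<close> makes \<open>e : V \<rightarrow> W\<close> a covering. Below the coverings are the deflations, and \<open>S\<close> is
  \<open>def C\<close>.\<close>

locale loc_cat = wk_cat C for C :: "('o, 'm, 'z) acat_scheme" (structure) +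
  fixes cov :: "'m \<Rightarrow> 'o \<Rightarrow> 'o \<Rightarrow> bool"
    and S :: "('o, 'm, 'm set) presheaf set"
  assumes cov_ar: "cov e V W \<Longrightarrow> ar e V W"
    and cov_id: "W \<in> Obj C \<Longrightarrow> cov (Ident C W) W W"
    and cov_comp: "cov e V W \<Longrightarrow> cov e' V' V \<Longrightarrow> cov (e \<cdot> e') V' W"
    and cov_pull: "cov e V W \<Longrightarrow> ar h W' W \<Longrightarrow> \<exists>V' e' h'. cov e' V' W' \<and> ar h' V' V \<and> h \<cdot> e' = e \<cdot> h'"
    and S_iff: "F \<in> S \<longleftrightarrow> F \<in> mod_objects C \<and>
      (\<forall>W a. el F W a \<longrightarrow> (\<exists>V e. cov e V W \<and> FAr F e a = zero_at F V))"
begin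

lemma mod_fp: "F \<in> mod_objects C \<Longrightarrow> fp F"
  by (simp add: mod_objects_def)

lemma mod_psh: "F \<in> mod_objects C \<Longrightarrow> psh F"
  by (simp add: mod_objects_def fp_psh)

text \<open>Pulling one covering back along the other gives a common refinement. It is used whenever
  two statements that hold locally have to be combined.\<close>

lemma cov_refineE:
  assumes e: "cov e V W" and e': "cov e' V' W"
  obtains f U f' where "cov f U V" "ar f' U V'" "e \<cdot> f = e' \<cdot> f'" "cov (e \<cdot> f) U W"
proof -
  obtain U f f' where *: "cov f U V" "ar f' U V'" "e \<cdot> f = e' \<cdot> f'"
    using cov_pull[OF e' cov_ar[OF e]] by (elim exE conjE)
  show thesis by (rule that[OF * cov_comp[OF e *(1)]])
qed

section \<open>Equality up to a covering\<close>

definition loc_eq :: "('o, 'm, 'g) presheaf \<Rightarrow> 'o \<Rightarrow> 'g \<Rightarrow> 'g \<Rightarrow> bool" where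
  "loc_eq F W a b \<longleftrightarrow> (\<exists>V e. cov e V W \<and> FAr F e a = FAr F e b)"

lemma loc_eqI: "cov e V W \<Longrightarrow> FAr F e a = FAr F e b \<Longrightarrow> loc_eq F W a b"
  unfolding loc_eq_def by blast

lemma loc_eqE: assumes "loc_eq F W a b" obtains e V where "cov e V W" "FAr F e a = FAr F e b"
  using assms unfolding loc_eq_def by blast

lemma loc_eq_refl: "W \<in> Obj C \<Longrightarrow> loc_eq F W a a"
  by (rule loc_eqI[OF cov_id]) simp_all

lemma loc_eq_sym: "loc_eq F W a b \<Longrightarrow> loc_eq F W b a"
  unfolding loc_eq_def by (elim exE conjE) (intro exI conjI, assumption, rule sym)

lemma loc_eq_act:
  assumes F: "psh F" and a: "el F W a" and b: "el F W b" and l: "loc_eq F W a b" and h: "ar h V W"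
  shows "loc_eq F V (FAr F h a) (FAr F h b)"
proof -
  obtain e U where e: "cov e U W" "FAr F e a = FAr F e b" using loc_eqE[OF l] .
  obtain V' e' h' where p: "cov e' V' V" "ar h' V' U" "h \<cdot> e' = e \<cdot> h'"
    using cov_pull[OF e(1) h] by (elim exE conjE)
  have *: "FAr F e' (FAr F h x) = FAr F h' (FAr F e x)" if x: "el F W x" for x
    using act_comp[OF F cov_ar[OF p(1)] h x] act_comp[OF F p(2) cov_ar[OF e(1)] x] p(3) by simp
  show ?thesis by (rule loc_eqI[OF p(1)]) (simp add: *[OF a] *[OF b] e(2))
qed

text \<open>Coverings compose, so local equality may itself be checked on a covering.\<close>

lemma loc_eq_local:
  assumes F: "psh F" and a: "el F W a" and b: "el F W b" and e: "cov e V W"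
    and l: "loc_eq F V (FAr F e a) (FAr F e b)"
  shows "loc_eq F W a b"
proof -
  obtain e' U where e': "cov e' U V" "FAr F e' (FAr F e a) = FAr F e' (FAr F e b)" using loc_eqE[OF l] .
  show ?thesis
    by (rule loc_eqI[OF cov_comp[OF e e'(1)]])
       (simp add: act_comp[OF F cov_ar[OF e'(1)] cov_ar[OF e]] a b e'(2))
qed

lemma loc_eq_trans:
  assumes F: "psh F" and a: "el F W a" and b: "el F W b" and c: "el F W c"
    and l: "loc_eq F W a b" "loc_eq F W b c"
  shows "loc_eq F W a c"
proof -
  obtain e U where e: "cov e U W" "FAr F e a = FAr F e b" using loc_eqE[OF l(1)] .
  have "loc_eq F U (FAr F e a) (FAr F e c)"
    using loc_eq_act[OF F b c l(2) cov_ar[OF e(1)]] e(2) by simp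
  then show ?thesis by (rule loc_eq_local[OF F a c e(1)])
qed

lemma loc_eq_nt:
  assumes "nt F G \<sigma>" "psh F" "el F W a" "el F W b" "loc_eq F W a b"
  shows "loc_eq G W (\<sigma> W a) (\<sigma> W b)"
proof -
  obtain e U where e: "cov e U W" "FAr F e a = FAr F e b" using loc_eqE[OF assms(5)] .
  show ?thesis
    using nt_nat[OF assms(1) cov_ar[OF e(1)] assms(3)] nt_nat[OF assms(1) cov_ar[OF e(1)] assms(4)]
    by (intro loc_eqI[OF e(1)]) (simp add: e(2))
qed

lemma loc_eq_plus:
  assumes F: "psh F" and el: "el F W a" "el F W b" "el F W c" "el F W d"
    and l: "loc_eq F W a b" "loc_eq F W c d"
  shows "loc_eq F W (plus_at F W a c) (plus_at F W b d)"
proof -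
  obtain e U where e: "cov e U W" "FAr F e a = FAr F e b" using loc_eqE[OF l(1)] .
  obtain e' U' where e': "cov e' U' U" "FAr F e' (FAr F e c) = FAr F e' (FAr F e d)"
    using loc_eqE[OF loc_eq_act[OF F el(3,4) l(2) cov_ar[OF e(1)]]] .
  note ee = cov_comp[OF e(1) e'(1)]
  note A = act_plus[OF F cov_ar[OF ee]]
  note B = act_comp[OF F cov_ar[OF e'(1)] cov_ar[OF e(1)]]
  show ?thesis
    by (rule loc_eqI[OF ee]) (simp add: A[OF el(1,3)] A[OF el(2,4)] B[OF el(1)] B[OF el(2)] B[OF el(3)] B[OF el(4)] e(2) e'(2))
qed

lemma loc_eq_sub_zero:
  assumes F: "psh F" and a: "el F W a" and b: "el F W b"
  shows "loc_eq F W (plus_at F W a (inv_at F W b)) (zero_at F W) \<longleftrightarrow> loc_eq F W a b"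
proof -
  note ib = el_inv[OF F b]
  have "FAr F e (plus_at F W a (inv_at F W b)) = FAr F e (zero_at F W) \<longleftrightarrow> FAr F e a = FAr F e b"
    if "cov e V W" for e V
    using act_plus[OF F cov_ar[OF that] a ib] act_inv[OF F cov_ar[OF that] b] act_zero[OF F cov_ar[OF that]]
      sub_zero_iff[OF F el_act[OF F cov_ar[OF that] a] el_act[OF F cov_ar[OF that] b]] by simp
  then show ?thesis unfolding loc_eq_def by blast
qed

lemma S_loc_eq: "F \<in> S \<longleftrightarrow> F \<in> mod_objects C \<and> (\<forall>W a. el F W a \<longrightarrow> loc_eq F W a (zero_at F W))"
proof -
  have "(FAr F e a = zero_at F V) = (FAr F e a = FAr F e (zero_at F W))"
    if "F \<in> mod_objects C" "cov e V W" for W V e a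
    using act_zero[OF mod_psh[OF that(1)] cov_ar[OF that(2)]] by simp
  then show ?thesis unfolding S_iff loc_eq_def by blast
qed

section \<open>Local injectivity and local surjectivity\<close>

definition loc_inj :: "('o, 'm, 'g) presheaf \<Rightarrow> ('o \<Rightarrow> 'g \<Rightarrow> 'h) \<Rightarrow> bool" where
  "loc_inj F \<sigma> \<longleftrightarrow> (\<forall>W a b. el F W a \<longrightarrow> el F W b \<longrightarrow> \<sigma> W a = \<sigma> W b \<longrightarrow> loc_eq F W a b)"

definition loc_surj :: "('o, 'm, 'g) presheaf \<Rightarrow> ('o, 'm, 'h) presheaf \<Rightarrow> ('o \<Rightarrow> 'g \<Rightarrow> 'h) \<Rightarrow> bool" where
  "loc_surj F G \<sigma> \<longleftrightarrow> (\<forall>W b. el G W b \<longrightarrow> (\<exists>V e a. cov e V W \<and> el F V a \<and> \<sigma> V a = FAr G e b))"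

lemma loc_injD: "loc_inj F \<sigma> \<Longrightarrow> el F W a \<Longrightarrow> el F W b \<Longrightarrow> \<sigma> W a = \<sigma> W b \<Longrightarrow> loc_eq F W a b"
  unfolding loc_inj_def by blast

lemma loc_surjE:
  assumes "loc_surj F G \<sigma>" "el G W b" obtains e V a where "cov e V W" "el F V a" "\<sigma> V a = FAr G e b"
  using assms unfolding loc_surj_def by blast

text \<open>On a covering where the images agree exactly, the definition applies to the restricted
  elements; local equality then descends.\<close>

lemma loc_inj_loc_eq:
  assumes "loc_inj F \<sigma>" "nt F G \<sigma>" "psh F" "el F W a" "el F W b" "loc_eq G W (\<sigma> W a) (\<sigma> W b)"
  shows "loc_eq F W a b"
proof -
  obtain e U where e: "cov e U W" "FAr G e (\<sigma> W a) = FAr G e (\<sigma> W b)" using loc_eqE[OF assms(6)] .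
  note ee = cov_ar[OF e(1)]
  have "\<sigma> U (FAr F e a) = \<sigma> U (FAr F e b)"
    using nt_nat[OF assms(2) ee assms(4)] nt_nat[OF assms(2) ee assms(5)] e(2) by simp
  then show ?thesis
    using loc_injD[OF assms(1) el_act[OF assms(3) ee assms(4)] el_act[OF assms(3) ee assms(5)]]
      loc_eq_local[OF assms(3-5) e(1)] by blast
qed

lemma loc_inj_comp:
  assumes "nt F G \<sigma>" "nt G H \<tau>" "psh F" "psh G" "loc_inj F \<sigma>" "loc_inj G \<tau>"
  shows "loc_inj F (nat_mk F (\<lambda>W a. \<tau> W (\<sigma> W a)))"
  unfolding loc_inj_def
proof (intro allI impI)
  fix W a b assume a: "el F W a" and b: "el F W b"
    and e: "nat_mk F (\<lambda>W a. \<tau> W (\<sigma> W a)) W a = nat_mk F (\<lambda>W a. \<tau> W (\<sigma> W a)) W b"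
  have "loc_eq G W (\<sigma> W a) (\<sigma> W b)"
    using loc_injD[OF assms(6) nt_el[OF assms(1) a] nt_el[OF assms(1) b]] e a b by (simp add: nat_mk_app)
  then show "loc_eq F W a b" by (rule loc_inj_loc_eq[OF assms(5,1,3) a b])
qed

lemma loc_surj_comp:
  assumes "nt F G \<sigma>" "nt G H \<tau>" "psh F" "psh G" "psh H" "loc_surj F G \<sigma>" "loc_surj G H \<tau>"
  shows "loc_surj F H (nat_mk F (\<lambda>W a. \<tau> W (\<sigma> W a)))"
  unfolding loc_surj_def
proof (intro allI impI)
  fix W c assume c: "el H W c"
  obtain e V b where e: "cov e V W" "el G V b" "\<tau> V b = FAr H e c" using loc_surjE[OF assms(7) c] .
  obtain e' U a where e': "cov e' U V" "el F U a" "\<sigma> U a = FAr G e' b" using loc_surjE[OF assms(6) e(2)] .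
  have "\<tau> U (\<sigma> U a) = FAr H (e \<cdot> e') c"
    using nt_nat[OF assms(2) cov_ar[OF e'(1)] e(2)] act_comp[OF assms(5) cov_ar[OF e'(1)] cov_ar[OF e(1)] c] e(3) e'(3)
    by simp
  then show "\<exists>V e a. cov e V W \<and> el F V a \<and> nat_mk F (\<lambda>W a. \<tau> W (\<sigma> W a)) V a = FAr H e c"
    using cov_comp[OF e(1) e'(1)] e'(2) by (intro exI[of _ U] exI[of _ "e \<cdot> e'"] exI[of _ a]) (simp add: nat_mk_app)
qed

section \<open>The category \<open>mod C\<close> and the arrows inverted in the quotient\<close>

abbreviation M where "M \<equiv> mod_cat C"

abbreviation MO where "MO \<equiv> mod_objects C"

lemma M_simps:
  "Obj M = MO"
  "m \<in> arr M F G \<longleftrightarrow> (\<exists>\<eta>. m = (F, \<eta>, G) \<and> nt F G \<eta>)"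
  "zero_arr M F G = (F, nat_mk F (\<lambda>W a. zero_at G W), G)"
  "Ident M F = (F, nat_mk F (\<lambda>W a. a), F)"
  "(G', \<theta>, H) \<cdot>\<^bsub>M\<^esub> (F, \<eta>, G) = (F, nat_mk F (\<lambda>W a. \<theta> W (\<eta> W a)), H)"
  "(F', \<eta>, G') \<otimes>\<^bsub>Hom M F G\<^esub> (F'', \<theta>, G'') = (F, nat_mk F (\<lambda>W a. plus_at G W (\<eta> W a) (\<theta> W a)), G)"
  "Dom M (F, \<eta>, G) = F" "Cod M (F, \<eta>, G) = G"
  by (auto simp: mod_cat_def presheaf_cat_def nat_mk_def)

lemma nat_mk_comp_eq_iff:
  "nat_mk F (\<lambda>W a. \<theta> W (\<eta> W a)) = nat_mk F \<tau> \<longleftrightarrow> (\<forall>W a. el F W a \<longrightarrow> \<theta> W (\<eta> W a) = \<tau> W a)"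
proof
  assume e: "nat_mk F (\<lambda>W a. \<theta> W (\<eta> W a)) = nat_mk F \<tau>"
  show "\<forall>W a. el F W a \<longrightarrow> \<theta> W (\<eta> W a) = \<tau> W a"
  proof (intro allI impI)
    fix W a assume "el F W a"
    then show "\<theta> W (\<eta> W a) = \<tau> W a"
      using fun_cong[OF fun_cong[OF e, of W], of a] by (simp add: nat_mk_app)
  qed
next
  assume "\<forall>W a. el F W a \<longrightarrow> \<theta> W (\<eta> W a) = \<tau> W a"
  then show "nat_mk F (\<lambda>W a. \<theta> W (\<eta> W a)) = nat_mk F \<tau>"
    by (auto simp: nat_mk_def el_def fun_eq_iff restrict_def)
qed

lemma nt_nat_mk_self: "nt F G \<eta> \<Longrightarrow> psh F \<Longrightarrow> nat_mk F \<eta> = \<eta>"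
  using nt_ext[of "nat_mk F \<eta>" F G \<eta>] nt_nat_mk[of F G \<eta>] by (simp add: nat_mk_app nt_el nt_plus nt_nat)

text \<open>Preimages under \<open>k\<close> are chosen element by element. The choice is
  automatically additive and natural, since the two sides of each identity have the same image under
  the injective \<open>k\<close>.\<close>

lemma factor_mono:
  assumes T: "psh T" and K: "psh K" and t: "nt T F t" and k: "nt K F k"
    and inj: "\<And>W a b. el K W a \<Longrightarrow> el K W b \<Longrightarrow> k W a = k W b \<Longrightarrow> a = b"
    and ex: "\<And>W a. el T W a \<Longrightarrow> \<exists>c. el K W c \<and> k W c = t W a"
  obtains u where "nt T K u" "\<And>W a. el T W a \<Longrightarrow> k W (u W a) = t W a"
proof -
  define v where "v W a = (SOME c. el K W c \<and> k W c = t W a)" for W a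
  have v: "el K W (v W a)" "k W (v W a) = t W a" if "el T W a" for W a
    using someI_ex[OF ex[OF that]] by (auto simp: v_def)
  have "nt T K (nat_mk T v)"
  proof (rule nt_nat_mk[OF T])
    show "el K W (v W a)" if "el T W a" for W a using v that by blast
    show "v W (plus_at T W a b) = plus_at K W (v W a) (v W b)" if a: "el T W a" and b: "el T W b" for W a b
    proof (rule inj)
      note ab = el_plus[OF T a b]
      show "el K W (v W (plus_at T W a b))" using v(1)[OF ab] .
      show "el K W (plus_at K W (v W a) (v W b))" using el_plus[OF K v(1)[OF a] v(1)[OF b]] .
      show "k W (v W (plus_at T W a b)) = k W (plus_at K W (v W a) (v W b))"
        using v(2)[OF ab] nt_plus[OF t a b] nt_plus[OF k v(1)[OF a] v(1)[OF b]] v(2)[OF a] v(2)[OF b] by simp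
    qed
    show "v X (FAr T f a) = FAr K f (v Y a)" if f: "ar f X Y" and a: "el T Y a" for X Y f a
    proof (rule inj)
      note fa = el_act[OF T f a]
      show "el K X (v X (FAr T f a))" using v(1)[OF fa] .
      show "el K X (FAr K f (v Y a))" using el_act[OF K f v(1)[OF a]] .
      show "k X (v X (FAr T f a)) = k X (FAr K f (v Y a))"
        using v(2)[OF fa] nt_nat[OF t f a] nt_nat[OF k f v(1)[OF a]] v(2)[OF a] by simp
    qed
  qed
  then show thesis using that[of "nat_mk T v"] v(2) by (simp add: nat_mk_app)
qed

text \<open>By \<open>eq\<close> the value of \<open>t\<close> on a preimage under \<open>c\<close>
  does not depend on the preimage, so additivity and naturality can be checked on chosen
  ones.\<close>

lemma factor_epi:
  assumes G: "psh G" and Q: "psh Q" and t: "nt G T t" and c: "nt G Q c"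
    and eq: "\<And>W a b. el G W a \<Longrightarrow> el G W b \<Longrightarrow> c W a = c W b \<Longrightarrow> t W a = t W b"
    and ex: "\<And>W d. el Q W d \<Longrightarrow> \<exists>b. el G W b \<and> c W b = d"
  obtains u where "nt Q T u" "\<And>W b. el G W b \<Longrightarrow> u W (c W b) = t W b"
proof -
  define s where "s W d = (SOME b. el G W b \<and> c W b = d)" for W d
  have s: "el G W (s W d)" "c W (s W d) = d" if "el Q W d" for W d
    using someI_ex[OF ex[OF that]] by (auto simp: s_def)
  define v where "v W d = t W (s W d)" for W d
  have v: "v W (c W b) = t W b" if b: "el G W b" for W b
    unfolding v_def using eq[OF s(1)[OF nt_el[OF c b]] b s(2)[OF nt_el[OF c b]]] .
  have "nt Q T (nat_mk Q v)"
  proof (rule nt_nat_mk[OF Q])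
    show "el T W (v W d)" if "el Q W d" for W d unfolding v_def using nt_el[OF t s(1)[OF that]] .
    show "v W (plus_at Q W a b) = plus_at T W (v W a) (v W b)" if a: "el Q W a" and b: "el Q W b" for W a b
    proof -
      note sa = s[OF a] and sb = s[OF b]
      show ?thesis
        using v[OF el_plus[OF G sa(1) sb(1)]] nt_plus[OF c sa(1) sb(1)] nt_plus[OF t sa(1) sb(1)]
          v[OF sa(1)] v[OF sb(1)] sa(2) sb(2) by simp
    qed
    show "v X (FAr Q f a) = FAr T f (v Y a)" if f: "ar f X Y" and a: "el Q Y a" for X Y f a
    proof -
      note sa = s[OF a]
      show ?thesis
        using v[OF el_act[OF G f sa(1)]] nt_nat[OF c f sa(1)] nt_nat[OF t f sa(1)] v[OF sa(1)] sa(2) by simp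
    qed
  qed
  then show thesis using that[of "nat_mk Q v"] v nt_el[OF c] by (simp add: nat_mk_app)
qed

lemma M_zero_comp:
  "(G', \<theta>, H) \<cdot>\<^bsub>M\<^esub> (F, \<eta>, G) = zero_arr M F H \<longleftrightarrow> (\<forall>W a. el F W a \<longrightarrow> \<theta> W (\<eta> W a) = zero_at H W)"
  by (simp add: M_simps nat_mk_comp_eq_iff)

lemma M_comp_eq:
  assumes "nt F H \<tau>" "psh F"
  shows "(G', \<theta>, H) \<cdot>\<^bsub>M\<^esub> (F, \<eta>, G) = (F, \<tau>, H) \<longleftrightarrow> (\<forall>W a. el F W a \<longrightarrow> \<theta> W (\<eta> W a) = \<tau> W a)"
  using nat_mk_comp_eq_iff[of F \<theta> \<eta> \<tau>] nt_nat_mk_self[OF assms] by (simp add: M_simps)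

text \<open>In \<open>serre_iso\<close> the kernel and cokernel are given by universal properties in
  \<open>mod C\<close>, not by elements. The kernel is tested on maps from representable functors
  and the cokernel on the pointwise cokernel of \<open>\<sigma>\<close>; conversely, the pointwise
  kernel and cokernel are shown to be locally zero.\<close>

lemma serre_iso_iff:
  "serre_iso M S F G s \<longleftrightarrow> F \<in> MO \<and> G \<in> MO \<and> (\<exists>\<sigma>. s = (F, \<sigma>, G) \<and> nt F G \<sigma> \<and> loc_inj F \<sigma> \<and> loc_surj F G \<sigma>)"
proof
  assume "serre_iso M S F G s"
  then obtain K k Q c where K: "K \<in> S" "is_kernel M K F G k s" and Q: "Q \<in> S" "is_cokernel M F G Q s c"
    unfolding serre_iso_def by blast
  have F: "F \<in> MO" and G: "G \<in> MO" and "s \<in> arr M F G" using K(2) unfolding is_kernel_def by (simp_all add: M_simps)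
  then obtain \<sigma> where s: "s = (F, \<sigma>, G)" and \<sigma>: "nt F G \<sigma>" by (auto simp: M_simps)
  note pF = mod_psh[OF F] and pG = mod_psh[OF G]
  have "loc_inj F \<sigma>"
    unfolding loc_inj_def
  proof (intro allI impI)
    fix W a b assume a: "el F W a" and b: "el F W b" and e: "\<sigma> W a = \<sigma> W b"
    have W: "W \<in> Obj C" using a by (simp add: el_def)
    let ?d = "plus_at F W a (inv_at F W b)"
    have d: "el F W ?d" using el_plus[OF pF a el_inv[OF pF b]] .
    have sd: "\<sigma> W ?d = zero_at G W"
      using nt_sub[OF \<sigma> pF pG a b] sub_zero_iff[OF pG nt_el[OF \<sigma> a] nt_el[OF \<sigma> b]] e by simp
    \<comment> \<open>The element \<open>?d\<close>, which \<open>\<sigma>\<close> kills, becomes a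
      map from \<open>yo W\<close>. This map factors through the given kernel, which is locally
      zero, and so \<open>?d\<close> is locally zero.\<close>
    obtain \<tau> where \<tau>: "nt (yo W) F \<tau>" "\<And>V h. ar h V W \<Longrightarrow> \<tau> V {h} = FAr F h ?d"
      by (rule yo_homE[OF W pF d]) (rule that; assumption)
    have "\<sigma> V (\<tau> V A) = zero_at G V" if A: "el (yo W) V A" for V A
    proof -
      obtain h where h: "ar h V W" "A = {h}" using iffD1[OF el_yo[OF W] A] by blast
      then show ?thesis using \<tau>(2)[OF h(1)] nt_nat[OF \<sigma> h(1) d] sd act_zero[OF pG h(1)] by simp
    qed
    then have "s \<cdot>\<^bsub>M\<^esub> (yo W, \<tau>, F) = zero_arr M (yo W) G" unfolding s M_zero_comp by blast
    moreover have "\<forall>T\<in>Obj M. \<forall>t\<in>arr M T F. s \<cdot>\<^bsub>M\<^esub> t = zero_arr M T G \<longrightarrow>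
        (\<exists>!u. u \<in> arr M T K \<and> k \<cdot>\<^bsub>M\<^esub> u = t)"
      using K(2) unfolding is_kernel_def by simp
    moreover have "yo W \<in> Obj M" "(yo W, \<tau>, F) \<in> arr M (yo W) F" using yo_mod[OF W] \<tau>(1) by (simp_all add: M_simps)
    ultimately have "\<exists>u. u \<in> arr M (yo W) K \<and> k \<cdot>\<^bsub>M\<^esub> u = (yo W, \<tau>, F)" by blast
    then obtain u where u: "nt (yo W) K u" "k \<cdot>\<^bsub>M\<^esub> (yo W, u, K) = (yo W, \<tau>, F)" by (auto simp: M_simps)
    have "k \<in> arr M K F" using K(2) unfolding is_kernel_def by blast
    then obtain \<kappa> where \<kappa>: "k = (K, \<kappa>, F)" "nt K F \<kappa>" by (auto simp: M_simps)
    have i: "el (yo W) W {Ident C W}" using el_yoI[OF ar_id[OF W]] .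
    let ?c = "u W {Ident C W}"
    have c: "el K W ?c" using nt_el[OF u(1) i] .
    have "\<kappa> W ?c = \<tau> W {Ident C W}" using u(2) i unfolding \<kappa>(1) M_comp_eq[OF \<tau>(1) psh_yo[OF W]] by blast
    then have kc: "\<kappa> W ?c = ?d" using \<tau>(2)[OF ar_id[OF W]] act_id[OF pF d] by simp
    have pK: "psh K" using K(1) by (simp add: S_loc_eq mod_psh)
    have "loc_eq K W ?c (zero_at K W)" using K(1) c by (simp add: S_loc_eq)
    then have "loc_eq F W ?d (zero_at F W)"
      using loc_eq_nt[OF \<kappa>(2) pK c el_zero[OF pK W]] kc nt_zero[OF \<kappa>(2) pK pF W] by simp
    then show "loc_eq F W a b" using loc_eq_sub_zero[OF pF a b] by simp
  qed
  moreover have "loc_surj F G \<sigma>"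
    unfolding loc_surj_def
  proof (intro allI impI)
    fix W b assume b: "el G W b"
    have W: "W \<in> Obj C" using b by (simp add: el_def)
    \<comment> \<open>The projection to the pointwise cokernel kills \<open>\<sigma>\<close> and
      thus factors through the given cokernel \<open>Q\<close>. Since \<open>Q\<close> is locally
      zero, every element of \<open>G\<close> locally comes from \<open>F\<close>.\<close>
    obtain Q' c' where Q': "Q' \<in> MO" "nt G Q' c'" "\<And>W a. el F W a \<Longrightarrow> c' W (\<sigma> W a) = zero_at Q' W"
      "\<And>W b. el G W b \<Longrightarrow> c' W b = zero_at Q' W \<Longrightarrow> \<exists>a. el F W a \<and> \<sigma> W a = b"
      by (rule cokernelE[OF mod_fp[OF F] mod_fp[OF G] \<sigma>]) (rule that; assumption)
    have "(G, c', Q') \<cdot>\<^bsub>M\<^esub> s = zero_arr M F Q'" unfolding s M_zero_comp using Q'(3) by blast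
    moreover have "\<forall>T\<in>Obj M. \<forall>t\<in>arr M G T. t \<cdot>\<^bsub>M\<^esub> s = zero_arr M F T \<longrightarrow>
        (\<exists>!u. u \<in> arr M Q T \<and> u \<cdot>\<^bsub>M\<^esub> c = t)"
      using Q(2) unfolding is_cokernel_def by simp
    moreover have "Q' \<in> Obj M" "(G, c', Q') \<in> arr M G Q'" using Q'(1,2) by (simp_all add: M_simps)
    ultimately have "\<exists>u. u \<in> arr M Q Q' \<and> u \<cdot>\<^bsub>M\<^esub> c = (G, c', Q')" by blast
    then obtain u where u: "nt Q Q' u" "(Q, u, Q') \<cdot>\<^bsub>M\<^esub> c = (G, c', Q')" by (auto simp: M_simps)
    have "c \<in> arr M G Q" using Q(2) unfolding is_cokernel_def by blast
    then obtain \<gamma> where \<gamma>: "c = (G, \<gamma>, Q)" "nt G Q \<gamma>" by (auto simp: M_simps)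
    have uc: "u V (\<gamma> V x) = c' V x" if "el G V x" for V x
      using u(2) that unfolding \<gamma>(1) M_comp_eq[OF Q'(2) pG] by blast
    have pQ: "psh Q" and pQ': "psh Q'" using Q(1) Q'(1) by (simp_all add: S_loc_eq mod_psh)
    obtain e V where e: "cov e V W" "FAr Q e (\<gamma> W b) = zero_at Q V"
      using Q(1) nt_el[OF \<gamma>(2) b] unfolding S_iff by blast
    note eb = el_act[OF pG cov_ar[OF e(1)] b]
    have V: "V \<in> Obj C" using eb by (simp add: el_def)
    have "\<gamma> V (FAr G e b) = zero_at Q V" using nt_nat[OF \<gamma>(2) cov_ar[OF e(1)] b] e(2) by simp
    then have "c' V (FAr G e b) = zero_at Q' V" using uc[OF eb] nt_zero[OF u(1) pQ pQ' V] by simp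
    then show "\<exists>V e a. cov e V W \<and> el F V a \<and> \<sigma> V a = FAr G e b" using Q'(4)[OF eb] e(1) by blast
  qed
  ultimately show "F \<in> MO \<and> G \<in> MO \<and> (\<exists>\<sigma>. s = (F, \<sigma>, G) \<and> nt F G \<sigma> \<and> loc_inj F \<sigma> \<and> loc_surj F G \<sigma>)"
    using F G s \<sigma> by blast
next
  assume "F \<in> MO \<and> G \<in> MO \<and> (\<exists>\<sigma>. s = (F, \<sigma>, G) \<and> nt F G \<sigma> \<and> loc_inj F \<sigma> \<and> loc_surj F G \<sigma>)"
  then obtain \<sigma> where F: "F \<in> MO" and G: "G \<in> MO" and s: "s = (F, \<sigma>, G)" and \<sigma>: "nt F G \<sigma>"
    and li: "loc_inj F \<sigma>" and ls: "loc_surj F G \<sigma>" by blast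
  note pF = mod_psh[OF F] and pG = mod_psh[OF G]
  obtain K k where K: "K \<in> MO" "nt K F k"
    "\<And>W c. el K W c \<Longrightarrow> \<sigma> W (k W c) = zero_at G W"
    "\<And>W a. el F W a \<Longrightarrow> \<sigma> W a = zero_at G W \<Longrightarrow> \<exists>c. el K W c \<and> k W c = a"
    "\<And>W a b. el K W a \<Longrightarrow> el K W b \<Longrightarrow> k W a = k W b \<Longrightarrow> a = b"
    by (rule kernelE[OF mod_fp[OF F] mod_fp[OF G] \<sigma>]) (rule that; assumption)
  note pK = mod_psh[OF K(1)]
  have inK: "loc_inj K k"
    unfolding loc_inj_def
  proof (intro allI impI)
    fix W a b assume a: "el K W a" and b: "el K W b" and "k W a = k W b"
    then have "a = b" by (rule K(5))
    then show "loc_eq K W a b" using loc_eq_refl[OF elD(1)[OF a]] by simp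
  qed
  have "loc_eq K W c (zero_at K W)" if c: "el K W c" for W c
  proof -
    have W: "W \<in> Obj C" using c by (simp add: el_def)
    have "loc_eq F W (k W c) (zero_at F W)"
      using loc_injD[OF li nt_el[OF K(2) c] el_zero[OF pF W]] K(3)[OF c] nt_zero[OF \<sigma> pF pG W] by simp
    then show ?thesis
      using loc_inj_loc_eq[OF inK K(2) pK c el_zero[OF pK W]] nt_zero[OF K(2) pK pF W] by simp
  qed
  then have KS: "K \<in> S" using K(1) by (simp add: S_loc_eq)
  have "is_kernel M K F G (K, k, F) s"
    unfolding is_kernel_def
  proof (intro conjI ballI impI)
    show "K \<in> Obj M" "F \<in> Obj M" "G \<in> Obj M" "(K, k, F) \<in> arr M K F" "s \<in> arr M F G"
      using K F G \<sigma> s by (simp_all add: M_simps)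
    show "s \<cdot>\<^bsub>M\<^esub> (K, k, F) = zero_arr M K G" unfolding s M_zero_comp using K(3) by blast
    fix T t assume T: "T \<in> Obj M" and "t \<in> arr M T F" and z: "s \<cdot>\<^bsub>M\<^esub> t = zero_arr M T G"
    then obtain \<tau> where t: "t = (T, \<tau>, F)" and \<tau>: "nt T F \<tau>" by (auto simp: M_simps)
    have pT: "psh T" using T by (simp add: M_simps mod_psh)
    have z': "\<sigma> W (\<tau> W a) = zero_at G W" if "el T W a" for W a using z that unfolding s t M_zero_comp by blast
    have ex: "\<exists>c. el K W c \<and> k W c = \<tau> W a" if "el T W a" for W a
      using K(4)[OF nt_el[OF \<tau> that] z'[OF that]] .
    obtain u where u: "nt T K u" "\<And>W a. el T W a \<Longrightarrow> k W (u W a) = \<tau> W a"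
      by (rule factor_mono[OF pT pK \<tau> K(2)]) (erule (2) K(5), erule ex, (rule that; assumption))
    have ku: "(K, k, F) \<cdot>\<^bsub>M\<^esub> (T, v, K) = t \<longleftrightarrow> (\<forall>W a. el T W a \<longrightarrow> k W (v W a) = \<tau> W a)" for v
      unfolding t by (rule M_comp_eq[OF \<tau> pT])
    show "\<exists>!u. u \<in> arr M T K \<and> (K, k, F) \<cdot>\<^bsub>M\<^esub> u = t"
    proof (rule ex1I[of _ "(T, u, K)"])
      show "(T, u, K) \<in> arr M T K \<and> (K, k, F) \<cdot>\<^bsub>M\<^esub> (T, u, K) = t" using u ku by (simp add: M_simps)
      fix w assume w: "w \<in> arr M T K \<and> (K, k, F) \<cdot>\<^bsub>M\<^esub> w = t"
      then obtain v where v: "w = (T, v, K)" "nt T K v" by (auto simp: M_simps(2))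
      have v3: "\<forall>W a. el T W a \<longrightarrow> k W (v W a) = \<tau> W a" using w ku v(1) by simp
      have "v = u"
      proof (rule nt_ext[OF v(2) u(1)])
        fix W a assume a: "el T W a"
        show "v W a = u W a" by (rule K(5)[OF nt_el[OF v(2) a] nt_el[OF u(1) a]]) (simp add: u(2)[OF a] v3 a)
      qed
      then show "w = (T, u, K)" using v(1) by simp
    qed
  qed
  moreover obtain Q c where Q: "Q \<in> MO" "nt G Q c"
    "\<And>W a. el F W a \<Longrightarrow> c W (\<sigma> W a) = zero_at Q W"
    "\<And>W b. el G W b \<Longrightarrow> c W b = zero_at Q W \<Longrightarrow> \<exists>a. el F W a \<and> \<sigma> W a = b"
    "\<And>W d. el Q W d \<Longrightarrow> \<exists>b. el G W b \<and> c W b = d"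
    by (rule cokernelE[OF mod_fp[OF F] mod_fp[OF G] \<sigma>]) (rule that; assumption)
  note pQ = mod_psh[OF Q(1)]
  have "\<exists>V e. cov e V W \<and> FAr Q e d = zero_at Q V" if d: "el Q W d" for W d
  proof -
    obtain b where b: "el G W b" "c W b = d" using Q(5)[OF d] by blast
    obtain e V a where e: "cov e V W" "el F V a" "\<sigma> V a = FAr G e b" using loc_surjE[OF ls b(1)] .
    have "FAr Q e d = zero_at Q V" using nt_nat[OF Q(2) cov_ar[OF e(1)] b(1)] b(2) e(3) Q(3)[OF e(2)] by simp
    then show ?thesis using e(1) by blast
  qed
  then have QS: "Q \<in> S" using Q(1) by (simp add: S_iff)
  have "is_cokernel M F G Q s (G, c, Q)"
    unfolding is_cokernel_def
  proof (intro conjI ballI impI)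
    show "Q \<in> Obj M" "F \<in> Obj M" "G \<in> Obj M" "(G, c, Q) \<in> arr M G Q" "s \<in> arr M F G"
      using Q F G \<sigma> s by (simp_all add: M_simps)
    show "(G, c, Q) \<cdot>\<^bsub>M\<^esub> s = zero_arr M F Q" unfolding s M_zero_comp using Q(3) by blast
    fix T t assume T: "T \<in> Obj M" and "t \<in> arr M G T" and z: "t \<cdot>\<^bsub>M\<^esub> s = zero_arr M F T"
    then obtain \<tau> where t: "t = (G, \<tau>, T)" and \<tau>: "nt G T \<tau>" by (auto simp: M_simps)
    have pT: "psh T" using T by (simp add: M_simps mod_psh)
    have z': "\<tau> W (\<sigma> W a) = zero_at T W" if "el F W a" for W a using z that unfolding s t M_zero_comp by blast
    have eqv: "\<tau> W a = \<tau> W b" if a: "el G W a" and b: "el G W b" and e: "c W a = c W b" for W a b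
    proof -
      have "c W (plus_at G W a (inv_at G W b)) = zero_at Q W"
        using nt_sub[OF Q(2) pG pQ a b] sub_zero_iff[OF pQ nt_el[OF Q(2) a] nt_el[OF Q(2) b]] e by simp
      then obtain x where "el F W x" "\<sigma> W x = plus_at G W a (inv_at G W b)"
        using Q(4)[OF el_plus[OF pG a el_inv[OF pG b]]] by blast
      then have "\<tau> W (plus_at G W a (inv_at G W b)) = zero_at T W" using z' by metis
      then show ?thesis
        using nt_sub[OF \<tau> pG pT a b] sub_zero_iff[OF pT nt_el[OF \<tau> a] nt_el[OF \<tau> b]] by simp
    qed
    obtain u where u: "nt Q T u" "\<And>W b. el G W b \<Longrightarrow> u W (c W b) = \<tau> W b"
      by (rule factor_epi[OF pG pQ \<tau> Q(2)]) (erule (2) eqv, erule Q(5), (rule that; assumption))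
    have cu: "(Q, v, T) \<cdot>\<^bsub>M\<^esub> (G, c, Q) = t \<longleftrightarrow> (\<forall>W a. el G W a \<longrightarrow> v W (c W a) = \<tau> W a)" for v
      unfolding t by (rule M_comp_eq[OF \<tau> pG])
    show "\<exists>!u. u \<in> arr M Q T \<and> u \<cdot>\<^bsub>M\<^esub> (G, c, Q) = t"
    proof (rule ex1I[of _ "(Q, u, T)"])
      show "(Q, u, T) \<in> arr M Q T \<and> (Q, u, T) \<cdot>\<^bsub>M\<^esub> (G, c, Q) = t" using u cu by (simp add: M_simps)
      fix w assume w: "w \<in> arr M Q T \<and> w \<cdot>\<^bsub>M\<^esub> (G, c, Q) = t"
      then obtain v where v: "w = (Q, v, T)" "nt Q T v" by (auto simp: M_simps(2))
      have v3: "\<forall>W a. el G W a \<longrightarrow> v W (c W a) = \<tau> W a" using w cu v(1) by simp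
      have "v = u"
      proof (rule nt_ext[OF v(2) u(1)])
        fix W d assume "el Q W d"
        then obtain b where "el G W b" "c W b = d" using Q(5) by blast
        then show "v W d = u W d" using u(2) v3 by auto
      qed
      then show "w = (Q, u, T)" using v(1) by simp
    qed
  qed
  ultimately show "serre_iso M S F G s" unfolding serre_iso_def using KS QS by blast
qed

section \<open>Roofs and their graphs\<close>

lemma act_square:
  assumes "psh F" "el F W a" "ar e' V' U" "ar k U W" "ar k' V' V" "ar e V W" "k \<cdot> e' = e \<cdot> k'"
  shows "FAr F e' (FAr F k a) = FAr F k' (FAr F e a)"
  using act_comp[OF assms(1,3,4,2)] act_comp[OF assms(1,5,6,2)] assms(7) by simp

text \<open>By \<open>serre_iso_iff\<close> the two local conditions on \<open>\<sigma>\<close> say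
  that this leg is inverted in the quotient.\<close>

definition isroof where
  "isroof F G H \<sigma> \<tau> \<longleftrightarrow> F \<in> MO \<and> G \<in> MO \<and> H \<in> MO \<and> nt H F \<sigma> \<and> nt H G \<tau> \<and> loc_inj H \<sigma> \<and> loc_surj H F \<sigma>"

lemma isroofD:
  assumes "isroof F G H \<sigma> \<tau>"
  shows "F \<in> MO" "G \<in> MO" "H \<in> MO" "nt H F \<sigma>" "nt H G \<tau>" "loc_inj H \<sigma>" "loc_surj H F \<sigma>" "psh F" "psh G" "psh H"
  using assms mod_psh unfolding isroof_def by auto

text \<open>The graph of the roof \<open>F \<leftarrow> H \<rightarrow> G\<close> consists of the pairs that locally have the form
  \<open>(\<sigma> h, \<tau> h)\<close>. It is a complete invariant of the class of the roof, see \<open>roof_equiv_iff\<close>.\<close>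

definition roof_graph ::
  "('o, 'm, 'm set) presheaf \<Rightarrow> ('o, 'm, 'm set) presheaf \<Rightarrow> ('o, 'm, 'm set) presheaf \<Rightarrow>
   ('o \<Rightarrow> 'm set \<Rightarrow> 'm set) \<Rightarrow> ('o \<Rightarrow> 'm set \<Rightarrow> 'm set) \<Rightarrow> ('o \<times> 'm set \<times> 'm set) set" where
  "roof_graph F G H \<sigma> \<tau> = {(W, a, b). el F W a \<and> el G W b \<and>
     (\<exists>V e h. cov e V W \<and> el H V h \<and> \<sigma> V h = FAr F e a \<and> \<tau> V h = FAr G e b)}"

lemma roof_graphI:
  "el F W a \<Longrightarrow> el G W b \<Longrightarrow> cov e V W \<Longrightarrow> el H V h \<Longrightarrow> \<sigma> V h = FAr F e a \<Longrightarrow> \<tau> V h = FAr G e b \<Longrightarrow>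
   (W, a, b) \<in> roof_graph F G H \<sigma> \<tau>"
  unfolding roof_graph_def by blast

lemma roof_graphE:
  assumes "(W, a, b) \<in> roof_graph F G H \<sigma> \<tau>"
  obtains e V h where "el F W a" "el G W b" "cov e V W" "el H V h" "\<sigma> V h = FAr F e a" "\<tau> V h = FAr G e b"
  using assms unfolding roof_graph_def by blast

lemma roof_graph_base:
  assumes r: "isroof F G H \<sigma> \<tau>" and h: "el H V h"
  shows "(V, \<sigma> V h, \<tau> V h) \<in> roof_graph F G H \<sigma> \<tau>"
proof -
  note a = nt_el[OF isroofD(4)[OF r] h] and b = nt_el[OF isroofD(5)[OF r] h]
  show ?thesis
    by (rule roof_graphI[OF a b cov_id[OF elD(1)[OF h]] h])
       (simp_all add: act_id[OF isroofD(8)[OF r] a] act_id[OF isroofD(9)[OF r] b])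
qed

text \<open>An additive relation, local for coverings, total up to coverings and single valued up to
  local equality: the graph of a map between the sheaves associated with \<open>F\<close> and
  \<open>G\<close>, stated without sheafification.\<close>

definition local_graph ::
  "('o, 'm, 'm set) presheaf \<Rightarrow> ('o, 'm, 'm set) presheaf \<Rightarrow> ('o \<times> 'm set \<times> 'm set) set \<Rightarrow> bool" where
  "local_graph F G \<Gamma> \<longleftrightarrow>
     (\<forall>W a b. (W, a, b) \<in> \<Gamma> \<longrightarrow> el F W a \<and> el G W b) \<and>
     (\<forall>W a b V h. (W, a, b) \<in> \<Gamma> \<longrightarrow> ar h V W \<longrightarrow> (V, FAr F h a, FAr G h b) \<in> \<Gamma>) \<and>
     (\<forall>W a b V e. el F W a \<longrightarrow> el G W b \<longrightarrow> cov e V W \<longrightarrow> (V, FAr F e a, FAr G e b) \<in> \<Gamma> \<longrightarrow> (W, a, b) \<in> \<Gamma>) \<and>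
     (\<forall>W a. el F W a \<longrightarrow> (\<exists>V e b. cov e V W \<and> (V, FAr F e a, b) \<in> \<Gamma>)) \<and>
     (\<forall>W a b b'. (W, a, b) \<in> \<Gamma> \<longrightarrow> (W, a, b') \<in> \<Gamma> \<longrightarrow> loc_eq G W b b') \<and>
     (\<forall>W a b a' b'. (W, a, b) \<in> \<Gamma> \<longrightarrow> (W, a', b') \<in> \<Gamma> \<longrightarrow> (W, plus_at F W a a', plus_at G W b b') \<in> \<Gamma>)"

lemma local_graphD:
  assumes "local_graph F G \<Gamma>"
  shows "(W, a, b) \<in> \<Gamma> \<Longrightarrow> el F W a" "(W, a, b) \<in> \<Gamma> \<Longrightarrow> el G W b"
    "(W, a, b) \<in> \<Gamma> \<Longrightarrow> ar h V W \<Longrightarrow> (V, FAr F h a, FAr G h b) \<in> \<Gamma>"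
    "el F W a \<Longrightarrow> el G W b \<Longrightarrow> cov e V W \<Longrightarrow> (V, FAr F e a, FAr G e b) \<in> \<Gamma> \<Longrightarrow> (W, a, b) \<in> \<Gamma>"
    "(W, a, b) \<in> \<Gamma> \<Longrightarrow> (W, a, b') \<in> \<Gamma> \<Longrightarrow> loc_eq G W b b'"
    "(W, a, b) \<in> \<Gamma> \<Longrightarrow> (W, a', b') \<in> \<Gamma> \<Longrightarrow> (W, plus_at F W a a', plus_at G W b b') \<in> \<Gamma>"
proof -
  note L = assms[unfolded local_graph_def]
  show "(W, a, b) \<in> \<Gamma> \<Longrightarrow> el F W a" "(W, a, b) \<in> \<Gamma> \<Longrightarrow> el G W b"
    using L[THEN conjunct1, rule_format] by simp_all
  show "(W, a, b) \<in> \<Gamma> \<Longrightarrow> ar h V W \<Longrightarrow> (V, FAr F h a, FAr G h b) \<in> \<Gamma>"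
    by (rule L[THEN conjunct2, THEN conjunct1, rule_format])
  show "el F W a \<Longrightarrow> el G W b \<Longrightarrow> cov e V W \<Longrightarrow> (V, FAr F e a, FAr G e b) \<in> \<Gamma> \<Longrightarrow> (W, a, b) \<in> \<Gamma>"
    by (rule L[THEN conjunct2, THEN conjunct2, THEN conjunct1, rule_format])
  show "(W, a, b) \<in> \<Gamma> \<Longrightarrow> (W, a, b') \<in> \<Gamma> \<Longrightarrow> loc_eq G W b b'"
    by (rule L[THEN conjunct2, THEN conjunct2, THEN conjunct2, THEN conjunct2, THEN conjunct1, rule_format])
  show "(W, a, b) \<in> \<Gamma> \<Longrightarrow> (W, a', b') \<in> \<Gamma> \<Longrightarrow> (W, plus_at F W a a', plus_at G W b b') \<in> \<Gamma>"
    by (rule L[THEN conjunct2, THEN conjunct2, THEN conjunct2, THEN conjunct2, THEN conjunct2, rule_format])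
qed

lemma local_graph_totE:
  assumes "local_graph F G \<Gamma>" "el F W a"
  obtains e V b where "cov e V W" "(V, FAr F e a, b) \<in> \<Gamma>"
proof -
  have "\<exists>V e b. cov e V W \<and> (V, FAr F e a, b) \<in> \<Gamma>"
    by (rule assms(1)[unfolded local_graph_def, THEN conjunct2, THEN conjunct2, THEN conjunct2, THEN conjunct1, rule_format])
       (rule assms(2))
  then show thesis by (elim exE conjE) (rule that)
qed

text \<open>Local surjectivity of \<open>\<sigma>\<close> makes the relation total and local
  injectivity makes it single valued. The remaining clauses come from naturality, additivity and the
  stability of coverings under pullback and composition.\<close>

lemma local_graph_roof_graph:
  assumes r: "isroof F G H \<sigma> \<tau>"
  shows "local_graph F G (roof_graph F G H \<sigma> \<tau>)"
  unfolding local_graph_def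
proof (intro conjI allI impI)
  note D = isroofD[OF r]
  fix W a b assume ab: "(W, a, b) \<in> roof_graph F G H \<sigma> \<tau>"
  then obtain e V h where a: "el F W a" and b: "el G W b" and e: "cov e V W" and h: "el H V h"
    and s: "\<sigma> V h = FAr F e a" and t: "\<tau> V h = FAr G e b" by (rule roof_graphE)
  note e' = cov_ar[OF e]
  show "el F W a" "el G W b" using a b .
  show "(U, FAr F k a, FAr G k b) \<in> roof_graph F G H \<sigma> \<tau>" if k: "ar k U W" for U k
  proof -
    obtain V' f k' where p: "cov f V' U" "ar k' V' V" "k \<cdot> f = e \<cdot> k'" using cov_pull[OF e k] by (elim exE conjE)
    show ?thesis
    proof (rule roof_graphI[OF el_act[OF D(8) k a] el_act[OF D(9) k b] p(1) el_act[OF D(10) p(2) h]])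
      show "\<sigma> V' (FAr H k' h) = FAr F f (FAr F k a)"
        using nt_nat[OF D(4) p(2) h] s act_square[OF D(8) a cov_ar[OF p(1)] k p(2) e' p(3)] by simp
      show "\<tau> V' (FAr H k' h) = FAr G f (FAr G k b)"
        using nt_nat[OF D(5) p(2) h] t act_square[OF D(9) b cov_ar[OF p(1)] k p(2) e' p(3)] by simp
    qed
  qed
  \<comment> \<open>Witnesses for two pairs over the same \<open>W\<close> are first moved to one
    covering; there they can be added.\<close>
  fix a' b'
  {
    assume "(W, a', b') \<in> roof_graph F G H \<sigma> \<tau>"
    then obtain f V' h' where a': "el F W a'" and b': "el G W b'" and f: "cov f V' W" and h': "el H V' h'"
      and s': "\<sigma> V' h' = FAr F f a'" and t': "\<tau> V' h' = FAr G f b'" by (rule roof_graphE)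
    obtain g U g' where g: "cov g U V" "ar g' U V'" "e \<cdot> g = f \<cdot> g'" "cov (e \<cdot> g) U W" by (rule cov_refineE[OF e f])
    note g0 = cov_ar[OF g(1)]
    have "\<sigma> U (FAr H g h) = FAr F (e \<cdot> g) a" "\<tau> U (FAr H g h) = FAr G (e \<cdot> g) b"
      "\<sigma> U (FAr H g' h') = FAr F (e \<cdot> g) a'" "\<tau> U (FAr H g' h') = FAr G (e \<cdot> g) b'"
      using nt_nat[OF D(4) g0 h] nt_nat[OF D(5) g0 h] nt_nat[OF D(4) g(2) h'] nt_nat[OF D(5) g(2) h']
        act_comp[OF D(8) g0 e' a] act_comp[OF D(9) g0 e' b] s t
        act_comp[OF D(8) g(2) cov_ar[OF f] a'] act_comp[OF D(9) g(2) cov_ar[OF f] b'] s' t' g(3) by simp_all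
    from this a' b' g(4) el_act[OF D(10) g0 h] el_act[OF D(10) g(2) h']
    have "\<exists>U k x x'. el F W a' \<and> el G W b' \<and> cov k U W \<and> el H U x \<and> el H U x' \<and> \<sigma> U x = FAr F k a \<and>
      \<tau> U x = FAr G k b \<and> \<sigma> U x' = FAr F k a' \<and> \<tau> U x' = FAr G k b'" by blast
  } note common = this
  {
    assume "(W, a', b') \<in> roof_graph F G H \<sigma> \<tau>"
    then obtain U k x x' where a': "el F W a'" and b': "el G W b'" and k: "cov k U W" and x: "el H U x" "el H U x'"
      and e1: "\<sigma> U x = FAr F k a" "\<tau> U x = FAr G k b" "\<sigma> U x' = FAr F k a'" "\<tau> U x' = FAr G k b'"
      using common by blast
    show "(W, plus_at F W a a', plus_at G W b b') \<in> roof_graph F G H \<sigma> \<tau>"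
    proof (rule roof_graphI[OF el_plus[OF D(8) a a'] el_plus[OF D(9) b b'] k el_plus[OF D(10) x]])
      show "\<sigma> U (plus_at H U x x') = FAr F k (plus_at F W a a')"
        using nt_plus[OF D(4) x] act_plus[OF D(8) cov_ar[OF k] a a'] e1 by simp
      show "\<tau> U (plus_at H U x x') = FAr G k (plus_at G W b b')"
        using nt_plus[OF D(5) x] act_plus[OF D(9) cov_ar[OF k] b b'] e1 by simp
    qed
  next
    assume "(W, a, b') \<in> roof_graph F G H \<sigma> \<tau>"
    then obtain f V' h' where b': "el G W b'" and f: "cov f V' W" and h': "el H V' h'"
      and s': "\<sigma> V' h' = FAr F f a" and t': "\<tau> V' h' = FAr G f b'" by (rule roof_graphE)
    obtain g U g' where g: "cov g U V" "ar g' U V'" "e \<cdot> g = f \<cdot> g'" "cov (e \<cdot> g) U W" by (rule cov_refineE[OF e f])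
    note g0 = cov_ar[OF g(1)]
    note x = el_act[OF D(10) g0 h] and x' = el_act[OF D(10) g(2) h']
    \<comment> \<open>Over the common covering both witnesses have the same image in
      \<open>F\<close>. They therefore agree locally in \<open>H\<close>, and so do their images in
      \<open>G\<close>.\<close>
    have "\<sigma> U (FAr H g h) = \<sigma> U (FAr H g' h')"
      using nt_nat[OF D(4) g0 h] nt_nat[OF D(4) g(2) h'] act_comp[OF D(8) g0 e' a] s
        act_comp[OF D(8) g(2) cov_ar[OF f] a] s' g(3) by simp
    then have "loc_eq G U (\<tau> U (FAr H g h)) (\<tau> U (FAr H g' h'))"
      using loc_eq_nt[OF D(5,10) x x' loc_injD[OF D(6) x x']] by blast
    then have "loc_eq G U (FAr G (e \<cdot> g) b) (FAr G (e \<cdot> g) b')"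
      using nt_nat[OF D(5) g0 h] nt_nat[OF D(5) g(2) h'] act_comp[OF D(9) g0 e' b] t
        act_comp[OF D(9) g(2) cov_ar[OF f] b'] t' g(3) by simp
    then show "loc_eq G W b b'" by (rule loc_eq_local[OF D(9) b b' g(4)])
  }
next
  note D = isroofD[OF r]
  fix W a b V e assume a: "el F W a" and b: "el G W b" and e: "cov e V W"
    and "(V, FAr F e a, FAr G e b) \<in> roof_graph F G H \<sigma> \<tau>"
  then obtain f U h where f: "cov f U V" and h: "el H U h" and s: "\<sigma> U h = FAr F f (FAr F e a)"
    and t: "\<tau> U h = FAr G f (FAr G e b)" by (auto elim: roof_graphE)
  show "(W, a, b) \<in> roof_graph F G H \<sigma> \<tau>"
    by (rule roof_graphI[OF a b cov_comp[OF e f] h])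
       (simp_all add: s t act_comp[OF D(8) cov_ar[OF f] cov_ar[OF e] a] act_comp[OF D(9) cov_ar[OF f] cov_ar[OF e] b])
next
  note D = isroofD[OF r]
  fix W a assume a: "el F W a"
  obtain e V h where "cov e V W" "el H V h" "\<sigma> V h = FAr F e a" using loc_surjE[OF D(7) a] .
  then show "\<exists>V e b. cov e V W \<and> (V, FAr F e a, b) \<in> roof_graph F G H \<sigma> \<tau>" using roof_graph_base[OF r] by metis
qed

lemma local_graph_loc_eq:
  assumes G: "psh G" and F: "psh F" and L: "local_graph F G \<Gamma>" and ab: "(W, a, b) \<in> \<Gamma>" and l: "loc_eq G W b b'" and b': "el G W b'"
  shows "(W, a, b') \<in> \<Gamma>"
proof -
  obtain e V where e: "cov e V W" "FAr G e b = FAr G e b'" using loc_eqE[OF l] .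
  have "(V, FAr F e a, FAr G e b') \<in> \<Gamma>" using local_graphD(3)[OF L ab cov_ar[OF e(1)]] e(2) by simp
  then show ?thesis using local_graphD(4)[OF L local_graphD(1)[OF L ab] b' e(1)] by blast
qed

text \<open>A local graph is everywhere defined up to coverings, so one inclusion suffices.\<close>

lemma local_graph_eqI:
  assumes F: "psh F" and G: "psh G" and L: "local_graph F G \<Gamma>" and L': "local_graph F G \<Gamma>'" and sub: "\<Gamma> \<subseteq> \<Gamma>'"
  shows "\<Gamma> = \<Gamma>'"
proof
  show "\<Gamma>' \<subseteq> \<Gamma>"
  proof (rule subsetI, clarify)
    fix W a b assume ab: "(W, a, b) \<in> \<Gamma>'"
    note a = local_graphD(1)[OF L' ab] and b = local_graphD(2)[OF L' ab]
    obtain e V c where e: "cov e V W" and c: "(V, FAr F e a, c) \<in> \<Gamma>" by (rule local_graph_totE[OF L a])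
    have "loc_eq G V c (FAr G e b)" using local_graphD(5)[OF L' subsetD[OF sub c] local_graphD(3)[OF L' ab cov_ar[OF e]]] .
    then have "(V, FAr F e a, FAr G e b) \<in> \<Gamma>"
      using local_graph_loc_eq[OF G F L c _ el_act[OF G cov_ar[OF e] b]] by blast
    then show "(W, a, b) \<in> \<Gamma>" using local_graphD(4)[OF L a b e] by blast
  qed
qed (rule sub)

section \<open>The class of a roof and its graph\<close>

definition graph_of_roof where
  "graph_of_roof F G \<rho> = (case \<rho> of (H, (_, \<sigma>, _), (_, \<tau>, _)) \<Rightarrow> roof_graph F G H \<sigma> \<tau>)"

definition mk_roof where "mk_roof F G H \<sigma> \<tau> = (H, (H, \<sigma>, F), (H, \<tau>, G))"

lemma graph_of_roof_mk_roof: "graph_of_roof F G (mk_roof F G H \<sigma> \<tau>) = roof_graph F G H \<sigma> \<tau>"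
  by (simp add: graph_of_roof_def mk_roof_def)

lemma in_roofs:
  assumes "F \<in> MO" "G \<in> MO"
  shows "\<rho> \<in> roofs M S F G \<longleftrightarrow> (\<exists>H \<sigma> \<tau>. \<rho> = mk_roof F G H \<sigma> \<tau> \<and> isroof F G H \<sigma> \<tau>)"
  using assms by (auto simp: roofs_def serre_iso_iff isroof_def mk_roof_def M_simps(1,2))

text \<open>\<open>u\<close> carries witnesses in \<open>L\<close> to witnesses in \<open>H\<close>,
  which gives one inclusion; \<open>local_graph_eqI\<close> supplies the other.\<close>

lemma roof_graph_refine:
  assumes r: "isroof F G H \<sigma> \<tau>" and L: "isroof F G L \<kappa> \<mu>" and u: "nt L H u"
    and s: "\<And>W l. el L W l \<Longrightarrow> \<kappa> W l = \<sigma> W (u W l)" and t: "\<And>W l. el L W l \<Longrightarrow> \<mu> W l = \<tau> W (u W l)"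
  shows "roof_graph F G L \<kappa> \<mu> = roof_graph F G H \<sigma> \<tau>"
proof (rule local_graph_eqI[OF isroofD(8,9)[OF r] local_graph_roof_graph[OF L] local_graph_roof_graph[OF r]], rule subsetI, clarify)
  fix W a b assume "(W, a, b) \<in> roof_graph F G L \<kappa> \<mu>"
  then obtain e V l where *: "el F W a" "el G W b" "cov e V W" "el L V l" "\<kappa> V l = FAr F e a" "\<mu> V l = FAr G e b"
    by (rule roof_graphE)
  show "(W, a, b) \<in> roof_graph F G H \<sigma> \<tau>"
    by (rule roof_graphI[OF *(1-3) nt_el[OF u *(4)]]) (use * s t in simp_all)
qed

text \<open>Passing to the common roof of the definition does not change the graph. Conversely, if
  the graphs are equal, the simultaneous pullback of both legs covers \<open>F\<close> and serves as
  the common roof.\<close>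

lemma roof_equiv_iff:
  assumes F: "F \<in> MO" and G: "G \<in> MO"
  shows "(\<rho>, \<rho>') \<in> roof_equiv M S F G \<longleftrightarrow> \<rho> \<in> roofs M S F G \<and> \<rho>' \<in> roofs M S F G \<and> graph_of_roof F G \<rho> = graph_of_roof F G \<rho>'"
proof
  assume e: "(\<rho>, \<rho>') \<in> roof_equiv M S F G"
  then have r: "\<rho> \<in> roofs M S F G" "\<rho>' \<in> roofs M S F G" unfolding roof_equiv_def by auto
  obtain H \<sigma> \<tau> where \<rho>: "\<rho> = mk_roof F G H \<sigma> \<tau>" and H: "isroof F G H \<sigma> \<tau>" using r(1) in_roofs[OF F G] by blast
  obtain H' \<sigma>' \<tau>' where \<rho>': "\<rho>' = mk_roof F G H' \<sigma>' \<tau>'" and H': "isroof F G H' \<sigma>' \<tau>'" using r(2) in_roofs[OF F G] by blast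
  note D = isroofD[OF H] and D' = isroofD[OF H']
  from e obtain L u u' where L: "L \<in> MO" and u: "nt L H u" and u': "nt L H' u'"
    and c1: "(H, \<sigma>, F) \<cdot>\<^bsub>M\<^esub> (L, u, H) = (H', \<sigma>', F) \<cdot>\<^bsub>M\<^esub> (L, u', H')"
    and c2: "(H, \<tau>, G) \<cdot>\<^bsub>M\<^esub> (L, u, H) = (H', \<tau>', G) \<cdot>\<^bsub>M\<^esub> (L, u', H')"
    and si: "serre_iso M S L F ((H, \<sigma>, F) \<cdot>\<^bsub>M\<^esub> (L, u, H))"
    unfolding roof_equiv_def \<rho> \<rho>' mk_roof_def by (auto simp: M_simps(1,2))
  note pL = mod_psh[OF L]
  let ?s = "nat_mk L (\<lambda>W l. \<sigma> W (u W l))" and ?t = "nat_mk L (\<lambda>W l. \<tau> W (u W l))"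
  have R: "isroof F G L ?s ?t"
    using si nt_comp[OF pL u D(5)] F G L unfolding serre_iso_iff isroof_def by (auto simp: M_simps(5))
  have "roof_graph F G L ?s ?t = roof_graph F G H \<sigma> \<tau>" by (rule roof_graph_refine[OF H R u]) (simp_all add: nat_mk_app)
  moreover have "?s = nat_mk L (\<lambda>W l. \<sigma>' W (u' W l))" "?t = nat_mk L (\<lambda>W l. \<tau>' W (u' W l))"
    using c1 c2 by (simp_all add: M_simps(5))
  then have "roof_graph F G L ?s ?t = roof_graph F G H' \<sigma>' \<tau>'"
    by (intro roof_graph_refine[OF H' R u']) (metis nat_mk_app)+
  ultimately show "\<rho> \<in> roofs M S F G \<and> \<rho>' \<in> roofs M S F G \<and> graph_of_roof F G \<rho> = graph_of_roof F G \<rho>'"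
    using r by (simp add: \<rho> \<rho>' graph_of_roof_mk_roof)
next
  assume r: "\<rho> \<in> roofs M S F G \<and> \<rho>' \<in> roofs M S F G \<and> graph_of_roof F G \<rho> = graph_of_roof F G \<rho>'"
  obtain H \<sigma> \<tau> where \<rho>: "\<rho> = mk_roof F G H \<sigma> \<tau>" and H: "isroof F G H \<sigma> \<tau>" using r in_roofs[OF F G] by blast
  obtain H' \<sigma>' \<tau>' where \<rho>': "\<rho>' = mk_roof F G H' \<sigma>' \<tau>'" and H': "isroof F G H' \<sigma>' \<tau>'" using r in_roofs[OF F G] by blast
  note D = isroofD[OF H] and D' = isroofD[OF H']
  have eq: "roof_graph F G H \<sigma> \<tau> = roof_graph F G H' \<sigma>' \<tau>'" using r by (simp add: \<rho> \<rho>' graph_of_roof_mk_roof)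
  \<comment> \<open>\<open>L\<close> consists of all pairs on which both legs agree, so every common
    roof maps to it.\<close>
  obtain L u u' where L: "L \<in> MO" "nt L H u" "nt L H' u'"
    "\<And>W c. el L W c \<Longrightarrow> \<sigma> W (u W c) = \<sigma>' W (u' W c) \<and> \<tau> W (u W c) = \<tau>' W (u' W c)"
    "\<And>W a b. el H W a \<Longrightarrow> el H' W b \<Longrightarrow> \<sigma> W a = \<sigma>' W b \<Longrightarrow> \<tau> W a = \<tau>' W b \<Longrightarrow>
       \<exists>c. el L W c \<and> u W c = a \<and> u' W c = b"
    "\<And>W a b. el L W a \<Longrightarrow> el L W b \<Longrightarrow> u W a = u W b \<Longrightarrow> u' W a = u' W b \<Longrightarrow> a = b"
    by (rule pullback_pairE[OF mod_fp[OF D(3)] mod_fp[OF D'(3)] mod_fp[OF F] mod_fp[OF G] D(4) D'(4) D(5) D'(5)])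
       (rule that; assumption)
  note pL = mod_psh[OF L(1)]
  let ?s = "nat_mk L (\<lambda>W l. \<sigma> W (u W l))"
  have li: "loc_inj L ?s"
    unfolding loc_inj_def
  proof (intro allI impI)
    fix W x y assume x: "el L W x" and y: "el L W y" and "?s W x = ?s W y"
    then have e: "\<sigma> W (u W x) = \<sigma> W (u W y)" by (simp add: nat_mk_app)
    then have e': "\<sigma>' W (u' W x) = \<sigma>' W (u' W y)" using L(4)[OF x] L(4)[OF y] by simp
    obtain e V where 1: "cov e V W" "FAr H e (u W x) = FAr H e (u W y)"
      using loc_eqE[OF loc_injD[OF D(6) nt_el[OF L(2) x] nt_el[OF L(2) y] e]] .
    obtain e' V' where 2: "cov e' V' W" "FAr H' e' (u' W x) = FAr H' e' (u' W y)"
      using loc_eqE[OF loc_injD[OF D'(6) nt_el[OF L(3) x] nt_el[OF L(3) y] e']] .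
    obtain f U f' where f: "cov f U V" "ar f' U V'" "e \<cdot> f = e' \<cdot> f'" "cov (e \<cdot> f) U W" by (rule cov_refineE[OF 1(1) 2(1)])
    have "u U (FAr L (e \<cdot> f) x) = u U (FAr L (e \<cdot> f) y)"
      using nt_nat[OF L(2) cov_ar[OF f(4)] x] nt_nat[OF L(2) cov_ar[OF f(4)] y] 1(2)
        act_comp[OF D(10) cov_ar[OF f(1)] cov_ar[OF 1(1)] nt_el[OF L(2) x]]
        act_comp[OF D(10) cov_ar[OF f(1)] cov_ar[OF 1(1)] nt_el[OF L(2) y]] by simp
    moreover have "u' U (FAr L (e \<cdot> f) x) = u' U (FAr L (e \<cdot> f) y)"
      using nt_nat[OF L(3) cov_ar[OF f(4)] x] nt_nat[OF L(3) cov_ar[OF f(4)] y] 2(2)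
        act_comp[OF D'(10) f(2) cov_ar[OF 2(1)] nt_el[OF L(3) x]]
        act_comp[OF D'(10) f(2) cov_ar[OF 2(1)] nt_el[OF L(3) y]] f(3) by simp
    ultimately have "FAr L (e \<cdot> f) x = FAr L (e \<cdot> f) y"
      by (rule L(6)[OF el_act[OF pL cov_ar[OF f(4)] x] el_act[OF pL cov_ar[OF f(4)] y]])
    then show "loc_eq L W x y" by (rule loc_eqI[OF f(4)])
  qed
  have ls: "loc_surj L F ?s"
    unfolding loc_surj_def
  proof (intro allI impI)
    fix W a assume a: "el F W a"
    obtain e V h where e: "cov e V W" "el H V h" "\<sigma> V h = FAr F e a" using loc_surjE[OF D(7) a] .
    \<comment> \<open>Here equality of the graphs enters: an element of \<open>H\<close> locally has
      a partner in \<open>H'\<close> with the same two images, and together they form an element of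
      \<open>L\<close>.\<close>
    have "(V, FAr F e a, \<tau> V h) \<in> roof_graph F G H' \<sigma>' \<tau>'" using roof_graph_base[OF H e(2)] e(3) eq by simp
    then obtain e' V' h' where e': "cov e' V' V" "el H' V' h'" "\<sigma>' V' h' = FAr F e' (FAr F e a)"
      "\<tau>' V' h' = FAr G e' (\<tau> V h)" by (auto elim: roof_graphE)
    note he = el_act[OF D(10) cov_ar[OF e'(1)] e(2)]
    have "\<sigma> V' (FAr H e' h) = \<sigma>' V' h'" "\<tau> V' (FAr H e' h) = \<tau>' V' h'"
      using nt_nat[OF D(4) cov_ar[OF e'(1)] e(2)] nt_nat[OF D(5) cov_ar[OF e'(1)] e(2)] e(3) e'(3,4) by simp_all
    then obtain c where c: "el L V' c" "u V' c = FAr H e' h" using L(5)[OF he e'(2)] by blast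
    have "?s V' c = FAr F (e \<cdot> e') a"
      using c nt_nat[OF D(4) cov_ar[OF e'(1)] e(2)] e(3) act_comp[OF D(8) cov_ar[OF e'(1)] cov_ar[OF e(1)] a]
      by (simp add: nat_mk_app)
    then show "\<exists>V e l. cov e V W \<and> el L V l \<and> ?s V l = FAr F e a"
      using cov_comp[OF e(1) e'(1)] c(1) by blast
  qed
  have c1: "(H, \<sigma>, F) \<cdot>\<^bsub>M\<^esub> (L, u, H) = (H', \<sigma>', F) \<cdot>\<^bsub>M\<^esub> (L, u', H')"
    using L(4) by (simp add: M_simps(5) nat_mk_comp_eq_iff)
  have c2: "(H, \<tau>, G) \<cdot>\<^bsub>M\<^esub> (L, u, H) = (H', \<tau>', G) \<cdot>\<^bsub>M\<^esub> (L, u', H')"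
    using L(4) by (simp add: M_simps(5) nat_mk_comp_eq_iff)
  have si: "serre_iso M S L F ((H, \<sigma>, F) \<cdot>\<^bsub>M\<^esub> (L, u, H))"
    unfolding serre_iso_iff using L(1) F li ls nt_comp[OF pL L(2) D(4)] by (auto simp: M_simps(5))
  have "\<exists>L\<in>Obj M. \<exists>v\<in>arr M L H. \<exists>v'\<in>arr M L H'. (H, \<sigma>, F) \<cdot>\<^bsub>M\<^esub> v = (H', \<sigma>', F) \<cdot>\<^bsub>M\<^esub> v' \<and>
     (H, \<tau>, G) \<cdot>\<^bsub>M\<^esub> v = (H', \<tau>', G) \<cdot>\<^bsub>M\<^esub> v' \<and> serre_iso M S L F ((H, \<sigma>, F) \<cdot>\<^bsub>M\<^esub> v)"
    using L(1-3) c1 c2 si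
    by (intro bexI[of _ L] bexI[of _ "(L, u, H)"] bexI[of _ "(L, u', H')"]) (simp_all add: M_simps(1,2))
  then show "(\<rho>, \<rho>') \<in> roof_equiv M S F G" using r unfolding roof_equiv_def \<rho> \<rho>' mk_roof_def by simp
qed

lemma roof_class_eq:
  assumes "F \<in> MO" "G \<in> MO" "\<rho> \<in> roofs M S F G"
  shows "roof_class M S F G \<rho> = {\<rho>' \<in> roofs M S F G. graph_of_roof F G \<rho>' = graph_of_roof F G \<rho>}"
  unfolding roof_class_def Image_singleton roof_equiv_iff[OF assms(1,2)] using assms(3) by metis

section \<open>Arrows of the quotient and their composites\<close>

abbreviation D where "D \<equiv> serre_quotient M S"

definition roof_arr where "roof_arr F G H \<sigma> \<tau> = (F, roof_class M S F G (mk_roof F G H \<sigma> \<tau>), G)"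

lemma arr_D:
  assumes "F \<in> MO" "G \<in> MO"
  shows "m \<in> arr D F G \<longleftrightarrow> (\<exists>H \<sigma> \<tau>. isroof F G H \<sigma> \<tau> \<and> m = roof_arr F G H \<sigma> \<tau>)"
proof -
  have "m \<in> arr D F G \<longleftrightarrow> (\<exists>\<rho>. \<rho> \<in> roofs M S F G \<and> m = (F, roof_class M S F G \<rho>, G))"
    unfolding serre_quotient_def quotient_def roof_class_def by (simp del: split_paired_Ex) blast
  then show ?thesis unfolding in_roofs[OF assms] roof_arr_def by blast
qed

text \<open>\<open>fst (snd m)\<close> is the class of roofs inside the triple \<open>m\<close>. Its
  members have equal graphs, so for an arrow the union is the graph of any representative.\<close>

definition arr_graph where "arr_graph F G m = (\<Union>\<rho>\<in>fst (snd m). graph_of_roof F G \<rho>)"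

lemma arr_graph_class:
  assumes "F \<in> MO" "G \<in> MO" "\<rho> \<in> roofs M S F G"
  shows "arr_graph F G (F, roof_class M S F G \<rho>, G) = graph_of_roof F G \<rho>"
  unfolding arr_graph_def roof_class_eq[OF assms] fst_conv snd_conv using assms(3) by blast

lemma roof_class_mk_roof:
  assumes r: "isroof F G H \<sigma> \<tau>"
  shows "mk_roof F G H \<sigma> \<tau> \<in> roofs M S F G"
    "roof_class M S F G (mk_roof F G H \<sigma> \<tau>) = {\<rho> \<in> roofs M S F G. graph_of_roof F G \<rho> = roof_graph F G H \<sigma> \<tau>}"
proof -
  show *: "mk_roof F G H \<sigma> \<tau> \<in> roofs M S F G" unfolding in_roofs[OF isroofD(1,2)[OF r]] using r by blast
  show "roof_class M S F G (mk_roof F G H \<sigma> \<tau>) = {\<rho> \<in> roofs M S F G. graph_of_roof F G \<rho> = roof_graph F G H \<sigma> \<tau>}"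
    unfolding roof_class_eq[OF isroofD(1,2)[OF r] *] graph_of_roof_mk_roof ..
qed

lemma arr_graph_roof_arr:
  assumes r: "isroof F G H \<sigma> \<tau>"
  shows "arr_graph F G (roof_arr F G H \<sigma> \<tau>) = roof_graph F G H \<sigma> \<tau>"
proof -
  have "mk_roof F G H \<sigma> \<tau> \<in> roofs M S F G" unfolding in_roofs[OF isroofD(1,2)[OF r]] using r by blast
  then show ?thesis unfolding roof_arr_def using arr_graph_class[OF isroofD(1,2)[OF r]] by (simp add: graph_of_roof_mk_roof)
qed

lemma arr_DE:
  assumes "F \<in> MO" "G \<in> MO" "m \<in> arr D F G"
  obtains H \<sigma> \<tau> where "isroof F G H \<sigma> \<tau>" "m = roof_arr F G H \<sigma> \<tau>" "arr_graph F G m = roof_graph F G H \<sigma> \<tau>"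
proof -
  obtain H \<sigma> \<tau> where *: "isroof F G H \<sigma> \<tau>" "m = roof_arr F G H \<sigma> \<tau>"
    using iffD1[OF arr_D[OF assms(1,2)] assms(3)] by blast
  show thesis by (rule that[OF *]) (simp add: *(2) arr_graph_roof_arr[OF *(1)])
qed

lemma arr_D_roof_arr: "isroof F G H \<sigma> \<tau> \<Longrightarrow> roof_arr F G H \<sigma> \<tau> \<in> arr D F G"
  using arr_D[OF isroofD(1,2)] by blast

lemma D_local_graph:
  assumes "F \<in> MO" "G \<in> MO" "m \<in> arr D F G"
  shows "local_graph F G (arr_graph F G m)"
proof -
  obtain H \<sigma> \<tau> where "isroof F G H \<sigma> \<tau>" "arr_graph F G m = roof_graph F G H \<sigma> \<tau>" using arr_DE[OF assms] by metis
  then show ?thesis using local_graph_roof_graph by simp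
qed

text \<open>Classes are the fibres of \<open>graph_of_roof\<close>, and between local graphs an
  inclusion is an equality. Identities in the quotient are accordingly proved by one
  inclusion.\<close>

lemma D_eqI:
  assumes F: "F \<in> MO" and G: "G \<in> MO" and m: "m \<in> arr D F G" and m': "m' \<in> arr D F G"
    and sub: "arr_graph F G m \<subseteq> arr_graph F G m'"
  shows "m = m'"
proof -
  obtain H \<sigma> \<tau> where r: "isroof F G H \<sigma> \<tau>" "m = roof_arr F G H \<sigma> \<tau>" "arr_graph F G m = roof_graph F G H \<sigma> \<tau>"
    using arr_DE[OF F G m] .
  obtain H' \<sigma>' \<tau>' where r': "isroof F G H' \<sigma>' \<tau>'" "m' = roof_arr F G H' \<sigma>' \<tau>'" "arr_graph F G m' = roof_graph F G H' \<sigma>' \<tau>'"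
    using arr_DE[OF F G m'] .
  have "roof_graph F G H \<sigma> \<tau> = roof_graph F G H' \<sigma>' \<tau>'"
    using local_graph_eqI[OF mod_psh[OF F] mod_psh[OF G] local_graph_roof_graph[OF r(1)] local_graph_roof_graph[OF r'(1)]] sub r(3) r'(3) by simp
  then show ?thesis
    unfolding r(2) r'(2) roof_arr_def roof_class_mk_roof(2)[OF r(1)] roof_class_mk_roof(2)[OF r'(1)] by simp
qed

definition graph_comp where
  "graph_comp F K \<Gamma> \<Gamma>' = {(W, a, c). el F W a \<and> el K W c \<and>
     (\<exists>V e b. cov e V W \<and> (V, FAr F e a, b) \<in> \<Gamma> \<and> (V, b, FAr K e c) \<in> \<Gamma>')}"

definition graph_sum where
  "graph_sum F G \<Gamma> \<Gamma>' = {(W, a, d). el F W a \<and> el G W d \<and>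
     (\<exists>V e b c. cov e V W \<and> (V, FAr F e a, b) \<in> \<Gamma> \<and> (V, FAr F e a, c) \<in> \<Gamma>' \<and> FAr G e d = plus_at G V b c)}"

text \<open>Whichever square over \<open>L\<close> completes the two roofs, the graph of the result
  is the composite of their graphs. This is the independence of choices that composition in the
  quotient requires.\<close>

lemma comp_roof:
  assumes r: "isroof F G H \<sigma> \<tau>" and r': "isroof G K H' \<sigma>' \<tau>'"
    and L: "L \<in> MO" and l: "nt L H \<kappa>" "loc_inj L \<kappa>" "loc_surj L H \<kappa>" and m: "nt L H' \<mu>"
    and sq: "\<And>W x. el L W x \<Longrightarrow> \<tau> W (\<kappa> W x) = \<sigma>' W (\<mu> W x)"
  shows "isroof F K L (nat_mk L (\<lambda>W x. \<sigma> W (\<kappa> W x))) (nat_mk L (\<lambda>W x. \<tau>' W (\<mu> W x)))" (is ?A)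
    and "roof_graph F K L (nat_mk L (\<lambda>W x. \<sigma> W (\<kappa> W x))) (nat_mk L (\<lambda>W x. \<tau>' W (\<mu> W x))) =
      graph_comp F K (roof_graph F G H \<sigma> \<tau>) (roof_graph G K H' \<sigma>' \<tau>')" (is "?B = ?C")
proof -
  note D = isroofD[OF r] and D' = isroofD[OF r'] and pL = mod_psh[OF L]
  show ?A
    unfolding isroof_def
    using D(1) D'(2) L nt_comp[OF pL l(1) D(4)] nt_comp[OF pL m D'(5)]
      loc_inj_comp[OF l(1) D(4) pL D(10) l(2) D(6)] loc_surj_comp[OF l(1) D(4) pL D(10,8) l(3) D(7)] by simp
  show "?B = ?C"
  proof
    show "?B \<subseteq> ?C"
    proof (rule subsetI, clarify)
      fix W a c assume "(W, a, c) \<in> ?B"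
      then obtain e V x where *: "el F W a" "el K W c" "cov e V W" "el L V x"
        "\<sigma> V (\<kappa> V x) = FAr F e a" "\<tau>' V (\<mu> V x) = FAr K e c" by (auto elim!: roof_graphE simp: nat_mk_app)
      have "(V, FAr F e a, \<tau> V (\<kappa> V x)) \<in> roof_graph F G H \<sigma> \<tau>" using roof_graph_base[OF r nt_el[OF l(1) *(4)]] *(5) by simp
      moreover have "(V, \<tau> V (\<kappa> V x), FAr K e c) \<in> roof_graph G K H' \<sigma>' \<tau>'"
        using roof_graph_base[OF r' nt_el[OF m *(4)]] *(6) sq[OF *(4)] by simp
      ultimately show "(W, a, c) \<in> ?C" unfolding graph_comp_def using *(1-3) by blast
    qed
    show "?C \<subseteq> ?B"
    proof (rule subsetI, clarify)
      fix W a c assume "(W, a, c) \<in> ?C"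
      then obtain V e b where a: "el F W a" and c: "el K W c" and e: "cov e V W"
        and ab: "(V, FAr F e a, b) \<in> roof_graph F G H \<sigma> \<tau>" and bc: "(V, b, FAr K e c) \<in> roof_graph G K H' \<sigma>' \<tau>'"
        unfolding graph_comp_def by blast
      obtain e1 V1 h where 1: "el G V b" "cov e1 V1 V" "el H V1 h" "\<sigma> V1 h = FAr F e1 (FAr F e a)" "\<tau> V1 h = FAr G e1 b"
        using ab by (auto elim: roof_graphE)
      obtain e2 V2 h' where 2: "cov e2 V2 V" "el H' V2 h'" "\<sigma>' V2 h' = FAr G e2 b" "\<tau>' V2 h' = FAr K e2 (FAr K e c)"
        using bc by (auto elim: roof_graphE)
      obtain e3 V3 x where 3: "cov e3 V3 V1" "el L V3 x" "\<kappa> V3 x = FAr H e3 h" using loc_surjE[OF l(3) 1(3)] .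
      note e13 = cov_comp[OF 1(2) 3(1)]
      obtain f U f' where f: "cov f U V3" "ar f' U V2" "(e1 \<cdot> e3) \<cdot> f = e2 \<cdot> f'" "cov ((e1 \<cdot> e3) \<cdot> f) U V"
        by (rule cov_refineE[OF e13 2(1)])
      note f0 = cov_ar[OF f(1)]
      let ?y = "FAr L f x"
      let ?g = "(e1 \<cdot> e3) \<cdot> f"
      have y: "el L U ?y" using el_act[OF pL f0 3(2)] .
      have ly: "\<kappa> U ?y = FAr H f (FAr H e3 h)" using nt_nat[OF l(1) f0 3(2)] 3(3) by simp
      have tri: "FAr P f (FAr P e3 (FAr P e1 z)) = FAr P ?g z" if "psh P" "el P V z" for P :: "('o, 'm, 'm set) presheaf" and z
        using act_comp[OF that(1) f0 cov_ar[OF e13] that(2)] act_comp[OF that(1) cov_ar[OF 3(1)] cov_ar[OF 1(2)] that(2)] by simp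
      note he = el_act[OF D(10) cov_ar[OF 3(1)] 1(3)]
      have sy: "\<sigma> U (\<kappa> U ?y) = FAr F ?g (FAr F e a)"
        unfolding ly using nt_nat[OF D(4) f0 he] nt_nat[OF D(4) cov_ar[OF 3(1)] 1(3)] 1(4)
          tri[OF D(8) el_act[OF D(8) cov_ar[OF e] a]] by simp
      have ty: "\<tau> U (\<kappa> U ?y) = FAr G ?g b"
        unfolding ly using nt_nat[OF D(5) f0 he] nt_nat[OF D(5) cov_ar[OF 3(1)] 1(3)] 1(5) tri[OF D(9) 1(1)] by simp
      note h'f = el_act[OF D'(10) f(2) 2(2)]
      \<comment> \<open>The element of \<open>H'\<close> coming from the square and the witness for
        \<open>(b, c)\<close> have the same image in \<open>G\<close>. By local injectivity of
        \<open>\<sigma>'\<close> they agree locally, and so do their images in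
        \<open>K\<close>.\<close>
      have "\<sigma>' U (\<mu> U ?y) = \<sigma>' U (FAr H' f' h')"
        using sq[OF y] ty nt_nat[OF D'(4) f(2) 2(2)] 2(3) act_comp[OF D(9) f(2) cov_ar[OF 2(1)] 1(1)] f(3) by simp
      then have "loc_eq H' U (\<mu> U ?y) (FAr H' f' h')" by (rule loc_injD[OF D'(6) nt_el[OF m y] h'f])
      then have "loc_eq K U (\<tau>' U (\<mu> U ?y)) (\<tau>' U (FAr H' f' h'))" by (rule loc_eq_nt[OF D'(5,10) nt_el[OF m y] h'f])
      moreover have "\<tau>' U (FAr H' f' h') = FAr K ?g (FAr K e c)"
        using nt_nat[OF D'(5) f(2) 2(2)] 2(4) act_comp[OF D'(9) f(2) cov_ar[OF 2(1)] el_act[OF D'(9) cov_ar[OF e] c]] f(3) by simp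
      ultimately have lq: "loc_eq K U (\<tau>' U (\<mu> U ?y)) (FAr K ?g (FAr K e c))" by simp
      have A: "(U, FAr F ?g (FAr F e a), \<tau>' U (\<mu> U ?y)) \<in> ?B"
        using roof_graph_base[OF \<open>?A\<close> y] y sy by (simp add: nat_mk_app)
      note ce = el_act[OF D'(9) cov_ar[OF e] c] and ae = el_act[OF D(8) cov_ar[OF e] a]
      have "(U, FAr F ?g (FAr F e a), FAr K ?g (FAr K e c)) \<in> ?B"
        by (rule local_graph_loc_eq[OF D'(9) D(8) local_graph_roof_graph[OF \<open>?A\<close>] A lq el_act[OF D'(9) cov_ar[OF f(4)] ce]])
      then have "(V, FAr F e a, FAr K e c) \<in> ?B" by (rule local_graphD(4)[OF local_graph_roof_graph[OF \<open>?A\<close>] ae ce f(4)])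
      then show "(W, a, c) \<in> ?B" by (rule local_graphD(4)[OF local_graph_roof_graph[OF \<open>?A\<close>] a c e])
    qed
  qed
qed

text \<open>The Ore condition of the calculus of fractions: a pullback of a locally injective and
  locally surjective map is again such a map.\<close>

lemma square_exists:
  assumes r: "isroof F G H \<sigma> \<tau>" and H': "H' \<in> MO" "nt H' G \<sigma>'" "loc_inj H' \<sigma>'" "loc_surj H' G \<sigma>'"
  obtains L \<kappa> \<mu> where "L \<in> MO" "nt L H \<kappa>" "nt L H' \<mu>" "loc_inj L \<kappa>" "loc_surj L H \<kappa>"
    "\<And>W x. el L W x \<Longrightarrow> \<tau> W (\<kappa> W x) = \<sigma>' W (\<mu> W x)"
proof -
  note D = isroofD[OF r]
  obtain L \<kappa> \<mu> where L: "L \<in> MO" "nt L H \<kappa>" "nt L H' \<mu>"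
    "\<And>W x. el L W x \<Longrightarrow> \<tau> W (\<kappa> W x) = \<sigma>' W (\<mu> W x)"
    "\<And>W a b. el H W a \<Longrightarrow> el H' W b \<Longrightarrow> \<tau> W a = \<sigma>' W b \<Longrightarrow> \<exists>c. el L W c \<and> \<kappa> W c = a \<and> \<mu> W c = b"
    "\<And>W a b. el L W a \<Longrightarrow> el L W b \<Longrightarrow> \<kappa> W a = \<kappa> W b \<Longrightarrow> \<mu> W a = \<mu> W b \<Longrightarrow> a = b"
    by (rule pullbackE[OF mod_fp[OF D(3)] mod_fp[OF H'(1)] mod_fp[OF D(2)] D(5) H'(2)]) (rule that; assumption)
  note pL = mod_psh[OF L(1)]
  have "loc_inj L \<kappa>"
    unfolding loc_inj_def
  proof (intro allI impI)
    fix W x y assume x: "el L W x" and y: "el L W y" and e: "\<kappa> W x = \<kappa> W y"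
    then have "\<sigma>' W (\<mu> W x) = \<sigma>' W (\<mu> W y)" using L(4)[OF x] L(4)[OF y] by simp
    then obtain e' V where 1: "cov e' V W" "FAr H' e' (\<mu> W x) = FAr H' e' (\<mu> W y)"
      using loc_eqE[OF loc_injD[OF H'(3) nt_el[OF L(3) x] nt_el[OF L(3) y]]] by blast
    note e0 = cov_ar[OF 1(1)]
    have "FAr L e' x = FAr L e' y"
      by (rule L(6)[OF el_act[OF pL e0 x] el_act[OF pL e0 y]])
         (simp_all add: nt_nat[OF L(2) e0 x] nt_nat[OF L(2) e0 y] nt_nat[OF L(3) e0 x] nt_nat[OF L(3) e0 y] e 1(2))
    then show "loc_eq L W x y" by (rule loc_eqI[OF 1(1)])
  qed
  moreover have "loc_surj L H \<kappa>"
    unfolding loc_surj_def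
  proof (intro allI impI)
    fix W h assume h: "el H W h"
    obtain e V h' where e: "cov e V W" "el H' V h'" "\<sigma>' V h' = FAr G e (\<tau> W h)"
      using loc_surjE[OF H'(4) nt_el[OF D(5) h]] .
    have "\<exists>c. el L V c \<and> \<kappa> V c = FAr H e h \<and> \<mu> V c = h'"
      by (rule L(5)[OF el_act[OF D(10) cov_ar[OF e(1)] h] e(2)]) (simp add: nt_nat[OF D(5) cov_ar[OF e(1)] h] e(3))
    then show "\<exists>V e a. cov e V W \<and> el L V a \<and> \<kappa> V a = FAr H e h" using e(1) by blast
  qed
  ultimately show thesis by (rule that[OF L(1-3) _ _ L(4)])
qed

lemma D_comp:
  assumes F: "F \<in> MO" and G: "G \<in> MO" and K: "K \<in> MO" and m: "m \<in> arr D F G" and m': "m' \<in> arr D G K"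
  shows "m' \<cdot>\<^bsub>D\<^esub> m \<in> arr D F K" and "arr_graph F K (m' \<cdot>\<^bsub>D\<^esub> m) = graph_comp F K (arr_graph F G m) (arr_graph G K m')"
proof -
  obtain H \<sigma> \<tau> where r: "isroof F G H \<sigma> \<tau>" "m = roof_arr F G H \<sigma> \<tau>" "arr_graph F G m = roof_graph F G H \<sigma> \<tau>"
    using arr_DE[OF F G m] .
  obtain H' \<sigma>' \<tau>' where r': "isroof G K H' \<sigma>' \<tau>'" "m' = roof_arr G K H' \<sigma>' \<tau>'" "arr_graph G K m' = roof_graph G K H' \<sigma>' \<tau>'"
    using arr_DE[OF G K m'] .
  let ?\<phi> = "roof_class M S F G (mk_roof F G H \<sigma> \<tau>)" and ?\<psi> = "roof_class M S G K (mk_roof G K H' \<sigma>' \<tau>')"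
  let ?X = "{roof_class M S F K (L, s \<cdot>\<^bsub>M\<^esub> t', g \<cdot>\<^bsub>M\<^esub> f') | H s f K' t g L t' f'.
             (H, s, f) \<in> ?\<phi> \<and> (K', t, g) \<in> ?\<psi> \<and> L \<in> Obj M \<and>
             serre_iso M S L H t' \<and> f' \<in> arr M L K' \<and> f \<cdot>\<^bsub>M\<^esub> t' = t \<cdot>\<^bsub>M\<^esub> f'}"
  define \<Gamma> where "\<Gamma> = graph_comp F K (arr_graph F G m) (arr_graph G K m')"
  define Cl where "Cl = {\<rho> \<in> roofs M S F K. graph_of_roof F K \<rho> = \<Gamma>}"
  have eq: "m' \<cdot>\<^bsub>D\<^esub> m = (F, \<Union>?X, K)"
    by (simp add: r(2) r'(2) roof_arr_def serre_quotient_def)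
  have phi: "?\<phi> = {\<rho> \<in> roofs M S F G. graph_of_roof F G \<rho> = arr_graph F G m}"
    unfolding roof_class_mk_roof(2)[OF r(1)] r(3) ..
  have psi: "?\<psi> = {\<rho> \<in> roofs M S G K. graph_of_roof G K \<rho> = arr_graph G K m'}"
    unfolding roof_class_mk_roof(2)[OF r'(1)] r'(3) ..
  \<comment> \<open>Every choice of representatives and of a square contributes the same class
    \<open>Cl\<close>, the roofs with graph \<open>\<Gamma>\<close>.\<close>
  have cls: "roof_class M S F K (L, s \<cdot>\<^bsub>M\<^esub> t', g \<cdot>\<^bsub>M\<^esub> f') = Cl \<and> (L, s \<cdot>\<^bsub>M\<^esub> t', g \<cdot>\<^bsub>M\<^esub> f') \<in> Cl"
    if in1: "(H, s, f) \<in> ?\<phi>" and in2: "(K', t, g) \<in> ?\<psi>" and inL: "L \<in> Obj M" and siL: "serre_iso M S L H t'" and inf: "f' \<in> arr M L K'"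
      and sqr: "f \<cdot>\<^bsub>M\<^esub> t' = t \<cdot>\<^bsub>M\<^esub> f'" for H s f K' t g L t' f'
  proof -
    obtain s0 f0 where s: "s = (H, s0, F)" "f = (H, f0, G)" "isroof F G H s0 f0" "roof_graph F G H s0 f0 = arr_graph F G m"
    proof -
      have *: "(H, s, f) \<in> roofs M S F G" "graph_of_roof F G (H, s, f) = arr_graph F G m"
        using in1 unfolding phi by simp_all
      obtain H0 a b where "(H, s, f) = mk_roof F G H0 a b" "isroof F G H0 a b"
        using *(1) unfolding in_roofs[OF F G] by blast
      then show thesis using *(2) that[of a b] by (simp add: mk_roof_def graph_of_roof_def)
    qed
    obtain t0 g0 where t: "t = (K', t0, G)" "g = (K', g0, K)" "isroof G K K' t0 g0" "roof_graph G K K' t0 g0 = arr_graph G K m'"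
    proof -
      have *: "(K', t, g) \<in> roofs M S G K" "graph_of_roof G K (K', t, g) = arr_graph G K m'"
        using in2 unfolding psi by simp_all
      obtain H0 a b where "(K', t, g) = mk_roof G K H0 a b" "isroof G K H0 a b"
        using *(1) unfolding in_roofs[OF G K] by blast
      then show thesis using *(2) that[of a b] by (simp add: mk_roof_def graph_of_roof_def)
    qed
    have L: "L \<in> MO" using inL by (simp add: M_simps)
    obtain l where l: "t' = (L, l, H)" "nt L H l" "loc_inj L l" "loc_surj L H l" using siL unfolding serre_iso_iff by blast
    obtain k where k: "f' = (L, k, K')" "nt L K' k" using inf by (auto simp: M_simps)
    have sq: "f0 W (l W x) = t0 W (k W x)" if x: "el L W x" for W x
      using sqr x unfolding s t l k by (simp add: M_simps(5) nat_mk_comp_eq_iff nat_mk_app)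
    note cr = comp_roof[OF s(3) t(3) L l(2-4) k(2) sq]
    have rr: "(L, s \<cdot>\<^bsub>M\<^esub> t', g \<cdot>\<^bsub>M\<^esub> f') = mk_roof F K L (nat_mk L (\<lambda>W x. s0 W (l W x))) (nat_mk L (\<lambda>W x. g0 W (k W x)))"
      by (simp add: s t l k M_simps(5) mk_roof_def)
    have "graph_of_roof F K (L, s \<cdot>\<^bsub>M\<^esub> t', g \<cdot>\<^bsub>M\<^esub> f') = \<Gamma>"
      unfolding rr graph_of_roof_mk_roof \<Gamma>_def s(4)[symmetric] t(4)[symmetric] by (rule cr(2))
    moreover have "(L, s \<cdot>\<^bsub>M\<^esub> t', g \<cdot>\<^bsub>M\<^esub> f') \<in> roofs M S F K"
      unfolding in_roofs[OF F K] using rr cr(1) by blast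
    ultimately show ?thesis using roof_class_eq[OF F K] by (simp add: Cl_def)
  qed
  note D = isroofD[OF r(1)] and D' = isroofD[OF r'(1)]
  \<comment> \<open>One admissible choice exists, so the union runs over a nonempty family and
    equals \<open>Cl\<close>.\<close>
  obtain L \<kappa> \<mu> where L: "L \<in> MO" "nt L H \<kappa>" "nt L H' \<mu>" "loc_inj L \<kappa>" "loc_surj L H \<kappa>"
    "\<And>W x. el L W x \<Longrightarrow> \<tau> W (\<kappa> W x) = \<sigma>' W (\<mu> W x)"
    by (rule square_exists[OF r(1) D'(3,4,6,7)]) (rule that; assumption)
  have mem: "(H, (H, \<sigma>, F), (H, \<tau>, G)) \<in> ?\<phi>" "(H', (H', \<sigma>', G), (H', \<tau>', K)) \<in> ?\<psi>"
    unfolding mk_roof_def[symmetric] using roof_class_mk_roof[OF r(1)] roof_class_mk_roof[OF r'(1)] by (simp_all add: graph_of_roof_mk_roof)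
  have side: "L \<in> Obj M" "serre_iso M S L H (L, \<kappa>, H)" "(L, \<mu>, H') \<in> arr M L H'"
    "(H, \<tau>, G) \<cdot>\<^bsub>M\<^esub> (L, \<kappa>, H) = (H', \<sigma>', G) \<cdot>\<^bsub>M\<^esub> (L, \<mu>, H')"
    using L D(3) by (auto simp: M_simps(1,2,5) serre_iso_iff nat_mk_comp_eq_iff)
  note c0 = cls[OF mem side]
  have ne: "Cl \<in> ?X" using mem side c0 by blast
  have "?X = {Cl}" using ne cls by blast
  then have U: "\<Union>?X = Cl" by simp
  obtain \<rho> where \<rho>: "\<rho> \<in> Cl" "roof_class M S F K \<rho> = Cl" using c0 by blast
  then have \<rho>r: "\<rho> \<in> roofs M S F K" "graph_of_roof F K \<rho> = \<Gamma>" by (auto simp: Cl_def)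
  obtain L l k where lk: "\<rho> = mk_roof F K L l k" "isroof F K L l k" using \<rho>r(1) in_roofs[OF F K] by blast
  have res: "m' \<cdot>\<^bsub>D\<^esub> m = roof_arr F K L l k" unfolding eq U \<rho>(2)[symmetric] lk(1) roof_arr_def ..
  show "m' \<cdot>\<^bsub>D\<^esub> m \<in> arr D F K" unfolding res by (rule arr_D_roof_arr[OF lk(2)])
  show "arr_graph F K (m' \<cdot>\<^bsub>D\<^esub> m) = graph_comp F K (arr_graph F G m) (arr_graph G K m')"
    unfolding res arr_graph_roof_arr[OF lk(2)] using \<rho>r(2) lk(1) by (simp add: graph_of_roof_mk_roof \<Gamma>_def)
qed

end

section \<open>The Serre quotient as a bilinear category\<close>

text \<open>These are the axioms of a preadditive category except that the hom-sets need not be known to be groups.\<close>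

locale lincat =
  fixes D :: "('p, 'n, 'y) acat_scheme" (structure)
  assumes l_dom: "F \<in> Obj D \<Longrightarrow> G \<in> Obj D \<Longrightarrow> m \<in> arr D F G \<Longrightarrow> Dom D m = F \<and> Cod D m = G"
    and l_id: "F \<in> Obj D \<Longrightarrow> Ident D F \<in> arr D F F"
    and l_comp: "F \<in> Obj D \<Longrightarrow> G \<in> Obj D \<Longrightarrow> H \<in> Obj D \<Longrightarrow> m \<in> arr D F G \<Longrightarrow> n \<in> arr D G H \<Longrightarrow> n \<cdot> m \<in> arr D F H"
    and l_add: "F \<in> Obj D \<Longrightarrow> G \<in> Obj D \<Longrightarrow> m \<in> arr D F G \<Longrightarrow> n \<in> arr D F G \<Longrightarrow> m \<otimes>\<^bsub>Hom D F G\<^esub> n \<in> arr D F G"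
    and l_idr: "F \<in> Obj D \<Longrightarrow> G \<in> Obj D \<Longrightarrow> m \<in> arr D F G \<Longrightarrow> m \<cdot> Ident D F = m"
    and l_idl: "F \<in> Obj D \<Longrightarrow> G \<in> Obj D \<Longrightarrow> m \<in> arr D F G \<Longrightarrow> Ident D G \<cdot> m = m"
    and l_assoc: "F \<in> Obj D \<Longrightarrow> G \<in> Obj D \<Longrightarrow> H \<in> Obj D \<Longrightarrow> K \<in> Obj D \<Longrightarrow>
      m \<in> arr D F G \<Longrightarrow> n \<in> arr D G H \<Longrightarrow> l \<in> arr D H K \<Longrightarrow> (l \<cdot> n) \<cdot> m = l \<cdot> (n \<cdot> m)"
    and l_addr: "F \<in> Obj D \<Longrightarrow> G \<in> Obj D \<Longrightarrow> H \<in> Obj D \<Longrightarrow>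
      m \<in> arr D F G \<Longrightarrow> m' \<in> arr D F G \<Longrightarrow> n \<in> arr D G H \<Longrightarrow>
      n \<cdot> (m \<otimes>\<^bsub>Hom D F G\<^esub> m') = (n \<cdot> m) \<otimes>\<^bsub>Hom D F H\<^esub> (n \<cdot> m')"
    and l_addl: "F \<in> Obj D \<Longrightarrow> G \<in> Obj D \<Longrightarrow> H \<in> Obj D \<Longrightarrow>
      m \<in> arr D F G \<Longrightarrow> n \<in> arr D G H \<Longrightarrow> n' \<in> arr D G H \<Longrightarrow>
      (n \<otimes>\<^bsub>Hom D G H\<^esub> n') \<cdot> m = (n \<cdot> m) \<otimes>\<^bsub>Hom D F H\<^esub> (n' \<cdot> m)"

context loc_cat
begin

section \<open>The quotient functor and the laws of a category\<close>

abbreviation id_map where "id_map F \<equiv> nat_mk F (\<lambda>W a. a)"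

definition quot_map where "quot_map F G \<sigma> = roof_arr F G F (id_map F) \<sigma>"

lemma isroof_id:
  assumes "F \<in> MO" "G \<in> MO" "nt F G \<sigma>"
  shows "isroof F G F (id_map F) \<sigma>"
proof -
  have "loc_inj F (id_map F)" unfolding loc_inj_def by (simp add: nat_mk_app loc_eq_refl elD(1))
  moreover have "loc_surj F F (id_map F)"
    unfolding loc_surj_def
  proof (intro allI impI)
    fix W b assume b: "el F W b"
    then show "\<exists>V e a. cov e V W \<and> el F V a \<and> id_map F V a = FAr F e b"
      using cov_id[OF elD(1)[OF b]] act_id[OF mod_psh[OF assms(1)] b]
      by (intro exI[of _ W] exI[of _ "Ident C W"] exI[of _ b]) (simp add: nat_mk_app)
  qed
  ultimately show ?thesis using assms nt_id[OF mod_psh[OF assms(1)]] by (simp add: isroof_def)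
qed

definition quot_arr where "quot_arr m F G \<longleftrightarrow> F \<in> MO \<and> G \<in> MO \<and> m \<in> arr D F G"

lemma quot_arrD: "quot_arr m F G \<Longrightarrow> F \<in> MO" "quot_arr m F G \<Longrightarrow> G \<in> MO" "quot_arr m F G \<Longrightarrow> m \<in> arr D F G"
  by (auto simp: quot_arr_def)

lemma quot_arrE:
  assumes "quot_arr m F G"
  obtains H \<sigma> \<tau> where "isroof F G H \<sigma> \<tau>" "m = roof_arr F G H \<sigma> \<tau>" "arr_graph F G m = roof_graph F G H \<sigma> \<tau>"
  using arr_DE[OF quot_arrD[OF assms]] .

lemma quot_arr_roof_arr: "isroof F G H \<sigma> \<tau> \<Longrightarrow> quot_arr (roof_arr F G H \<sigma> \<tau>) F G"
  by (simp add: quot_arr_def isroofD(1,2) arr_D_roof_arr)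

lemma quot_arr_local_graph: "quot_arr m F G \<Longrightarrow> local_graph F G (arr_graph F G m)"
  by (simp add: quot_arr_def D_local_graph)

lemma quot_arr_eqI:
  assumes "quot_arr m F G" "quot_arr m' F G" "\<And>W a b. (W, a, b) \<in> arr_graph F G m \<Longrightarrow> (W, a, b) \<in> arr_graph F G m'"
  shows "m = m'"
  by (rule D_eqI[OF quot_arrD[OF assms(1)] quot_arrD(3)[OF assms(2)]]) (use assms(3) in auto)

lemma quot_arr_comp: "quot_arr m F G \<Longrightarrow> quot_arr m' G K \<Longrightarrow> quot_arr (m' \<cdot>\<^bsub>D\<^esub> m) F K"
  using D_comp(1)[of F G K m m'] by (simp add: quot_arr_def)

lemma arr_graph_comp: "quot_arr m F G \<Longrightarrow> quot_arr m' G K \<Longrightarrow> arr_graph F K (m' \<cdot>\<^bsub>D\<^esub> m) = graph_comp F K (arr_graph F G m) (arr_graph G K m')"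
  using D_comp(2)[of F G K m m'] by (simp add: quot_arr_def)

lemma arr_graph_compI:
  assumes "quot_arr m F G" "quot_arr m' G K" "(W, a, b) \<in> arr_graph F G m" "(W, b, c) \<in> arr_graph G K m'"
  shows "(W, a, c) \<in> arr_graph F K (m' \<cdot>\<^bsub>D\<^esub> m)"
proof -
  note a = local_graphD(1)[OF quot_arr_local_graph[OF assms(1)] assms(3)] and c = local_graphD(2)[OF quot_arr_local_graph[OF assms(2)] assms(4)]
  have "FAr F (Ident C W) a = a" "FAr K (Ident C W) c = c"
    using act_id[OF mod_psh a] act_id[OF mod_psh c] quot_arrD(1)[OF assms(1)] quot_arrD(2)[OF assms(2)] by simp_all
  then show ?thesis
    unfolding arr_graph_comp[OF assms(1,2)] graph_comp_def mem_Collect_eq prod.case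
    by (intro conjI a c exI[of _ W] exI[of _ "Ident C W"] exI[of _ b] cov_id[OF elD(1)[OF a]])
       (simp_all add: assms(3,4))
qed

lemma arr_graph_compE:
  assumes "quot_arr m F G" "quot_arr m' G K" "(W, a, c) \<in> arr_graph F K (m' \<cdot>\<^bsub>D\<^esub> m)"
  obtains e V b where "el F W a" "el K W c" "cov e V W" "(V, FAr F e a, b) \<in> arr_graph F G m" "(V, b, FAr K e c) \<in> arr_graph G K m'"
  using assms(3) unfolding arr_graph_comp[OF assms(1,2)] graph_comp_def by blast

lemma arr_graph_local:
  assumes "quot_arr m F G" "el F W a" "el G W b" "cov e V W" "(V, FAr F e a, FAr G e b) \<in> arr_graph F G m"
  shows "(W, a, b) \<in> arr_graph F G m"
  by (rule local_graphD(4)[OF quot_arr_local_graph[OF assms(1)] assms(2-5)])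

lemma arr_graph_act:
  assumes "quot_arr m F G" "(W, a, b) \<in> arr_graph F G m" "ar h V W"
  shows "(V, FAr F h a, FAr G h b) \<in> arr_graph F G m"
  by (rule local_graphD(3)[OF quot_arr_local_graph[OF assms(1)] assms(2,3)])

lemma arr_graph_loc_eq:
  assumes "quot_arr m F G" "(W, a, b) \<in> arr_graph F G m" "loc_eq G W b b'" "el G W b'"
  shows "(W, a, b') \<in> arr_graph F G m"
  by (rule local_graph_loc_eq[OF mod_psh mod_psh quot_arr_local_graph[OF assms(1)] assms(2-4)]) (rule quot_arrD[OF assms(1)])+

lemma arr_graph_el:
  assumes "quot_arr m F G" "(W, a, b) \<in> arr_graph F G m"
  shows "el F W a" "el G W b"
  using local_graphD(1,2)[OF quot_arr_local_graph[OF assms(1)] assms(2)] by simp_all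

lemma quot_arr_quot_map: "F \<in> MO \<Longrightarrow> G \<in> MO \<Longrightarrow> nt F G \<sigma> \<Longrightarrow> quot_arr (quot_map F G \<sigma>) F G"
  unfolding quot_map_def by (rule quot_arr_roof_arr[OF isroof_id])

lemma arr_graph_quot_map:
  assumes F: "F \<in> MO" and G: "G \<in> MO" and s: "nt F G \<sigma>"
  shows "(W, a, b) \<in> arr_graph F G (quot_map F G \<sigma>) \<longleftrightarrow> el F W a \<and> el G W b \<and> loc_eq G W (\<sigma> W a) b"
proof -
  note r = isroof_id[OF assms]
  have "(W, a, b) \<in> roof_graph F G F (id_map F) \<sigma> \<longleftrightarrow> el F W a \<and> el G W b \<and> loc_eq G W (\<sigma> W a) b"
  proof
    assume "(W, a, b) \<in> roof_graph F G F (id_map F) \<sigma>"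
    then obtain e V h where *: "el F W a" "el G W b" "cov e V W" "el F V h" "id_map F V h = FAr F e a" "\<sigma> V h = FAr G e b"
      by (rule roof_graphE)
    have "FAr G e (\<sigma> W a) = FAr G e b" using * nt_nat[OF s cov_ar[OF *(3)] *(1)] by (simp add: nat_mk_app)
    then show "el F W a \<and> el G W b \<and> loc_eq G W (\<sigma> W a) b" by (intro conjI *(1,2) loc_eqI[OF *(3)])
  next
    assume *: "el F W a \<and> el G W b \<and> loc_eq G W (\<sigma> W a) b"
    obtain e V where e: "cov e V W" "FAr G e (\<sigma> W a) = FAr G e b" using loc_eqE[OF *[THEN conjunct2, THEN conjunct2]] .
    have a: "el F W a" and b: "el G W b" using * by simp_all
    note ea = el_act[OF mod_psh[OF F] cov_ar[OF e(1)] a]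
    show "(W, a, b) \<in> roof_graph F G F (id_map F) \<sigma>"
      by (rule roof_graphI[OF a b e(1) ea]) (simp_all add: nat_mk_app[OF ea] nt_nat[OF s cov_ar[OF e(1)] a] e(2))
  qed
  then show ?thesis unfolding quot_map_def arr_graph_roof_arr[OF r] .
qed

lemma arr_graph_quot_map_self: "F \<in> MO \<Longrightarrow> G \<in> MO \<Longrightarrow> nt F G \<sigma> \<Longrightarrow> el F W a \<Longrightarrow> (W, a, \<sigma> W a) \<in> arr_graph F G (quot_map F G \<sigma>)"
  unfolding arr_graph_quot_map by (simp add: nt_el loc_eq_refl elD(1))

lemma D_simps:
  "Obj D = MO" "Ident D F = quot_map F F (id_map F)" "zero_arr D F G = quot_map F G (nat_mk F (\<lambda>W a. zero_at G W))"
  by (simp_all add: serre_quotient_def quot_map_def roof_arr_def mk_roof_def M_simps)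

lemma D_dom: "m \<in> arr D F G \<Longrightarrow> Dom D m = F \<and> Cod D m = G"
  by (auto simp: serre_quotient_def)

lemma Q_functor: "FAr (serre_quotient_functor M S) (F, \<sigma>, G) = quot_map F G \<sigma>" "FOb (serre_quotient_functor M S) F = F"
  by (simp_all add: serre_quotient_functor_def quot_map_def roof_arr_def mk_roof_def M_simps)

lemma quot_map_eq_iff:
  assumes "F \<in> MO" "G \<in> MO" "nt F G \<sigma>" "nt F G \<tau>"
  shows "quot_map F G \<sigma> = quot_map F G \<tau> \<longleftrightarrow> (\<forall>W a. el F W a \<longrightarrow> loc_eq G W (\<sigma> W a) (\<tau> W a))"
proof
  assume e: "quot_map F G \<sigma> = quot_map F G \<tau>"
  show "\<forall>W a. el F W a \<longrightarrow> loc_eq G W (\<sigma> W a) (\<tau> W a)"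
  proof (intro allI impI)
    fix W a assume a: "el F W a"
    have "(W, a, \<tau> W a) \<in> arr_graph F G (quot_map F G \<sigma>)" unfolding e by (rule arr_graph_quot_map_self[OF assms(1,2,4) a])
    then show "loc_eq G W (\<sigma> W a) (\<tau> W a)" using arr_graph_quot_map[OF assms(1-3)] by simp
  qed
next
  assume *: "\<forall>W a. el F W a \<longrightarrow> loc_eq G W (\<sigma> W a) (\<tau> W a)"
  show "quot_map F G \<sigma> = quot_map F G \<tau>"
  proof (rule quot_arr_eqI[OF quot_arr_quot_map[OF assms(1-3)] quot_arr_quot_map[OF assms(1,2,4)]])
    fix W a b assume "(W, a, b) \<in> arr_graph F G (quot_map F G \<sigma>)"
    then have a: "el F W a" and b: "el G W b" and l: "loc_eq G W (\<sigma> W a) b" using arr_graph_quot_map[OF assms(1-3)] by simp_all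
    have l': "loc_eq G W (\<sigma> W a) (\<tau> W a)" using * a by blast
    have "loc_eq G W (\<tau> W a) b"
      by (rule loc_eq_trans[OF mod_psh[OF assms(2)] nt_el[OF assms(4) a] nt_el[OF assms(3) a] b loc_eq_sym[OF l'] l])
    then show "(W, a, b) \<in> arr_graph F G (quot_map F G \<tau>)" using arr_graph_quot_map[OF assms(1,2,4)] a b by simp
  qed
qed

lemma D_idr:
  assumes m: "quot_arr m F G"
  shows "m \<cdot>\<^bsub>D\<^esub> quot_map F F (id_map F) = m"
proof (rule sym, rule quot_arr_eqI[OF m])
  note F = quot_arrD(1)[OF m]
  note i = nt_id[OF mod_psh[OF F]]
  note q = quot_arr_quot_map[OF F F i]
  show "quot_arr (m \<cdot>\<^bsub>D\<^esub> quot_map F F (id_map F)) F G" by (rule quot_arr_comp[OF q m])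
  fix W a b assume ab: "(W, a, b) \<in> arr_graph F G m"
  note a = arr_graph_el(1)[OF m ab]
  have "(W, a, a) \<in> arr_graph F F (quot_map F F (id_map F))" using arr_graph_quot_map_self[OF F F i a] a by (simp add: nat_mk_app)
  then show "(W, a, b) \<in> arr_graph F G (m \<cdot>\<^bsub>D\<^esub> quot_map F F (id_map F))" using ab by (rule arr_graph_compI[OF q m])
qed

lemma D_idl:
  assumes m: "quot_arr m F G"
  shows "quot_map G G (id_map G) \<cdot>\<^bsub>D\<^esub> m = m"
proof (rule sym, rule quot_arr_eqI[OF m])
  note G = quot_arrD(2)[OF m]
  note i = nt_id[OF mod_psh[OF G]]
  note q = quot_arr_quot_map[OF G G i]
  show "quot_arr (quot_map G G (id_map G) \<cdot>\<^bsub>D\<^esub> m) F G" by (rule quot_arr_comp[OF m q])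
  fix W a b assume ab: "(W, a, b) \<in> arr_graph F G m"
  note b = arr_graph_el(2)[OF m ab]
  have "(W, b, b) \<in> arr_graph G G (quot_map G G (id_map G))" using arr_graph_quot_map_self[OF G G i b] b by (simp add: nat_mk_app)
  then show "(W, a, b) \<in> arr_graph F G (quot_map G G (id_map G) \<cdot>\<^bsub>D\<^esub> m)" by (rule arr_graph_compI[OF m q ab])
qed

lemma D_assoc:
  assumes m: "quot_arr m F G" and n: "quot_arr n G H" and l: "quot_arr l H K"
  shows "(l \<cdot>\<^bsub>D\<^esub> n) \<cdot>\<^bsub>D\<^esub> m = l \<cdot>\<^bsub>D\<^esub> (n \<cdot>\<^bsub>D\<^esub> m)"
proof (rule quot_arr_eqI)
  note ln = quot_arr_comp[OF n l] and nm = quot_arr_comp[OF m n]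
  show L: "quot_arr ((l \<cdot>\<^bsub>D\<^esub> n) \<cdot>\<^bsub>D\<^esub> m) F K" by (rule quot_arr_comp[OF m ln])
  show R: "quot_arr (l \<cdot>\<^bsub>D\<^esub> (n \<cdot>\<^bsub>D\<^esub> m)) F K" by (rule quot_arr_comp[OF nm l])
  note pF = mod_psh[OF quot_arrD(1)[OF m]] and pK = mod_psh[OF quot_arrD(2)[OF l]]
  fix W a d assume "(W, a, d) \<in> arr_graph F K ((l \<cdot>\<^bsub>D\<^esub> n) \<cdot>\<^bsub>D\<^esub> m)"
  then obtain e V b where a: "el F W a" and d: "el K W d" and e: "cov e V W" and ab: "(V, FAr F e a, b) \<in> arr_graph F G m"
    and bd: "(V, b, FAr K e d) \<in> arr_graph G K (l \<cdot>\<^bsub>D\<^esub> n)" by (rule arr_graph_compE[OF m ln])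
  obtain e' V' c where e': "cov e' V' V" and bc: "(V', FAr G e' b, c) \<in> arr_graph G H n"
    and cd: "(V', c, FAr K e' (FAr K e d)) \<in> arr_graph H K l" using arr_graph_compE[OF n l bd] by metis
  have "(V', FAr F e' (FAr F e a), c) \<in> arr_graph F H (n \<cdot>\<^bsub>D\<^esub> m)"
    by (rule arr_graph_compI[OF m n arr_graph_act[OF m ab cov_ar[OF e']] bc])
  then have "(V', FAr F e' (FAr F e a), FAr K e' (FAr K e d)) \<in> arr_graph F K (l \<cdot>\<^bsub>D\<^esub> (n \<cdot>\<^bsub>D\<^esub> m))"
    by (rule arr_graph_compI[OF nm l _ cd])
  then have "(V', FAr F (e \<cdot> e') a, FAr K (e \<cdot> e') d) \<in> arr_graph F K (l \<cdot>\<^bsub>D\<^esub> (n \<cdot>\<^bsub>D\<^esub> m))"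
    using act_comp[OF pF cov_ar[OF e'] cov_ar[OF e] a] act_comp[OF pK cov_ar[OF e'] cov_ar[OF e] d] by simp
  then show "(W, a, d) \<in> arr_graph F K (l \<cdot>\<^bsub>D\<^esub> (n \<cdot>\<^bsub>D\<^esub> m))"
    by (rule arr_graph_local[OF R a d cov_comp[OF e e']])
qed

section \<open>Sums of arrows in the quotient\<close>

lemma sum_roof:
  assumes r: "isroof F G H \<sigma> \<tau>" and r': "isroof F G H \<sigma> \<tau>'"
  shows "isroof F G H \<sigma> (nat_mk H (\<lambda>W h. plus_at G W (\<tau> W h) (\<tau>' W h)))" (is ?A)
    and "roof_graph F G H \<sigma> (nat_mk H (\<lambda>W h. plus_at G W (\<tau> W h) (\<tau>' W h))) =
      graph_sum F G (roof_graph F G H \<sigma> \<tau>) (roof_graph F G H \<sigma> \<tau>')" (is "?B = ?C")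
proof -
  note D = isroofD[OF r] and t' = isroofD(5)[OF r']
  show A: ?A unfolding isroof_def using D nt_add[OF D(10,9,5) t'] by simp
  show "?B = ?C"
  proof
    show "?B \<subseteq> ?C"
    proof (rule subsetI, clarify)
      fix W a d assume "(W, a, d) \<in> ?B"
      then obtain e V h where *: "el F W a" "el G W d" "cov e V W" "el H V h" "\<sigma> V h = FAr F e a"
        "plus_at G V (\<tau> V h) (\<tau>' V h) = FAr G e d" by (auto elim!: roof_graphE simp: nat_mk_app)
      have "(V, FAr F e a, \<tau> V h) \<in> roof_graph F G H \<sigma> \<tau>" "(V, FAr F e a, \<tau>' V h) \<in> roof_graph F G H \<sigma> \<tau>'"
        using roof_graph_base[OF r *(4)] roof_graph_base[OF r' *(4)] *(5) by simp_all
      then show "(W, a, d) \<in> ?C" unfolding graph_sum_def using *(1-3) *(6)[symmetric] by blast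
    qed
    show "?C \<subseteq> ?B"
    proof (rule subsetI, clarify)
      fix W a d assume "(W, a, d) \<in> ?C"
      then obtain V e b c where a: "el F W a" and d: "el G W d" and e: "cov e V W"
        and ab: "(V, FAr F e a, b) \<in> roof_graph F G H \<sigma> \<tau>" and ac: "(V, FAr F e a, c) \<in> roof_graph F G H \<sigma> \<tau>'"
        and bc: "FAr G e d = plus_at G V b c" unfolding graph_sum_def by blast
      note L' = local_graph_roof_graph[OF r'] and LB = local_graph_roof_graph[OF A]
      obtain f U h where b: "el G V b" and f: "cov f U V" and h: "el H U h" and sh: "\<sigma> U h = FAr F f (FAr F e a)"
        and th: "\<tau> U h = FAr G f b" using ab by (auto elim: roof_graphE)
      note c = local_graphD(2)[OF L' ac]
      have base: "(U, FAr F f (FAr F e a), plus_at G U (\<tau> U h) (\<tau>' U h)) \<in> ?B"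
        using roof_graph_base[OF A h] h sh by (simp add: nat_mk_app)
      have "loc_eq G U (\<tau>' U h) (FAr G f c)"
        by (rule local_graphD(5)[OF L' _ local_graphD(3)[OF L' ac cov_ar[OF f]]]) (use roof_graph_base[OF r' h] sh in simp)
      then have lq: "loc_eq G U (plus_at G U (\<tau> U h) (\<tau>' U h)) (plus_at G U (FAr G f b) (FAr G f c))"
        unfolding th
        by (intro loc_eq_plus[OF D(9) _ _ nt_el[OF t' h]] loc_eq_refl elD(1)[OF h] el_act[OF D(9) cov_ar[OF f]] b c)
      have eqd: "plus_at G U (FAr G f b) (FAr G f c) = FAr G f (FAr G e d)"
        using act_plus[OF D(9) cov_ar[OF f] b c] bc by simp
      have fd: "el G V (FAr G e d)" using el_act[OF D(9) cov_ar[OF e] d] .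
      have "(U, FAr F f (FAr F e a), FAr G f (FAr G e d)) \<in> ?B"
        by (rule local_graph_loc_eq[OF D(9,8) LB base lq[unfolded eqd] el_act[OF D(9) cov_ar[OF f] fd]])
      then have "(V, FAr F e a, FAr G e d) \<in> ?B"
        by (rule local_graphD(4)[OF LB el_act[OF D(8) cov_ar[OF e] a] fd f])
      then show "(W, a, d) \<in> ?B" by (rule local_graphD(4)[OF LB a d e])
    qed
  qed
qed

lemma D_add:
  assumes m: "quot_arr m F G" and m': "quot_arr m' F G"
  shows "quot_arr (m \<otimes>\<^bsub>Hom D F G\<^esub> m') F G" and "arr_graph F G (m \<otimes>\<^bsub>Hom D F G\<^esub> m') = graph_sum F G (arr_graph F G m) (arr_graph F G m')"
proof -
  note F = quot_arrD(1)[OF m] and G = quot_arrD(2)[OF m]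
  obtain H \<sigma> \<tau> where r: "isroof F G H \<sigma> \<tau>" "m = roof_arr F G H \<sigma> \<tau>" "arr_graph F G m = roof_graph F G H \<sigma> \<tau>"
    using quot_arrE[OF m] .
  obtain H' \<sigma>' \<tau>' where r': "isroof F G H' \<sigma>' \<tau>'" "m' = roof_arr F G H' \<sigma>' \<tau>'" "arr_graph F G m' = roof_graph F G H' \<sigma>' \<tau>'"
    using quot_arrE[OF m'] .
  let ?\<phi> = "roof_class M S F G (mk_roof F G H \<sigma> \<tau>)" and ?\<psi> = "roof_class M S F G (mk_roof F G H' \<sigma>' \<tau>')"
  let ?X = "{roof_class M S F G (H, s, f \<otimes>\<^bsub>Hom M H G\<^esub> g) | H s f g. (H, s, f) \<in> ?\<phi> \<and> (H, s, g) \<in> ?\<psi>}"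
  define \<Gamma> where "\<Gamma> = graph_sum F G (arr_graph F G m) (arr_graph F G m')"
  define Cl where "Cl = {\<rho> \<in> roofs M S F G. graph_of_roof F G \<rho> = \<Gamma>}"
  have eq: "m \<otimes>\<^bsub>Hom D F G\<^esub> m' = (F, \<Union>?X, G)"
    by (simp add: r(2) r'(2) roof_arr_def serre_quotient_def)
  have phi: "?\<phi> = {\<rho> \<in> roofs M S F G. graph_of_roof F G \<rho> = arr_graph F G m}" unfolding roof_class_mk_roof(2)[OF r(1)] r(3) ..
  have psi: "?\<psi> = {\<rho> \<in> roofs M S F G. graph_of_roof F G \<rho> = arr_graph F G m'}" unfolding roof_class_mk_roof(2)[OF r'(1)] r'(3) ..
  have cls: "roof_class M S F G (H, s, f \<otimes>\<^bsub>Hom M H G\<^esub> g) = Cl \<and> (H, s, f \<otimes>\<^bsub>Hom M H G\<^esub> g) \<in> Cl"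
    if in1: "(H, s, f) \<in> ?\<phi>" and in2: "(H, s, g) \<in> ?\<psi>" for H s f g
  proof -
    have *: "(H, s, f) \<in> roofs M S F G" "graph_of_roof F G (H, s, f) = arr_graph F G m"
      "(H, s, g) \<in> roofs M S F G" "graph_of_roof F G (H, s, g) = arr_graph F G m'"
      using in1 in2 unfolding phi psi by simp_all
    obtain H0 a b where 1: "(H, s, f) = mk_roof F G H0 a b" "isroof F G H0 a b"
      using *(1) unfolding in_roofs[OF F G] by blast
    obtain H1 a' c where 2: "(H, s, g) = mk_roof F G H1 a' c" "isroof F G H1 a' c"
      using *(3) unfolding in_roofs[OF F G] by blast
    have H: "H0 = H" "H1 = H" "s = (H, a, F)" "a' = a" "f = (H, b, G)" "g = (H, c, G)"
      using 1(1) 2(1) by (auto simp: mk_roof_def)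
    note ra = 1(2)[unfolded H] and rb = 2(2)[unfolded H]
    note sr = sum_roof[OF ra rb]
    have rr: "(H, s, f \<otimes>\<^bsub>Hom M H G\<^esub> g) = mk_roof F G H a (nat_mk H (\<lambda>W h. plus_at G W (b W h) (c W h)))"
      by (simp add: H mk_roof_def M_simps)
    have "graph_of_roof F G (H, s, f \<otimes>\<^bsub>Hom M H G\<^esub> g) = \<Gamma>"
      unfolding rr graph_of_roof_mk_roof sr(2) \<Gamma>_def *(2,4)[symmetric] by (simp add: graph_of_roof_def H)
    moreover have "(H, s, f \<otimes>\<^bsub>Hom M H G\<^esub> g) \<in> roofs M S F G"
      unfolding rr by (rule roof_class_mk_roof(1)[OF sr(1)])
    ultimately show ?thesis using roof_class_eq[OF F G] by (simp add: Cl_def)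
  qed
  note D = isroofD[OF r(1)] and D' = isroofD[OF r'(1)]
  \<comment> \<open>With \<open>\<sigma>\<close> as both legs, \<open>H\<close> is a roof from
    \<open>F\<close> to itself; completing it to a square with \<open>\<sigma>'\<close> produces a
    common denominator.\<close>
  have "isroof F F H \<sigma> \<sigma>" using D by (simp add: isroof_def)
  then obtain L \<kappa> \<mu> where L: "L \<in> MO" "nt L H \<kappa>" "nt L H' \<mu>" "loc_inj L \<kappa>" "loc_surj L H \<kappa>"
    "\<And>W x. el L W x \<Longrightarrow> \<sigma> W (\<kappa> W x) = \<sigma>' W (\<mu> W x)"
    by (rule square_exists[OF _ D'(3,4,6,7)]) (rule that; assumption)
  note pL = mod_psh[OF L(1)]
  let ?s = "nat_mk L (\<lambda>W x. \<sigma> W (\<kappa> W x))"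
  have R: "isroof F G L ?s (nat_mk L (\<lambda>W x. \<tau> W (\<kappa> W x)))"
    unfolding isroof_def using F G L(1) nt_comp[OF pL L(2) D(4)] nt_comp[OF pL L(2) D(5)]
      loc_inj_comp[OF L(2) D(4) pL D(10) L(4) D(6)] loc_surj_comp[OF L(2) D(4) pL D(10,8) L(5) D(7)] by simp
  have R': "isroof F G L ?s (nat_mk L (\<lambda>W x. \<tau>' W (\<mu> W x)))"
    using R nt_comp[OF pL L(3) D'(5)] by (simp add: isroof_def)
  have mem: "(L, (L, ?s, F), (L, nat_mk L (\<lambda>W x. \<tau> W (\<kappa> W x)), G)) \<in> ?\<phi>"
    unfolding phi mk_roof_def[symmetric] r(3) using roof_class_mk_roof(1)[OF R]
    by (simp add: graph_of_roof_mk_roof) (rule roof_graph_refine[OF r(1) R L(2)], simp_all add: nat_mk_app)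
  have mem': "(L, (L, ?s, F), (L, nat_mk L (\<lambda>W x. \<tau>' W (\<mu> W x)), G)) \<in> ?\<psi>"
    unfolding psi mk_roof_def[symmetric] r'(3) using roof_class_mk_roof(1)[OF R']
    by (simp add: graph_of_roof_mk_roof) (rule roof_graph_refine[OF r'(1) R' L(3)], simp_all add: nat_mk_app L(6))
  note c0 = cls[OF mem mem']
  have ne: "Cl \<in> ?X" using mem mem' c0 by blast
  have "?X = {Cl}" using ne cls by blast
  then have U: "\<Union>?X = Cl" by simp
  obtain \<rho> where \<rho>: "\<rho> \<in> Cl" "roof_class M S F G \<rho> = Cl" using c0 by blast
  then have \<rho>r: "\<rho> \<in> roofs M S F G" "graph_of_roof F G \<rho> = \<Gamma>" by (auto simp: Cl_def)
  obtain L l k where lk: "\<rho> = mk_roof F G L l k" "isroof F G L l k" using \<rho>r(1) in_roofs[OF F G] by blast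
  have res: "m \<otimes>\<^bsub>Hom D F G\<^esub> m' = roof_arr F G L l k" unfolding eq U \<rho>(2)[symmetric] lk(1) roof_arr_def ..
  show "quot_arr (m \<otimes>\<^bsub>Hom D F G\<^esub> m') F G" unfolding res by (rule quot_arr_roof_arr[OF lk(2)])
  show "arr_graph F G (m \<otimes>\<^bsub>Hom D F G\<^esub> m') = graph_sum F G (arr_graph F G m) (arr_graph F G m')"
    unfolding res arr_graph_roof_arr[OF lk(2)] using \<rho>r(2) lk(1) by (simp add: graph_of_roof_mk_roof \<Gamma>_def)
qed

lemma arr_graph_addE:
  assumes "quot_arr m F G" "quot_arr m' F G" "(W, a, d) \<in> arr_graph F G (m \<otimes>\<^bsub>Hom D F G\<^esub> m')"
  obtains e V b c where "el F W a" "el G W d" "cov e V W" "(V, FAr F e a, b) \<in> arr_graph F G m" "(V, FAr F e a, c) \<in> arr_graph F G m'"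
    "FAr G e d = plus_at G V b c"
  using assms(3) unfolding D_add(2)[OF assms(1,2)] graph_sum_def by blast

lemma arr_graph_addI:
  assumes "quot_arr m F G" "quot_arr m' F G" "(W, a, b) \<in> arr_graph F G m" "(W, a, c) \<in> arr_graph F G m'"
  shows "(W, a, plus_at G W b c) \<in> arr_graph F G (m \<otimes>\<^bsub>Hom D F G\<^esub> m')"
proof -
  note pF = mod_psh[OF quot_arrD(1)[OF assms(1)]] and pG = mod_psh[OF quot_arrD(2)[OF assms(1)]]
  note a = arr_graph_el(1)[OF assms(1,3)] and d = el_plus[OF pG arr_graph_el(2)[OF assms(1,3)] arr_graph_el(2)[OF assms(2,4)]]
  show ?thesis
    unfolding D_add(2)[OF assms(1,2)] graph_sum_def
      mem_Collect_eq prod.case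
    by (intro conjI a d exI[of _ W] exI[of _ "Ident C W"] exI[of _ b] exI[of _ c] cov_id[OF elD(1)[OF a]])
       (simp_all add: act_id[OF pF a] act_id[OF pG d] assms(3,4))
qed

lemma D_addl:
  assumes m: "quot_arr m F G" and n: "quot_arr n G H" and n': "quot_arr n' G H"
  shows "(n \<otimes>\<^bsub>Hom D G H\<^esub> n') \<cdot>\<^bsub>D\<^esub> m = (n \<cdot>\<^bsub>D\<^esub> m) \<otimes>\<^bsub>Hom D F H\<^esub> (n' \<cdot>\<^bsub>D\<^esub> m)"
proof (rule quot_arr_eqI)
  note nn = D_add(1)[OF n n'] and nm = quot_arr_comp[OF m n] and nm' = quot_arr_comp[OF m n']
  show "quot_arr ((n \<otimes>\<^bsub>Hom D G H\<^esub> n') \<cdot>\<^bsub>D\<^esub> m) F H" by (rule quot_arr_comp[OF m nn])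
  show R: "quot_arr ((n \<cdot>\<^bsub>D\<^esub> m) \<otimes>\<^bsub>Hom D F H\<^esub> (n' \<cdot>\<^bsub>D\<^esub> m)) F H" by (rule D_add(1)[OF nm nm'])
  note pF = mod_psh[OF quot_arrD(1)[OF m]] and pH = mod_psh[OF quot_arrD(2)[OF n]]
  fix W a d assume "(W, a, d) \<in> arr_graph F H ((n \<otimes>\<^bsub>Hom D G H\<^esub> n') \<cdot>\<^bsub>D\<^esub> m)"
  then obtain e V b where a: "el F W a" and d: "el H W d" and e: "cov e V W" and ab: "(V, FAr F e a, b) \<in> arr_graph F G m"
    and bd: "(V, b, FAr H e d) \<in> arr_graph G H (n \<otimes>\<^bsub>Hom D G H\<^esub> n')" by (rule arr_graph_compE[OF m nn])
  obtain e' V' c c' where e': "cov e' V' V" and c: "(V', FAr G e' b, c) \<in> arr_graph G H n" "(V', FAr G e' b, c') \<in> arr_graph G H n'"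
    and cc: "FAr H e' (FAr H e d) = plus_at H V' c c'" using arr_graph_addE[OF n n' bd] by metis
  note ab' = arr_graph_act[OF m ab cov_ar[OF e']]
  have "(V', FAr F e' (FAr F e a), plus_at H V' c c') \<in> arr_graph F H ((n \<cdot>\<^bsub>D\<^esub> m) \<otimes>\<^bsub>Hom D F H\<^esub> (n' \<cdot>\<^bsub>D\<^esub> m))"
    by (rule arr_graph_addI[OF nm nm' arr_graph_compI[OF m n ab' c(1)] arr_graph_compI[OF m n' ab' c(2)]])
  then have "(V, FAr F e a, FAr H e d) \<in> arr_graph F H ((n \<cdot>\<^bsub>D\<^esub> m) \<otimes>\<^bsub>Hom D F H\<^esub> (n' \<cdot>\<^bsub>D\<^esub> m))"
    using arr_graph_local[OF R el_act[OF pF cov_ar[OF e] a] el_act[OF pH cov_ar[OF e] d] e'] cc by simp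
  then show "(W, a, d) \<in> arr_graph F H ((n \<cdot>\<^bsub>D\<^esub> m) \<otimes>\<^bsub>Hom D F H\<^esub> (n' \<cdot>\<^bsub>D\<^esub> m))" by (rule arr_graph_local[OF R a d e])
qed

lemma D_addr:
  assumes m: "quot_arr m F G" and m': "quot_arr m' F G" and n: "quot_arr n G H"
  shows "n \<cdot>\<^bsub>D\<^esub> (m \<otimes>\<^bsub>Hom D F G\<^esub> m') = (n \<cdot>\<^bsub>D\<^esub> m) \<otimes>\<^bsub>Hom D F H\<^esub> (n \<cdot>\<^bsub>D\<^esub> m')"
proof (rule quot_arr_eqI)
  note mm = D_add(1)[OF m m'] and nm = quot_arr_comp[OF m n] and nm' = quot_arr_comp[OF m' n]
  show "quot_arr (n \<cdot>\<^bsub>D\<^esub> (m \<otimes>\<^bsub>Hom D F G\<^esub> m')) F H" by (rule quot_arr_comp[OF mm n])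
  show R: "quot_arr ((n \<cdot>\<^bsub>D\<^esub> m) \<otimes>\<^bsub>Hom D F H\<^esub> (n \<cdot>\<^bsub>D\<^esub> m')) F H" by (rule D_add(1)[OF nm nm'])
  note pF = mod_psh[OF quot_arrD(1)[OF m]] and pG = mod_psh[OF quot_arrD(1)[OF n]] and pH = mod_psh[OF quot_arrD(2)[OF n]]
  note LH = quot_arr_local_graph[OF n]
  fix W a d assume "(W, a, d) \<in> arr_graph F H (n \<cdot>\<^bsub>D\<^esub> (m \<otimes>\<^bsub>Hom D F G\<^esub> m'))"
  then obtain e V b where a: "el F W a" and d: "el H W d" and e: "cov e V W"
    and ab: "(V, FAr F e a, b) \<in> arr_graph F G (m \<otimes>\<^bsub>Hom D F G\<^esub> m')"
    and bd: "(V, b, FAr H e d) \<in> arr_graph G H n" by (rule arr_graph_compE[OF mm n])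
  obtain e' V' c c' where e': "cov e' V' V" and c: "(V', FAr F e' (FAr F e a), c) \<in> arr_graph F G m"
    and c': "(V', FAr F e' (FAr F e a), c') \<in> arr_graph F G m'"
    and cc: "FAr G e' b = plus_at G V' c c'" using arr_graph_addE[OF m m' ab] by metis
  \<comment> \<open>A value of \<open>n\<close> is known at the sum \<open>b\<close> but not at the
    summands. After two further coverings there are values at both summands, and their sum is
    locally the value at \<open>b\<close> because the graph of \<open>n\<close> is additive and
    single valued.\<close>
  obtain f U y where f: "cov f U V'" and y: "(U, FAr G f c, y) \<in> arr_graph G H n"
    by (rule local_graph_totE[OF LH arr_graph_el(2)[OF m c]])
  obtain f' U' y' where f': "cov f' U' U" and y': "(U', FAr G f' (FAr G f c'), y') \<in> arr_graph G H n"
    by (rule local_graph_totE[OF LH el_act[OF pG cov_ar[OF f] arr_graph_el(2)[OF m' c']]])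
  note y1 = arr_graph_act[OF n y cov_ar[OF f']]
  define g where "g = f \<cdot> f'"
  have g: "cov g U' V'" unfolding g_def by (rule cov_comp[OF f f'])
  have gact: "FAr P g x = FAr P f' (FAr P f x)" if "psh P" "el P V' x" for P :: "('o, 'm, 'm set) presheaf" and x
    unfolding g_def by (rule act_comp[OF that(1) cov_ar[OF f'] cov_ar[OF f] that(2)])
  let ?y = "FAr H f' y"
  have 1: "(U', FAr G g c, ?y) \<in> arr_graph G H n" "(U', FAr G g c', y') \<in> arr_graph G H n"
    using y1 y' gact[OF pG arr_graph_el(2)[OF m c]] gact[OF pG arr_graph_el(2)[OF m' c']] by simp_all
  have 2: "(U', plus_at G U' (FAr G g c) (FAr G g c'), plus_at H U' ?y y') \<in> arr_graph G H n"
    by (rule local_graphD(6)[OF LH 1])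
  have 3: "(U', FAr G g (FAr G e' b), FAr H g (FAr H e' (FAr H e d))) \<in> arr_graph G H n"
    by (rule arr_graph_act[OF n arr_graph_act[OF n bd cov_ar[OF e']] cov_ar[OF g]])
  have "plus_at G U' (FAr G g c) (FAr G g c') = FAr G g (FAr G e' b)"
    unfolding cc by (rule act_plus[OF pG cov_ar[OF g] arr_graph_el(2)[OF m c] arr_graph_el(2)[OF m' c'], symmetric])
  then have lq: "loc_eq H U' (plus_at H U' ?y y') (FAr H g (FAr H e' (FAr H e d)))"
    using local_graphD(5)[OF LH _ 3] 2 by simp
  have "(U', FAr F g (FAr F e' (FAr F e a)), plus_at H U' ?y y') \<in> arr_graph F H ((n \<cdot>\<^bsub>D\<^esub> m) \<otimes>\<^bsub>Hom D F H\<^esub> (n \<cdot>\<^bsub>D\<^esub> m'))"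
    by (rule arr_graph_addI[OF nm nm' arr_graph_compI[OF m n arr_graph_act[OF m c cov_ar[OF g]] 1(1)]
          arr_graph_compI[OF m' n arr_graph_act[OF m' c' cov_ar[OF g]] 1(2)]])
  note * = arr_graph_loc_eq[OF R this lq]
  note d1 = el_act[OF pH cov_ar[OF e] d] and a1 = el_act[OF pF cov_ar[OF e] a]
  note d2 = el_act[OF pH cov_ar[OF e'] d1] and a2 = el_act[OF pF cov_ar[OF e'] a1]
  note d3 = el_act[OF pH cov_ar[OF g] d2]
  show "(W, a, d) \<in> arr_graph F H ((n \<cdot>\<^bsub>D\<^esub> m) \<otimes>\<^bsub>Hom D F H\<^esub> (n \<cdot>\<^bsub>D\<^esub> m'))"
    by (rule arr_graph_local[OF R a d e arr_graph_local[OF R a1 d1 e' arr_graph_local[OF R a2 d2 g *[OF d3]]]])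
qed

lemma lincat_D: "lincat D"
proof
  fix F G m assume F: "F \<in> Obj D" and G: "G \<in> Obj D" and m: "m \<in> arr D F G"
  show "Dom D m = F \<and> Cod D m = G" by (rule D_dom[OF m])
  have m': "quot_arr m F G" using F G m by (simp add: quot_arr_def D_simps)
  show "m \<cdot>\<^bsub>D\<^esub> Ident D F = m" "Ident D G \<cdot>\<^bsub>D\<^esub> m = m"
    unfolding D_simps by (rule D_idr[OF m'], rule D_idl[OF m'])
  show "m \<otimes>\<^bsub>Hom D F G\<^esub> n \<in> arr D F G" if "n \<in> arr D F G" for n
    by (rule quot_arrD(3)[OF D_add(1)[OF m']]) (use F G that in \<open>simp add: quot_arr_def D_simps\<close>)
  fix H n assume H: "H \<in> Obj D" and n: "n \<in> arr D G H"
  have n': "quot_arr n G H" using G H n by (simp add: quot_arr_def D_simps)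
  show "n \<cdot>\<^bsub>D\<^esub> m \<in> arr D F H" by (rule quot_arrD(3)[OF quot_arr_comp[OF m' n']])
  show "n \<cdot>\<^bsub>D\<^esub> (m \<otimes>\<^bsub>Hom D F G\<^esub> k) = (n \<cdot>\<^bsub>D\<^esub> m) \<otimes>\<^bsub>Hom D F H\<^esub> (n \<cdot>\<^bsub>D\<^esub> k)" if "k \<in> arr D F G" for k
    by (rule D_addr[OF m' _ n']) (use F G that in \<open>simp add: quot_arr_def D_simps\<close>)
  show "(n \<otimes>\<^bsub>Hom D G H\<^esub> k) \<cdot>\<^bsub>D\<^esub> m = (n \<cdot>\<^bsub>D\<^esub> m) \<otimes>\<^bsub>Hom D F H\<^esub> (k \<cdot>\<^bsub>D\<^esub> m)" if "k \<in> arr D G H" for k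
    by (rule D_addl[OF m' n']) (use G H that in \<open>simp add: quot_arr_def D_simps\<close>)
  show "(l \<cdot>\<^bsub>D\<^esub> n) \<cdot>\<^bsub>D\<^esub> m = l \<cdot>\<^bsub>D\<^esub> (n \<cdot>\<^bsub>D\<^esub> m)" if "K \<in> Obj D" "l \<in> arr D H K" for K l
    by (rule D_assoc[OF m' n']) (use H that in \<open>simp add: quot_arr_def D_simps\<close>)
next
  fix F assume "F \<in> Obj D"
  then have F: "F \<in> MO" by (simp add: D_simps)
  show "Ident D F \<in> arr D F F" unfolding D_simps by (rule quot_arrD(3)[OF quot_arr_quot_map[OF F F nt_id[OF mod_psh[OF F]]]])
qed

end

section \<open>Equivalences and reflection of kernels\<close>

locale lincat0 = lincat D for D :: "('p, 'n, 'y) acat_scheme" (structure) +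
  assumes z_arr: "F \<in> Obj D \<Longrightarrow> G \<in> Obj D \<Longrightarrow> zero_arr D F G \<in> arr D F G"
    and z_left: "F \<in> Obj D \<Longrightarrow> G \<in> Obj D \<Longrightarrow> H \<in> Obj D \<Longrightarrow> m \<in> arr D F G \<Longrightarrow> zero_arr D G H \<cdot> m = zero_arr D F H"
    and z_right: "F \<in> Obj D \<Longrightarrow> G \<in> Obj D \<Longrightarrow> H \<in> Obj D \<Longrightarrow> m \<in> arr D G H \<Longrightarrow> m \<cdot> zero_arr D F G = zero_arr D F H"
begin

text \<open>Kernels and cokernels in the quotient arise on arbitrary functors. The four lemmas on
  isomorphisms move them onto representable functors, from where they can be reflected to
  \<open>C\<close>.\<close>

lemma kernel_iso:
  assumes k: "is_kernel D K F G k s" and K': "K' \<in> Obj D" and i: "iso_arr D K' K i"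
  shows "is_kernel D K' F G (k \<cdot> i) s"
proof -
  have o: "K \<in> Obj D" "F \<in> Obj D" "G \<in> Obj D" and a: "k \<in> arr D K F" "s \<in> arr D F G" and z: "s \<cdot> k = zero_arr D K G"
    using k unfolding is_kernel_def by simp_all
  have univ: "\<exists>!u. u \<in> arr D T K \<and> k \<cdot> u = t" if "T \<in> Obj D" "t \<in> arr D T F" "s \<cdot> t = zero_arr D T G" for T t
    using k that unfolding is_kernel_def by blast
  obtain j where i: "i \<in> arr D K' K" and j: "j \<in> arr D K K'" "j \<cdot> i = Ident D K'" "i \<cdot> j = Ident D K"
    using i unfolding iso_arr_def by blast
  show ?thesis
    unfolding is_kernel_def
  proof (intro conjI ballI impI o K' a(2))
    show "k \<cdot> i \<in> arr D K' F" using l_comp[OF K' o(1,2) i a(1)] .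
    show "s \<cdot> (k \<cdot> i) = zero_arr D K' G"
      using l_assoc[OF K' o i a] z z_left[OF K' o(1,3) i] by simp
    fix T t assume T: "T \<in> Obj D" and t: "t \<in> arr D T F" and e: "s \<cdot> t = zero_arr D T G"
    obtain u where u: "u \<in> arr D T K" "k \<cdot> u = t" and uq: "\<And>v. v \<in> arr D T K \<Longrightarrow> k \<cdot> v = t \<Longrightarrow> v = u"
      using univ[OF T t e] by blast
    show "\<exists>!u. u \<in> arr D T K' \<and> (k \<cdot> i) \<cdot> u = t"
    proof (rule ex1I[of _ "j \<cdot> u"])
      have ju: "j \<cdot> u \<in> arr D T K'" using l_comp[OF T o(1) K' u(1) j(1)] .
      have "i \<cdot> (j \<cdot> u) = u" using l_assoc[OF T o(1) K' o(1) u(1) j(1) i] j(3) l_idl[OF T o(1) u(1)] by simp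
      then show "j \<cdot> u \<in> arr D T K' \<and> (k \<cdot> i) \<cdot> (j \<cdot> u) = t"
        using ju l_assoc[OF T K' o(1,2) ju i a(1)] u(2) by simp
      fix v assume v: "v \<in> arr D T K' \<and> (k \<cdot> i) \<cdot> v = t"
      then have v1: "v \<in> arr D T K'" and v2: "(k \<cdot> i) \<cdot> v = t" by simp_all
      have "i \<cdot> v = u"
        by (rule uq[OF l_comp[OF T K' o(1) v1 i]]) (simp add: l_assoc[OF T K' o(1,2) v1 i a(1), symmetric] v2)
      then have "j \<cdot> (i \<cdot> v) = j \<cdot> u" by simp
      then show "v = j \<cdot> u" unfolding l_assoc[OF T K' o(1) K' v1 i j(1), symmetric] j(2) l_idl[OF T K' v1] .
    qed
  qed
qed

lemma kernel_post_iso: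
  assumes k: "is_kernel D K F G k s" and G': "G' \<in> Obj D" and i: "iso_arr D G G' i"
  shows "is_kernel D K F G' k (i \<cdot> s)"
proof -
  have o: "K \<in> Obj D" "F \<in> Obj D" "G \<in> Obj D" and a: "k \<in> arr D K F" "s \<in> arr D F G" and z: "s \<cdot> k = zero_arr D K G"
    using k unfolding is_kernel_def by simp_all
  have univ: "\<exists>!u. u \<in> arr D T K \<and> k \<cdot> u = t" if "T \<in> Obj D" "t \<in> arr D T F" "s \<cdot> t = zero_arr D T G" for T t
    using k that unfolding is_kernel_def by blast
  obtain j where i: "i \<in> arr D G G'" and j: "j \<in> arr D G' G" "j \<cdot> i = Ident D G" "i \<cdot> j = Ident D G'"
    using i unfolding iso_arr_def by blast
  show ?thesis
    unfolding is_kernel_def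
  proof (intro conjI ballI impI o G' a(1))
    show "i \<cdot> s \<in> arr D F G'" using l_comp[OF o(2,3) G' a(2) i] .
    show "(i \<cdot> s) \<cdot> k = zero_arr D K G'"
      using l_assoc[OF o G' a i] z z_right[OF o(1,3) G' i] by simp
    fix T t assume T: "T \<in> Obj D" and t: "t \<in> arr D T F" and e: "(i \<cdot> s) \<cdot> t = zero_arr D T G'"
    have st: "s \<cdot> t \<in> arr D T G" using l_comp[OF T o(2,3) t a(2)] .
    have "i \<cdot> (s \<cdot> t) = zero_arr D T G'" using e l_assoc[OF T o(2,3) G' t a(2) i] by simp
    then have "j \<cdot> (i \<cdot> (s \<cdot> t)) = zero_arr D T G" using z_right[OF T G' o(3) j(1)] by simp
    then have "s \<cdot> t = zero_arr D T G"
      using l_assoc[OF T o(3) G' o(3) st i j(1)] j(2) l_idl[OF T o(3) st] by simp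
    then show "\<exists>!u. u \<in> arr D T K \<and> k \<cdot> u = t" by (rule univ[OF T t])
  qed
qed

lemma cokernel_iso:
  assumes c: "is_cokernel D F G Q s c" and Q': "Q' \<in> Obj D" and i: "iso_arr D Q Q' i"
  shows "is_cokernel D F G Q' s (i \<cdot> c)"
proof -
  have o: "F \<in> Obj D" "G \<in> Obj D" "Q \<in> Obj D" and a: "s \<in> arr D F G" "c \<in> arr D G Q" and z: "c \<cdot> s = zero_arr D F Q"
    using c unfolding is_cokernel_def by simp_all
  have univ: "\<exists>!u. u \<in> arr D Q T \<and> u \<cdot> c = t" if "T \<in> Obj D" "t \<in> arr D G T" "t \<cdot> s = zero_arr D F T" for T t
    using c that unfolding is_cokernel_def by blast
  obtain j where i: "i \<in> arr D Q Q'" and j: "j \<in> arr D Q' Q" "j \<cdot> i = Ident D Q" "i \<cdot> j = Ident D Q'"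
    using i unfolding iso_arr_def by blast
  show ?thesis
    unfolding is_cokernel_def
  proof (intro conjI ballI impI o Q' a(1))
    show ic: "i \<cdot> c \<in> arr D G Q'" using l_comp[OF o(2,3) Q' a(2) i] .
    show "(i \<cdot> c) \<cdot> s = zero_arr D F Q'"
      using l_assoc[OF o Q' a i] z z_right[OF o(1,3) Q' i] by simp
    fix T t assume T: "T \<in> Obj D" and t: "t \<in> arr D G T" and e: "t \<cdot> s = zero_arr D F T"
    obtain u where u: "u \<in> arr D Q T" "u \<cdot> c = t" and uq: "\<And>v. v \<in> arr D Q T \<Longrightarrow> v \<cdot> c = t \<Longrightarrow> v = u"
      using univ[OF T t e] by blast
    show "\<exists>!u. u \<in> arr D Q' T \<and> u \<cdot> (i \<cdot> c) = t"
    proof (rule ex1I[of _ "u \<cdot> j"])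
      have uj: "u \<cdot> j \<in> arr D Q' T" using l_comp[OF Q' o(3) T j(1) u(1)] .
      have "(u \<cdot> j) \<cdot> i = u" using l_assoc[OF o(3) Q' o(3) T i j(1) u(1)] j(2) l_idr[OF o(3) T u(1)] by simp
      then show "u \<cdot> j \<in> arr D Q' T \<and> (u \<cdot> j) \<cdot> (i \<cdot> c) = t"
        using uj l_assoc[OF o(2,3) Q' T a(2) i uj] u(2) by simp
      fix v assume v: "v \<in> arr D Q' T \<and> v \<cdot> (i \<cdot> c) = t"
      then have v1: "v \<in> arr D Q' T" and v2: "v \<cdot> (i \<cdot> c) = t" by simp_all
      have "v \<cdot> i = u"
        by (rule uq[OF l_comp[OF o(3) Q' T i v1]]) (simp add: l_assoc[OF o(2,3) Q' T a(2) i v1] v2)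
      then have "(v \<cdot> i) \<cdot> j = u \<cdot> j" by simp
      then show "v = u \<cdot> j" unfolding l_assoc[OF Q' o(3) Q' T j(1) i v1] j(3) l_idr[OF Q' T v1] .
    qed
  qed
qed

lemma cokernel_pre_iso:
  assumes c: "is_cokernel D F G Q s c" and F': "F' \<in> Obj D" and i: "iso_arr D F' F i"
  shows "is_cokernel D F' G Q (s \<cdot> i) c"
proof -
  have o: "F \<in> Obj D" "G \<in> Obj D" "Q \<in> Obj D" and a: "s \<in> arr D F G" "c \<in> arr D G Q" and z: "c \<cdot> s = zero_arr D F Q"
    using c unfolding is_cokernel_def by simp_all
  have univ: "\<exists>!u. u \<in> arr D Q T \<and> u \<cdot> c = t" if "T \<in> Obj D" "t \<in> arr D G T" "t \<cdot> s = zero_arr D F T" for T t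
    using c that unfolding is_cokernel_def by blast
  obtain j where i: "i \<in> arr D F' F" and j: "j \<in> arr D F F'" "j \<cdot> i = Ident D F'" "i \<cdot> j = Ident D F"
    using i unfolding iso_arr_def by blast
  show ?thesis
    unfolding is_cokernel_def
  proof (intro conjI ballI impI o F' a(2))
    show "s \<cdot> i \<in> arr D F' G" using l_comp[OF F' o(1,2) i a(1)] .
    show "c \<cdot> (s \<cdot> i) = zero_arr D F' Q"
      using l_assoc[OF F' o i a] z z_left[OF F' o(1,3) i] by simp
    fix T t assume T: "T \<in> Obj D" and t: "t \<in> arr D G T" and e: "t \<cdot> (s \<cdot> i) = zero_arr D F' T"
    have ts: "t \<cdot> s \<in> arr D F T" using l_comp[OF o(1,2) T a(1) t] .
    have "(t \<cdot> s) \<cdot> i = zero_arr D F' T" using e l_assoc[OF F' o(1,2) T i a(1) t] by simp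
    then have "((t \<cdot> s) \<cdot> i) \<cdot> j = zero_arr D F T" using z_left[OF o(1) F' T j(1)] by simp
    then have "t \<cdot> s = zero_arr D F T"
      using l_assoc[OF o(1) F' o(1) T j(1) i ts] j(3) l_idr[OF o(1) T ts] by simp
    then show "\<exists>!u. u \<in> arr D Q T \<and> u \<cdot> c = t" by (rule univ[OF T t])
  qed
qed

end

section \<open>Functors from \<open>C\<close>: equivalences and reflection\<close>

locale functor_pair = preadd_cat C + lincat D
  for C :: "('o, 'm, 'z) acat_scheme" and D :: "('p, 'n, 'y) acat_scheme" and E :: "('o, 'm, 'p, 'n) fctr" +
  assumes add_fun: "additive_functor C D E"
begin

lemma E_ob: "X \<in> Obj C \<Longrightarrow> FOb E X \<in> Obj D"
  using add_fun unfolding additive_functor_def by simp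

lemma E_ar: "ar f X Y \<Longrightarrow> FAr E f \<in> arr D (FOb E X) (FOb E Y)"
  using add_fun unfolding additive_functor_def ar_def hom_def by auto

lemma E_add: "ar f X Y \<Longrightarrow> ar g X Y \<Longrightarrow> FAr E (add X Y f g) = FAr E f \<otimes>\<^bsub>Hom D (FOb E X) (FOb E Y)\<^esub> FAr E g"
  using add_fun unfolding additive_functor_def ar_def hom_def by auto

lemma E_id: "X \<in> Obj C \<Longrightarrow> FAr E (Ident C X) = Ident D (FOb E X)"
  using add_fun unfolding additive_functor_def by simp

lemma E_comp: "ar f X Y \<Longrightarrow> ar g Y Z \<Longrightarrow> FAr E (g \<cdot>\<^bsub>C\<^esub> f) = FAr E g \<cdot>\<^bsub>D\<^esub> FAr E f"
  using add_fun unfolding additive_functor_def ar_def by auto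

definition ess where "ess \<longleftrightarrow> (\<forall>F\<in>Obj D. \<exists>X\<in>Obj C. \<exists>i. iso_arr D (FOb E X) F i)"

lemma ff_inj: "fully_faithful C D E \<Longrightarrow> ar f X Y \<Longrightarrow> ar g X Y \<Longrightarrow> FAr E f = FAr E g \<Longrightarrow> f = g"
  unfolding fully_faithful_def ar_def bij_betw_def inj_on_def by auto

lemma ff_surjE:
  assumes "fully_faithful C D E" "X \<in> Obj C" "Y \<in> Obj C" "m \<in> arr D (FOb E X) (FOb E Y)"
  obtains f where "ar f X Y" "FAr E f = m"
proof -
  have "m \<in> FAr E ` arr C X Y" using assms unfolding fully_faithful_def bij_betw_def by simp
  then show thesis using that assms(2,3) by (auto simp: ar_def)
qed

text \<open>The quasi-inverse sends an arrow to the preimage under \<open>E\<close> of its conjugate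
  by chosen isomorphisms \<open>ii\<close> and \<open>jj\<close>. Every identity required in
  \<open>C\<close> is checked after applying the faithful \<open>E\<close>.\<close>

lemma equivalence_if:
  assumes ff: "fully_faithful C D E" and es: ess
  shows "is_equivalence C D E"
proof -
  have "\<forall>F. \<exists>X i j. F \<in> Obj D \<longrightarrow> X \<in> Obj C \<and> i \<in> arr D (FOb E X) F \<and> j \<in> arr D F (FOb E X) \<and>
     j \<cdot>\<^bsub>D\<^esub> i = Ident D (FOb E X) \<and> i \<cdot>\<^bsub>D\<^esub> j = Ident D F"
    using es unfolding ess_def iso_arr_def by metis
  then obtain ob ii jj where P: "\<And>F. F \<in> Obj D \<Longrightarrow> ob F \<in> Obj C \<and> ii F \<in> arr D (FOb E (ob F)) F \<and>
     jj F \<in> arr D F (FOb E (ob F)) \<and> jj F \<cdot>\<^bsub>D\<^esub> ii F = Ident D (FOb E (ob F)) \<and> ii F \<cdot>\<^bsub>D\<^esub> jj F = Ident D F"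
    by metis
  have o: "ob F \<in> Obj C" "FOb E (ob F) \<in> Obj D" and i: "ii F \<in> arr D (FOb E (ob F)) F"
    and j: "jj F \<in> arr D F (FOb E (ob F))" and ji: "jj F \<cdot>\<^bsub>D\<^esub> ii F = Ident D (FOb E (ob F))"
    and ij: "ii F \<cdot>\<^bsub>D\<^esub> jj F = Ident D F" if "F \<in> Obj D" for F
    using P[OF that] E_ob by auto
  define t where "t F G m = jj G \<cdot>\<^bsub>D\<^esub> (m \<cdot>\<^bsub>D\<^esub> ii F)" for F G m
  \<comment> \<open>\<open>FAr\<close> receives an arrow without its source and target; they are
    recovered by \<open>Dom\<close> and \<open>Cod\<close>.\<close>
  define gm where "gm m = (SOME f. ar f (ob (Dom D m)) (ob (Cod D m)) \<and> FAr E f = t (Dom D m) (Cod D m) m)" for m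
  define Gf where "Gf = \<lparr>FOb = ob, FAr = gm\<rparr>"
  have t: "t F G m \<in> arr D (FOb E (ob F)) (FOb E (ob G))" if "F \<in> Obj D" "G \<in> Obj D" "m \<in> arr D F G" for F G m
    unfolding t_def by (rule l_comp[OF o(2) _ o(2) l_comp[OF o(2) _ _ i] j]) (use that in simp_all)
  have g: "ar (gm m) (ob F) (ob G)" "FAr E (gm m) = t F G m" if F: "F \<in> Obj D" and G: "G \<in> Obj D" and m: "m \<in> arr D F G" for F G m
  proof -
    obtain f where f: "ar f (ob F) (ob G)" "FAr E f = t F G m" by (rule ff_surjE[OF ff o(1)[OF F] o(1)[OF G] t[OF F G m]])
    have "ar (gm m) (ob F) (ob G) \<and> FAr E (gm m) = t F G m"
      unfolding gm_def l_dom[OF F G m, THEN conjunct1] l_dom[OF F G m, THEN conjunct2]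
      by (rule someI[of _ f]) (use f in simp)
    then show "ar (gm m) (ob F) (ob G)" "FAr E (gm m) = t F G m" by auto
  qed
  have it: "ii G \<cdot>\<^bsub>D\<^esub> t F G m = m \<cdot>\<^bsub>D\<^esub> ii F" if F: "F \<in> Obj D" and G: "G \<in> Obj D" and m: "m \<in> arr D F G" for F G m
  proof -
    have mi: "m \<cdot>\<^bsub>D\<^esub> ii F \<in> arr D (FOb E (ob F)) G" by (rule l_comp[OF o(2)[OF F] F G i[OF F] m])
    show ?thesis
      unfolding t_def l_assoc[OF o(2)[OF F] G o(2)[OF G] G mi j[OF G] i[OF G], symmetric] ij[OF G]
      by (rule l_idl[OF o(2)[OF F] G mi])
  qed
  \<comment> \<open>\<open>ii G\<close> has the inverse \<open>jj G\<close> and can be cancelled on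
    the left, which reduces functoriality to the naturality \<open>it\<close>.\<close>
  have cancel: "a = b" if F: "F \<in> Obj D" and G: "G \<in> Obj D" and a: "a \<in> arr D F (FOb E (ob G))" and b: "b \<in> arr D F (FOb E (ob G))"
    and e: "ii G \<cdot>\<^bsub>D\<^esub> a = ii G \<cdot>\<^bsub>D\<^esub> b" for F G a b
    using arg_cong[OF e, of "\<lambda>x. jj G \<cdot>\<^bsub>D\<^esub> x"] l_assoc[OF F o(2)[OF G] G o(2)[OF G] a i[OF G] j[OF G]]
      l_assoc[OF F o(2)[OF G] G o(2)[OF G] b i[OF G] j[OF G]] ji[OF G] l_idl[OF F o(2)[OF G] a] l_idl[OF F o(2)[OF G] b] by simp
  have aG: "additive_functor D C Gf"
    unfolding additive_functor_def
  proof (intro conjI ballI)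
    fix F assume F: "F \<in> Obj D"
    show "FOb Gf F \<in> Obj C" using o[OF F] by (simp add: Gf_def)
    note idF = l_id[OF F]
    have "gm (Ident D F) = Ident C (ob F)"
    proof (rule ff_inj[OF ff g(1)[OF F F idF] ar_id[OF o(1)[OF F]]])
      show "FAr E (gm (Ident D F)) = FAr E (Ident C (ob F))"
        unfolding g(2)[OF F F idF] E_id[OF o(1)[OF F]] t_def l_idl[OF o(2)[OF F] F i[OF F]] by (rule ji[OF F])
    qed
    then show "FAr Gf (Ident D F) = Ident C (FOb Gf F)" by (simp add: Gf_def)
    fix G assume G: "G \<in> Obj D"
    have "gm (m \<otimes>\<^bsub>Hom D F G\<^esub> n) = add (ob F) (ob G) (gm m) (gm n)" if m: "m \<in> arr D F G" and n: "n \<in> arr D F G" for m n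
    proof (rule ff_inj[OF ff g(1)[OF F G l_add[OF F G m n]] ar_add[OF g(1)[OF F G m] g(1)[OF F G n]]])
      show "FAr E (gm (m \<otimes>\<^bsub>Hom D F G\<^esub> n)) = FAr E (add (ob F) (ob G) (gm m) (gm n))"
        unfolding g(2)[OF F G l_add[OF F G m n]] E_add[OF g(1)[OF F G m] g(1)[OF F G n]] g(2)[OF F G m] g(2)[OF F G n] t_def
          l_addl[OF o(2)[OF F] F G i[OF F] m n]
        by (rule l_addr[OF o(2)[OF F] G o(2)[OF G] l_comp[OF o(2)[OF F] F G i[OF F] m] l_comp[OF o(2)[OF F] F G i[OF F] n] j[OF G]])
    qed
    then show "FAr Gf \<in> hom (Hom D F G) (Hom C (FOb Gf F) (FOb Gf G))"
      using g(1)[OF F G] by (auto simp: Gf_def hom_def ar_def)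
    fix H m n assume H: "H \<in> Obj D" and m: "m \<in> arr D F G" and n: "n \<in> arr D G H"
    note nm = l_comp[OF F G H m n]
    have "gm (n \<cdot>\<^bsub>D\<^esub> m) = gm n \<cdot>\<^bsub>C\<^esub> gm m"
    proof (rule ff_inj[OF ff g(1)[OF F H nm] ar_comp[OF g(1)[OF F G m] g(1)[OF G H n]]])
      note tm = t[OF F G m] and tn = t[OF G H n]
      have "t F H (n \<cdot>\<^bsub>D\<^esub> m) = t G H n \<cdot>\<^bsub>D\<^esub> t F G m"
      proof (rule cancel[OF o(2)[OF F] H t[OF F H nm] l_comp[OF o(2)[OF F] o(2)[OF G] o(2)[OF H] tm tn]])
        have "ii H \<cdot>\<^bsub>D\<^esub> (t G H n \<cdot>\<^bsub>D\<^esub> t F G m) = (n \<cdot>\<^bsub>D\<^esub> ii G) \<cdot>\<^bsub>D\<^esub> t F G m"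
          unfolding l_assoc[OF o(2)[OF F] o(2)[OF G] o(2)[OF H] H tm tn i[OF H], symmetric] it[OF G H n] ..
        also have "\<dots> = n \<cdot>\<^bsub>D\<^esub> (m \<cdot>\<^bsub>D\<^esub> ii F)"
          unfolding l_assoc[OF o(2)[OF F] o(2)[OF G] G H tm i[OF G] n] it[OF F G m] ..
        also have "\<dots> = ii H \<cdot>\<^bsub>D\<^esub> t F H (n \<cdot>\<^bsub>D\<^esub> m)"
          unfolding it[OF F H nm] l_assoc[OF o(2)[OF F] F G H i[OF F] m n] ..
        finally show "ii H \<cdot>\<^bsub>D\<^esub> t F H (n \<cdot>\<^bsub>D\<^esub> m) = ii H \<cdot>\<^bsub>D\<^esub> (t G H n \<cdot>\<^bsub>D\<^esub> t F G m)" by simp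
      qed
      then show "FAr E (gm (n \<cdot>\<^bsub>D\<^esub> m)) = FAr E (gm n \<cdot>\<^bsub>C\<^esub> gm m)"
        unfolding g(2)[OF F H nm] E_comp[OF g(1)[OF F G m] g(1)[OF G H n]] g(2)[OF F G m] g(2)[OF G H n] .
    qed
    then show "FAr Gf (n \<cdot>\<^bsub>D\<^esub> m) = FAr Gf n \<cdot>\<^bsub>C\<^esub> FAr Gf m" by (simp add: Gf_def)
  qed
  have n2: "naturally_isomorphic D D (fctr_comp E Gf) fctr_id"
    unfolding naturally_isomorphic_def
  proof (intro exI[of _ ii] conjI ballI)
    fix F assume F: "F \<in> Obj D"
    show "iso_arr D (FOb (fctr_comp E Gf) F) (FOb fctr_id F) (ii F)"
      unfolding iso_arr_def using i[OF F] j[OF F] ij[OF F] ji[OF F] by (auto simp: fctr_comp_def fctr_id_def Gf_def)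
    fix G m assume G: "G \<in> Obj D" and m: "m \<in> arr D F G"
    show "ii G \<cdot>\<^bsub>D\<^esub> FAr (fctr_comp E Gf) m = FAr fctr_id m \<cdot>\<^bsub>D\<^esub> ii F"
      using it[OF F G m] g(2)[OF F G m] by (simp add: fctr_comp_def fctr_id_def Gf_def)
  qed
  \<comment> \<open>The second natural isomorphism is the preimage under \<open>E\<close> of
    \<open>ii\<close> at the objects \<open>FOb E X\<close>.\<close>
  have "\<exists>u. ar u (ob (FOb E X)) X \<and> FAr E u = ii (FOb E X)" if "X \<in> Obj C" for X
    using ff_surjE[OF ff o(1)[OF E_ob[OF that]] that i[OF E_ob[OF that]]] by metis
  then obtain uu where uu: "\<And>X. X \<in> Obj C \<Longrightarrow> ar (uu X) (ob (FOb E X)) X \<and> FAr E (uu X) = ii (FOb E X)" by metis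
  have n1: "naturally_isomorphic C C (fctr_comp Gf E) fctr_id"
    unfolding naturally_isomorphic_def
  proof (intro exI[of _ uu] conjI ballI)
    fix X assume X: "X \<in> Obj C"
    note u = uu[OF X, THEN conjunct1] and eu = uu[OF X, THEN conjunct2] and EX = E_ob[OF X]
    note oX = o(1)[OF EX]
    obtain v where v: "ar v X (ob (FOb E X))" "FAr E v = jj (FOb E X)" by (rule ff_surjE[OF ff X oX j[OF EX]])
    have "v \<cdot>\<^bsub>C\<^esub> uu X = Ident C (ob (FOb E X))"
      by (rule ff_inj[OF ff ar_comp[OF u v(1)] ar_id[OF oX]]) (simp add: E_comp[OF u v(1)] E_id[OF oX] eu v(2) ji[OF EX])
    moreover have "uu X \<cdot>\<^bsub>C\<^esub> v = Ident C X"
      by (rule ff_inj[OF ff ar_comp[OF v(1) u] ar_id[OF X]]) (simp add: E_comp[OF v(1) u] E_id[OF X] eu v(2) ij[OF EX])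
    ultimately show "iso_arr C (FOb (fctr_comp Gf E) X) (FOb fctr_id X) (uu X)"
      unfolding iso_arr_def using u v(1) by (auto simp: fctr_comp_def fctr_id_def Gf_def ar_def)
    fix Y f assume Y: "Y \<in> Obj C" and "f \<in> arr C X Y"
    then have f: "ar f X Y" using X by (simp add: ar_def)
    note EY = E_ob[OF Y] and w = uu[OF Y, THEN conjunct1] and ew = uu[OF Y, THEN conjunct2]
    note gf = g[OF EX EY E_ar[OF f]]
    have "uu Y \<cdot>\<^bsub>C\<^esub> gm (FAr E f) = f \<cdot>\<^bsub>C\<^esub> uu X"
      by (rule ff_inj[OF ff ar_comp[OF gf(1) w] ar_comp[OF u f]])
         (simp add: E_comp[OF gf(1) w] E_comp[OF u f] gf(2) eu ew it[OF EX EY E_ar[OF f]])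
    then show "uu Y \<cdot>\<^bsub>C\<^esub> FAr (fctr_comp Gf E) f = FAr fctr_id f \<cdot>\<^bsub>C\<^esub> uu X"
      by (simp add: fctr_comp_def fctr_id_def Gf_def)
  qed
  show ?thesis unfolding is_equivalence_def using add_fun aG n1 n2 by blast
qed

lemma equivalenceD:
  assumes "is_equivalence C D E"
  shows "fully_faithful C D E" ess
proof -
  obtain Gf where aG: "additive_functor D C Gf"
    and n1: "naturally_isomorphic C C (fctr_comp Gf E) fctr_id" and n2: "naturally_isomorphic D D (fctr_comp E Gf) fctr_id"
    using assms unfolding is_equivalence_def by blast
  obtain \<eta> where N1: "\<forall>X\<in>Obj C. iso_arr C (FOb Gf (FOb E X)) X (\<eta> X)"
    "\<forall>X\<in>Obj C. \<forall>Y\<in>Obj C. \<forall>f\<in>arr C X Y. \<eta> Y \<cdot>\<^bsub>C\<^esub> FAr Gf (FAr E f) = f \<cdot>\<^bsub>C\<^esub> \<eta> X"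
    using n1 unfolding naturally_isomorphic_def fctr_comp_def fctr_id_def fctr.simps by blast
  note \<eta> = N1(1)[rule_format]
  have \<eta>n: "\<eta> Y \<cdot>\<^bsub>C\<^esub> FAr Gf (FAr E f) = f \<cdot>\<^bsub>C\<^esub> \<eta> X" if "ar f X Y" for X Y f
    using N1(2) that by (simp add: ar_def)
  obtain \<epsilon> where N2: "\<forall>F\<in>Obj D. iso_arr D (FOb E (FOb Gf F)) F (\<epsilon> F)"
    "\<forall>F\<in>Obj D. \<forall>G\<in>Obj D. \<forall>m\<in>arr D F G. \<epsilon> G \<cdot>\<^bsub>D\<^esub> FAr E (FAr Gf m) = m \<cdot>\<^bsub>D\<^esub> \<epsilon> F"
    using n2 unfolding naturally_isomorphic_def fctr_comp_def fctr_id_def fctr.simps by blast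
  note \<epsilon> = N2(1)[rule_format] and \<epsilon>n = N2(2)[rule_format]
  have Go: "FOb Gf F \<in> Obj C" if "F \<in> Obj D" for F using aG that unfolding additive_functor_def by simp
  have Ga: "ar (FAr Gf m) (FOb Gf F) (FOb Gf G)" if "F \<in> Obj D" "G \<in> Obj D" "m \<in> arr D F G" for F G m
    using aG that Go unfolding additive_functor_def hom_def ar_def by blast
  show ess unfolding ess_def using \<epsilon> Go by blast
  \<comment> \<open>\<open>Gf\<close> followed by \<open>E\<close> is isomorphic to the identity, so
    \<open>Gf\<close> is faithful. Fullness of \<open>E\<close> can then be verified after applying
    \<open>Gf\<close>.\<close>
  have Gfaith: "m = n" if F: "F \<in> Obj D" and G: "G \<in> Obj D" and m: "m \<in> arr D F G" and n: "n \<in> arr D F G"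
    and e: "FAr Gf m = FAr Gf n" for F G m n
  proof -
    obtain d where d: "\<epsilon> F \<in> arr D (FOb E (FOb Gf F)) F" "d \<in> arr D F (FOb E (FOb Gf F))" "\<epsilon> F \<cdot>\<^bsub>D\<^esub> d = Ident D F"
      using \<epsilon>[OF F] unfolding iso_arr_def by blast
    note EF = E_ob[OF Go[OF F]]
    have "m \<cdot>\<^bsub>D\<^esub> \<epsilon> F = n \<cdot>\<^bsub>D\<^esub> \<epsilon> F" using \<epsilon>n[OF F G m] \<epsilon>n[OF F G n] e by simp
    then have "(m \<cdot>\<^bsub>D\<^esub> \<epsilon> F) \<cdot>\<^bsub>D\<^esub> d = (n \<cdot>\<^bsub>D\<^esub> \<epsilon> F) \<cdot>\<^bsub>D\<^esub> d" by simp
    then show ?thesis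
      using l_assoc[OF F EF F G d(2,1) m] l_assoc[OF F EF F G d(2,1) n] d(3) l_idr[OF F G m] l_idr[OF F G n] by simp
  qed
  have "bij_betw (FAr E) (arr C X Y) (arr D (FOb E X) (FOb E Y))" if X: "X \<in> Obj C" and Y: "Y \<in> Obj C" for X Y
    unfolding bij_betw_def
  proof
    note EX = E_ob[OF X] and EY = E_ob[OF Y]
    obtain v where v: "ar (\<eta> X) (FOb Gf (FOb E X)) X" "ar v X (FOb Gf (FOb E X))" "\<eta> X \<cdot>\<^bsub>C\<^esub> v = Ident C X"
      "v \<cdot>\<^bsub>C\<^esub> \<eta> X = Ident C (FOb Gf (FOb E X))"
      using iso_arrE[OF \<eta>[OF X] Go[OF EX] X] by metis
    obtain w where w: "ar (\<eta> Y) (FOb Gf (FOb E Y)) Y" "ar w Y (FOb Gf (FOb E Y))" "\<eta> Y \<cdot>\<^bsub>C\<^esub> w = Ident C Y"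
      "w \<cdot>\<^bsub>C\<^esub> \<eta> Y = Ident C (FOb Gf (FOb E Y))"
      using iso_arrE[OF \<eta>[OF Y] Go[OF EY] Y] by metis
    show "inj_on (FAr E) (arr C X Y)"
    proof (rule inj_onI)
      fix f g assume "f \<in> arr C X Y" "g \<in> arr C X Y" and e: "FAr E f = FAr E g"
      then have f: "ar f X Y" and g: "ar g X Y" using X Y by (simp_all add: ar_def)
      have "f \<cdot>\<^bsub>C\<^esub> \<eta> X = g \<cdot>\<^bsub>C\<^esub> \<eta> X" using \<eta>n[OF f] \<eta>n[OF g] e by simp
      then have "(f \<cdot>\<^bsub>C\<^esub> \<eta> X) \<cdot>\<^bsub>C\<^esub> v = (g \<cdot>\<^bsub>C\<^esub> \<eta> X) \<cdot>\<^bsub>C\<^esub> v" by simp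
      then show "f = g" using comp_assoc[OF v(2,1) f] comp_assoc[OF v(2,1) g] v(3) comp_id(1)[OF f] comp_id(1)[OF g] by simp
    qed
    have "\<exists>f. f \<in> arr C X Y \<and> FAr E f = m" if m: "m \<in> arr D (FOb E X) (FOb E Y)" for m
    proof -
      note Gm = Ga[OF EX EY m]
      \<comment> \<open>The candidate preimage is \<open>Gf m\<close> conjugated by
        \<open>\<eta>\<close>. Naturality of \<open>\<eta>\<close> shows that \<open>Gf\<close>
        takes the same value on \<open>FAr E f\<close> and on \<open>m\<close>.\<close>
      define f where "f = \<eta> Y \<cdot>\<^bsub>C\<^esub> (FAr Gf m \<cdot>\<^bsub>C\<^esub> v)"
      have gv: "ar (FAr Gf m \<cdot>\<^bsub>C\<^esub> v) X (FOb Gf (FOb E Y))" by (rule ar_comp[OF v(2) Gm])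
      have f: "ar f X Y" unfolding f_def by (rule ar_comp[OF gv w(1)])
      note GEf = Ga[OF EX EY E_ar[OF f]]
      have "f \<cdot>\<^bsub>C\<^esub> \<eta> X = \<eta> Y \<cdot>\<^bsub>C\<^esub> FAr Gf m"
        unfolding f_def comp_assoc[OF v(1) gv w(1)] comp_assoc[OF v(1,2) Gm] v(4) comp_id(1)[OF Gm] ..
      then have "\<eta> Y \<cdot>\<^bsub>C\<^esub> FAr Gf (FAr E f) = \<eta> Y \<cdot>\<^bsub>C\<^esub> FAr Gf m" unfolding \<eta>n[OF f] .
      then have "w \<cdot>\<^bsub>C\<^esub> (\<eta> Y \<cdot>\<^bsub>C\<^esub> FAr Gf (FAr E f)) = w \<cdot>\<^bsub>C\<^esub> (\<eta> Y \<cdot>\<^bsub>C\<^esub> FAr Gf m)" by simp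
      then have "FAr Gf (FAr E f) = FAr Gf m"
        unfolding comp_assoc[OF GEf w(1,2), symmetric] comp_assoc[OF Gm w(1,2), symmetric] w(4) comp_id(2)[OF GEf] comp_id(2)[OF Gm] .
      then have "FAr E f = m" by (rule Gfaith[OF EX EY E_ar[OF f] m])
      then show ?thesis using f by (auto simp: ar_def)
    qed
    then show "FAr E ` arr C X Y = arr D (FOb E X) (FOb E Y)"
      using E_ar X Y by (force simp: ar_def)
  qed
  then show "fully_faithful C D E" unfolding fully_faithful_def using add_fun by blast
qed

text \<open>Fullness brings the factorization back to \<open>C\<close> and faithfulness brings back
  the equations. Preservation of zero arrows is a hypothesis because the hom-sets of
  \<open>D\<close> are not assumed to be groups, so it does not follow from additivity.\<close>

lemma reflect_kernel:
  assumes ff: "fully_faithful C D E" and z: "\<And>X Y. X \<in> Obj C \<Longrightarrow> Y \<in> Obj C \<Longrightarrow> FAr E (zr X Y) = zero_arr D (FOb E X) (FOb E Y)"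
    and k: "ar k K X" and f: "ar f X Y"
    and ker: "is_kernel D (FOb E K) (FOb E X) (FOb E Y) (FAr E k) (FAr E f)"
  shows "is_kernel C K X Y k f"
proof -
  note X = arD(1)[OF f] and Y = arD(2)[OF f] and K = arD(1)[OF k]
  have univ: "\<exists>!u. u \<in> arr D T (FOb E K) \<and> FAr E k \<cdot>\<^bsub>D\<^esub> u = t"
    if "T \<in> Obj D" "t \<in> arr D T (FOb E X)" "FAr E f \<cdot>\<^bsub>D\<^esub> t = zero_arr D T (FOb E Y)" for T t
    using ker that unfolding is_kernel_def by blast
  have fk: "f \<cdot>\<^bsub>C\<^esub> k = zr K Y"
    by (rule ff_inj[OF ff ar_comp[OF k f] ar_zr[OF K Y]]) (use ker in \<open>simp add: E_comp[OF k f] z[OF K Y] is_kernel_def\<close>)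
  have u1: "\<exists>!u. u \<in> arr D (FOb E T) (FOb E K) \<and> FAr E k \<cdot>\<^bsub>D\<^esub> u = FAr E t" if t: "ar t T X" and ft: "f \<cdot>\<^bsub>C\<^esub> t = zr T Y" for T t
    by (rule univ[OF E_ob[OF arD(1)[OF t]] E_ar[OF t]]) (simp add: E_comp[OF t f, symmetric] ft z arD(1)[OF t] Y)
  show ?thesis
  proof (rule kernelI[OF k f fk])
    fix T t assume t: "ar t T X" and ft: "f \<cdot>\<^bsub>C\<^esub> t = zr T Y"
    obtain m where m: "m \<in> arr D (FOb E T) (FOb E K)" "FAr E k \<cdot>\<^bsub>D\<^esub> m = FAr E t" using u1[OF t ft] by blast
    obtain u where u: "ar u T K" "FAr E u = m" by (rule ff_surjE[OF ff arD(1)[OF t] K m(1)])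
    have "k \<cdot>\<^bsub>C\<^esub> u = t" by (rule ff_inj[OF ff ar_comp[OF u(1) k] t]) (simp add: E_comp[OF u(1) k] u(2) m(2))
    then show "\<exists>u. ar u T K \<and> k \<cdot>\<^bsub>C\<^esub> u = t" using u(1) by blast
  next
    fix T u assume u: "ar u T K" and ku: "k \<cdot>\<^bsub>C\<^esub> u = zr T X"
    note T = arD(1)[OF u]
    have 0: "f \<cdot>\<^bsub>C\<^esub> zr T X = zr T Y" by (rule comp_zr[OF f T])
    note zz = ar_zr[OF T K]
    have "FAr E k \<cdot>\<^bsub>D\<^esub> FAr E u = FAr E (zr T X)" "FAr E k \<cdot>\<^bsub>D\<^esub> FAr E (zr T K) = FAr E (zr T X)"
      using E_comp[OF u k] E_comp[OF zz k] ku comp_zr[OF k T] by simp_all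
    then have "FAr E u = FAr E (zr T K)" using u1[OF ar_zr[OF T X] 0] E_ar[OF u] E_ar[OF zz] by blast
    then show "u = zr T K" by (rule ff_inj[OF ff u zz])
  qed
qed

lemma reflect_cokernel:
  assumes ff: "fully_faithful C D E" and z: "\<And>X Y. X \<in> Obj C \<Longrightarrow> Y \<in> Obj C \<Longrightarrow> FAr E (zr X Y) = zero_arr D (FOb E X) (FOb E Y)"
    and f: "ar f X Y" and c: "ar c Y Q"
    and cok: "is_cokernel D (FOb E X) (FOb E Y) (FOb E Q) (FAr E f) (FAr E c)"
  shows "is_cokernel C X Y Q f c"
proof -
  note X = arD(1)[OF f] and Y = arD(2)[OF f] and Q = arD(2)[OF c]
  have univ: "\<exists>!u. u \<in> arr D (FOb E Q) T \<and> u \<cdot>\<^bsub>D\<^esub> FAr E c = t"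
    if "T \<in> Obj D" "t \<in> arr D (FOb E Y) T" "t \<cdot>\<^bsub>D\<^esub> FAr E f = zero_arr D (FOb E X) T" for T t
    using cok that unfolding is_cokernel_def by blast
  have cf: "c \<cdot>\<^bsub>C\<^esub> f = zr X Q"
    by (rule ff_inj[OF ff ar_comp[OF f c] ar_zr[OF X Q]]) (use cok in \<open>simp add: E_comp[OF f c] z[OF X Q] is_cokernel_def\<close>)
  have u1: "\<exists>!u. u \<in> arr D (FOb E Q) (FOb E T) \<and> u \<cdot>\<^bsub>D\<^esub> FAr E c = FAr E t" if t: "ar t Y T" and tf: "t \<cdot>\<^bsub>C\<^esub> f = zr X T" for T t
    by (rule univ[OF E_ob[OF arD(2)[OF t]] E_ar[OF t]]) (simp add: E_comp[OF f t, symmetric] tf z arD(2)[OF t] X)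
  show ?thesis
  proof (rule cokernelI[OF f c cf])
    fix T t assume t: "ar t Y T" and tf: "t \<cdot>\<^bsub>C\<^esub> f = zr X T"
    obtain m where m: "m \<in> arr D (FOb E Q) (FOb E T)" "m \<cdot>\<^bsub>D\<^esub> FAr E c = FAr E t" using u1[OF t tf] by blast
    obtain u where u: "ar u Q T" "FAr E u = m" by (rule ff_surjE[OF ff Q arD(2)[OF t] m(1)])
    have "u \<cdot>\<^bsub>C\<^esub> c = t" by (rule ff_inj[OF ff ar_comp[OF c u(1)] t]) (simp add: E_comp[OF c u(1)] u(2) m(2))
    then show "\<exists>u. ar u Q T \<and> u \<cdot>\<^bsub>C\<^esub> c = t" using u(1) by blast
  next
    fix T u assume u: "ar u Q T" and uc: "u \<cdot>\<^bsub>C\<^esub> c = zr Y T"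
    note T = arD(2)[OF u]
    have 0: "zr Y T \<cdot>\<^bsub>C\<^esub> f = zr X T" by (rule zr_comp[OF f T])
    note zz = ar_zr[OF Q T]
    have "FAr E u \<cdot>\<^bsub>D\<^esub> FAr E c = FAr E (zr Y T)" "FAr E (zr Q T) \<cdot>\<^bsub>D\<^esub> FAr E c = FAr E (zr Y T)"
      using E_comp[OF c u] E_comp[OF c zz] uc zr_comp[OF c T] by simp_all
    then have "FAr E u = FAr E (zr Q T)" using u1[OF ar_zr[OF Y T] 0] E_ar[OF u] E_ar[OF zz] by blast
    then show "u = zr Q T" by (rule ff_inj[OF ff u zz])
  qed
qed

end

context loc_cat
begin

section \<open>Exactness in the Serre quotient\<close>

lemma Q_comp:
  assumes F: "F \<in> MO" and G: "G \<in> MO" and H: "H \<in> MO" and s: "nt F G \<sigma>" and t: "nt G H \<tau>"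
  shows "quot_map G H \<tau> \<cdot>\<^bsub>D\<^esub> quot_map F G \<sigma> = quot_map F H (nat_mk F (\<lambda>W a. \<tau> W (\<sigma> W a)))"
proof (rule sym, rule quot_arr_eqI)
  note q = quot_arr_quot_map[OF F G s] and q' = quot_arr_quot_map[OF G H t]
  note st = nt_comp[OF mod_psh[OF F] s t]
  show "quot_arr (quot_map F H (nat_mk F (\<lambda>W a. \<tau> W (\<sigma> W a)))) F H" by (rule quot_arr_quot_map[OF F H st])
  show R: "quot_arr (quot_map G H \<tau> \<cdot>\<^bsub>D\<^esub> quot_map F G \<sigma>) F H" by (rule quot_arr_comp[OF q q'])
  fix W a b assume "(W, a, b) \<in> arr_graph F H (quot_map F H (nat_mk F (\<lambda>W a. \<tau> W (\<sigma> W a))))"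
  then have a: "el F W a" and b: "el H W b" and l: "loc_eq H W (\<tau> W (\<sigma> W a)) b"
    unfolding arr_graph_quot_map[OF F H st] by (auto simp: nat_mk_app)
  have "(W, a, \<tau> W (\<sigma> W a)) \<in> arr_graph F H (quot_map G H \<tau> \<cdot>\<^bsub>D\<^esub> quot_map F G \<sigma>)"
    by (rule arr_graph_compI[OF q q' arr_graph_quot_map_self[OF F G s a] arr_graph_quot_map_self[OF G H t nt_el[OF s a]]])
  then show "(W, a, b) \<in> arr_graph F H (quot_map G H \<tau> \<cdot>\<^bsub>D\<^esub> quot_map F G \<sigma>)" by (rule arr_graph_loc_eq[OF R _ l b])
qed

lemma Q_add:
  assumes F: "F \<in> MO" and G: "G \<in> MO" and s: "nt F G \<sigma>" and t: "nt F G \<tau>"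
  shows "quot_map F G (nat_mk F (\<lambda>W a. plus_at G W (\<sigma> W a) (\<tau> W a))) = quot_map F G \<sigma> \<otimes>\<^bsub>Hom D F G\<^esub> quot_map F G \<tau>"
proof (rule quot_arr_eqI)
  note q = quot_arr_quot_map[OF F G s] and q' = quot_arr_quot_map[OF F G t]
  note st = nt_add[OF mod_psh[OF F] mod_psh[OF G] s t]
  show "quot_arr (quot_map F G (nat_mk F (\<lambda>W a. plus_at G W (\<sigma> W a) (\<tau> W a)))) F G" by (rule quot_arr_quot_map[OF F G st])
  show R: "quot_arr (quot_map F G \<sigma> \<otimes>\<^bsub>Hom D F G\<^esub> quot_map F G \<tau>) F G" by (rule D_add(1)[OF q q'])
  fix W a b assume "(W, a, b) \<in> arr_graph F G (quot_map F G (nat_mk F (\<lambda>W a. plus_at G W (\<sigma> W a) (\<tau> W a))))"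
  then have a: "el F W a" and b: "el G W b" and l: "loc_eq G W (plus_at G W (\<sigma> W a) (\<tau> W a)) b"
    unfolding arr_graph_quot_map[OF F G st] by (auto simp: nat_mk_app)
  have "(W, a, plus_at G W (\<sigma> W a) (\<tau> W a)) \<in> arr_graph F G (quot_map F G \<sigma> \<otimes>\<^bsub>Hom D F G\<^esub> quot_map F G \<tau>)"
    by (rule arr_graph_addI[OF q q' arr_graph_quot_map_self[OF F G s a] arr_graph_quot_map_self[OF F G t a]])
  then show "(W, a, b) \<in> arr_graph F G (quot_map F G \<sigma> \<otimes>\<^bsub>Hom D F G\<^esub> quot_map F G \<tau>)" by (rule arr_graph_loc_eq[OF R _ l b])
qed

abbreviation zero_map where "zero_map F G \<equiv> nat_mk F (\<lambda>W a. zero_at G W)"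

lemma arr_graph_zero:
  assumes F: "F \<in> MO" and G: "G \<in> MO"
  shows "(W, a, b) \<in> arr_graph F G (quot_map F G (zero_map F G)) \<longleftrightarrow> el F W a \<and> el G W b \<and> loc_eq G W (zero_at G W) b"
  using arr_graph_quot_map[OF F G nt_zero_map[OF mod_psh[OF F] mod_psh[OF G]], of W a b] by (auto simp: nat_mk_app)

lemma quot_arr_zero: "F \<in> MO \<Longrightarrow> G \<in> MO \<Longrightarrow> quot_arr (quot_map F G (zero_map F G)) F G"
  by (intro quot_arr_quot_map nt_zero_map mod_psh)

lemma D_zero_left:
  assumes m: "quot_arr m F G" and H: "H \<in> MO"
  shows "quot_map G H (zero_map G H) \<cdot>\<^bsub>D\<^esub> m = quot_map F H (zero_map F H)"
proof (rule quot_arr_eqI)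
  note F = quot_arrD(1)[OF m] and G = quot_arrD(2)[OF m]
  note z = quot_arr_zero[OF G H]
  show "quot_arr (quot_map G H (zero_map G H) \<cdot>\<^bsub>D\<^esub> m) F H" by (rule quot_arr_comp[OF m z])
  show "quot_arr (quot_map F H (zero_map F H)) F H" by (rule quot_arr_zero[OF F H])
  fix W a c assume "(W, a, c) \<in> arr_graph F H (quot_map G H (zero_map G H) \<cdot>\<^bsub>D\<^esub> m)"
  then obtain e V b where a: "el F W a" and c: "el H W c" and e: "cov e V W" and bc: "(V, b, FAr H e c) \<in> arr_graph G H (quot_map G H (zero_map G H))"
    using arr_graph_compE[OF m z] by metis
  have "loc_eq H V (zero_at H V) (FAr H e c)" using bc unfolding arr_graph_zero[OF G H] by simp
  then have "loc_eq H W (zero_at H W) c"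
    using loc_eq_local[OF mod_psh[OF H] el_zero[OF mod_psh[OF H] elD(1)[OF a]] c e] act_zero[OF mod_psh[OF H] cov_ar[OF e]] by simp
  then show "(W, a, c) \<in> arr_graph F H (quot_map F H (zero_map F H))" unfolding arr_graph_zero[OF F H] using a c by simp
qed

text \<open>Locally zero has some value \<open>c\<close>. By additivity \<open>c + c\<close> is a
  value of zero as well, so single-valuedness makes \<open>c\<close> locally equal to its double,
  hence locally zero.\<close>

lemma arr_graph_zero_zero:
  assumes m: "quot_arr m F G" and W: "W \<in> Obj C"
  shows "(W, zero_at F W, zero_at G W) \<in> arr_graph F G m"
proof -
  note pF = mod_psh[OF quot_arrD(1)[OF m]] and pG = mod_psh[OF quot_arrD(2)[OF m]]
  note L = quot_arr_local_graph[OF m]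
  obtain e V c where e: "cov e V W" and c0: "(V, FAr F e (zero_at F W), c) \<in> arr_graph F G m"
    by (rule local_graph_totE[OF L el_zero[OF pF W]])
  have V: "V \<in> Obj C" using arD(1)[OF cov_ar[OF e]] .
  have c: "(V, zero_at F V, c) \<in> arr_graph F G m" using c0 act_zero[OF pF cov_ar[OF e]] by simp
  note ec = arr_graph_el(2)[OF m c] and zF = el_zero[OF pF V] and zG = el_zero[OF pG V]
  have "(V, zero_at F V, plus_at G V c c) \<in> arr_graph F G m"
    using local_graphD(6)[OF L c c] plus_zero(1)[OF pF zF] by simp
  then have l: "loc_eq G V (plus_at G V c c) c" using c by (rule local_graphD(5)[OF L])
  have "loc_eq G V (plus_at G V (plus_at G V c c) (inv_at G V c)) (plus_at G V c (inv_at G V c))"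
    by (rule loc_eq_plus[OF pG el_plus[OF pG ec ec] ec el_inv[OF pG ec] el_inv[OF pG ec] l loc_eq_refl[OF V]])
  moreover have "plus_at G V (plus_at G V c c) (inv_at G V c) = c"
    using plus_assoc[OF pG ec ec el_inv[OF pG ec]] plus_inv(1)[OF pG ec] plus_zero(1)[OF pG ec] by simp
  ultimately have "loc_eq G V c (zero_at G V)" using plus_inv(1)[OF pG ec] by simp
  then have "(V, zero_at F V, zero_at G V) \<in> arr_graph F G m" by (rule arr_graph_loc_eq[OF m c _ zG])
  then show ?thesis
    using arr_graph_local[OF m el_zero[OF pF W] el_zero[OF pG W] e] act_zero[OF pF cov_ar[OF e]] act_zero[OF pG cov_ar[OF e]] by simp
qed

lemma D_zero_right:
  assumes m: "quot_arr m G H" and F: "F \<in> MO"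
  shows "m \<cdot>\<^bsub>D\<^esub> quot_map F G (zero_map F G) = quot_map F H (zero_map F H)"
proof (rule sym, rule quot_arr_eqI)
  note G = quot_arrD(1)[OF m] and H = quot_arrD(2)[OF m]
  note z = quot_arr_zero[OF F G]
  show R: "quot_arr (m \<cdot>\<^bsub>D\<^esub> quot_map F G (zero_map F G)) F H" by (rule quot_arr_comp[OF z m])
  show "quot_arr (quot_map F H (zero_map F H)) F H" by (rule quot_arr_zero[OF F H])
  fix W a c assume "(W, a, c) \<in> arr_graph F H (quot_map F H (zero_map F H))"
  then have a: "el F W a" and c: "el H W c" and l: "loc_eq H W (zero_at H W) c" unfolding arr_graph_zero[OF F H] by simp_all
  note W = elD(1)[OF a]
  have "(W, a, zero_at G W) \<in> arr_graph F G (quot_map F G (zero_map F G))"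
    unfolding arr_graph_zero[OF F G] using a el_zero[OF mod_psh[OF G] W] loc_eq_refl[OF W] by simp
  then have "(W, a, zero_at H W) \<in> arr_graph F H (m \<cdot>\<^bsub>D\<^esub> quot_map F G (zero_map F G))"
    by (rule arr_graph_compI[OF z m _ arr_graph_zero_zero[OF m W]])
  then show "(W, a, c) \<in> arr_graph F H (m \<cdot>\<^bsub>D\<^esub> quot_map F G (zero_map F G))" by (rule arr_graph_loc_eq[OF R _ l c])
qed

lemma lincat0_D: "lincat0 D"
proof -
  interpret lincat D by (rule lincat_D)
  show ?thesis
  proof
    fix F G assume F: "F \<in> Obj D" and G: "G \<in> Obj D"
    then have F': "F \<in> MO" and G': "G \<in> MO" by (simp_all add: D_simps)
    show "zero_arr D F G \<in> arr D F G" unfolding D_simps by (rule quot_arrD(3)[OF quot_arr_zero[OF F' G']])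
    fix H m assume H: "H \<in> Obj D"
    then have H': "H \<in> MO" by (simp add: D_simps)
    show "zero_arr D G H \<cdot>\<^bsub>D\<^esub> m = zero_arr D F H" if "m \<in> arr D F G"
      unfolding D_simps by (rule D_zero_left[OF _ H']) (use that F' G' in \<open>simp add: quot_arr_def\<close>)
    show "m \<cdot>\<^bsub>D\<^esub> zero_arr D F G = zero_arr D F H" if "m \<in> arr D G H"
      unfolding D_simps by (rule D_zero_right[OF _ F']) (use that H' G' in \<open>simp add: quot_arr_def\<close>)
  qed
qed

lemma Q_iso:
  assumes F: "F \<in> MO" and G: "G \<in> MO" and s: "nt F G \<sigma>" and li: "loc_inj F \<sigma>" and ls: "loc_surj F G \<sigma>"
  shows "iso_arr D F G (quot_map F G \<sigma>)"
proof -
  note q = quot_arr_quot_map[OF F G s] and pF = mod_psh[OF F] and pG = mod_psh[OF G]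
  note iF = nt_id[OF pF]
  \<comment> \<open>The inverse has \<open>\<sigma>\<close> as denominator and the identity as
    numerator.\<close>
  have r: "isroof G F F \<sigma> (id_map F)" unfolding isroof_def using F G s li ls iF by simp
  let ?n = "roof_arr G F F \<sigma> (id_map F)"
  note n = quot_arr_roof_arr[OF r]
  note iG = nt_id[OF pG]
  have base: "(W, \<sigma> W a, a) \<in> arr_graph G F ?n" if "el F W a" for W a
    using roof_graph_base[OF r that] that unfolding arr_graph_roof_arr[OF r] by (simp add: nat_mk_app)
  have "quot_map F F (id_map F) = ?n \<cdot>\<^bsub>D\<^esub> quot_map F G \<sigma>"
  proof (rule quot_arr_eqI[OF quot_arr_quot_map[OF F F iF] quot_arr_comp[OF q n]])
    fix W a b assume "(W, a, b) \<in> arr_graph F F (quot_map F F (id_map F))"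
    then have ab: "el F W a" "el F W b" "loc_eq F W a b" unfolding arr_graph_quot_map[OF F F iF] by (auto simp: nat_mk_app)
    have "(W, a, a) \<in> arr_graph F F (?n \<cdot>\<^bsub>D\<^esub> quot_map F G \<sigma>)" by (rule arr_graph_compI[OF q n arr_graph_quot_map_self[OF F G s ab(1)] base[OF ab(1)]])
    then show "(W, a, b) \<in> arr_graph F F (?n \<cdot>\<^bsub>D\<^esub> quot_map F G \<sigma>)" by (rule arr_graph_loc_eq[OF quot_arr_comp[OF q n] _ ab(3,2)])
  qed
  moreover have "quot_map F G \<sigma> \<cdot>\<^bsub>D\<^esub> ?n = quot_map G G (id_map G)"
  proof (rule sym, rule quot_arr_eqI[OF quot_arr_quot_map[OF G G iG] quot_arr_comp[OF n q]])
    note nq = quot_arr_comp[OF n q]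
    fix W a b assume "(W, a, b) \<in> arr_graph G G (quot_map G G (id_map G))"
    then have a: "el G W a" and b: "el G W b" and l: "loc_eq G W a b" unfolding arr_graph_quot_map[OF G G iG] by (auto simp: nat_mk_app)
    obtain e V x where e: "cov e V W" "el F V x" "\<sigma> V x = FAr G e a" using loc_surjE[OF ls a] .
    have "(V, FAr G e a, FAr G e a) \<in> arr_graph G G (quot_map F G \<sigma> \<cdot>\<^bsub>D\<^esub> ?n)"
      using arr_graph_compI[OF n q base[OF e(2)] arr_graph_quot_map_self[OF F G s e(2)]] e(3) by simp
    then have "(W, a, a) \<in> arr_graph G G (quot_map F G \<sigma> \<cdot>\<^bsub>D\<^esub> ?n)" by (rule arr_graph_local[OF nq a a e(1)])
    then show "(W, a, b) \<in> arr_graph G G (quot_map F G \<sigma> \<cdot>\<^bsub>D\<^esub> ?n)" by (rule arr_graph_loc_eq[OF nq _ l b])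
  qed
  ultimately show ?thesis
    unfolding iso_arr_def D_simps using quot_arrD(3)[OF q] quot_arrD(3)[OF n] by (intro conjI bexI[of _ ?n]) simp_all
qed

text \<open>The conditions say that \<open>K\<close>, \<open>F\<close>, \<open>G\<close> form a left
  exact sequence up to coverings. A roof into \<open>F\<close> with zero composite is pulled back
  along \<open>k\<close>; local exactness makes the pullback a denominator over
  \<open>T\<close>.\<close>

lemma D_kernel:
  assumes K: "K \<in> MO" and F: "F \<in> MO" and G: "G \<in> MO" and k: "nt K F k" and s: "nt F G \<sigma>"
    and li: "loc_inj K k" and sk: "\<And>W c. el K W c \<Longrightarrow> loc_eq G W (\<sigma> W (k W c)) (zero_at G W)"
    and ex: "\<And>W a. el F W a \<Longrightarrow> loc_eq G W (\<sigma> W a) (zero_at G W) \<Longrightarrow> \<exists>V e c. cov e V W \<and> el K V c \<and> k V c = FAr F e a"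
  shows "is_kernel D K F G (quot_map K F k) (quot_map F G \<sigma>)"
proof -
  note qk = quot_arr_quot_map[OF K F k] and qs = quot_arr_quot_map[OF F G s]
  note pK = mod_psh[OF K] and pF = mod_psh[OF F] and pG = mod_psh[OF G]
  have z: "quot_map F G \<sigma> \<cdot>\<^bsub>D\<^esub> quot_map K F k = quot_map K G (zero_map K G)"
    unfolding Q_comp[OF K F G k s] quot_map_eq_iff[OF K G nt_comp[OF pK k s] nt_zero_map[OF pK pG]]
    using sk by (simp add: nat_mk_app)
  \<comment> \<open>The image in \<open>F\<close> determines an element of \<open>K\<close> up to
    local equality, which is enough to compare graphs.\<close>
  have uniq: "u = v" if u: "quot_arr u T K" and v: "quot_arr v T K" and e: "quot_map K F k \<cdot>\<^bsub>D\<^esub> u = quot_map K F k \<cdot>\<^bsub>D\<^esub> v" for T u v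
  proof (rule quot_arr_eqI[OF u v])
    fix W a c assume ac: "(W, a, c) \<in> arr_graph T K u"
    note a = arr_graph_el(1)[OF u ac] and c = arr_graph_el(2)[OF u ac]
    note pT = mod_psh[OF quot_arrD(1)[OF u]]
    have "(W, a, k W c) \<in> arr_graph T F (quot_map K F k \<cdot>\<^bsub>D\<^esub> v)"
      unfolding e[symmetric] by (rule arr_graph_compI[OF u qk ac arr_graph_quot_map_self[OF K F k c]])
    then obtain e V d where e: "cov e V W" and ad: "(V, FAr T e a, d) \<in> arr_graph T K v"
      and d: "(V, d, FAr F e (k W c)) \<in> arr_graph K F (quot_map K F k)" using arr_graph_compE[OF v qk] by metis
    have d': "el K V d" "loc_eq F V (k V d) (FAr F e (k W c))" using d unfolding arr_graph_quot_map[OF K F k] by simp_all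
    note ec = el_act[OF pK cov_ar[OF e] c]
    have "loc_eq F V (k V d) (k V (FAr K e c))" using d'(2) nt_nat[OF k cov_ar[OF e] c] by simp
    then have "loc_eq K V d (FAr K e c)" by (rule loc_inj_loc_eq[OF li k pK d'(1) ec])
    then have "(V, FAr T e a, FAr K e c) \<in> arr_graph T K v" by (rule arr_graph_loc_eq[OF v ad _ ec])
    then show "(W, a, c) \<in> arr_graph T K v" by (rule arr_graph_local[OF v a c e])
  qed
  show ?thesis
    unfolding is_kernel_def
  proof (intro conjI ballI impI)
    show "K \<in> Obj D" "F \<in> Obj D" "G \<in> Obj D" using K F G by (simp_all add: D_simps)
    show "quot_map K F k \<in> arr D K F" "quot_map F G \<sigma> \<in> arr D F G" using quot_arrD(3)[OF qk] quot_arrD(3)[OF qs] .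
    show "quot_map F G \<sigma> \<cdot>\<^bsub>D\<^esub> quot_map K F k = zero_arr D K G" unfolding z D_simps ..
    fix T t assume "T \<in> Obj D" and "t \<in> arr D T F" and tz: "quot_map F G \<sigma> \<cdot>\<^bsub>D\<^esub> t = zero_arr D T G"
    then have t: "quot_arr t T F" using F by (simp add: quot_arr_def D_simps)
    note T = quot_arrD(1)[OF t] and pT = mod_psh[OF quot_arrD(1)[OF t]]
    obtain H s0 \<tau> where r: "isroof T F H s0 \<tau>" and tq: "t = roof_arr T F H s0 \<tau>" and gt: "arr_graph T F t = roof_graph T F H s0 \<tau>"
      using quot_arrE[OF t] .
    note R = isroofD[OF r]
    obtain P p q where P: "P \<in> MO" "nt P H p" "nt P K q" "\<And>W c. el P W c \<Longrightarrow> \<tau> W (p W c) = k W (q W c)"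
      "\<And>W a b. el H W a \<Longrightarrow> el K W b \<Longrightarrow> \<tau> W a = k W b \<Longrightarrow> \<exists>c. el P W c \<and> p W c = a \<and> q W c = b"
      "\<And>W a b. el P W a \<Longrightarrow> el P W b \<Longrightarrow> p W a = p W b \<Longrightarrow> q W a = q W b \<Longrightarrow> a = b"
      by (rule pullbackE[OF mod_fp[OF R(3)] mod_fp[OF K] mod_fp[OF F] R(5) k]) (rule that; assumption)
    note pP = mod_psh[OF P(1)]
    have li': "loc_inj P p"
      unfolding loc_inj_def
    proof (intro allI impI)
      fix W x y assume x: "el P W x" and y: "el P W y" and e: "p W x = p W y"
      then have "k W (q W x) = k W (q W y)" using P(4)[OF x] P(4)[OF y] by simp
      then obtain f V where f: "cov f V W" "FAr K f (q W x) = FAr K f (q W y)"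
        using loc_eqE[OF loc_injD[OF li nt_el[OF P(3) x] nt_el[OF P(3) y]]] by metis
      note f0 = cov_ar[OF f(1)]
      have "FAr P f x = FAr P f y"
        by (rule P(6)[OF el_act[OF pP f0 x] el_act[OF pP f0 y]])
           (simp_all add: nt_nat[OF P(2) f0 x] nt_nat[OF P(2) f0 y] nt_nat[OF P(3) f0 x] nt_nat[OF P(3) f0 y] e f(2))
      then show "loc_eq P W x y" by (rule loc_eqI[OF f(1)])
    qed
    have ls': "loc_surj P H p"
      unfolding loc_surj_def
    proof (intro allI impI)
      fix W h assume h: "el H W h"
      \<comment> \<open>On graphs the vanishing of the composite says that
        \<open>\<sigma> (\<tau> h)\<close> is locally zero, so \<open>\<tau> h\<close> locally comes
        from \<open>K\<close>.\<close>
      have "(W, s0 W h, \<sigma> W (\<tau> W h)) \<in> arr_graph T G (quot_map F G \<sigma> \<cdot>\<^bsub>D\<^esub> t)"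
        using arr_graph_compI[OF t qs _ arr_graph_quot_map_self[OF F G s nt_el[OF R(5) h]]] roof_graph_base[OF r h] gt by simp
      then have "loc_eq G W (zero_at G W) (\<sigma> W (\<tau> W h))" unfolding tz D_simps arr_graph_zero[OF T G] by simp
      then obtain V e c where e: "cov e V W" "el K V c" "k V c = FAr F e (\<tau> W h)"
        using ex[OF nt_el[OF R(5) h] loc_eq_sym] by blast
      have "\<exists>x. el P V x \<and> p V x = FAr H e h \<and> q V x = c"
        by (rule P(5)[OF el_act[OF R(10) cov_ar[OF e(1)] h] e(2)]) (simp add: nt_nat[OF R(5) cov_ar[OF e(1)] h] e(3))
      then show "\<exists>V e x. cov e V W \<and> el P V x \<and> p V x = FAr H e h" using e(1) by blast
    qed
    let ?s = "nat_mk P (\<lambda>W x. s0 W (p W x))"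
    have ur: "isroof T K P ?s q"
      unfolding isroof_def using T K P(1,3) nt_comp[OF pP P(2) R(4)] loc_inj_comp[OF P(2) R(4) pP R(10) li' R(6)]
        loc_surj_comp[OF P(2) R(4) pP R(10,8) ls' R(7)] by simp
    let ?u = "roof_arr T K P ?s q"
    note u = quot_arr_roof_arr[OF ur]
    have ku: "quot_map K F k \<cdot>\<^bsub>D\<^esub> ?u = t"
    proof (rule sym, rule quot_arr_eqI[OF t quot_arr_comp[OF u qk]])
      note ukk = quot_arr_comp[OF u qk]
      fix W a b assume "(W, a, b) \<in> arr_graph T F t"
      then obtain e V h where a: "el T W a" and b: "el F W b" and e: "cov e V W" and h: "el H V h"
        and sh: "s0 V h = FAr T e a" and th: "\<tau> V h = FAr F e b" unfolding gt by (rule roof_graphE)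
      obtain e' V' x where e': "cov e' V' V" and x: "el P V' x" and px: "p V' x = FAr H e' h" using loc_surjE[OF ls' h] .
      have "(V', s0 V' (p V' x), q V' x) \<in> arr_graph T K ?u" using roof_graph_base[OF ur x] x unfolding arr_graph_roof_arr[OF ur] by (simp add: nat_mk_app)
      then have "(V', s0 V' (p V' x), k V' (q V' x)) \<in> arr_graph T F (quot_map K F k \<cdot>\<^bsub>D\<^esub> ?u)"
        by (rule arr_graph_compI[OF u qk _ arr_graph_quot_map_self[OF K F k nt_el[OF P(3) x]]])
      then have "(V', FAr T e' (FAr T e a), FAr F e' (FAr F e b)) \<in> arr_graph T F (quot_map K F k \<cdot>\<^bsub>D\<^esub> ?u)"
        using P(4)[OF x] px sh th nt_nat[OF R(4) cov_ar[OF e'] h] nt_nat[OF R(5) cov_ar[OF e'] h] by simp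
      then have "(V, FAr T e a, FAr F e b) \<in> arr_graph T F (quot_map K F k \<cdot>\<^bsub>D\<^esub> ?u)"
        by (rule arr_graph_local[OF ukk el_act[OF pT cov_ar[OF e] a] el_act[OF pF cov_ar[OF e] b] e'])
      then show "(W, a, b) \<in> arr_graph T F (quot_map K F k \<cdot>\<^bsub>D\<^esub> ?u)" by (rule arr_graph_local[OF ukk a b e])
    qed
    show "\<exists>!u. u \<in> arr D T K \<and> quot_map K F k \<cdot>\<^bsub>D\<^esub> u = t"
    proof (rule ex1I[of _ ?u])
      show "?u \<in> arr D T K \<and> quot_map K F k \<cdot>\<^bsub>D\<^esub> ?u = t" using quot_arrD(3)[OF u] ku by simp
      fix v assume v: "v \<in> arr D T K \<and> quot_map K F k \<cdot>\<^bsub>D\<^esub> v = t"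
      then have "quot_arr v T K" using T K by (simp add: quot_arr_def)
      then show "v = ?u" using uniq[OF _ u] v ku by simp
    qed
  qed
qed

lemma arr_graph_loc_eq1:
  assumes m: "quot_arr m F G" and ab: "(W, a, b) \<in> arr_graph F G m" and l: "loc_eq F W a a'" and a': "el F W a'"
  shows "(W, a', b) \<in> arr_graph F G m"
proof -
  obtain e V where e: "cov e V W" "FAr F e a = FAr F e a'" using loc_eqE[OF l] .
  have "(V, FAr F e a', FAr G e b) \<in> arr_graph F G m" using arr_graph_act[OF m ab cov_ar[OF e(1)]] e(2) by simp
  then show ?thesis by (rule arr_graph_local[OF m a' arr_graph_el(2)[OF m ab] e(1)])
qed

text \<open>This is not a formal dual of \<open>D_kernel\<close>, since roofs carry their
  denominator over the source. The factorization from \<open>Q\<close> to \<open>T\<close> needs a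
  denominator over \<open>Q\<close>, found as the image of \<open>H\<close> in the sum of
  \<open>Q\<close> and \<open>T\<close>. Its local injectivity over \<open>Q\<close> is where the
  vanishing on \<open>F\<close> enters.\<close>

lemma D_cokernel:
  assumes F: "F \<in> MO" and G: "G \<in> MO" and Q: "Q \<in> MO" and s: "nt F G \<sigma>" and c: "nt G Q c"
    and ls: "loc_surj G Q c" and cs: "\<And>W a. el F W a \<Longrightarrow> loc_eq Q W (c W (\<sigma> W a)) (zero_at Q W)"
    and ex: "\<And>W b. el G W b \<Longrightarrow> loc_eq Q W (c W b) (zero_at Q W) \<Longrightarrow> \<exists>V e a. cov e V W \<and> el F V a \<and> \<sigma> V a = FAr G e b"
  shows "is_cokernel D F G Q (quot_map F G \<sigma>) (quot_map G Q c)"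
proof -
  note qs = quot_arr_quot_map[OF F G s] and qc = quot_arr_quot_map[OF G Q c]
  note pF = mod_psh[OF F] and pG = mod_psh[OF G] and pQ = mod_psh[OF Q]
  have z: "quot_map G Q c \<cdot>\<^bsub>D\<^esub> quot_map F G \<sigma> = quot_map F Q (zero_map F Q)"
    unfolding Q_comp[OF F G Q s c] quot_map_eq_iff[OF F Q nt_comp[OF pF s c] nt_zero_map[OF pF pQ]]
    using cs by (simp add: nat_mk_app)
  \<comment> \<open>An element of \<open>Q\<close> locally comes from \<open>G\<close>, and on
    \<open>G\<close> the two composites agree.\<close>
  have uniq: "u = v" if u: "quot_arr u Q T" and v: "quot_arr v Q T" and e: "u \<cdot>\<^bsub>D\<^esub> quot_map G Q c = v \<cdot>\<^bsub>D\<^esub> quot_map G Q c" for T u v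
  proof (rule quot_arr_eqI[OF u v])
    fix W x d assume xd: "(W, x, d) \<in> arr_graph Q T u"
    note x = arr_graph_el(1)[OF u xd] and d = arr_graph_el(2)[OF u xd]
    note pT = mod_psh[OF quot_arrD(2)[OF u]]
    obtain e V b where e: "cov e V W" and b: "el G V b" and cb: "c V b = FAr Q e x" using loc_surjE[OF ls x] .
    have "(V, c V b, FAr T e d) \<in> arr_graph Q T u" using arr_graph_act[OF u xd cov_ar[OF e]] cb by simp
    then have "(V, b, FAr T e d) \<in> arr_graph G T (v \<cdot>\<^bsub>D\<^esub> quot_map G Q c)"
      unfolding \<open>u \<cdot>\<^bsub>D\<^esub> quot_map G Q c = v \<cdot>\<^bsub>D\<^esub> quot_map G Q c\<close>[symmetric]
      by (rule arr_graph_compI[OF qc u arr_graph_quot_map_self[OF G Q c b]])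
    then obtain e' V' x' where e': "cov e' V' V" and bx: "(V', FAr G e' b, x') \<in> arr_graph G Q (quot_map G Q c)"
      and x'd: "(V', x', FAr T e' (FAr T e d)) \<in> arr_graph Q T v" using arr_graph_compE[OF qc v] by metis
    have l: "loc_eq Q V' x' (FAr Q e' (FAr Q e x))"
      using bx loc_eq_sym nt_nat[OF c cov_ar[OF e'] b] cb unfolding arr_graph_quot_map[OF G Q c] by auto
    note ex1 = el_act[OF pQ cov_ar[OF e] x] and ed1 = el_act[OF pT cov_ar[OF e] d]
    show "(W, x, d) \<in> arr_graph Q T v"
      by (rule arr_graph_local[OF v x d e arr_graph_local[OF v ex1 ed1 e' arr_graph_loc_eq1[OF v x'd l el_act[OF pQ cov_ar[OF e'] ex1]]]])
  qed
  show ?thesis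
    unfolding is_cokernel_def
  proof (intro conjI ballI impI)
    show "Q \<in> Obj D" "F \<in> Obj D" "G \<in> Obj D" using Q F G by (simp_all add: D_simps)
    show "quot_map G Q c \<in> arr D G Q" "quot_map F G \<sigma> \<in> arr D F G" using quot_arrD(3)[OF qc] quot_arrD(3)[OF qs] .
    show "quot_map G Q c \<cdot>\<^bsub>D\<^esub> quot_map F G \<sigma> = zero_arr D F Q" unfolding z D_simps ..
    fix T t assume "T \<in> Obj D" and "t \<in> arr D G T" and tz: "t \<cdot>\<^bsub>D\<^esub> quot_map F G \<sigma> = zero_arr D F T"
    then have t: "quot_arr t G T" using G by (simp add: quot_arr_def D_simps)
    note T = quot_arrD(2)[OF t] and pT = mod_psh[OF quot_arrD(2)[OF t]]
    obtain H s0 \<tau> where r: "isroof G T H s0 \<tau>" and tq: "t = roof_arr G T H s0 \<tau>" and gt: "arr_graph G T t = roof_graph G T H s0 \<tau>"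
      using quot_arrE[OF t] .
    note R = isroofD[OF r]
    obtain X x where gx: "gen H X x" using fp_genE[OF mod_fp[OF R(3)]] .
    note x = genD(1)[OF gx]
    \<comment> \<open>\<open>P\<close> is generated by the two images of the generator of
      \<open>H\<close>. Thus its elements are the elements of \<open>H\<close> with those identified
      that have equal images in \<open>Q\<close> and in \<open>T\<close>.\<close>
    obtain P g p q where P: "P \<in> MO" "gen P X g" "nt P Q p" "nt P T q" "p X g = c X (s0 X x)" "q X g = \<tau> X x"
      and inj: "\<And>W a b. el P W a \<Longrightarrow> el P W b \<Longrightarrow> p W a = p W b \<Longrightarrow> q W a = q W b \<Longrightarrow> a = b"
      by (rule image_pairE[OF mod_fp[OF Q] mod_fp[OF T] nt_el[OF c nt_el[OF R(4) x]] nt_el[OF R(5) x]]) (rule that; assumption)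
    note pP = mod_psh[OF P(1)] and gg = genD(1)[OF P(2)]
    have pq: "p W (FAr P k g) = c W (s0 W (FAr H k x))" "q W (FAr P k g) = \<tau> W (FAr H k x)" if k: "ar k W X" for W k
      using nt_nat[OF P(3) k gg] nt_nat[OF P(4) k gg] P(5,6) nt_nat[OF R(4) k x] nt_nat[OF R(5) k x]
        nt_nat[OF c k nt_el[OF R(4) x]] by simp_all
    have lift: "\<exists>y. el P W y \<and> p W y = c W (s0 W h) \<and> q W y = \<tau> W h" if h: "el H W h" for W h
    proof -
      obtain k where k: "ar k W X" "h = FAr H k x" using genD(2)[OF gx h] by blast
      then show ?thesis using pq[OF k(1)] el_act[OF pP k(1) gg] by blast
    qed
    have desc: "\<exists>h. el H W h \<and> p W y = c W (s0 W h) \<and> q W y = \<tau> W h" if y: "el P W y" for W y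
    proof -
      obtain k where k: "ar k W X" "y = FAr P k g" using genD(2)[OF P(2) y] by blast
      then show ?thesis using pq[OF k(1)] el_act[OF R(10) k(1) x] by blast
    qed
    have ls': "loc_surj P Q p"
      unfolding loc_surj_def
    proof (intro allI impI)
      fix W d assume d: "el Q W d"
      obtain e V b where e: "cov e V W" and b: "el G V b" and cb: "c V b = FAr Q e d" using loc_surjE[OF ls d] .
      obtain e' V' h where e': "cov e' V' V" and h: "el H V' h" and sh: "s0 V' h = FAr G e' b" using loc_surjE[OF R(7) b] .
      obtain y where y: "el P V' y" "p V' y = c V' (s0 V' h)" using lift[OF h] by blast
      have "p V' y = FAr Q (e \<cdot> e') d"
        using y(2) sh nt_nat[OF c cov_ar[OF e'] b] cb act_comp[OF pQ cov_ar[OF e'] cov_ar[OF e] d] by simp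
      then show "\<exists>V e y. cov e V W \<and> el P V y \<and> p V y = FAr Q e d" using cov_comp[OF e e'] y(1) by blast
    qed
    have li': "loc_inj P p"
      unfolding loc_inj_def
    proof (intro allI impI)
      fix W y y' assume y: "el P W y" and y': "el P W y'" and e: "p W y = p W y'"
      obtain h where h: "el H W h" "p W y = c W (s0 W h)" "q W y = \<tau> W h" using desc[OF y] by blast
      obtain h' where h': "el H W h'" "p W y' = c W (s0 W h')" "q W y' = \<tau> W h'" using desc[OF y'] by blast
      let ?d = "plus_at H W h (inv_at H W h')"
      have d: "el H W ?d" using el_plus[OF R(10) h(1) el_inv[OF R(10) h'(1)]] .
      note W = elD(1)[OF y]
      note sh = nt_el[OF R(4) h(1)] and sh' = nt_el[OF R(4) h'(1)] and sd = nt_el[OF R(4) d]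
      have "c W (s0 W ?d) = zero_at Q W"
        unfolding nt_sub[OF R(4) R(10) pG h(1) h'(1)] nt_sub[OF c pG pQ sh sh']
          sub_zero_iff[OF pQ nt_el[OF c sh] nt_el[OF c sh']] using e h(2) h'(2) by simp
      then obtain V f a where f: "cov f V W" and a: "el F V a" and sa: "\<sigma> V a = FAr G f (s0 W ?d)"
        using ex[OF sd] loc_eq_refl[OF W, of Q "zero_at Q W"] by auto
      note f0 = cov_ar[OF f]
      note fd = el_act[OF R(10) f0 d]
      have "(V, s0 V (FAr H f ?d), \<tau> V (FAr H f ?d)) \<in> arr_graph G T t" unfolding gt by (rule roof_graph_base[OF r fd])
      then have "(V, \<sigma> V a, \<tau> V (FAr H f ?d)) \<in> arr_graph G T t" using sa nt_nat[OF R(4) f0 d] by simp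
      \<comment> \<open>The difference of two elements with equal image in \<open>Q\<close> locally
        comes from \<open>F\<close>, where \<open>t\<close> vanishes; hence their images in
        \<open>T\<close> agree locally.\<close>
      then have "(V, a, \<tau> V (FAr H f ?d)) \<in> arr_graph F T (t \<cdot>\<^bsub>D\<^esub> quot_map F G \<sigma>)"
        by (rule arr_graph_compI[OF qs t arr_graph_quot_map_self[OF F G s a]])
      then have "loc_eq T V (zero_at T V) (\<tau> V (FAr H f ?d))" unfolding tz D_simps arr_graph_zero[OF F T] by simp
      then have "loc_eq T V (FAr T f (\<tau> W ?d)) (FAr T f (zero_at T W))"
        using loc_eq_sym nt_nat[OF R(5) f0 d] act_zero[OF pT f0] by simp
      then have "loc_eq T W (\<tau> W ?d) (zero_at T W)" by (rule loc_eq_local[OF pT nt_el[OF R(5) d] el_zero[OF pT W] f])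
      then have "loc_eq T W (\<tau> W h) (\<tau> W h')"
        unfolding nt_sub[OF R(5) R(10) pT h(1) h'(1)] loc_eq_sub_zero[OF pT nt_el[OF R(5) h(1)] nt_el[OF R(5) h'(1)]] .
      then obtain e' V' where e': "cov e' V' W" "FAr T e' (\<tau> W h) = FAr T e' (\<tau> W h')" by (rule loc_eqE)
      note e0 = cov_ar[OF e'(1)]
      have "FAr P e' y = FAr P e' y'"
        by (rule inj[OF el_act[OF pP e0 y] el_act[OF pP e0 y']])
           (simp_all add: nt_nat[OF P(3) e0 y] nt_nat[OF P(3) e0 y'] nt_nat[OF P(4) e0 y] nt_nat[OF P(4) e0 y'] e h(3) h'(3) e'(2))
      then show "loc_eq P W y y'" by (rule loc_eqI[OF e'(1)])
    qed
    have ur: "isroof Q T P p q" unfolding isroof_def using Q T P(1,3,4) li' ls' by simp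
    let ?u = "roof_arr Q T P p q"
    note u = quot_arr_roof_arr[OF ur]
    have uc: "?u \<cdot>\<^bsub>D\<^esub> quot_map G Q c = t"
    proof (rule sym, rule quot_arr_eqI[OF t quot_arr_comp[OF qc u]])
      note ucc = quot_arr_comp[OF qc u]
      fix W b d assume "(W, b, d) \<in> arr_graph G T t"
      then obtain e V h where b: "el G W b" and d: "el T W d" and e: "cov e V W" and h: "el H V h"
        and sh: "s0 V h = FAr G e b" and th: "\<tau> V h = FAr T e d" unfolding gt by (rule roof_graphE)
      obtain y where y: "el P V y" "p V y = c V (s0 V h)" "q V y = \<tau> V h" using lift[OF h] by blast
      have "(V, c V (FAr G e b), FAr T e d) \<in> arr_graph Q T ?u" using roof_graph_base[OF ur y(1)] y(2,3) sh th unfolding arr_graph_roof_arr[OF ur] by simp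
      then have "(V, FAr G e b, FAr T e d) \<in> arr_graph G T (?u \<cdot>\<^bsub>D\<^esub> quot_map G Q c)"
        by (rule arr_graph_compI[OF qc u arr_graph_quot_map_self[OF G Q c el_act[OF pG cov_ar[OF e] b]]])
      then show "(W, b, d) \<in> arr_graph G T (?u \<cdot>\<^bsub>D\<^esub> quot_map G Q c)" by (rule arr_graph_local[OF ucc b d e])
    qed
    show "\<exists>!u. u \<in> arr D Q T \<and> u \<cdot>\<^bsub>D\<^esub> quot_map G Q c = t"
    proof (rule ex1I[of _ ?u])
      show "?u \<in> arr D Q T \<and> ?u \<cdot>\<^bsub>D\<^esub> quot_map G Q c = t" using quot_arrD(3)[OF u] uc by simp
      fix v assume v: "v \<in> arr D Q T \<and> v \<cdot>\<^bsub>D\<^esub> quot_map G Q c = t"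
      then have "quot_arr v Q T" using T Q by (simp add: quot_arr_def)
      then show "v = ?u" using uniq[OF _ u] v uc by simp
    qed
  qed
qed

text \<open>The projection onto the pointwise cokernel and the zero map have the same composite with
  the epic. They are therefore equal in the quotient, so the pointwise cokernel is locally
  zero.\<close>

lemma Q_epic_loc_surj:
  assumes F: "F \<in> MO" and G: "G \<in> MO" and s: "nt F G \<sigma>" and ep: "epic D F G (quot_map F G \<sigma>)"
  shows "loc_surj F G \<sigma>"
proof -
  obtain Q c where Q: "Q \<in> MO" "nt G Q c" "\<And>W a. el F W a \<Longrightarrow> c W (\<sigma> W a) = zero_at Q W"
    "\<And>W b. el G W b \<Longrightarrow> c W b = zero_at Q W \<Longrightarrow> \<exists>a. el F W a \<and> \<sigma> W a = b"
    by (rule cokernelE[OF mod_fp[OF F] mod_fp[OF G] s]) (rule that; assumption)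
  note pF = mod_psh[OF F] and pG = mod_psh[OF G] and pQ = mod_psh[OF Q(1)]
  note zn = nt_zero_map[OF pG pQ]
  note qc = quot_arr_quot_map[OF G Q(1,2)] and qz = quot_arr_zero[OF G Q(1)]
  have "quot_map G Q c \<cdot>\<^bsub>D\<^esub> quot_map F G \<sigma> = quot_map G Q (zero_map G Q) \<cdot>\<^bsub>D\<^esub> quot_map F G \<sigma>"
    unfolding D_zero_left[OF quot_arr_quot_map[OF F G s] Q(1)] Q_comp[OF F G Q(1) s Q(2)]
      quot_map_eq_iff[OF F Q(1) nt_comp[OF pF s Q(2)] nt_zero_map[OF pF pQ]]
    using Q(3) by (auto simp: nat_mk_app intro!: loc_eq_refl dest: elD(1))
  then have "quot_map G Q c = quot_map G Q (zero_map G Q)"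
    using ep quot_arrD(3)[OF qc] quot_arrD(3)[OF qz] Q(1) unfolding epic_def D_simps(1) by blast
  then have l: "loc_eq Q W (c W b) (zero_at Q W)" if "el G W b" for W b
    using that unfolding quot_map_eq_iff[OF G Q(1,2) zn] by (auto simp: nat_mk_app)
  show ?thesis
    unfolding loc_surj_def
  proof (intro allI impI)
    fix W b assume b: "el G W b"
    obtain e V where e: "cov e V W" "FAr Q e (c W b) = FAr Q e (zero_at Q W)" using loc_eqE[OF l[OF b]] .
    note e0 = cov_ar[OF e(1)]
    have "c V (FAr G e b) = zero_at Q V" using e(2) nt_nat[OF Q(2) e0 b] act_zero[OF pQ e0] by simp
    then show "\<exists>V e a. cov e V W \<and> el F V a \<and> \<sigma> V a = FAr G e b" using Q(4)[OF el_act[OF pG e0 b]] e(1) by blast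
  qed
qed

end

section \<open>Extriangulated categories\<close>

locale ext_cat = add_cat C for C :: "('o, 'm, 'e) extri" (structure) +
  assumes extriangulated: "extriangulated C"
begin

abbreviation ext :: "'o \<Rightarrow> 'o \<Rightarrow> 'e \<Rightarrow> bool" where
  "ext X Z \<delta> \<equiv> \<delta> \<in> carrier (Ext C X Z)"

definition realizes :: "'o \<Rightarrow> 'o \<Rightarrow> 'e \<Rightarrow> 'o \<Rightarrow> 'm \<Rightarrow> 'm \<Rightarrow> bool" where
  "realizes X Z \<delta> Y g f \<longleftrightarrow> X \<in> Obj C \<and> Z \<in> Obj C \<and> ext X Z \<delta> \<and> (Y, g, f) \<in> Rlz C X Z \<delta>"

lemma biadd: "biadditive_functor C" and arz: "additive_realization C" and rzn: "realization C"
  and et3: "ET3 C" and et4: "ET4 C" and et3op: "ET3 (op_extri C)" and et4op: "ET4 (op_extri C)"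
  using extriangulated by (auto simp: extriangulated_def additive_realization_def)

lemma conflation_iff: "conflation C Z Y X g f \<longleftrightarrow> (\<exists>\<delta>. realizes X Z \<delta> Y g f)"
  unfolding conflation_def realizes_def by blast

lemma Rlz_class: "X \<in> Obj C \<Longrightarrow> Z \<in> Obj C \<Longrightarrow> ext X Z \<delta> \<Longrightarrow> Rlz C X Z \<delta> \<in> sequences C X Z // seq_equiv C X Z"
  using rzn unfolding realization_def by simp

lemma realizesD: assumes "realizes X Z \<delta> Y g f" shows "X \<in> Obj C" "Z \<in> Obj C" "ext X Z \<delta>" "ar g Z Y" "ar f Y X" "Y \<in> Obj C"
proof -
  show "X \<in> Obj C" "Z \<in> Obj C" "ext X Z \<delta>" using assms by (auto simp: realizes_def)
  then have "(Y, g, f) \<in> sequences C X Z"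
    using Rlz_class[of X Z \<delta>] assms unfolding quotient_def seq_equiv_def realizes_def by auto
  then show "ar g Z Y" "ar f Y X" "Y \<in> Obj C" using \<open>X \<in> Obj C\<close> \<open>Z \<in> Obj C\<close> by (auto simp: sequences_def ar_def)
qed

lemma realizes_exists:
  assumes "X \<in> Obj C" "Z \<in> Obj C" "ext X Z \<delta>"
  obtains Y g f where "realizes X Z \<delta> Y g f"
proof -
  obtain s where s: "s \<in> sequences C X Z" "Rlz C X Z \<delta> = seq_equiv C X Z `` {s}"
    using Rlz_class[OF assms] unfolding quotient_def by blast
  obtain Y g f where sy: "s = (Y, g, f)" by (cases s)
  have Y: "Y \<in> Obj C" and g: "ar g Z Y" and f: "ar f Y X" using s(1) assms by (auto simp: sy sequences_def ar_def)
  have "iso_arr C Y Y (Ident C Y)"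
    unfolding iso_arr_def using ar_id[OF Y] comp_id[OF ar_id[OF Y]] by (auto simp: ar_def)
  then have "(s, s) \<in> seq_equiv C X Z"
    unfolding seq_equiv_def using s(1) comp_id[OF g] comp_id[OF f] by (auto simp: sy)
  then show thesis using that assms s(2) by (auto simp: realizes_def sy)
qed

text \<open>The realization is the class of some sequence \<open>s\<close>; the isomorphism from
  \<open>s\<close> to the given sequence is composed with \<open>y\<close>.\<close>

lemma realizes_iso:
  assumes r: "realizes X Z \<delta> Y g f" and y: "ar y Y Y'" "ar y' Y' Y" "y' \<cdot> y = Ident C Y" "y \<cdot> y' = Ident C Y'"
    and g': "g' = y \<cdot> g" and f': "ar f' Y' X" "f' \<cdot> y = f"
  shows "realizes X Z \<delta> Y' g' f'"
proof -
  note R = realizesD[OF r]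
  obtain s where s: "s \<in> sequences C X Z" "Rlz C X Z \<delta> = seq_equiv C X Z `` {s}"
    using Rlz_class[OF R(1-3)] unfolding quotient_def by blast
  obtain W k h where sy: "s = (W, k, h)" by (cases s)
  have W: "W \<in> Obj C" and k: "ar k Z W" and h: "ar h W X" using s(1) R by (auto simp: sy sequences_def ar_def)
  have "((W, k, h), (Y, g, f)) \<in> seq_equiv C X Z" using r s(2) sy by (auto simp: realizes_def)
  then obtain u where u: "iso_arr C W Y u" "u \<cdot> k = g" "f \<cdot> u = h" unfolding seq_equiv_def by auto
  obtain v where v: "ar u W Y" "ar v Y W" "v \<cdot> u = Ident C W" "u \<cdot> v = Ident C Y" using iso_arrE[OF u(1) W R(6)] by metis
  note yu = ar_comp[OF v(1) y(1)] and vy = ar_comp[OF y(2) v(2)]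
  have "(v \<cdot> y') \<cdot> (y \<cdot> u) = Ident C W"
    unfolding comp_assoc[OF yu y(2) v(2)] comp_assoc[OF v(1) y(1,2), symmetric] y(3) comp_id(2)[OF v(1)] by (rule v(3))
  moreover have "(y \<cdot> u) \<cdot> (v \<cdot> y') = Ident C Y'"
    unfolding comp_assoc[OF vy v(1) y(1)] comp_assoc[OF y(2) v(2,1), symmetric] v(4) comp_id(2)[OF y(2)] by (rule y(4))
  ultimately have "iso_arr C W Y' (y \<cdot> u)" unfolding iso_arr_def using yu vy by (auto simp: ar_def)
  moreover have "(y \<cdot> u) \<cdot> k = g'" unfolding comp_assoc[OF k v(1) y(1)] u(2) g' ..
  moreover have "f' \<cdot> (y \<cdot> u) = h" unfolding comp_assoc[OF v(1) y(1) f'(1), symmetric] f'(2) u(3) ..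
  moreover have "(Y', g', f') \<in> sequences C X Z"
    using ar_comp[OF R(4) y(1)] f'(1) g' by (auto simp: sequences_def ar_def)
  ultimately have "((W, k, h), (Y', g', f')) \<in> seq_equiv C X Z" using s(1) unfolding seq_equiv_def by (auto simp: sy)
  then show ?thesis using s(2) R(1-3) by (auto simp: realizes_def sy)
qed

section \<open>Functoriality of extensions and the axioms on morphisms\<close>

lemma ext_group: "X \<in> Obj C \<Longrightarrow> Z \<in> Obj C \<Longrightarrow> group (Ext C X Z)"
  using biadd unfolding biadditive_functor_def by (simp add: comm_group.axioms(2))

lemma ext_one: "X \<in> Obj C \<Longrightarrow> Z \<in> Obj C \<Longrightarrow> ext X Z \<one>\<^bsub>Ext C X Z\<^esub>"
  using ext_group by (simp add: group.is_monoid monoid.one_closed)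

lemma EMap_hom: "ar x X' X \<Longrightarrow> ar z Z Z' \<Longrightarrow> EMap C x z \<in> hom (Ext C X Z) (Ext C X' Z')"
  using biadd unfolding biadditive_functor_def ar_def by simp

lemma EMap_ext: "ar x X' X \<Longrightarrow> ar z Z Z' \<Longrightarrow> ext X Z \<delta> \<Longrightarrow> ext X' Z' (EMap C x z \<delta>)"
  using EMap_hom unfolding hom_def by blast

lemma EMap_one: "ar x X' X \<Longrightarrow> ar z Z Z' \<Longrightarrow> EMap C x z \<one>\<^bsub>Ext C X Z\<^esub> = \<one>\<^bsub>Ext C X' Z'\<^esub>"
  by (rule hom_one[OF EMap_hom ext_group ext_group]) (auto simp: ar_def)

lemma EMap_id: "X \<in> Obj C \<Longrightarrow> Z \<in> Obj C \<Longrightarrow> ext X Z \<delta> \<Longrightarrow> EMap C (Ident C X) (Ident C Z) \<delta> = \<delta>"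
  using biadd unfolding biadditive_functor_def by simp

lemma EMap_comp:
  assumes x: "ar x X' X" and x': "ar x' X'' X'" and z: "ar z Z Z'" and z': "ar z' Z' Z''" and d: "ext X Z \<delta>"
  shows "EMap C x' z' (EMap C x z \<delta>) = EMap C (x \<cdot> x') (z' \<cdot> z) \<delta>"
  by (rule biadd[unfolded biadditive_functor_def, THEN conjunct2, THEN conjunct2, THEN conjunct2, THEN conjunct1,
        rule_format, OF arD(2)[OF x] arD(1)[OF x] arD(1)[OF x'] arD(1)[OF z] arD(2)[OF z] arD(2)[OF z']
        arD(3)[OF x] arD(3)[OF x'] arD(3)[OF z] arD(3)[OF z'] d, symmetric])

lemma realize_morphism:
  assumes r: "realizes X Z \<delta> Y g f" and r': "realizes X' Z' \<delta>' Y' g' f'" and z: "ar z Z Z'" and x: "ar x X X'"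
    and e: "EMap C (Ident C X) z \<delta> = EMap C x (Ident C Z') \<delta>'"
  obtains y where "ar y Y Y'" "y \<cdot> g = g' \<cdot> z" "x \<cdot> f = f' \<cdot> y"
proof -
  note R = realizesD[OF r] and R' = realizesD[OF r']
  have "ext_morphism C X Z \<delta> X' Z' \<delta>' z x"
    using z x e by (simp add: ext_morphism_def pushf_def pullb_def ar_def)
  then have "\<exists>y\<in>arr C Y Y'. y \<cdot> g = g' \<cdot> z \<and> x \<cdot> f = f' \<cdot> y"
    using rzn[unfolded realization_def, THEN conjunct2, rule_format, OF R(1,2) R'(1,2) R(3) R'(3)] r r'
    unfolding realizes_def by blast
  then show thesis using that R(6) R'(6) by (auto simp: ar_def)
qed

lemma ET3E:
  assumes r: "realizes X Z \<delta> Y g f" and r': "realizes X' Z' \<delta>' Y' g' f'" and z: "ar z Z Z'" and y: "ar y Y Y'"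
    and e: "y \<cdot> g = g' \<cdot> z"
  obtains x where "ar x X X'" "x \<cdot> f = f' \<cdot> y" "EMap C (Ident C X) z \<delta> = EMap C x (Ident C Z') \<delta>'"
proof -
  note R = realizesD[OF r] and R' = realizesD[OF r']
  have "\<exists>x\<in>arr C X X'. x \<cdot> f = f' \<cdot> y \<and> ext_morphism C X Z \<delta> X' Z' \<delta>' z x"
    using et3[unfolded ET3_def, rule_format, OF R(1,2) R'(1,2) R(3) R'(3) arD(3)[OF z] arD(3)[OF y]] r r' e
    unfolding realizes_def by blast
  then show thesis using that R(1) R'(1) by (auto simp: ar_def ext_morphism_def pushf_def pullb_def)
qed

text \<open>Passing to \<open>op_extri\<close> reverses morphisms of extensions, so the axiom is
  applied from \<open>\<delta>'\<close> to \<open>\<delta>\<close>.\<close>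

lemma ET3opE:
  assumes r: "realizes X Z \<delta> Y g f" and r': "realizes X' Z' \<delta>' Y' g' f'" and x: "ar x X X'" and y: "ar y Y Y'"
    and e: "x \<cdot> f = f' \<cdot> y"
  obtains z where "ar z Z Z'" "y \<cdot> g = g' \<cdot> z" "EMap C (Ident C X) z \<delta> = EMap C x (Ident C Z') \<delta>'"
proof -
  note R = realizesD[OF r] and R' = realizesD[OF r']
  let ?O = "op_extri C"
  have o: "Z' \<in> Obj ?O" "X' \<in> Obj ?O" "Z \<in> Obj ?O" "X \<in> Obj ?O" using R R' by (simp_all add: op_extri_def)
  have d: "\<delta>' \<in> carrier (Ext ?O Z' X')" "\<delta> \<in> carrier (Ext ?O Z X)" using R R' by (simp_all add: op_extri_def)
  have a: "x \<in> arr ?O X' X" "y \<in> arr ?O Y' Y" using x y by (simp_all add: op_extri_def ar_def)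
  have "(Y', f', g') \<in> Rlz ?O Z' X' \<delta>' \<and> (Y, f, g) \<in> Rlz ?O Z X \<delta> \<and> y \<cdot>\<^bsub>?O\<^esub> f' = f \<cdot>\<^bsub>?O\<^esub> x"
    using r r' e by (simp add: op_extri_def realizes_def)
  from et3op[unfolded ET3_def, rule_format, OF o d a this]
  have "\<exists>z\<in>arr ?O Z' Z. z \<cdot>\<^bsub>?O\<^esub> g' = g \<cdot>\<^bsub>?O\<^esub> y \<and> ext_morphism ?O Z' X' \<delta>' Z X \<delta> x z" .
  then show thesis using that R(2) R'(2) by (auto simp: ar_def ext_morphism_def pushf_def pullb_def op_extri_def)
qed

text \<open>A biproduct with a zero object realizes the split extension, which yields the
  conflations \<open>X = X -> 0\<close> and \<open>0 -> X = X\<close>. Comparing an arbitrary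
  conflation with these gives the weak exactness properties below.\<close>

lemma zero_object_trivial:
  obtains N where "N \<in> Obj C" "\<And>X. X \<in> Obj C \<Longrightarrow> realizes N X \<one>\<^bsub>Ext C N X\<^esub> X (Ident C X) (zr X N)"
    "\<And>X. X \<in> Obj C \<Longrightarrow> realizes X N \<one>\<^bsub>Ext C X N\<^esub> X (zr N X) (Ident C X)"
proof -
  obtain N where N: "N \<in> Obj C" "\<And>X f. ar f X N \<Longrightarrow> f = zr X N" "\<And>X f. ar f N X \<Longrightarrow> f = zr N X"
    by (rule zero_objectE) (rule that; assumption)
  have iN: "Ident C N = zr N N" by (rule N(2)[OF ar_id[OF N(1)]])
  have zN: "zr X N \<cdot> zr N X = Ident C N" if X: "X \<in> Obj C" for X
    using comp_zr[OF ar_zr[OF X N(1)] N(1)] iN by simp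
  note split = arz[unfolded additive_realization_def, THEN conjunct2, THEN conjunct1, rule_format]
  have "realizes N X \<one>\<^bsub>Ext C N X\<^esub> X (Ident C X) (zr X N)" if X: "X \<in> Obj C" for X
  proof -
    note i = ar_id[OF X] and z = ar_zr[OF N(1) X] and z' = ar_zr[OF X N(1)]
    have "biproduct C X N X (Ident C X) (zr N X) (Ident C X) (zr X N)"
      unfolding biproduct_def
      using i z z' zN[OF X] comp_id[OF i] comp_id[OF z] comp_id[OF z'] comp_zr[OF z X] add_zr(1)[OF i]
      by (simp add: ar_def)
    then have "(X, Ident C X, zr X N) \<in> Rlz C N X \<one>\<^bsub>Ext C N X\<^esub>" using split[OF N(1) X] by blast
    then show ?thesis unfolding realizes_def using X N(1) ext_one by simp
  qed
  moreover have "realizes X N \<one>\<^bsub>Ext C X N\<^esub> X (zr N X) (Ident C X)" if X: "X \<in> Obj C" for X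
  proof -
    note i = ar_id[OF X] and z = ar_zr[OF N(1) X] and z' = ar_zr[OF X N(1)]
    have "biproduct C N X X (zr N X) (Ident C X) (zr X N) (Ident C X)"
      unfolding biproduct_def
      using i z z' zN[OF X] comp_id[OF i] comp_id[OF z] comp_id[OF z'] comp_zr[OF z X] add_zr(2)[OF i]
      by (simp add: ar_def)
    then have "(X, zr N X, Ident C X) \<in> Rlz C X N \<one>\<^bsub>Ext C X N\<^esub>" using split[OF X N(1)] by blast
    then show ?thesis unfolding realizes_def using X N(1) ext_one by simp
  qed
  ultimately show thesis using that[OF N(1)] by blast
qed

text \<open>(ET3) applied to the arrow \<open>g\<close> from the middle of \<open>Z = Z -> 0\<close>
  to the middle of the conflation factors \<open>f g\<close> through a zero object.\<close>

lemma realizes_comp_zero: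
  assumes r: "realizes X Z \<delta> Y g f"
  shows "f \<cdot> g = zr Z X"
proof -
  note R = realizesD[OF r]
  obtain N where N: "N \<in> Obj C" "\<And>X. X \<in> Obj C \<Longrightarrow> realizes N X \<one>\<^bsub>Ext C N X\<^esub> X (Ident C X) (zr X N)"
    by (rule zero_object_trivial) (rule that; assumption)
  obtain x where x: "ar x N X" "x \<cdot> zr Z N = f \<cdot> g"
    by (rule ET3E[OF N(2)[OF R(2)] r ar_id[OF R(2)] R(4)]) (simp_all add: comp_id[OF R(4)] that)
  then show ?thesis using comp_zr[OF x(1) R(2)] by simp
qed

lemma realizes_weak_kernel:
  assumes r: "realizes X Z \<delta> Y g f" and t: "ar t T Y" and ft: "f \<cdot> t = zr T X"
  obtains u where "ar u T Z" "t = g \<cdot> u"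
proof -
  note R = realizesD[OF r] and T = arD(1)[OF t]
  obtain N where N: "N \<in> Obj C" "\<And>X. X \<in> Obj C \<Longrightarrow> realizes N X \<one>\<^bsub>Ext C N X\<^esub> X (Ident C X) (zr X N)"
    by (rule zero_object_trivial) (rule that; assumption)
  note z = ar_zr[OF N(1) R(1)]
  have e: "zr N X \<cdot> zr T N = f \<cdot> t" using comp_zr[OF z T] ft by simp
  obtain u where "ar u T Z" "t \<cdot> Ident C T = g \<cdot> u" by (rule ET3opE[OF N(2)[OF T] r z t e])
  then show thesis using that comp_id[OF t] by simp
qed

text \<open>Comparison with \<open>Y = Y -> 0\<close> exhibits the pushforward along
  \<open>g\<close> as a pullback of the zero extension.\<close>

lemma push_inflation:
  assumes r: "realizes X Z \<delta> Y g f"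
  shows "EMap C (Ident C X) g \<delta> = \<one>\<^bsub>Ext C X Y\<^esub>"
proof -
  note R = realizesD[OF r]
  obtain N where N: "N \<in> Obj C" "\<And>X. X \<in> Obj C \<Longrightarrow> realizes N X \<one>\<^bsub>Ext C N X\<^esub> X (Ident C X) (zr X N)"
    by (rule zero_object_trivial) (rule that; assumption)
  obtain x where x: "ar x X N" "EMap C (Ident C X) g \<delta> = EMap C x (Ident C Y) \<one>\<^bsub>Ext C N Y\<^esub>"
    by (rule ET3E[OF r N(2)[OF R(6)] R(4) ar_id[OF R(6)]]) (simp_all add: that)
  then show ?thesis using EMap_one[OF x(1) ar_id[OF R(6)]] by simp
qed

lemma pull_deflation:
  assumes r: "realizes X Z \<delta> Y g f"
  shows "EMap C f (Ident C Z) \<delta> = \<one>\<^bsub>Ext C Y Z\<^esub>"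
proof -
  note R = realizesD[OF r]
  obtain N where N: "N \<in> Obj C" "\<And>X. X \<in> Obj C \<Longrightarrow> realizes X N \<one>\<^bsub>Ext C X N\<^esub> X (zr N X) (Ident C X)"
    by (rule zero_object_trivial) (rule that; assumption)
  obtain z where z: "ar z N Z" "EMap C (Ident C Y) z \<one>\<^bsub>Ext C Y N\<^esub> = EMap C f (Ident C Z) \<delta>"
    by (rule ET3opE[OF N(2)[OF R(6)] r R(5) ar_id[OF R(6)]]) (simp_all add: that)
  then show ?thesis using EMap_one[OF ar_id[OF R(6)] z(1)] by simp
qed

text \<open>The pushforward along \<open>v\<close> is split, so a realization of the morphism of
  extensions ends in a biproduct; its component in \<open>T\<close> is the extension of
  \<open>v\<close>.\<close>

lemma extend_along_inflation:
  assumes r: "realizes X Z \<delta> Y g f" and v: "ar v Z T" and e: "EMap C (Ident C X) v \<delta> = \<one>\<^bsub>Ext C X T\<^esub>"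
  obtains w where "ar w Y T" "v = w \<cdot> g"
proof -
  note R = realizesD[OF r] and T = arD(2)[OF v]
  obtain P i j p q where b: "biproduct C T X P i j p q" and P: "P \<in> Obj C" using biproductE[OF T R(1)] .
  note B = biproductD[OF b T R(1)]
  have "(P, i, q) \<in> Rlz C X T \<one>\<^bsub>Ext C X T\<^esub>"
    using arz b R(1) T unfolding additive_realization_def by blast
  then have r': "realizes X T \<one>\<^bsub>Ext C X T\<^esub> P i q" unfolding realizes_def using R(1) T ext_one by simp
  have e': "EMap C (Ident C X) v \<delta> = EMap C (Ident C X) (Ident C T) \<one>\<^bsub>Ext C X T\<^esub>"
    using e EMap_one[OF ar_id[OF R(1)] ar_id[OF T]] by simp
  obtain y where y: "ar y Y P" "y \<cdot> g = i \<cdot> v" by (rule realize_morphism[OF r r' v ar_id[OF R(1)] e'])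
  have "(p \<cdot> y) \<cdot> g = v"
    unfolding comp_assoc[OF R(4) y(1) B(3)] y(2) comp_assoc[OF v B(1,3), symmetric] B(5) by (rule comp_id(2)[OF v])
  then show thesis using that[OF ar_comp[OF y(1) B(3)]] by simp
qed

lemma lift_along_deflation:
  assumes r: "realizes X Z \<delta> Y g f" and x: "ar x T X" and e: "EMap C x (Ident C Z) \<delta> = \<one>\<^bsub>Ext C T Z\<^esub>"
  obtains w where "ar w T Y" "x = f \<cdot> w"
proof -
  note R = realizesD[OF r] and T = arD(1)[OF x]
  obtain P i j p q where b: "biproduct C Z T P i j p q" and P: "P \<in> Obj C" using biproductE[OF R(2) T] .
  note B = biproductD[OF b R(2) T]
  have "(P, i, q) \<in> Rlz C T Z \<one>\<^bsub>Ext C T Z\<^esub>"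
    using arz b R(2) T unfolding additive_realization_def by blast
  then have r': "realizes T Z \<one>\<^bsub>Ext C T Z\<^esub> P i q" unfolding realizes_def using R(2) T ext_one by simp
  have e': "EMap C (Ident C T) (Ident C Z) \<one>\<^bsub>Ext C T Z\<^esub> = EMap C x (Ident C Z) \<delta>"
    using e EMap_one[OF ar_id[OF T] ar_id[OF R(2)]] by simp
  obtain y where y: "ar y P Y" "x \<cdot> q = f \<cdot> y" by (rule realize_morphism[OF r' r ar_id[OF R(2)] x e'])
  have "f \<cdot> (y \<cdot> j) = x"
    unfolding comp_assoc[OF B(2) y(1) R(5), symmetric] y(2)[symmetric] comp_assoc[OF B(2,4) x] B(6) by (rule comp_id(1)[OF x])
  then show thesis using that[OF ar_comp[OF B(2) y(1)]] by simp
qed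

section \<open>Pullbacks, pushouts and composites of conflations\<close>

lemma pullbackX:
  assumes r: "realizes X Z \<delta> Y g f" and x: "ar x X' X"
  obtains Y' g' f' y where "realizes X' Z (EMap C x (Ident C Z) \<delta>) Y' g' f'" "ar y Y' Y" "y \<cdot> g' = g" "x \<cdot> f' = f \<cdot> y"
proof -
  note R = realizesD[OF r] and X' = arD(1)[OF x]
  note iZ = ar_id[OF R(2)]
  let ?d = "EMap C x (Ident C Z) \<delta>"
  have d: "ext X' Z ?d" by (rule EMap_ext[OF x iZ R(3)])
  obtain Y' g' f' where r': "realizes X' Z ?d Y' g' f'" using realizes_exists[OF X' R(2) d] .
  obtain y where y: "ar y Y' Y" "y \<cdot> g' = g \<cdot> Ident C Z" "x \<cdot> f' = f \<cdot> y"
    by (rule realize_morphism[OF r' r iZ x EMap_id[OF X' R(2) d]])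
  then show thesis using that[OF r' y(1)] comp_id(1)[OF R(4)] by simp
qed

lemma pushoutX:
  assumes r: "realizes X Z \<delta> Y g f" and z: "ar z Z Z'"
  obtains Y' g' f' y where "realizes X Z' (EMap C (Ident C X) z \<delta>) Y' g' f'" "ar y Y Y'" "y \<cdot> g = g' \<cdot> z" "f' \<cdot> y = f"
proof -
  note R = realizesD[OF r] and Z' = arD(2)[OF z]
  note iX = ar_id[OF R(1)]
  let ?d = "EMap C (Ident C X) z \<delta>"
  have d: "ext X Z' ?d" by (rule EMap_ext[OF iX z R(3)])
  obtain Y' g' f' where r': "realizes X Z' ?d Y' g' f'" using realizes_exists[OF R(1) Z' d] .
  obtain y where y: "ar y Y Y'" "y \<cdot> g = g' \<cdot> z" "Ident C X \<cdot> f = f' \<cdot> y"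
    by (rule realize_morphism[OF r r' z iX EMap_id[OF R(1) Z' d, symmetric]])
  then show thesis using that[OF r' y(1,2)] comp_id(2)[OF R(5)] by simp
qed

lemma inflation_comp:
  assumes r: "realizes X Z \<delta> Y g f" and r': "realizes A Y \<delta>' B b a"
  obtains D \<delta>'' f' where "realizes D Z \<delta>'' B (b \<cdot> g) f'"
proof -
  note R = realizesD[OF r] and R' = realizesD[OF r']
  have "\<exists>D\<in>Obj C. \<exists>f'\<in>arr C B D. \<exists>b'\<in>arr C X D. \<exists>a'\<in>arr C D A. \<exists>\<delta>''\<in>carrier (Ext C D Z).
             b' \<cdot> f = f' \<cdot> b \<and> a' \<cdot> f' = a \<and>
             (B, b \<cdot> g, f') \<in> Rlz C D Z \<delta>'' \<and>
             (D, b', a') \<in> Rlz C A X (pushf C A f \<delta>') \<and>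
             pullb C Z b' \<delta>'' = \<delta> \<and>
             pushf C D g \<delta>'' = pullb C Y a' \<delta>'"
    by (rule et4[unfolded ET4_def, rule_format, OF R(1,2,6) R'(1) R(3) R'(3)])
       (use r r' in \<open>simp add: realizes_def\<close>)
  then obtain D f' \<delta>'' where "D \<in> Obj C" "ext D Z \<delta>''" "(B, b \<cdot> g, f') \<in> Rlz C D Z \<delta>''" by blast
  then show thesis using that R(2) by (simp add: realizes_def)
qed

text \<open>(ET4) in the opposite category; of its octahedron only the conflation with the composite
  deflation is retained.\<close>

lemma deflation_comp:
  assumes r: "realizes X Z \<delta> Y g f" and r': "realizes Y A \<delta>' B a b"
  obtains D \<delta>'' g' where "realizes X D \<delta>'' B g' (f \<cdot> b)"
proof -
  note R = realizesD[OF r] and R' = realizesD[OF r']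
  let ?O = "op_extri C"
  have o: "Z \<in> Obj ?O" "X \<in> Obj ?O" "Y \<in> Obj ?O" "A \<in> Obj ?O" using R R' by (simp_all add: op_extri_def)
  have d: "\<delta> \<in> carrier (Ext ?O Z X)" "\<delta>' \<in> carrier (Ext ?O A Y)" using R R' by (simp_all add: op_extri_def)
  have s: "(Y, f, g) \<in> Rlz ?O Z X \<delta> \<and> (B, b, a) \<in> Rlz ?O A Y \<delta>'"
    using r r' by (simp add: op_extri_def realizes_def)
  have "\<exists>D\<in>Obj ?O. \<exists>f'\<in>arr ?O B D. \<exists>b'\<in>arr ?O Z D. \<exists>a'\<in>arr ?O D A. \<exists>\<delta>''\<in>carrier (Ext ?O D X).
             b' \<cdot>\<^bsub>?O\<^esub> g = f' \<cdot>\<^bsub>?O\<^esub> b \<and> a' \<cdot>\<^bsub>?O\<^esub> f' = a \<and>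
             (B, b \<cdot>\<^bsub>?O\<^esub> f, f') \<in> Rlz ?O D X \<delta>'' \<and>
             (D, b', a') \<in> Rlz ?O A Z (pushf ?O A g \<delta>') \<and>
             pullb ?O X b' \<delta>'' = \<delta> \<and>
             pushf ?O D f \<delta>'' = pullb ?O Y a' \<delta>'"
    by (rule et4op[unfolded ET4_def, rule_format, OF o d s])
  then obtain D f' \<delta>'' where "D \<in> Obj ?O" "\<delta>'' \<in> carrier (Ext ?O D X)" "(B, b \<cdot>\<^bsub>?O\<^esub> f, f') \<in> Rlz ?O D X \<delta>''" by blast
  then show thesis using that R(1) by (simp add: realizes_def op_extri_def)
qed

section \<open>Deflations as coverings\<close>

definition defl :: "'m \<Rightarrow> 'o \<Rightarrow> 'o \<Rightarrow> bool" where
  "defl e V W \<longleftrightarrow> (\<exists>Z \<delta> g. realizes W Z \<delta> V g e)"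

lemma defl_ar: "defl e V W \<Longrightarrow> ar e V W"
  unfolding defl_def using realizesD(5) by blast

lemma defl_id: "W \<in> Obj C \<Longrightarrow> defl (Ident C W) W W"
  using zero_object_trivial unfolding defl_def by metis

lemma defl_comp: "defl e V W \<Longrightarrow> defl e' V' V \<Longrightarrow> defl (e \<cdot> e') V' W"
  unfolding defl_def using deflation_comp by metis

lemma defl_pull: "defl e V W \<Longrightarrow> ar h W' W \<Longrightarrow> \<exists>V' e' h'. defl e' V' W' \<and> ar h' V' V \<and> h \<cdot> e' = e \<cdot> h'"
  unfolding defl_def using pullbackX by metis

section \<open>Exact categories as extriangulated categories\<close>

text \<open>The map \<open>(\<alpha>, e)\<close> is the composite of the deflation \<open>1 \<oplus> e\<close> with \<open>(\<alpha>, 1)\<close>, which is a split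
  deflation for a sheared biproduct structure.\<close>

lemma sum_deflation:
  assumes a: "ar \<alpha> R X" and e: "defl e Y X" and b: "biproduct C R Y P i j p q"
  shows "defl (add P X (\<alpha> \<cdot> p) (e \<cdot> q)) P X"
proof -
  obtain Z \<delta> g where r: "realizes X Z \<delta> Y g e" using e unfolding defl_def by blast
  note Rz = realizesD[OF r] and R = arD(1)[OF a]
  obtain N where N: "N \<in> Obj C" "\<And>X. X \<in> Obj C \<Longrightarrow> realizes X N \<one>\<^bsub>Ext C X N\<^esub> X (zr N X) (Ident C X)"
    by (rule zero_object_trivial) (rule that; assumption)
  note r0 = N(2)[OF R]
  obtain PX iX jX pX qX where bX: "biproduct C R X PX iX jX pX qX" and PX: "PX \<in> Obj C" using biproductE[OF R Rz(1)] .
  obtain PZ iZ jZ pZ qZ where bZ: "biproduct C N Z PZ iZ jZ pZ qZ" and PZ: "PZ \<in> Obj C" using biproductE[OF N(1) Rz(2)] .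
  note BX = biproductD[OF bX R Rz(1)] and BZ = biproductD[OF bZ N(1) Rz(2)] and B = biproductD[OF b R Rz(6)]
  let ?d = "add P PX (iX \<cdot> Ident C R \<cdot> p) (jX \<cdot> e \<cdot> q)"
  let ?g = "add PZ P (i \<cdot> zr N R \<cdot> pZ) (j \<cdot> g \<cdot> qZ)"
  let ?\<epsilon> = "EMap C pX iZ \<one>\<^bsub>Ext C R N\<^esub> \<otimes>\<^bsub>Ext C PX PZ\<^esub> EMap C qX jZ \<delta>"
  \<comment> \<open>Additivity of the realization, applied to \<open>0 -> R = R\<close> and to the
    conflation of \<open>e\<close>, makes \<open>1 \<oplus> e\<close> a deflation.\<close>
  have "(P, ?g, ?d) \<in> Rlz C PX PZ ?\<epsilon>"
  proof -
    have "(R, zr N R, Ident C R) \<in> Rlz C R N \<one>\<^bsub>Ext C R N\<^esub> \<and> (Y, g, e) \<in> Rlz C X Z \<delta> \<and>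
      biproduct C R X PX iX jX pX qX \<and> biproduct C R Y P i j p q \<and> biproduct C N Z PZ iZ jZ pZ qZ"
      using r0 r bX b bZ by (simp add: realizes_def)
    then show ?thesis
      by (rule arz[unfolded additive_realization_def, THEN conjunct2, THEN conjunct2, rule_format,
            OF R N(1) Rz(1,2) realizesD(3)[OF r0] Rz(3)])
  qed
  moreover have "ext PX PZ ?\<epsilon>"
    using ext_group[OF PX PZ] EMap_ext[OF BX(3) BZ(1) realizesD(3)[OF r0]] EMap_ext[OF BX(4) BZ(2) Rz(3)]
    by (simp add: group.is_monoid monoid.m_closed)
  ultimately have d1: "defl ?d P PX" unfolding defl_def realizes_def using PX PZ by blast
  note ap = ar_comp[OF BX(3) a]
  \<comment> \<open>\<open>q'\<close> is the row \<open>(\<alpha>, 1)\<close> on the biproduct of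
    \<open>R\<close> and \<open>X\<close>, and \<open>i'\<close> is the column
    \<open>(1, -\<alpha>)\<close>, which it kills. Together with \<open>jX\<close> and
    \<open>pX\<close> they form the sheared biproduct structure on \<open>PX\<close>.\<close>
  define q' where "q' = add PX X (\<alpha> \<cdot> pX) qX"
  define i' where "i' = add R PX iX (neg R PX (jX \<cdot> \<alpha>))"
  note ja = ar_comp[OF a BX(2)]
  have q': "ar q' PX X" unfolding q'_def by (rule ar_add[OF ap BX(4)])
  have i': "ar i' R PX" unfolding i'_def by (rule ar_add[OF BX(1) ar_neg[OF ja]])
  have q't: "q' \<cdot> t = add W X (\<alpha> \<cdot> (pX \<cdot> t)) (qX \<cdot> t)" if "ar t W PX" for t W
    unfolding q'_def comp_add_left[OF that ap BX(4)] comp_assoc[OF that BX(3) a] ..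
  have pj: "pX \<cdot> (jX \<cdot> \<alpha>) = zr R R"
    unfolding comp_assoc[OF a BX(2,3), symmetric] BX(7) by (rule zr_comp[OF a R])
  have qj: "qX \<cdot> (jX \<cdot> \<alpha>) = \<alpha>"
    unfolding comp_assoc[OF a BX(2,4), symmetric] BX(6) by (rule comp_id(2)[OF a])
  have pi': "pX \<cdot> i' = Ident C R"
    unfolding i'_def comp_sub[OF BX(1) ja BX(3)] pj BX(5) neg_zr[OF R R] by (rule add_zr(1)[OF ar_id[OF R]])
  have qi': "qX \<cdot> i' = neg R X \<alpha>"
    unfolding i'_def comp_sub[OF BX(1) ja BX(4)] qj BX(8) by (rule add_zr(2)[OF ar_neg[OF a]])
  have "q' \<cdot> i' = zr R X"
    unfolding q't[OF i'] pi' qi' comp_id(1)[OF a] by (rule add_neg(1)[OF a])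
  moreover have "q' \<cdot> jX = Ident C X"
    unfolding q't[OF BX(2)] BX(7) BX(6) comp_zr[OF a Rz(1)] by (rule add_zr(2)[OF ar_id[OF Rz(1)]])
  moreover have "add PX PX (i' \<cdot> pX) (jX \<cdot> q') = Ident C PX"
  proof -
    note ip = ar_comp[OF BX(3,1)] and jap = ar_comp[OF ap BX(2)] and jq = ar_comp[OF BX(4,2)]
    have 1: "i' \<cdot> pX = add PX PX (iX \<cdot> pX) (neg PX PX (jX \<cdot> (\<alpha> \<cdot> pX)))"
      unfolding i'_def sub_comp[OF BX(3,1) ja] comp_assoc[OF BX(3) a BX(2)] ..
    have 2: "jX \<cdot> q' = add PX PX (jX \<cdot> (\<alpha> \<cdot> pX)) (jX \<cdot> qX)"
      unfolding q'_def by (rule comp_add_right[OF ap BX(4,2)])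
    have "add PX PX (i' \<cdot> pX) (jX \<cdot> q') = add PX PX (add PX PX (i' \<cdot> pX) (jX \<cdot> (\<alpha> \<cdot> pX))) (jX \<cdot> qX)"
      unfolding 2 by (rule add_assoc[OF ar_comp[OF BX(3) i'] jap jq, symmetric])
    also have "add PX PX (i' \<cdot> pX) (jX \<cdot> (\<alpha> \<cdot> pX)) = iX \<cdot> pX" unfolding 1 by (rule sub_add[OF ip jap])
    finally show ?thesis using BX(9) by simp
  qed
  ultimately have "biproduct C R X PX i' jX pX q'"
    unfolding biproduct_def using PX BX(2,3,7) i' q' pi' by (simp add: ar_def)
  then have "(PX, i', q') \<in> Rlz C X R \<one>\<^bsub>Ext C X R\<^esub>"
    using arz[unfolded additive_realization_def, THEN conjunct2, THEN conjunct1, rule_format, OF Rz(1) R] by blast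
  then have "realizes X R \<one>\<^bsub>Ext C X R\<^esub> PX i' q'" unfolding realizes_def using Rz(1) R ext_one by simp
  then have d2: "defl q' PX X" unfolding defl_def by blast
  have "q' \<cdot> ?d = add P X (\<alpha> \<cdot> p) (e \<cdot> q)"
  proof -
    have s: "iX \<cdot> Ident C R \<cdot> p = iX \<cdot> p" unfolding comp_id(1)[OF BX(1)] ..
    have s': "jX \<cdot> e \<cdot> q = jX \<cdot> (e \<cdot> q)" by (rule comp_assoc[OF B(4) Rz(5) BX(2)])
    note eq = ar_comp[OF B(4) Rz(5)]
    note w = biproduct_pair[OF bX B(3) eq]
    show ?thesis unfolding s s' q't[OF w(1)] w(2,3) ..
  qed
  then show ?thesis using defl_comp[OF d2 d1] by simp
qed

section \<open>Kernel-cokernel pairs and the axioms of Quillen\<close>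

definition conflations_exact where "conflations_exact \<longleftrightarrow> (\<forall>Z Y X g f. conflation C Z Y X g f \<longrightarrow> short_exact C Z Y X g f)"

lemma conflations_exactD:
  assumes "conflations_exact" "realizes X Z \<delta> Y g f"
  shows "is_kernel C Z Y X g f" "is_cokernel C Z Y X g f"
  using assms conflation_iff unfolding conflations_exact_def short_exact_def by blast+

text \<open>If \<open>u g = v z\<close>, pushing \<open>\<delta>\<close> forward along
  \<open>v z\<close> gives zero because \<open>g\<close> already does so. Hence \<open>v\<close>
  extends along \<open>g'\<close>. The cokernel property of the deflations then corrects the
  extension and makes it unique.\<close>

lemma pushout_univ:
  assumes kc: conflations_exact and r: "realizes X Z \<delta> Y g f" and z: "ar z Z Z'"
    and r': "realizes X Z' (EMap C (Ident C X) z \<delta>) Y' g' f'" and y: "ar y Y Y'" "y \<cdot> g = g' \<cdot> z" "f' \<cdot> y = f"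
  shows pushout_exists: "\<And>T u v. ar u Y T \<Longrightarrow> ar v Z' T \<Longrightarrow> u \<cdot> g = v \<cdot> z \<Longrightarrow> \<exists>w. ar w Y' T \<and> w \<cdot> y = u \<and> w \<cdot> g' = v"
    and pushout_unique: "\<And>T w w'. ar w Y' T \<Longrightarrow> ar w' Y' T \<Longrightarrow> w \<cdot> y = w' \<cdot> y \<Longrightarrow> w \<cdot> g' = w' \<cdot> g' \<Longrightarrow> w = w'"
proof -
  note R = realizesD[OF r] and R' = realizesD[OF r']
  note cok = cokernelD[OF conflations_exactD(2)[OF kc r]] and cok' = cokernelD[OF conflations_exactD(2)[OF kc r']]
  show "\<exists>w. ar w Y' T \<and> w \<cdot> y = u \<and> w \<cdot> g' = v" if u: "ar u Y T" and v: "ar v Z' T" and e: "u \<cdot> g = v \<cdot> z" for T u v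
  proof -
    note T = arD(2)[OF u] and iX = ar_id[OF R(1)]
    have "EMap C (Ident C X) v (EMap C (Ident C X) z \<delta>) = EMap C (Ident C X) (v \<cdot> z) \<delta>"
      using EMap_comp[OF iX iX z v R(3)] comp_id(1)[OF iX] by simp
    also have "\<dots> = EMap C (Ident C X) u (EMap C (Ident C X) g \<delta>)"
      using EMap_comp[OF iX iX R(4) u R(3)] comp_id(1)[OF iX] e by simp
    also have "\<dots> = \<one>\<^bsub>Ext C X T\<^esub>" unfolding push_inflation[OF r] by (rule EMap_one[OF iX u])
    finally obtain w0 where w0: "ar w0 Y' T" "v = w0 \<cdot> g'" by (rule extend_along_inflation[OF r' v])
    note w0y = ar_comp[OF y(1) w0(1)]
    \<comment> \<open>The extension \<open>w0\<close> has the right restriction to \<open>Z'\<close>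
      but perhaps not to \<open>Y\<close>. The error kills \<open>g\<close>, so it factors through
      \<open>f\<close> and is compensated by an arrow through \<open>f'\<close>, which leaves the
      restriction to \<open>Z'\<close> unchanged.\<close>
    let ?u = "add Y T u (neg Y T (w0 \<cdot> y))"
    have u': "ar ?u Y T" by (rule ar_add[OF u ar_neg[OF w0y]])
    have "(w0 \<cdot> y) \<cdot> g = u \<cdot> g"
      unfolding comp_assoc[OF R(4) y(1) w0(1)] y(2) comp_assoc[OF z R'(4) w0(1), symmetric] w0(2)[symmetric] e ..
    then have "?u \<cdot> g = zr Z T" unfolding sub_comp[OF R(4) u w0y] using add_neg(1)[OF ar_comp[OF R(4) u]] by simp
    then obtain t where t: "ar t X T" "t \<cdot> f = ?u" using cok(4)[OF u'] by blast
    note tf' = ar_comp[OF R'(5) t(1)]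
    let ?w = "add Y' T w0 (t \<cdot> f')"
    have w: "ar ?w Y' T" by (rule ar_add[OF w0(1) tf'])
    have "?w \<cdot> y = add Y T (w0 \<cdot> y) ?u"
      unfolding comp_add_left[OF y(1) w0(1) tf'] comp_assoc[OF y(1) R'(5) t(1)] y(3) t(2) ..
    also have "\<dots> = u" by (rule add_sub[OF u w0y])
    finally have 1: "?w \<cdot> y = u" .
    have "?w \<cdot> g' = add Z' T v (t \<cdot> (f' \<cdot> g'))"
      unfolding comp_add_left[OF R'(4) w0(1) tf'] comp_assoc[OF R'(4) R'(5) t(1)] w0(2) ..
    also have "\<dots> = v" unfolding realizes_comp_zero[OF r'] comp_zr[OF t(1) R'(2)] by (rule add_zr(1)[OF v])
    finally show ?thesis using w 1 by blast
  qed
  show "w = w'" if w: "ar w Y' T" and w': "ar w' Y' T" and ey: "w \<cdot> y = w' \<cdot> y" and eg: "w \<cdot> g' = w' \<cdot> g'" for T w w'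
  proof -
    note T = arD(2)[OF w]
    let ?d = "add Y' T w (neg Y' T w')"
    have d: "ar ?d Y' T" by (rule ar_add[OF w ar_neg[OF w']])
    have "?d \<cdot> g' = zr Z' T" unfolding sub_comp[OF R'(4) w w'] eg by (rule add_neg(1)[OF ar_comp[OF R'(4) w']])
    then obtain t where t: "ar t X T" "t \<cdot> f' = ?d" using cok'(4)[OF d] by blast
    \<comment> \<open>\<open>f\<close> is \<open>f' y\<close>, and the two arrows agree after
      composition with \<open>y\<close>; the cokernel \<open>f\<close> can then be
      cancelled.\<close>
    have "t \<cdot> f = zr Y T"
      unfolding y(3)[symmetric] comp_assoc[OF y(1) R'(5) t(1), symmetric] t(2) sub_comp[OF y(1) w w'] ey
      by (rule add_neg(1)[OF ar_comp[OF y(1) w']])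
    then have "t \<cdot> f = zr X T \<cdot> f" using zr_comp[OF R(5) T] by simp
    then have "t = zr X T" by (rule cok(5)[OF t(1) ar_zr[OF R(1) T]])
    then have "?d = zr Y' T" using t(2) zr_comp[OF R'(5) T] by simp
    then show ?thesis using sub_eq_zr[OF w w'] by simp
  qed
qed

text \<open>The dual argument: \<open>v\<close> lifts along \<open>f'\<close> because the pullback
  of \<open>\<delta>\<close> along \<open>f u\<close> is zero. The error of the lift is compensated
  by an arrow through \<open>g'\<close>.\<close>

lemma pullback_univ:
  assumes kc: conflations_exact and r: "realizes X Z \<delta> Y g f" and x: "ar x X' X"
    and r': "realizes X' Z (EMap C x (Ident C Z) \<delta>) Y' g' f'" and y: "ar y Y' Y" "y \<cdot> g' = g" "x \<cdot> f' = f \<cdot> y"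
  shows pullback_exists: "\<And>T u v. ar u T Y \<Longrightarrow> ar v T X' \<Longrightarrow> f \<cdot> u = x \<cdot> v \<Longrightarrow> \<exists>w. ar w T Y' \<and> y \<cdot> w = u \<and> f' \<cdot> w = v"
    and pullback_unique: "\<And>T w w'. ar w T Y' \<Longrightarrow> ar w' T Y' \<Longrightarrow> y \<cdot> w = y \<cdot> w' \<Longrightarrow> f' \<cdot> w = f' \<cdot> w' \<Longrightarrow> w = w'"
proof -
  note R = realizesD[OF r] and R' = realizesD[OF r']
  note ker = kernelD[OF conflations_exactD(1)[OF kc r]] and ker' = kernelD[OF conflations_exactD(1)[OF kc r']]
  show "\<exists>w. ar w T Y' \<and> y \<cdot> w = u \<and> f' \<cdot> w = v" if u: "ar u T Y" and v: "ar v T X'" and e: "f \<cdot> u = x \<cdot> v" for T u v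
  proof -
    note T = arD(1)[OF u] and iZ = ar_id[OF R(2)]
    have "EMap C v (Ident C Z) (EMap C x (Ident C Z) \<delta>) = EMap C (x \<cdot> v) (Ident C Z) \<delta>"
      using EMap_comp[OF x v iZ iZ R(3)] comp_id(1)[OF iZ] by simp
    also have "\<dots> = EMap C u (Ident C Z) (EMap C f (Ident C Z) \<delta>)"
      using EMap_comp[OF R(5) u iZ iZ R(3)] comp_id(1)[OF iZ] e by simp
    also have "\<dots> = \<one>\<^bsub>Ext C T Z\<^esub>" unfolding pull_deflation[OF r] by (rule EMap_one[OF u iZ])
    finally obtain w0 where w0: "ar w0 T Y'" "v = f' \<cdot> w0" by (rule lift_along_deflation[OF r' v])
    note yw0 = ar_comp[OF w0(1) y(1)]
    let ?u = "add T Y u (neg T Y (y \<cdot> w0))"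
    have u': "ar ?u T Y" by (rule ar_add[OF u ar_neg[OF yw0]])
    have "f \<cdot> (y \<cdot> w0) = f \<cdot> u"
      unfolding comp_assoc[OF w0(1) y(1) R(5), symmetric] y(3)[symmetric] comp_assoc[OF w0(1) R'(5) x] w0(2)[symmetric] e ..
    then have "f \<cdot> ?u = zr T X" unfolding comp_sub[OF u yw0 R(5)] using add_neg(1)[OF ar_comp[OF u R(5)]] by simp
    then obtain t where t: "ar t T Z" "g \<cdot> t = ?u" using ker(4)[OF u'] by blast
    note gt = ar_comp[OF t(1) R'(4)]
    let ?w = "add T Y' w0 (g' \<cdot> t)"
    have w: "ar ?w T Y'" by (rule ar_add[OF w0(1) gt])
    have "y \<cdot> ?w = add T Y (y \<cdot> w0) ?u"
      unfolding comp_add_right[OF w0(1) gt y(1)] comp_assoc[OF t(1) R'(4) y(1), symmetric] y(2) t(2) ..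
    also have "\<dots> = u" by (rule add_sub[OF u yw0])
    finally have 1: "y \<cdot> ?w = u" .
    have "f' \<cdot> ?w = add T X' v ((f' \<cdot> g') \<cdot> t)"
      unfolding comp_add_right[OF w0(1) gt R'(5)] comp_assoc[OF t(1) R'(4,5)] w0(2) ..
    also have "\<dots> = v" unfolding realizes_comp_zero[OF r'] zr_comp[OF t(1) R'(1)] by (rule add_zr(1)[OF v])
    finally show ?thesis using w 1 by blast
  qed
  show "w = w'" if w: "ar w T Y'" and w': "ar w' T Y'" and ey: "y \<cdot> w = y \<cdot> w'" and ef: "f' \<cdot> w = f' \<cdot> w'" for T w w'
  proof -
    note T = arD(1)[OF w]
    let ?d = "add T Y' w (neg T Y' w')"
    have d: "ar ?d T Y'" by (rule ar_add[OF w ar_neg[OF w']])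
    have "f' \<cdot> ?d = zr T X'" unfolding comp_sub[OF w w' R'(5)] ef by (rule add_neg(1)[OF ar_comp[OF w' R'(5)]])
    then obtain t where t: "ar t T Z" "g' \<cdot> t = ?d" using ker'(4)[OF d] by blast
    have "g \<cdot> t = zr T Y"
      unfolding y(2)[symmetric] comp_assoc[OF t(1) R'(4) y(1)] t(2) comp_sub[OF w w' y(1)] ey
      by (rule add_neg(1)[OF ar_comp[OF w' y(1)]])
    then have "g \<cdot> t = g \<cdot> zr T Z" using comp_zr[OF R(4) T] by simp
    then have "t = zr T Z" by (rule ker(5)[OF t(1) ar_zr[OF T R(2)]])
    then have "?d = zr T Y'" using t(2) comp_zr[OF R'(4) T] by simp
    then show ?thesis using sub_eq_zr[OF w w'] by simp
  qed
qed

text \<open>Since \<open>\<theta> - 1\<close> kills \<open>g\<close> and is killed by \<open>f\<close>, its square vanishes and \<open>1 - (\<theta> - 1)\<close> is the inverse.\<close>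

lemma unipotent_inverse:
  assumes kc: conflations_exact and r: "realizes X Z \<delta> Y g f" and t: "ar \<theta> Y Y" "\<theta> \<cdot> g = g" "f \<cdot> \<theta> = f"
  obtains \<psi> where "ar \<psi> Y Y" "\<theta> \<cdot> \<psi> = Ident C Y" "\<psi> \<cdot> \<theta> = Ident C Y"
proof -
  note R = realizesD[OF r] and i = ar_id[OF realizesD(6)[OF r]]
  note cok = cokernelD[OF conflations_exactD(2)[OF kc r]]
  let ?n = "add Y Y \<theta> (neg Y Y (Ident C Y))"
  have n: "ar ?n Y Y" by (rule ar_add[OF t(1) ar_neg[OF i]])
  have "?n \<cdot> g = zr Z Y" unfolding sub_comp[OF R(4) t(1) i] t(2) comp_id(2)[OF R(4)] by (rule add_neg(1)[OF R(4)])
  then obtain s where s: "ar s X Y" "s \<cdot> f = ?n" using cok(4)[OF n] by blast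
  have fn: "f \<cdot> ?n = zr Y X" unfolding comp_sub[OF t(1) i R(5)] t(3) comp_id(1)[OF R(5)] by (rule add_neg(1)[OF R(5)])
  have "?n \<cdot> ?n = zr Y Y"
    using comp_assoc[OF n R(5) s(1)] s(2) fn comp_zr[OF s(1) R(6)] by simp
  note nn = this
  have th: "\<theta> = add Y Y ?n (Ident C Y)" using sub_add[OF t(1) i] by simp
  let ?p = "add Y Y (Ident C Y) (neg Y Y ?n)"
  have p: "ar ?p Y Y" by (rule ar_add[OF i ar_neg[OF n]])
  have np: "?n \<cdot> ?p = ?n"
    unfolding comp_sub[OF i n n] comp_id(1)[OF n] nn neg_zr[OF R(6) R(6)] by (rule add_zr(1)[OF n])
  have pn: "?p \<cdot> ?n = ?n"
    unfolding sub_comp[OF n i n] comp_id(2)[OF n] nn neg_zr[OF R(6) R(6)] by (rule add_zr(1)[OF n])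
  have "\<theta> \<cdot> ?p = add Y Y (?n \<cdot> ?p) ?p"
    using comp_add_left[OF p n i] comp_id(2)[OF p] th by simp
  also have "\<dots> = Ident C Y" unfolding np by (rule add_sub[OF i n])
  finally have 1: "\<theta> \<cdot> ?p = Ident C Y" .
  have "?p \<cdot> \<theta> = add Y Y (?p \<cdot> ?n) ?p"
    using comp_add_right[OF n i p] comp_id(1)[OF p] th by simp
  also have "\<dots> = Ident C Y" unfolding pn by (rule add_sub[OF i n])
  finally show thesis by (rule that[OF p 1])
qed

text \<open>A realization is invariant under isomorphisms of the middle term only, so isomorphisms
  at the ends require another extension. The comparison arrows \<open>t\<close> and
  \<open>t'\<close> given by the realization need not be inverse to each other, but their composites
  fix the outer maps and are invertible by \<open>unipotent_inverse\<close>.\<close>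

lemma conflation_iso_closed:
  assumes kc: conflations_exact and r: "realizes X Z \<delta> Y g f"
    and z: "iso_arr C Z Z' z" and y: "iso_arr C Y Y' y" and x: "iso_arr C X X' x"
    and o: "Z' \<in> Obj C" "Y' \<in> Obj C" "X' \<in> Obj C" and g': "ar g' Z' Y'" and f': "ar f' Y' X'"
    and e1: "y \<cdot> g = g' \<cdot> z" and e2: "x \<cdot> f = f' \<cdot> y"
  shows "conflation C Z' Y' X' g' f'"
proof -
  note R = realizesD[OF r]
  obtain z1 where z: "ar z Z Z'" "ar z1 Z' Z" "z1 \<cdot> z = Ident C Z" "z \<cdot> z1 = Ident C Z'" using iso_arrE[OF z R(2) o(1)] .
  obtain y1 where y: "ar y Y Y'" "ar y1 Y' Y" "y1 \<cdot> y = Ident C Y" "y \<cdot> y1 = Ident C Y'" using iso_arrE[OF y R(6) o(2)] .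
  obtain x1 where x: "ar x X X'" "ar x1 X' X" "x1 \<cdot> x = Ident C X" "x \<cdot> x1 = Ident C X'" using iso_arrE[OF x R(1) o(3)] .
  note iX' = ar_id[OF o(3)] and iZ' = ar_id[OF o(1)]
  \<comment> \<open>The extension is transported to the new ends: pushed forward along
    \<open>z\<close> and pulled back along the inverse of \<open>x\<close>.\<close>
  let ?d = "EMap C x1 z \<delta>"
  have d: "ext X' Z' ?d" by (rule EMap_ext[OF x(2) z(1) R(3)])
  obtain W k h where w: "realizes X' Z' ?d W k h" using realizes_exists[OF o(3,1) d] .
  note Wd = realizesD[OF w]
  have m1: "EMap C (Ident C X) z \<delta> = EMap C x (Ident C Z') ?d"
    unfolding EMap_comp[OF x(2,1) z(1) iZ' R(3)] x(3) comp_id(2)[OF z(1)] ..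
  obtain t where t: "ar t Y W" "t \<cdot> g = k \<cdot> z" "x \<cdot> f = h \<cdot> t" by (rule realize_morphism[OF r w z(1) x(1) m1])
  have m2: "EMap C (Ident C X') z1 ?d = EMap C x1 (Ident C Z) \<delta>"
    unfolding EMap_comp[OF x(2) iX' z(1,2) R(3)] z(3) comp_id(1)[OF x(2)] ..
  obtain t' where t': "ar t' W Y" "t' \<cdot> k = g \<cdot> z1" "x1 \<cdot> h = f \<cdot> t'" by (rule realize_morphism[OF w r z(2) x(2) m2])
  have a1: "(t' \<cdot> t) \<cdot> g = g"
    unfolding comp_assoc[OF R(4) t(1) t'(1)] t(2) comp_assoc[OF z(1) Wd(4) t'(1), symmetric] t'(2)
      comp_assoc[OF z(1,2) R(4)] z(3) by (rule comp_id(1)[OF R(4)])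
  have a2: "f \<cdot> (t' \<cdot> t) = f"
    unfolding comp_assoc[OF t(1) t'(1) R(5), symmetric] t'(3)[symmetric] comp_assoc[OF t(1) Wd(5) x(2)] t(3)[symmetric]
      comp_assoc[OF R(5) x(1,2), symmetric] x(3) by (rule comp_id(2)[OF R(5)])
  obtain p where p: "ar p Y Y" "(t' \<cdot> t) \<cdot> p = Ident C Y" "p \<cdot> (t' \<cdot> t) = Ident C Y"
    by (rule unipotent_inverse[OF kc r ar_comp[OF t(1) t'(1)] a1 a2])
  have b1: "(t \<cdot> t') \<cdot> k = k"
    unfolding comp_assoc[OF Wd(4) t'(1) t(1)] t'(2) comp_assoc[OF z(2) R(4) t(1), symmetric] t(2)
      comp_assoc[OF z(2,1) Wd(4)] z(4) by (rule comp_id(1)[OF Wd(4)])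
  have b2: "h \<cdot> (t \<cdot> t') = h"
    unfolding comp_assoc[OF t'(1) t(1) Wd(5), symmetric] t(3)[symmetric] comp_assoc[OF t'(1) R(5) x(1)] t'(3)[symmetric]
      comp_assoc[OF Wd(5) x(2,1), symmetric] x(4) by (rule comp_id(2)[OF Wd(5)])
  obtain p' where p': "ar p' W W" "(t \<cdot> t') \<cdot> p' = Ident C W" "p' \<cdot> (t \<cdot> t') = Ident C W"
    by (rule unipotent_inverse[OF kc w ar_comp[OF t'(1) t(1)] b1 b2])
  \<comment> \<open>Both composites of \<open>t\<close> and \<open>t'\<close> are invertible, so
    \<open>t\<close> has the left inverse \<open>l\<close> and the right inverse \<open>m\<close>,
    and these coincide.\<close>
  define l where "l = p \<cdot> t'"
  have l: "ar l W Y" unfolding l_def by (rule ar_comp[OF t'(1) p(1)])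
  have lt: "l \<cdot> t = Ident C Y" unfolding l_def comp_assoc[OF t(1) t'(1) p(1)] by (rule p(3))
  define m where "m = t' \<cdot> p'"
  have m: "ar m W Y" unfolding m_def by (rule ar_comp[OF p'(1) t'(1)])
  have tm: "t \<cdot> m = Ident C W" unfolding m_def comp_assoc[OF p'(1) t'(1) t(1), symmetric] by (rule p'(2))
  have "l = l \<cdot> (t \<cdot> m)" unfolding tm comp_id(1)[OF l] ..
  also have "\<dots> = m" unfolding comp_assoc[OF m t(1) l, symmetric] lt by (rule comp_id(2)[OF m])
  finally have tl: "t \<cdot> l = Ident C W" using tm by simp
  note yl = ar_comp[OF l y(1)] and ty = ar_comp[OF y(2) t(1)]
  have "realizes X' Z' ?d Y' g' f'"
  proof (rule realizes_iso[OF w yl ty])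
    show "(t \<cdot> y1) \<cdot> (y \<cdot> l) = Ident C W"
      unfolding comp_assoc[OF yl y(2) t(1)] comp_assoc[OF l y(1,2), symmetric] y(3) comp_id(2)[OF l] by (rule tl)
    show "(y \<cdot> l) \<cdot> (t \<cdot> y1) = Ident C Y'"
      unfolding comp_assoc[OF ty l y(1)] comp_assoc[OF y(2) t(1) l, symmetric] lt comp_id(2)[OF y(2)] by (rule y(4))
    have tg: "k = t \<cdot> (g \<cdot> z1)"
      unfolding comp_assoc[OF z(2) R(4) t(1), symmetric] t(2) comp_assoc[OF z(2,1) Wd(4)] z(4) comp_id(1)[OF Wd(4)] ..
    have "l \<cdot> k = g \<cdot> z1"
      unfolding tg comp_assoc[OF ar_comp[OF z(2) R(4)] t(1) l, symmetric] lt by (rule comp_id(2)[OF ar_comp[OF z(2) R(4)]])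
    then have "(y \<cdot> l) \<cdot> k = (y \<cdot> g) \<cdot> z1"
      unfolding comp_assoc[OF Wd(4) l y(1)] using comp_assoc[OF z(2) R(4) y(1)] by simp
    also have "\<dots> = g'" unfolding e1 comp_assoc[OF z(2,1) g'] z(4) by (rule comp_id(1)[OF g'])
    finally show "g' = (y \<cdot> l) \<cdot> k" by simp
    show "ar f' Y' X'" by (rule f')
    have "f' \<cdot> (y \<cdot> l) = (x \<cdot> f) \<cdot> l" unfolding e2 by (rule comp_assoc[OF l y(1) f', symmetric])
    also have "\<dots> = h" unfolding t(3) comp_assoc[OF l t(1) Wd(5)] tl by (rule comp_id(1)[OF Wd(5)])
    finally show "f' \<cdot> (y \<cdot> l) = h" .
  qed
  then show ?thesis unfolding conflation_iff by blast
qed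

text \<open>Composition of admissible arrows is (ET4) and its dual, and the required pushouts and
  pullbacks are those of extensions. Identities come from the trivial conflations with a zero
  object.\<close>

lemma quillen_of_conflations_exact:
  assumes kc: conflations_exact
  shows "quillen_exact C (conflation C)"
  unfolding quillen_exact_def
proof (intro conjI)
  show "additive_category C" by (rule additive)
  show "\<forall>Z Y X g f. conflation C Z Y X g f \<longrightarrow> short_exact C Z Y X g f" using kc by (simp add: conflations_exact_def)
  show "\<forall>Z Y X g f. \<forall>Z'\<in>Obj C. \<forall>Y'\<in>Obj C. \<forall>X'\<in>Obj C. \<forall>g'\<in>arr C Z' Y'. \<forall>f'\<in>arr C Y' X'. \<forall>z y x.
      conflation C Z Y X g f \<and> iso_arr C Z Z' z \<and> iso_arr C Y Y' y \<and> iso_arr C X X' x \<and>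
      y \<cdot> g = g' \<cdot> z \<and> x \<cdot> f = f' \<cdot> y \<longrightarrow> conflation C Z' Y' X' g' f'"
  proof (intro allI ballI impI, elim conjE)
    fix Z Y X g f Z' Y' X' g' f' z y x
    assume o: "Z' \<in> Obj C" "Y' \<in> Obj C" "X' \<in> Obj C" and g': "g' \<in> arr C Z' Y'" "f' \<in> arr C Y' X'"
      and c: "conflation C Z Y X g f" and i: "iso_arr C Z Z' z" "iso_arr C Y Y' y" "iso_arr C X X' x"
      and e: "y \<cdot> g = g' \<cdot> z" "x \<cdot> f = f' \<cdot> y"
    obtain \<delta> where r: "realizes X Z \<delta> Y g f" using c unfolding conflation_iff by blast
    show "conflation C Z' Y' X' g' f'"
      by (rule conflation_iso_closed[OF kc r i o _ _ e]) (simp_all add: ar_def o g')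
  qed
  show "\<forall>X\<in>Obj C. adm_monic (conflation C) X X (Ident C X) \<and> adm_epic (conflation C) X X (Ident C X)"
    unfolding adm_monic_def adm_epic_def conflation_iff using zero_object_trivial by metis
  show "\<forall>X Y Z f g. adm_monic (conflation C) X Y f \<and> adm_monic (conflation C) Y Z g \<longrightarrow> adm_monic (conflation C) X Z (g \<cdot> f)"
    unfolding adm_monic_def conflation_iff using inflation_comp by metis
  show "\<forall>X Y Z f g. adm_epic (conflation C) X Y f \<and> adm_epic (conflation C) Y Z g \<longrightarrow> adm_epic (conflation C) X Z (g \<cdot> f)"
    unfolding adm_epic_def conflation_iff using deflation_comp by metis
  show "\<forall>Z Y g. \<forall>Z'\<in>Obj C. \<forall>z\<in>arr C Z Z'. adm_monic (conflation C) Z Y g \<longrightarrow>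
        (\<exists>P g' y. is_pushout C Z Y Z' P g z y g' \<and> adm_monic (conflation C) Z' P g')"
  proof (intro allI ballI impI)
    fix Z Y g Z' z assume Z': "Z' \<in> Obj C" and "z \<in> arr C Z Z'" and "adm_monic (conflation C) Z Y g"
    then obtain X f \<delta> where r: "realizes X Z \<delta> Y g f" unfolding adm_monic_def conflation_iff by blast
    note R = realizesD[OF r]
    have z: "ar z Z Z'" using R(2) Z' \<open>z \<in> arr C Z Z'\<close> by (simp add: ar_def)
    obtain Y' g' f' y where p: "realizes X Z' (EMap C (Ident C X) z \<delta>) Y' g' f'" "ar y Y Y'" "y \<cdot> g = g' \<cdot> z" "f' \<cdot> y = f"
      by (rule pushoutX[OF r z])
    note R' = realizesD[OF p(1)]
    have "is_pushout C Z Y Z' Y' g z y g'"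
      unfolding is_pushout_def
    proof (intro conjI ballI impI)
      show "Y' \<in> Obj C" "g \<in> arr C Z Y" "z \<in> arr C Z Z'" "y \<in> arr C Y Y'" "g' \<in> arr C Z' Y'" "y \<cdot> g = g' \<cdot> z"
        using R R' p z by (simp_all add: ar_def)
      fix T u v assume T: "T \<in> Obj C" and u0: "u \<in> arr C Y T" and v0: "v \<in> arr C Z' T" and e: "u \<cdot> g = v \<cdot> z"
      have u: "ar u Y T" and v: "ar v Z' T" using T R R' u0 v0 by (simp_all add: ar_def)
      obtain w where w: "ar w Y' T" "w \<cdot> y = u" "w \<cdot> g' = v"
        using pushout_exists[OF kc r z p u v e] by blast
      show "\<exists>!w. w \<in> arr C Y' T \<and> w \<cdot> y = u \<and> w \<cdot> g' = v"
      proof (rule ex1I[of _ w])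
        show "w \<in> arr C Y' T \<and> w \<cdot> y = u \<and> w \<cdot> g' = v" using w by (simp add: ar_def)
        fix w' assume w': "w' \<in> arr C Y' T \<and> w' \<cdot> y = u \<and> w' \<cdot> g' = v"
        then have "ar w' Y' T" using T R' by (simp add: ar_def)
        then show "w' = w" by (rule pushout_unique[OF kc r z p _ w(1)]) (simp_all add: w w')
      qed
    qed
    moreover have "adm_monic (conflation C) Z' Y' g'" unfolding adm_monic_def conflation_iff using p(1) by blast
    ultimately show "\<exists>P g' y. is_pushout C Z Y Z' P g z y g' \<and> adm_monic (conflation C) Z' P g'" by blast
  qed
  show "\<forall>Y X f. \<forall>X'\<in>Obj C. \<forall>x\<in>arr C X' X. adm_epic (conflation C) Y X f \<longrightarrow>
        (\<exists>P f' y. is_pullback C P Y X' X y f' f x \<and> adm_epic (conflation C) P X' f')"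
  proof (intro allI ballI impI)
    fix Y X f X' x assume X': "X' \<in> Obj C" and "x \<in> arr C X' X" and "adm_epic (conflation C) Y X f"
    then obtain Z g \<delta> where r: "realizes X Z \<delta> Y g f" unfolding adm_epic_def conflation_iff by blast
    note R = realizesD[OF r]
    have x: "ar x X' X" using R(1) X' \<open>x \<in> arr C X' X\<close> by (simp add: ar_def)
    obtain Y' g' f' y where p: "realizes X' Z (EMap C x (Ident C Z) \<delta>) Y' g' f'" "ar y Y' Y" "y \<cdot> g' = g" "x \<cdot> f' = f \<cdot> y"
      by (rule pullbackX[OF r x])
    note R' = realizesD[OF p(1)]
    have "is_pullback C Y' Y X' X y f' f x"
      unfolding is_pullback_def
    proof (intro conjI ballI impI)
      show "Y' \<in> Obj C" "y \<in> arr C Y' Y" "f' \<in> arr C Y' X'" "f \<in> arr C Y X" "x \<in> arr C X' X" "f \<cdot> y = x \<cdot> f'"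
        using R R' p x by (simp_all add: ar_def)
      fix T u v assume T: "T \<in> Obj C" and u0: "u \<in> arr C T Y" and v0: "v \<in> arr C T X'" and e: "f \<cdot> u = x \<cdot> v"
      have u: "ar u T Y" and v: "ar v T X'" using T R R' u0 v0 by (simp_all add: ar_def)
      obtain w where w: "ar w T Y'" "y \<cdot> w = u" "f' \<cdot> w = v"
        using pullback_exists[OF kc r x p u v e] by blast
      show "\<exists>!w. w \<in> arr C T Y' \<and> y \<cdot> w = u \<and> f' \<cdot> w = v"
      proof (rule ex1I[of _ w])
        show "w \<in> arr C T Y' \<and> y \<cdot> w = u \<and> f' \<cdot> w = v" using w by (simp add: ar_def)
        fix w' assume w': "w' \<in> arr C T Y' \<and> y \<cdot> w' = u \<and> f' \<cdot> w' = v"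
        then have "ar w' T Y'" using T R' by (simp add: ar_def)
        then show "w' = w" by (rule pullback_unique[OF kc r x p _ w(1)]) (simp_all add: w w')
      qed
    qed
    moreover have "adm_epic (conflation C) Y' X' f'" unfolding adm_epic_def conflation_iff using p(1) by blast
    ultimately show "\<exists>P f' y. is_pullback C P Y X' X y f' f x \<and> adm_epic (conflation C) P X' f'" by blast
  qed
qed

end

section \<open>Defects are the locally zero functors\<close>

locale ext_wk = ext_cat C + wk_cat C for C :: "('o, 'm, 'e) extri" (structure)
begin

text \<open>A locally zero functor has a generator killed by some deflation \<open>e\<close>. If
  \<open>r\<close> covers the relations, then so does \<open>(r, e)\<close>, which is a deflation by
  \<open>sum_deflation\<close>; its defect is the given functor.\<close>

lemma def_objects_iff:
  "F \<in> def_objects C \<longleftrightarrow> F \<in> mod_objects C \<and>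
    (\<forall>W a. el F W a \<longrightarrow> (\<exists>V e. defl e V W \<and> FAr F e a = zero_at F V))"
proof
  assume F: "F \<in> def_objects C"
  then obtain Z Y X g f where "conflation C Z Y X g f" and iso: "presheaf_iso C F
       (presheaf_cok C (representable C Y) (representable C X) (representable_map C f))" and FM: "F \<in> mod_objects C"
    unfolding def_objects_def by blast
  then obtain \<delta> where r: "realizes X Z \<delta> Y g f" unfolding conflation_iff by blast
  note R = realizesD[OF r]
  have fd: "defl f Y X" unfolding defl_def using r by blast
  have pF: "psh F" using FM by (simp add: mod_objects_def fp_psh)
  note c = cokf_facts[OF R(5)]
  let ?c = "cokcls f X (Ident C X)"
  have "presheaf_cok C (representable C Y) (representable C X) (representable_map C f) = cokf f"
    by (simp add: cokf_def ar_dom[OF R(5)] ar_cod[OF R(5)])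
  then obtain \<eta> where \<eta>: "nt F (cokf f) \<eta>" "\<forall>X\<in>Obj C. \<eta> X \<in> iso (FOb F X) (FOb (cokf f) X)"
    using iso unfolding presheaf_iso_def by auto
  have "\<exists>V e. defl e V W \<and> FAr F e a = zero_at F V" if a: "el F W a" for W a
  proof -
    obtain h where h: "ar h W X" "\<eta> W a = FAr (cokf f) h ?c" using genD(2)[OF c(2) nt_el[OF \<eta>(1) a]] by blast
    \<comment> \<open>The covering that kills a class is the pullback of the deflation
      \<open>f\<close> along a representative \<open>h\<close>.\<close>
    obtain V e h' where e: "defl e V W" "ar h' V Y" "h \<cdot> e = f \<cdot> h'" using defl_pull[OF fd h(1)] by blast
    note e0 = defl_ar[OF e(1)]
    note V = arD(1)[OF e0]
    have "\<eta> V (FAr F e a) = FAr (cokf f) (h \<cdot> e) ?c"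
      using nt_nat[OF \<eta>(1) e0 a] h(2) act_comp[OF c(1) e0 h(1) genD(1)[OF c(2)]] by simp
    also have "\<dots> = zero_at (cokf f) V" unfolding e(3) by (rule ann_zero[OF c(1,3) genD(1)[OF c(2)] e(2)])
    also have "\<dots> = \<eta> V (zero_at F V)" using nt_zero[OF \<eta>(1) pF c(1) V] by simp
    finally have "FAr F e a = zero_at F V"
      using \<eta>(2) V elD(2)[OF el_act[OF pF e0 a]] elD(2)[OF el_zero[OF pF V]]
      unfolding iso_def bij_betw_def inj_on_def by blast
    then show ?thesis using e(1) by blast
  qed
  then show "F \<in> mod_objects C \<and> (\<forall>W a. el F W a \<longrightarrow> (\<exists>V e. defl e V W \<and> FAr F e a = zero_at F V))"
    using FM by blast
next
  assume *: "F \<in> mod_objects C \<and> (\<forall>W a. el F W a \<longrightarrow> (\<exists>V e. defl e V W \<and> FAr F e a = zero_at F V))"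
  then have FM: "F \<in> mod_objects C" by blast
  then have fpF: "fp F" by (simp add: mod_objects_def)
  obtain X x R r where pF: "psh F" and g: "gen F X x" and a: "ann F X x R r" using fpF[unfolded fp_iff] by blast
  note x = genD(1)[OF g] and r = annD(1)[OF a]
  obtain Y e where e: "defl e Y X" "FAr F e x = zero_at F Y" using * x by blast
  note e0 = defl_ar[OF e(1)]
  obtain P i j p q where b: "biproduct C R Y P i j p q" and P: "P \<in> Obj C" using biproductE[OF arD(1)[OF r] arD(1)[OF e0]] .
  note B = biproductD[OF b arD(1)[OF r] arD(1)[OF e0]]
  \<comment> \<open>Since \<open>e\<close> kills the generator, adding it to the relations leaves
    the cokernel unchanged, while the relation becomes a deflation.\<close>
  let ?d = "add P X (r \<cdot> p) (e \<cdot> q)"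
  have d: "defl ?d P X" by (rule sum_deflation[OF r e(1) b])
  note d0 = defl_ar[OF d]
  note rp = ar_comp[OF B(3) r] and eq = ar_comp[OF B(4) e0]
  have "FAr F ?d x = zero_at F P"
    unfolding act_add[OF pF rp eq x] act_comp[OF pF B(3) r x] act_comp[OF pF B(4) e0 x] annD(2)[OF a] e(2)
      act_zero[OF pF B(3)] act_zero[OF pF B(4)] by (rule plus_zero(1)[OF pF el_zero[OF pF P]])
  moreover have di: "?d \<cdot> i = r"
    unfolding comp_add_left[OF B(1) rp eq] comp_assoc[OF B(1,3) r] comp_assoc[OF B(1,4) e0] B(5,8) comp_id(1)[OF r]
      comp_zr[OF e0 arD(1)[OF r]] by (rule add_zr(1)[OF r])
  have "\<exists>k. ar k W P \<and> h = ?d \<cdot> k" if h: "ar h W X" "FAr F h x = zero_at F W" for W h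
  proof -
    obtain k where k: "ar k W R" "h = r \<cdot> k" using annD(3)[OF a h] by blast
    have "h = ?d \<cdot> (i \<cdot> k)" unfolding comp_assoc[OF k(1) B(1) d0, symmetric] di by (rule k(2))
    then show ?thesis using ar_comp[OF k(1) B(1)] by blast
  qed
  ultimately have "ann F X x P ?d" unfolding ann_def using d0 by blast
  then have iso: "presheaf_iso C F (cokf ?d)" by (rule presheaf_iso_cokf[OF pF g])
  obtain Z \<delta> k where "realizes X Z \<delta> P k ?d" using d unfolding defl_def by blast
  then have cf: "conflation C Z P X k ?d" unfolding conflation_iff by blast
  have ce: "cokf ?d = presheaf_cok C (representable C P) (representable C X) (representable_map C ?d)"
    by (simp add: cokf_def ar_dom[OF d0] ar_cod[OF d0])
  show "F \<in> def_objects C"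
    unfolding def_objects_def
    by (intro CollectI conjI FM exI, rule cf, rule iso[unfolded ce])
qed

sublocale loc_cat C defl "def_objects C"
proof
  show "defl e V W \<Longrightarrow> ar e V W" for e V W by (rule defl_ar)
  show "W \<in> Obj C \<Longrightarrow> defl (Ident C W) W W" for W by (rule defl_id)
  show "defl e V W \<Longrightarrow> defl e' V' V \<Longrightarrow> defl (e \<cdot> e') V' W" for e V W e' V' by (rule defl_comp)
  show "defl e V W \<Longrightarrow> ar h W' W \<Longrightarrow> \<exists>V' e' h'. defl e' V' W' \<and> ar h' V' V \<and> h \<cdot> e' = e \<cdot> h'" for e V W h W'
    by (rule defl_pull)
  show "F \<in> def_objects C \<longleftrightarrow> F \<in> mod_objects C \<and>
      (\<forall>W a. el F W a \<longrightarrow> (\<exists>V e. defl e V W \<and> FAr F e a = zero_at F V))" for F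
    by (rule def_objects_iff)
qed

end

section \<open>The functor into the Serre quotient\<close>

text \<open>This makes the criterion \<open>equivalence_if\<close> available for
  \<open>lex_cat\<close> as well as for the quotient.\<close>

lemma lincat_presheaf_cat:
  fixes C :: "('o, 'm, 'z) acat_scheme"
  assumes C: "preadditive C" and P: "\<And>F. F \<in> \<P> \<Longrightarrow> is_presheaf C F"
  shows "lincat (presheaf_cat C \<P>)"
proof -
  interpret preadd_cat C by unfold_locales (rule C)
  let ?L = "presheaf_cat C \<P>"
  have S: "Obj ?L = \<P>"
    "m \<in> arr ?L F G \<longleftrightarrow> (\<exists>\<eta>. m = (F, \<eta>, G) \<and> nt F G \<eta>)"
    "Ident ?L F = (F, nat_mk F (\<lambda>W a. a), F)"
    "(G', \<theta>, H) \<cdot>\<^bsub>?L\<^esub> (F, \<eta>, G) = (F, nat_mk F (\<lambda>W a. \<theta> W (\<eta> W a)), H)"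
    "(F', \<eta>, G') \<otimes>\<^bsub>Hom ?L F G\<^esub> (F'', \<theta>, G'') = (F, nat_mk F (\<lambda>W a. plus_at G W (\<eta> W a) (\<theta> W a)), G)"
    "Dom ?L (F, \<eta>, G) = F" "Cod ?L (F, \<eta>, G) = G"
    for F G H F' G' F'' G'' \<eta> \<theta> m
    by (auto simp: presheaf_cat_def nat_mk_def)
  have eq: "nat_mk F \<sigma> = nat_mk F \<tau>" if "\<And>W a. el F W a \<Longrightarrow> \<sigma> W a = \<tau> W a" for F :: "('o, 'm, 'c) presheaf" and \<sigma> \<tau> :: "'o \<Rightarrow> 'c \<Rightarrow> 'c"
    using that by (auto simp: nat_mk_def el_def fun_eq_iff restrict_def)
  have self: "nat_mk F \<sigma> = \<sigma>" if "psh F" "nt F G \<sigma>" for F G :: "('o, 'm, 'c) presheaf" and \<sigma>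
    using nt_ext[of "nat_mk F \<sigma>" F G \<sigma>] nt_nat_mk[of F G \<sigma>] that by (simp add: nat_mk_app nt_el nt_plus nt_nat)
  show ?thesis
  proof
    fix F G m assume F: "F \<in> Obj ?L" and G: "G \<in> Obj ?L" and "m \<in> arr ?L F G"
    then obtain \<eta> where m: "m = (F, \<eta>, G)" and \<eta>: "nt F G \<eta>" by (auto simp: S(2))
    have pF: "psh F" and pG: "psh G" using F G P by (simp_all add: S(1))
    show "Dom ?L m = F \<and> Cod ?L m = G" by (simp add: m S)
    show "m \<cdot>\<^bsub>?L\<^esub> Ident ?L F = m"
      unfolding m S(3,4) using eq[of F "\<lambda>W a. \<eta> W (nat_mk F (\<lambda>W a. a) W a)" \<eta>] self[OF pF \<eta>] by (simp add: nat_mk_app)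
    show "Ident ?L G \<cdot>\<^bsub>?L\<^esub> m = m"
      unfolding m S(3,4) using eq[of F "\<lambda>W a. nat_mk G (\<lambda>W a. a) W (\<eta> W a)" \<eta>] self[OF pF \<eta>] nt_el[OF \<eta>] by (simp add: nat_mk_app)
    show "m \<otimes>\<^bsub>Hom ?L F G\<^esub> n \<in> arr ?L F G" if n: "n \<in> arr ?L F G" for n
    proof -
      obtain \<theta> where "n = (F, \<theta>, G)" "nt F G \<theta>" using n by (auto simp: S(2))
      then show ?thesis using nt_add[OF pF pG \<eta>] by (simp add: m S)
    qed
    fix H n assume H: "H \<in> Obj ?L" and "n \<in> arr ?L G H"
    then obtain \<theta> where n: "n = (G, \<theta>, H)" and \<theta>: "nt G H \<theta>" by (auto simp: S(2))
    show "n \<cdot>\<^bsub>?L\<^esub> m \<in> arr ?L F H" unfolding m n S(4) using nt_comp[OF pF \<eta> \<theta>] by (simp add: S(2))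
    show "n \<cdot>\<^bsub>?L\<^esub> (m \<otimes>\<^bsub>Hom ?L F G\<^esub> k) = (n \<cdot>\<^bsub>?L\<^esub> m) \<otimes>\<^bsub>Hom ?L F H\<^esub> (n \<cdot>\<^bsub>?L\<^esub> k)" if k: "k \<in> arr ?L F G" for k
    proof -
      obtain \<kappa> where "k = (F, \<kappa>, G)" "nt F G \<kappa>" using k by (auto simp: S(2))
      then show ?thesis by (auto simp: m n S nat_mk_app nt_plus[OF \<theta>] nt_el[OF \<eta>] nt_el intro!: eq)
    qed
    show "(n \<otimes>\<^bsub>Hom ?L G H\<^esub> k) \<cdot>\<^bsub>?L\<^esub> m = (n \<cdot>\<^bsub>?L\<^esub> m) \<otimes>\<^bsub>Hom ?L F H\<^esub> (k \<cdot>\<^bsub>?L\<^esub> m)" if k: "k \<in> arr ?L G H" for k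
    proof -
      obtain \<kappa> where "k = (G, \<kappa>, H)" "nt G H \<kappa>" using k by (auto simp: S(2))
      then show ?thesis by (auto simp: m n S nat_mk_app nt_el[OF \<eta>] intro!: eq)
    qed
    show "(l \<cdot>\<^bsub>?L\<^esub> n) \<cdot>\<^bsub>?L\<^esub> m = l \<cdot>\<^bsub>?L\<^esub> (n \<cdot>\<^bsub>?L\<^esub> m)" if l: "l \<in> arr ?L H K" for K l
    proof -
      obtain \<kappa> where "l = (H, \<kappa>, K)" "nt H K \<kappa>" using l by (auto simp: S(2))
      then show ?thesis by (auto simp: m n S nat_mk_app nt_el[OF \<eta>] intro!: eq)
    qed
  next
    fix F assume "F \<in> Obj ?L"
    then have "psh F" using P by (simp add: S(1))
    then show "Ident ?L F \<in> arr ?L F F" unfolding S(3) using nt_id by (simp add: S(2))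
  qed
qed

lemma iso_arr_sym: "iso_arr C X Y f \<Longrightarrow> \<exists>g. iso_arr C Y X g"
  unfolding iso_arr_def by blast

context add_cat
begin

lemma ymap_id: "X \<in> Obj C \<Longrightarrow> ymap (Ident C X) = nat_mk (yo X) (\<lambda>W a. a)"
  by (rule nt_ext[OF nt_ymap[OF ar_id] nt_id[OF psh_yo]])
     (auto simp: el_yo ymap_app[OF ar_id] comp_id nat_mk_app el_yoI)

lemma ymap_comp:
  assumes f: "ar f X Y" and g: "ar g Y Z"
  shows "ymap (g \<cdot> f) = nat_mk (yo X) (\<lambda>W a. ymap g W (ymap f W a))"
  by (rule nt_ext[OF nt_ymap[OF ar_comp[OF f g]] nt_comp[OF psh_yo[OF arD(1)[OF f]] nt_ymap[OF f] nt_ymap[OF g]]])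
     (auto simp: el_yo[OF arD(1)[OF f]] ymap_app[OF ar_comp[OF f g]] ymap_app[OF f] ymap_app[OF g] ar_comp[OF _ f]
       comp_assoc[OF _ f g] nat_mk_app el_yoI)

lemma ymap_add:
  assumes f: "ar f X Y" and g: "ar g X Y"
  shows "ymap (add X Y f g) = nat_mk (yo X) (\<lambda>W a. plus_at (yo Y) W (ymap f W a) (ymap g W a))"
  by (rule nt_ext[OF nt_ymap[OF ar_add[OF f g]] nt_add[OF psh_yo[OF arD(1)[OF f]] psh_yo[OF arD(2)[OF f]] nt_ymap[OF f] nt_ymap[OF g]]])
     (auto simp: el_yo[OF arD(1)[OF f]] ymap_app[OF ar_add[OF f g]] ymap_app[OF f] ymap_app[OF g] yo_plus
       comp_add_left[OF _ f g] nat_mk_app el_yoI)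

lemma ymap_zr:
  assumes "X \<in> Obj C" "Y \<in> Obj C"
  shows "ymap (zr X Y) = nat_mk (yo X) (\<lambda>W a. zero_at (yo Y) W)"
  by (rule nt_ext[OF nt_ymap[OF ar_zr[OF assms]] nt_zero_map[OF psh_yo[OF assms(1)] psh_yo[OF assms(2)]]])
     (auto simp: el_yo[OF assms(1)] ymap_app[OF ar_zr[OF assms]] yo_zero zr_comp assms nat_mk_app el_yoI)

end

context ext_wk
begin

section \<open>The functor \<open>E\<close>: exactness, fullness and faithfulness\<close>

abbreviation E where "E \<equiv> E_functor C"

lemma mod_quotient_eq: "mod_quotient C = D"
  by (simp add: mod_quotient_def)

lemma E_simps: "FOb E X = yo X" "ar f X Y \<Longrightarrow> FAr E f = quot_map (yo X) (yo Y) (ymap f)"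
  using Q_functor(1)[of "yo X" "ymap f" "yo Y"] Q_functor(2)
  by (simp_all add: E_functor_def fctr_comp_def yoneda_def ymap_def ar_dom ar_cod)

lemma E_additive: "additive_functor C D E"
  unfolding additive_functor_def
proof (intro conjI ballI)
  fix X assume X: "X \<in> Obj C"
  show "FOb E X \<in> Obj D" using yo_mod[OF X] by (simp add: E_simps(1) D_simps)
  show "FAr E (Ident C X) = Ident D (FOb E X)"
    unfolding E_simps(2)[OF ar_id[OF X]] E_simps(1) D_simps ymap_id[OF X] ..
  fix Y assume Y: "Y \<in> Obj C"
  note M = yo_mod[OF X] yo_mod[OF Y]
  show "FAr E \<in> hom (Hom C X Y) (Hom D (FOb E X) (FOb E Y))"
  proof (rule homI)
    fix f assume "f \<in> arr C X Y"
    then have f: "ar f X Y" using X Y by (simp add: ar_def)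
    show "FAr E f \<in> arr D (FOb E X) (FOb E Y)"
      unfolding E_simps(2)[OF f] E_simps(1) by (rule quot_arrD(3)[OF quot_arr_quot_map[OF M nt_ymap[OF f]]])
    fix g assume "g \<in> arr C X Y"
    then have g: "ar g X Y" using X Y by (simp add: ar_def)
    show "FAr E (add X Y f g) = FAr E f \<otimes>\<^bsub>Hom D (FOb E X) (FOb E Y)\<^esub> FAr E g"
      unfolding E_simps(2)[OF f] E_simps(2)[OF g] E_simps(2)[OF ar_add[OF f g]] E_simps(1) ymap_add[OF f g]
      by (rule Q_add[OF M nt_ymap[OF f] nt_ymap[OF g]])
  qed
  fix Z f g assume Z: "Z \<in> Obj C" and "f \<in> arr C X Y" "g \<in> arr C Y Z"
  then have f: "ar f X Y" and g: "ar g Y Z" using X Y Z by (simp_all add: ar_def)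
  show "FAr E (g \<cdot> f) = FAr E g \<cdot>\<^bsub>D\<^esub> FAr E f"
    unfolding E_simps(2)[OF f] E_simps(2)[OF g] E_simps(2)[OF ar_comp[OF f g]] ymap_comp[OF f g]
    by (rule Q_comp[OF M yo_mod[OF Z] nt_ymap[OF f] nt_ymap[OF g], symmetric])
qed

lemma E_zero: "X \<in> Obj C \<Longrightarrow> Y \<in> Obj C \<Longrightarrow> FAr E (zr X Y) = zero_arr D (FOb E X) (FOb E Y)"
  by (simp add: E_simps(1) E_simps(2)[OF ar_zr] D_simps ymap_zr)

sublocale Q: lincat0 D by (rule lincat0_D)

sublocale EF: functor_pair C D E
  by unfold_locales (rule E_additive)

text \<open>The images of conflations are kernel-cokernel pairs by exactness, and a fully faithful
  functor that preserves zero arrows reflects both universal properties.\<close>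

lemma conflations_exact_of_exact_ff:
  assumes ex: "exact_functor C D E" and ff: "fully_faithful C D E"
  shows conflations_exact
  unfolding conflations_exact_def
proof (intro allI impI)
  fix Z Y X g f assume c: "conflation C Z Y X g f"
  then obtain \<delta> where "realizes X Z \<delta> Y g f" unfolding conflation_iff by blast
  note R = realizesD[OF this]
  have se: "short_exact D (FOb E Z) (FOb E Y) (FOb E X) (FAr E g) (FAr E f)"
    using ex c unfolding exact_functor_def by blast
  show "short_exact C Z Y X g f"
    unfolding short_exact_def
    using EF.reflect_kernel[OF ff E_zero R(4,5)] EF.reflect_cokernel[OF ff E_zero R(4,5)] se
    unfolding short_exact_def by blast
qed

text \<open>A deflation is a cokernel and can be cancelled on the right; in sheaf terms,
  representable functors are separated.\<close>

lemma loc_eq_yo: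
  assumes kc: conflations_exact and h: "ar h W X" and k: "ar k W X"
  shows "loc_eq (yo X) W {h} {k} \<longleftrightarrow> h = k"
proof
  assume "loc_eq (yo X) W {h} {k}"
  then obtain e V where e: "defl e V W" "FAr (yo X) e {h} = FAr (yo X) e {k}" by (rule loc_eqE)
  obtain Z \<delta> g where "realizes W Z \<delta> V g e" using e(1) unfolding defl_def by blast
  then show "h = k" using cokernelD(5)[OF conflations_exactD(2)[OF kc] h k] e(2) by (simp add: yo_act)
qed (simp add: loc_eq_refl arD(1)[OF h])

lemma loc_inj_yo:
  assumes f: "ar f X Y" and m: "\<And>T u. ar u T X \<Longrightarrow> f \<cdot> u = zr T Y \<Longrightarrow> u = zr T X"
  shows "loc_inj (yo X) (ymap f)"
  unfolding loc_inj_def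
proof (intro allI impI)
  fix W a b assume a: "el (yo X) W a" and b: "el (yo X) W b" and e: "ymap f W a = ymap f W b"
  obtain h where h: "ar h W X" "a = {h}" using iffD1[OF el_yo[OF arD(1)[OF f]] a] by blast
  obtain k where k: "ar k W X" "b = {k}" using iffD1[OF el_yo[OF arD(1)[OF f]] b] by blast
  have "f \<cdot> h = f \<cdot> k" using e by (simp add: h(2) k(2) ymap_app[OF f h(1)] ymap_app[OF f k(1)])
  then have "f \<cdot> add W X h (neg W X k) = zr W Y"
    unfolding comp_sub[OF h(1) k(1) f] using add_neg(1)[OF ar_comp[OF k(1) f]] by simp
  then have "h = k" using m[OF ar_add[OF h(1) ar_neg[OF k(1)]]] sub_eq_zr[OF h(1) k(1)] by blast
  then show "loc_eq (yo X) W a b" using loc_eq_refl[OF elD(1)[OF a]] h(2) k(2) by simp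
qed

text \<open>An arrow into \<open>X\<close> lifts along \<open>f\<close> after the deflation has been
  pulled back along it.\<close>

lemma loc_surj_yo:
  assumes f: "defl f Y X"
  shows "loc_surj (yo Y) (yo X) (ymap f)"
  unfolding loc_surj_def
proof (intro allI impI)
  note f0 = defl_ar[OF f]
  fix W b assume b: "el (yo X) W b"
  obtain h where h: "ar h W X" "b = {h}" using iffD1[OF el_yo[OF arD(2)[OF f0]] b] by blast
  obtain V e h' where e: "defl e V W" "ar h' V Y" "h \<cdot> e = f \<cdot> h'" using defl_pull[OF f h(1)] by blast
  have "ymap f V {h'} = FAr (yo X) e b" by (simp add: ymap_app[OF f0 e(2)] h(2) yo_act e(3))
  then show "\<exists>V e a. defl e V W \<and> el (yo Y) V a \<and> ymap f V a = FAr (yo X) e b"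
    using e(1) el_yoI[OF e(2)] by blast
qed

lemma E_exact:
  assumes kc: conflations_exact
  shows "exact_functor C D E"
  unfolding exact_functor_def
proof (intro conjI E_additive allI impI)
  fix Z Y X g f assume "conflation C Z Y X g f"
  then obtain \<delta> where r: "realizes X Z \<delta> Y g f" unfolding conflation_iff by blast
  note R = realizesD[OF r]
  note ker = kernelD[OF conflations_exactD(1)[OF kc r]]
  note MZ = yo_mod[OF R(2)] and MY = yo_mod[OF R(6)] and MX = yo_mod[OF R(1)]
  note ng = nt_ymap[OF R(4)] and nf = nt_ymap[OF R(5)]
  have fd: "defl f Y X" unfolding defl_def using r by blast
  have li: "loc_inj (yo Z) (ymap g)"
  proof (rule loc_inj_yo[OF R(4)])
    fix T u assume u: "ar u T Z" and "g \<cdot> u = zr T Y"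
    then have "g \<cdot> u = g \<cdot> zr T Z" using comp_zr[OF R(4) arD(1)[OF u]] by simp
    then show "u = zr T Z" by (rule ker(5)[OF u ar_zr[OF arD(1)[OF u] R(2)]])
  qed
  have z: "loc_eq (yo X) W (ymap f W (ymap g W c)) (zero_at (yo X) W)" if c: "el (yo Z) W c" for W c
  proof -
    obtain h where h: "ar h W Z" "c = {h}" using iffD1[OF el_yo[OF R(2)] c] by blast
    have "f \<cdot> (g \<cdot> h) = zr W X"
      unfolding comp_assoc[OF h(1) R(4,5), symmetric] ker(3) by (rule zr_comp[OF h(1) R(1)])
    then show ?thesis
      unfolding h(2) ymap_app[OF R(4) h(1)] ymap_app[OF R(5) ar_comp[OF h(1) R(4)]] yo_zero
      using loc_eq_refl[OF arD(1)[OF h(1)]] by simp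
  qed
  have ex: "\<exists>V e c. defl e V W \<and> el (yo Z) V c \<and> ymap g V c = FAr (yo Y) e a"
    if a: "el (yo Y) W a" and l: "loc_eq (yo X) W (ymap f W a) (zero_at (yo X) W)" for W a
  proof -
    obtain h where h: "ar h W Y" "a = {h}" using iffD1[OF el_yo[OF R(6)] a] by blast
    note W = arD(1)[OF h(1)]
    have "f \<cdot> h = zr W X"
      using l loc_eq_yo[OF kc ar_comp[OF h(1) R(5)] ar_zr[OF W R(1)]] by (simp add: h(2) ymap_app[OF R(5) h(1)] yo_zero)
    then obtain u where u: "ar u W Z" "g \<cdot> u = h" using ker(4)[OF h(1)] by blast
    have "ymap g W {u} = FAr (yo Y) (Ident C W) a" by (simp add: ymap_app[OF R(4) u(1)] u(2) h(2) yo_act comp_id(1)[OF h(1)])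
    then show ?thesis using defl_id[OF W] el_yoI[OF u(1)] by blast
  qed
  have "is_kernel D (yo Z) (yo Y) (yo X) (quot_map (yo Z) (yo Y) (ymap g)) (quot_map (yo Y) (yo X) (ymap f))"
    by (rule D_kernel[OF MZ MY MX ng nf li z ex])
  moreover have "is_cokernel D (yo Z) (yo Y) (yo X) (quot_map (yo Z) (yo Y) (ymap g)) (quot_map (yo Y) (yo X) (ymap f))"
    by (rule D_cokernel[OF MZ MY MX ng nf loc_surj_yo[OF fd] z ex])
  ultimately show "short_exact D (FOb E Z) (FOb E Y) (FOb E X) (FAr E g) (FAr E f)"
    unfolding short_exact_def E_simps(1) E_simps(2)[OF R(4)] E_simps(2)[OF R(5)] by blast
qed

lemma E_ff:
  assumes kc: conflations_exact
  shows "fully_faithful C D E"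
  unfolding fully_faithful_def
proof (intro conjI E_additive ballI)
  fix X X' assume X: "X \<in> Obj C" and X': "X' \<in> Obj C"
  note MX = yo_mod[OF X] and MX' = yo_mod[OF X']
  have "inj_on (FAr E) (arr C X X')"
  proof (rule inj_onI)
    fix f g assume "f \<in> arr C X X'" "g \<in> arr C X X'" and e: "FAr E f = FAr E g"
    then have f: "ar f X X'" and g: "ar g X X'" using X X' by (simp_all add: ar_def)
    have "loc_eq (yo X') X (ymap f X {Ident C X}) (ymap g X {Ident C X})"
      using e el_yoI[OF ar_id[OF X]] unfolding E_simps(2)[OF f] E_simps(2)[OF g] quot_map_eq_iff[OF MX MX' nt_ymap[OF f] nt_ymap[OF g]] by blast
    then show "f = g"
      unfolding ymap_app[OF f ar_id[OF X]] ymap_app[OF g ar_id[OF X]] comp_id(1)[OF f] comp_id(1)[OF g] loc_eq_yo[OF kc f g] .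
  qed
  moreover have "\<exists>h. ar h X X' \<and> FAr E h = m" if "m \<in> arr D (yo X) (yo X')" for m
  proof -
    have m: "quot_arr m (yo X) (yo X')" using MX MX' that by (simp add: quot_arr_def)
    obtain H \<sigma> \<tau> where r: "isroof (yo X) (yo X') H \<sigma> \<tau>" and gm: "arr_graph (yo X) (yo X') m = roof_graph (yo X) (yo X') H \<sigma> \<tau>"
      using quot_arrE[OF m] by metis
    note R = isroofD[OF r]
    \<comment> \<open>The identity of \<open>X\<close> lifts to \<open>H\<close> only after
      restriction along a deflation \<open>e\<close>; there the roof is given by an arrow
      \<open>t\<close> from \<open>V\<close> to \<open>X'\<close>.\<close>
    obtain e V a where e: "defl e V X" and a: "el H V a" and sa0: "\<sigma> V a = FAr (yo X) e {Ident C X}"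
      using loc_surjE[OF R(7) el_yoI[OF ar_id[OF X]]] .
    note e0 = defl_ar[OF e] and V = elD(1)[OF a]
    have sa: "\<sigma> V a = {e}" using sa0 by (simp add: yo_act comp_id(2)[OF e0])
    obtain t where t: "ar t V X'" "\<tau> V a = {t}" using iffD1[OF el_yo[OF X'] nt_el[OF R(5) a]] by blast
    obtain Z \<delta> z where rc: "realizes X Z \<delta> V z e" using e unfolding defl_def by blast
    note RC = realizesD[OF rc]
    note az = el_act[OF R(10) RC(4) a]
    note zH = el_zero[OF R(10) RC(2)]
    \<comment> \<open>As \<open>e z = 0\<close>, the lift restricted to \<open>Z\<close> is locally
      zero. Hence \<open>t z = 0\<close>, and \<open>t\<close> descends along the cokernel
      \<open>e\<close> of \<open>z\<close>.\<close>
    have "\<sigma> Z (FAr H z a) = \<sigma> Z (zero_at H Z)"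
      unfolding nt_nat[OF R(4) RC(4) a] sa yo_act realizes_comp_zero[OF rc] nt_zero[OF R(4,10,8) RC(2)] yo_zero ..
    then have "loc_eq (yo X') Z (\<tau> Z (FAr H z a)) (\<tau> Z (zero_at H Z))"
      by (intro loc_eq_nt[OF R(5,10) az zH] loc_injD[OF R(6) az zH])
    then have "loc_eq (yo X') Z {t \<cdot> z} {zr Z X'}"
      unfolding nt_nat[OF R(5) RC(4) a] t(2) yo_act nt_zero[OF R(5,10,9) RC(2)] yo_zero .
    then have "t \<cdot> z = zr Z X'" unfolding loc_eq_yo[OF kc ar_comp[OF RC(4) t(1)] ar_zr[OF RC(2) X']] .
    then obtain h where h: "ar h X X'" "h \<cdot> e = t" using cokernelD(4)[OF conflations_exactD(2)[OF kc rc] t(1)] by blast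
    have "m = quot_map (yo X) (yo X') (ymap h)"
    proof (rule quot_arr_eqI[OF m quot_arr_quot_map[OF MX MX' nt_ymap[OF h(1)]]])
      fix W x y assume "(W, x, y) \<in> arr_graph (yo X) (yo X') m"
      then obtain f U b where x: "el (yo X) W x" and y: "el (yo X') W y" and f: "defl f U W" and b: "el H U b"
        and sb: "\<sigma> U b = FAr (yo X) f x" and tb: "\<tau> U b = FAr (yo X') f y" unfolding gm by (rule roof_graphE)
      note f0 = defl_ar[OF f]
      obtain u where u: "ar u W X" "x = {u}" using iffD1[OF el_yo[OF X] x] by blast
      obtain w where w: "ar w W X'" "y = {w}" using iffD1[OF el_yo[OF X'] y] by blast
      note uf = ar_comp[OF f0 u(1)] and wf = ar_comp[OF f0 w(1)]
      \<comment> \<open>A general pair in the graph is compared with the lift of the identity over a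
        covering on which its first component factors through \<open>e\<close>.\<close>
      obtain U' f' k where f': "defl f' U' U" and k: "ar k U' V" and sq: "(u \<cdot> f) \<cdot> f' = e \<cdot> k" using defl_pull[OF e uf] by blast
      note f0' = defl_ar[OF f']
      note b' = el_act[OF R(10) f0' b] and a' = el_act[OF R(10) k a]
      have "\<sigma> U' (FAr H f' b) = \<sigma> U' (FAr H k a)"
        unfolding nt_nat[OF R(4) f0' b] nt_nat[OF R(4) k a] sb sa u(2) yo_act sq ..
      then have "loc_eq (yo X') U' (\<tau> U' (FAr H f' b)) (\<tau> U' (FAr H k a))"
        by (intro loc_eq_nt[OF R(5,10) b' a'] loc_injD[OF R(6) b' a'])
      then have "loc_eq (yo X') U' {(w \<cdot> f) \<cdot> f'} {t \<cdot> k}"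
        unfolding nt_nat[OF R(5) f0' b] nt_nat[OF R(5) k a] tb t(2) w(2) yo_act .
      then have "(w \<cdot> f) \<cdot> f' = t \<cdot> k" unfolding loc_eq_yo[OF kc ar_comp[OF f0' wf] ar_comp[OF k t(1)]] .
      also have "t \<cdot> k = h \<cdot> ((u \<cdot> f) \<cdot> f')" unfolding h(2)[symmetric] comp_assoc[OF k e0 h(1)] sq ..
      also have "\<dots> = ((h \<cdot> u) \<cdot> f) \<cdot> f'"
        unfolding comp_assoc[OF f0 u(1) h(1)] comp_assoc[OF f0' uf h(1)] ..
      finally have eq: "((h \<cdot> u) \<cdot> f) \<cdot> f' = (w \<cdot> f) \<cdot> f'" by simp
      note hu = ar_comp[OF u(1) h(1)]
      have "loc_eq (yo X') W {h \<cdot> u} {w}"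
        by (rule loc_eqI[OF defl_comp[OF f f']])
           (simp add: yo_act comp_assoc[OF f0' f0 hu, symmetric] comp_assoc[OF f0' f0 w(1), symmetric] eq)
      then show "(W, x, y) \<in> arr_graph (yo X) (yo X') (quot_map (yo X) (yo X') (ymap h))"
        unfolding arr_graph_quot_map[OF MX MX' nt_ymap[OF h(1)]] using x y by (simp add: u(2) w(2) ymap_app[OF h(1) u(1)])
    qed
    then show ?thesis using h(1) E_simps(2)[OF h(1)] by auto
  qed
  then have "arr D (yo X) (yo X') \<subseteq> FAr E ` arr C X X'" unfolding ar_def by blast
  moreover have "FAr E ` arr C X X' \<subseteq> arr D (yo X) (yo X')"
    using EF.E_ar[of _ X X'] X X' unfolding E_simps(1) ar_def by blast
  ultimately show "bij_betw (FAr E) (arr C X X') (arr D (FOb E X) (FOb E X'))"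
    unfolding bij_betw_def E_simps(1) by blast
qed

text \<open>Kernels and cokernels are formed pointwise in \<open>mod C\<close>, passed to the
  quotient, moved onto representable functors by essential surjectivity and reflected to
  \<open>C\<close>. It remains to see that the abelian structure has no short exact sequences
  besides the conflations.\<close>

lemma abelian_of_equivalence:
  assumes kc: conflations_exact and ff: "fully_faithful C D E" and ess: "EF.ess"
  shows "is_abelian_category C"
proof -
  have im: "\<exists>Z i. Z \<in> Obj C \<and> iso_arr D (yo Z) F i" if "F \<in> MO" for F
    using ess that unfolding EF.ess_def E_simps(1) D_simps(1) by blast
  have im': "\<exists>Z i. Z \<in> Obj C \<and> iso_arr D F (yo Z) i" if F: "F \<in> MO" for F
  proof -
    obtain Z i where Z: "Z \<in> Obj C" and "iso_arr D (yo Z) F i" using im[OF F] by blast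
    then obtain j where "iso_arr D F (yo Z) j" using iso_arr_sym by metis
    then show ?thesis using Z by blast
  qed
  note yoD = yo_mod[folded D_simps(1)]
  have full: "\<exists>f. ar f X Y \<and> FAr E f = m" if "X \<in> Obj C" "Y \<in> Obj C" "m \<in> arr D (yo X) (yo Y)" for X Y m
    using EF.ff_surjE[OF ff that(1,2)] that(3) unfolding E_simps(1) by metis
  have kernels: "\<exists>K k. is_kernel C K X Y k f" if f: "ar f X Y" for X Y f
  proof -
    note MX = yo_mod[OF arD(1)[OF f]] and MY = yo_mod[OF arD(2)[OF f]] and nf = nt_ymap[OF f]
    obtain K k where K: "K \<in> MO" "nt K (yo X) k" "\<And>W c. el K W c \<Longrightarrow> ymap f W (k W c) = zero_at (yo Y) W"
      "\<And>W a. el (yo X) W a \<Longrightarrow> ymap f W a = zero_at (yo Y) W \<Longrightarrow> \<exists>c. el K W c \<and> k W c = a"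
      "\<And>W a b. el K W a \<Longrightarrow> el K W b \<Longrightarrow> k W a = k W b \<Longrightarrow> a = b"
      by (rule kernelE[OF mod_fp[OF MX] mod_fp[OF MY] nf]) (rule that; assumption)
    have li: "loc_inj K k"
      unfolding loc_inj_def
    proof (intro allI impI)
      fix W a b assume a: "el K W a" and b: "el K W b" and e: "k W a = k W b"
      show "loc_eq K W a b" using K(5)[OF a b e] loc_eq_refl[OF elD(1)[OF a]] by simp
    qed
    have "is_kernel D K (yo X) (yo Y) (quot_map K (yo X) k) (quot_map (yo X) (yo Y) (ymap f))"
    proof (rule D_kernel[OF K(1) MX MY K(2) nf li])
      show "loc_eq (yo Y) W (ymap f W (k W c)) (zero_at (yo Y) W)" if c: "el K W c" for W c
        using K(3)[OF c] loc_eq_refl[OF elD(1)[OF c]] by simp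
      fix W a assume a: "el (yo X) W a" and "loc_eq (yo Y) W (ymap f W a) (zero_at (yo Y) W)"
      then obtain e V where e: "defl e V W" "FAr (yo Y) e (ymap f W a) = FAr (yo Y) e (zero_at (yo Y) W)" by (elim loc_eqE)
      note e0 = defl_ar[OF e(1)]
      have "ymap f V (FAr (yo X) e a) = zero_at (yo Y) V"
        using e(2) nt_nat[OF nf e0 a] act_zero[OF mod_psh[OF MY] e0] by simp
      then show "\<exists>V e c. defl e V W \<and> el K V c \<and> k V c = FAr (yo X) e a"
        using K(4)[OF el_act[OF mod_psh[OF MX] e0 a]] e(1) by blast
    qed
    moreover obtain Z i where Z: "Z \<in> Obj C" and i: "iso_arr D (yo Z) K i" using im[OF K(1)] by blast
    ultimately have kz: "is_kernel D (yo Z) (yo X) (yo Y) (quot_map K (yo X) k \<cdot>\<^bsub>D\<^esub> i) (quot_map (yo X) (yo Y) (ymap f))"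
      using Q.kernel_iso[OF _ yoD[OF Z] i] by blast
    then have "quot_map K (yo X) k \<cdot>\<^bsub>D\<^esub> i \<in> arr D (yo Z) (yo X)" unfolding is_kernel_def by blast
    then obtain g where g: "ar g Z X" "FAr E g = quot_map K (yo X) k \<cdot>\<^bsub>D\<^esub> i" using full[OF Z arD(1)[OF f]] by blast
    have "is_kernel C Z X Y g f"
      by (rule EF.reflect_kernel[OF ff E_zero g(1) f]) (simp_all add: E_simps(1) E_simps(2)[OF f] g(2) kz)
    then show ?thesis by blast
  qed
  \<comment> \<open>The cokernel is recorded by conditions on elements rather than by its universal
    property, because the same data also exhibit a monic as a kernel.\<close>
  have cok: "\<exists>Q c i Z. Q \<in> MO \<and> nt (yo Y) Q c \<and> Z \<in> Obj C \<and> iso_arr D Q (yo Z) i \<and>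
      (\<forall>W a. el (yo X) W a \<longrightarrow> c W (ymap f W a) = zero_at Q W) \<and>
      (\<forall>W b. el (yo Y) W b \<longrightarrow> loc_eq Q W (c W b) (zero_at Q W) \<longrightarrow> (\<exists>V e a. defl e V W \<and> el (yo X) V a \<and> ymap f V a = FAr (yo Y) e b)) \<and>
      loc_surj (yo Y) Q c" if f: "ar f X Y" for X Y f
  proof -
    note MX = yo_mod[OF arD(1)[OF f]] and MY = yo_mod[OF arD(2)[OF f]] and nf = nt_ymap[OF f]
    obtain Q c where Q: "Q \<in> MO" "nt (yo Y) Q c" "\<And>W a. el (yo X) W a \<Longrightarrow> c W (ymap f W a) = zero_at Q W"
      "\<And>W b. el (yo Y) W b \<Longrightarrow> c W b = zero_at Q W \<Longrightarrow> \<exists>a. el (yo X) W a \<and> ymap f W a = b"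
      "\<And>W d. el Q W d \<Longrightarrow> \<exists>b. el (yo Y) W b \<and> c W b = d"
      by (rule cokernelE[OF mod_fp[OF MX] mod_fp[OF MY] nf]) (rule that; assumption)
    have ls: "loc_surj (yo Y) Q c"
      unfolding loc_surj_def
    proof (intro allI impI)
      fix W d assume d: "el Q W d"
      obtain b where b: "el (yo Y) W b" "c W b = d" using Q(5)[OF d] by blast
      then show "\<exists>V e a. defl e V W \<and> el (yo Y) V a \<and> c V a = FAr Q e d"
        using defl_id[OF elD(1)[OF d]] act_id[OF mod_psh[OF Q(1)] d] by metis
    qed
    have loc: "\<exists>V e a. defl e V W \<and> el (yo X) V a \<and> ymap f V a = FAr (yo Y) e b"
      if b: "el (yo Y) W b" and l: "loc_eq Q W (c W b) (zero_at Q W)" for W b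
    proof -
      obtain e V where e: "defl e V W" "FAr Q e (c W b) = FAr Q e (zero_at Q W)" using loc_eqE[OF l] .
      note e0 = defl_ar[OF e(1)]
      have "c V (FAr (yo Y) e b) = zero_at Q V"
        using e(2) nt_nat[OF Q(2) e0 b] act_zero[OF mod_psh[OF Q(1)] e0] by simp
      then show ?thesis using Q(4)[OF el_act[OF mod_psh[OF MY] e0 b]] e(1) by blast
    qed
    obtain Z i where "Z \<in> Obj C" "iso_arr D Q (yo Z) i" using im'[OF Q(1)] by blast
    then show ?thesis using Q(1-3) ls loc by blast
  qed
  have cokernels: "\<exists>Q c. is_cokernel C X Y Q f c" if f: "ar f X Y" for X Y f
  proof -
    note MX = yo_mod[OF arD(1)[OF f]] and MY = yo_mod[OF arD(2)[OF f]] and nf = nt_ymap[OF f]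
    obtain Q c i Z where Q: "Q \<in> MO" "nt (yo Y) Q c" and Z: "Z \<in> Obj C" and i: "iso_arr D Q (yo Z) i"
      and z: "\<forall>W a. el (yo X) W a \<longrightarrow> c W (ymap f W a) = zero_at Q W"
      and loc: "\<forall>W b. el (yo Y) W b \<longrightarrow> loc_eq Q W (c W b) (zero_at Q W) \<longrightarrow> (\<exists>V e a. defl e V W \<and> el (yo X) V a \<and> ymap f V a = FAr (yo Y) e b)"
      and ls: "loc_surj (yo Y) Q c" using cok[OF f] by blast
    have "is_cokernel D (yo X) (yo Y) Q (quot_map (yo X) (yo Y) (ymap f)) (quot_map (yo Y) Q c)"
    proof (rule D_cokernel[OF MX MY Q(1) nf Q(2) ls])
      show "loc_eq Q W (c W (ymap f W a)) (zero_at Q W)" if "el (yo X) W a" for W a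
        using z that loc_eq_refl[OF elD(1)[OF that]] by simp
    qed (use loc in blast)
    then have cz: "is_cokernel D (yo X) (yo Y) (yo Z) (quot_map (yo X) (yo Y) (ymap f)) (i \<cdot>\<^bsub>D\<^esub> quot_map (yo Y) Q c)"
      by (rule Q.cokernel_iso[OF _ yoD[OF Z] i])
    then have "i \<cdot>\<^bsub>D\<^esub> quot_map (yo Y) Q c \<in> arr D (yo Y) (yo Z)" unfolding is_cokernel_def by blast
    then obtain g where g: "ar g Y Z" "FAr E g = i \<cdot>\<^bsub>D\<^esub> quot_map (yo Y) Q c" using full[OF arD(2)[OF f] Z] by blast
    have "is_cokernel C X Y Z f g"
      by (rule EF.reflect_cokernel[OF ff E_zero f g(1)]) (simp_all add: E_simps(1) E_simps(2)[OF f] g(2) cz)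
    then show ?thesis by blast
  qed
  have mono: "\<exists>W h. is_kernel C X Y W f h" if f: "ar f X Y" and m: "monic C X Y f" for X Y f
  proof -
    note MX = yo_mod[OF arD(1)[OF f]] and MY = yo_mod[OF arD(2)[OF f]] and nf = nt_ymap[OF f]
    obtain Q c i Z where Q: "Q \<in> MO" "nt (yo Y) Q c" and Z: "Z \<in> Obj C" and i: "iso_arr D Q (yo Z) i"
      and z: "\<forall>W a. el (yo X) W a \<longrightarrow> c W (ymap f W a) = zero_at Q W"
      and loc: "\<forall>W b. el (yo Y) W b \<longrightarrow> loc_eq Q W (c W b) (zero_at Q W) \<longrightarrow> (\<exists>V e a. defl e V W \<and> el (yo X) V a \<and> ymap f V a = FAr (yo Y) e b)"
      using cok[OF f] by blast
    \<comment> \<open>A monic induces an injective map of representable functors, so the sequence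
      ending in the pointwise cokernel is also left exact up to coverings.\<close>
    have li: "loc_inj (yo X) (ymap f)" using loc_inj_yo[OF f] m unfolding monic_iff_zr[OF f] by blast
    have "is_kernel D (yo X) (yo Y) Q (quot_map (yo X) (yo Y) (ymap f)) (quot_map (yo Y) Q c)"
    proof (rule D_kernel[OF MX MY Q(1) nf Q(2) li])
      show "loc_eq Q W (c W (ymap f W a)) (zero_at Q W)" if "el (yo X) W a" for W a
        using z that loc_eq_refl[OF elD(1)[OF that]] by simp
    qed (use loc in blast)
    then have kz: "is_kernel D (yo X) (yo Y) (yo Z) (quot_map (yo X) (yo Y) (ymap f)) (i \<cdot>\<^bsub>D\<^esub> quot_map (yo Y) Q c)"
      by (rule Q.kernel_post_iso[OF _ yoD[OF Z] i])
    then have "i \<cdot>\<^bsub>D\<^esub> quot_map (yo Y) Q c \<in> arr D (yo Y) (yo Z)" unfolding is_kernel_def by blast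
    then obtain g where g: "ar g Y Z" "FAr E g = i \<cdot>\<^bsub>D\<^esub> quot_map (yo Y) Q c" using full[OF arD(2)[OF f] Z] by blast
    have "is_kernel C X Y Z f g"
      by (rule EF.reflect_kernel[OF ff E_zero f g(1)]) (simp_all add: E_simps(1) E_simps(2)[OF f] g(2) kz)
    then show ?thesis by blast
  qed
  \<comment> \<open>Test objects in the quotient are isomorphic to representable functors, and test
    arrows between these come from \<open>C\<close>. Hence an epic of \<open>C\<close> remains epic
    in the quotient.\<close>
  have epi_ls: "loc_surj (yo X) (yo Y) (ymap f)" if f: "ar f X Y" and ep: "epic C X Y f" for X Y f
  proof (rule Q_epic_loc_surj[OF yo_mod[OF arD(1)[OF f]] yo_mod[OF arD(2)[OF f]] nt_ymap[OF f]])
    note X = arD(1)[OF f] and Y = arD(2)[OF f]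
    have Ef: "FAr E f \<in> arr D (yo X) (yo Y)" using EF.E_ar[OF f] by (simp add: E_simps(1))
    have "u = v" if T: "T \<in> Obj D" and u: "u \<in> arr D (yo Y) T" and v: "v \<in> arr D (yo Y) T"
      and e: "u \<cdot>\<^bsub>D\<^esub> FAr E f = v \<cdot>\<^bsub>D\<^esub> FAr E f" for T u v
    proof -
      obtain Z j where Z: "Z \<in> Obj C" and "iso_arr D T (yo Z) j" using im' T unfolding D_simps(1) by blast
      then obtain i where j: "j \<in> arr D T (yo Z)" and i: "i \<in> arr D (yo Z) T" "i \<cdot>\<^bsub>D\<^esub> j = Ident D T"
        unfolding iso_arr_def by blast
      obtain u' where u': "ar u' Y Z" "FAr E u' = j \<cdot>\<^bsub>D\<^esub> u" using full[OF Y Z Q.l_comp[OF yoD[OF Y] T yoD[OF Z] u j]] by blast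
      obtain v' where v': "ar v' Y Z" "FAr E v' = j \<cdot>\<^bsub>D\<^esub> v" using full[OF Y Z Q.l_comp[OF yoD[OF Y] T yoD[OF Z] v j]] by blast
      have "FAr E (u' \<cdot> f) = FAr E (v' \<cdot> f)"
        unfolding EF.E_comp[OF f u'(1)] EF.E_comp[OF f v'(1)] u'(2) v'(2)
          Q.l_assoc[OF yoD[OF X] yoD[OF Y] T yoD[OF Z] Ef u j] Q.l_assoc[OF yoD[OF X] yoD[OF Y] T yoD[OF Z] Ef v j] e ..
      then have "u' \<cdot> f = v' \<cdot> f" by (rule EF.ff_inj[OF ff ar_comp[OF f u'(1)] ar_comp[OF f v'(1)]])
      then have "u' = v'" using ep Z u'(1) v'(1) unfolding epic_def ar_def by blast
      then have "i \<cdot>\<^bsub>D\<^esub> (j \<cdot>\<^bsub>D\<^esub> u) = i \<cdot>\<^bsub>D\<^esub> (j \<cdot>\<^bsub>D\<^esub> v)" using u'(2) v'(2) by simp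
      then show ?thesis
        unfolding Q.l_assoc[OF yoD[OF Y] T yoD[OF Z] T u j i(1), symmetric] Q.l_assoc[OF yoD[OF Y] T yoD[OF Z] T v j i(1), symmetric]
          i(2) Q.l_idl[OF yoD[OF Y] T u] Q.l_idl[OF yoD[OF Y] T v] .
    qed
    then show "epic D (yo X) (yo Y) (quot_map (yo X) (yo Y) (ymap f))"
      unfolding epic_def E_simps(2)[OF f, symmetric] using Ef by blast
  qed
  have epi: "\<exists>W h. is_cokernel C W X Y h f" if f: "ar f X Y" and ep: "epic C X Y f" for X Y f
  proof -
    note MX = yo_mod[OF arD(1)[OF f]] and MY = yo_mod[OF arD(2)[OF f]] and nf = nt_ymap[OF f]
    obtain K k where K: "K \<in> MO" "nt K (yo X) k" "\<And>W c. el K W c \<Longrightarrow> ymap f W (k W c) = zero_at (yo Y) W"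
      "\<And>W a. el (yo X) W a \<Longrightarrow> ymap f W a = zero_at (yo Y) W \<Longrightarrow> \<exists>c. el K W c \<and> k W c = a"
      "\<And>W a b. el K W a \<Longrightarrow> el K W b \<Longrightarrow> k W a = k W b \<Longrightarrow> a = b"
      by (rule kernelE[OF mod_fp[OF MX] mod_fp[OF MY] nf]) (rule that; assumption)
    have "is_cokernel D K (yo X) (yo Y) (quot_map K (yo X) k) (quot_map (yo X) (yo Y) (ymap f))"
    proof (rule D_cokernel[OF K(1) MX MY K(2) nf epi_ls[OF f ep]])
      show "loc_eq (yo Y) W (ymap f W (k W c)) (zero_at (yo Y) W)" if c: "el K W c" for W c
        using K(3)[OF c] loc_eq_refl[OF elD(1)[OF c]] by simp
      fix W a assume a: "el (yo X) W a" and "loc_eq (yo Y) W (ymap f W a) (zero_at (yo Y) W)"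
      then obtain e V where e: "defl e V W" "FAr (yo Y) e (ymap f W a) = FAr (yo Y) e (zero_at (yo Y) W)" by (elim loc_eqE)
      note e0 = defl_ar[OF e(1)]
      have "ymap f V (FAr (yo X) e a) = zero_at (yo Y) V"
        using e(2) nt_nat[OF nf e0 a] act_zero[OF mod_psh[OF MY] e0] by simp
      then show "\<exists>V e c. defl e V W \<and> el K V c \<and> k V c = FAr (yo X) e a"
        using K(4)[OF el_act[OF mod_psh[OF MX] e0 a]] e(1) by blast
    qed
    moreover obtain Z i where Z: "Z \<in> Obj C" and i: "iso_arr D (yo Z) K i" using im[OF K(1)] by blast
    ultimately have cz: "is_cokernel D (yo Z) (yo X) (yo Y) (quot_map K (yo X) k \<cdot>\<^bsub>D\<^esub> i) (quot_map (yo X) (yo Y) (ymap f))"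
      using Q.cokernel_pre_iso[OF _ yoD[OF Z] i] by blast
    then have "quot_map K (yo X) k \<cdot>\<^bsub>D\<^esub> i \<in> arr D (yo Z) (yo X)" unfolding is_cokernel_def by blast
    then obtain g where g: "ar g Z X" "FAr E g = quot_map K (yo X) k \<cdot>\<^bsub>D\<^esub> i" using full[OF Z arD(1)[OF f]] by blast
    have "is_cokernel C Z X Y g f"
      by (rule EF.reflect_cokernel[OF ff E_zero g(1) f]) (simp_all add: E_simps(1) E_simps(2)[OF f] g(2) cz)
    then show ?thesis by blast
  qed
  have ab: "abelian_category C"
    unfolding abelian_category_def
    using additive kernels cokernels mono epi unfolding ar_def monic_def epic_def by blast
  have "conflation C Z Y X g f" if se: "short_exact C Z Y X g f" for Z Y X g f
  proof -
    note ker = kernelD[OF se[unfolded short_exact_def, THEN conjunct1]]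
    note cok = cokernelD[OF se[unfolded short_exact_def, THEN conjunct2]]
    note g = ker(1) and f = ker(2)
    note X = arD(2)[OF f] and Y = arD(1)[OF f] and Z = arD(1)[OF g]
    have "epic C Y X f"
      unfolding epic_iff_zr[OF f]
    proof (intro allI impI)
      fix T t assume t: "ar t X T" and "t \<cdot> f = zr Y T"
      then have "t \<cdot> f = zr X T \<cdot> f" using zr_comp[OF f arD(2)[OF t]] by simp
      then show "t = zr X T" by (rule cok(5)[OF t ar_zr[OF X arD(2)[OF t]]])
    qed
    then have ls: "loc_surj (yo Y) (yo X) (ymap f)" by (rule epi_ls[OF f])
    \<comment> \<open>Local surjectivity at the identity of \<open>X\<close> produces a deflation
      \<open>e\<close> that factors through \<open>f\<close>.\<close>
    obtain e W a where e: "defl e W X" and a: "el (yo Y) W a" and ea: "ymap f W a = FAr (yo X) e {Ident C X}"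
      using loc_surjE[OF ls el_yoI[OF ar_id[OF X]]] .
    note e0 = defl_ar[OF e]
    obtain h where h: "ar h W Y" "a = {h}" using iffD1[OF el_yo[OF Y] a] by blast
    have fh: "f \<cdot> h = e" using ea by (simp add: h(2) ymap_app[OF f h(1)] yo_act comp_id(2)[OF e0])
    obtain V \<delta> k where r: "realizes X V \<delta> W k e" using e unfolding defl_def by blast
    note R = realizesD[OF r]
    note hk = ar_comp[OF R(4) h(1)]
    have "f \<cdot> (h \<cdot> k) = zr V X" unfolding comp_assoc[OF R(4) h(1) f, symmetric] fh by (rule realizes_comp_zero[OF r])
    then obtain v where v: "ar v V Z" "g \<cdot> v = h \<cdot> k" using ker(4)[OF hk] by blast
    \<comment> \<open>Pushing out along the arrow \<open>v\<close> induced on kernels gives a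
      conflation with the same ends \<open>Z\<close> and \<open>X\<close> as the given
      sequence.\<close>
    obtain Y' g' f' w where p: "realizes X Z (EMap C (Ident C X) v \<delta>) Y' g' f'" "ar w W Y'" "w \<cdot> k = g' \<cdot> v" "f' \<cdot> w = e"
      by (rule pushoutX[OF r v(1)])
    note R' = realizesD[OF p(1)]
    \<comment> \<open>The pushout property yields an arrow between the middle terms. It is the
      identity on both ends, and a diagram chase shows it to be monic and epic.\<close>
    obtain \<phi> where \<phi>: "ar \<phi> Y' Y" "\<phi> \<cdot> w = h" "\<phi> \<cdot> g' = g"
      using pushout_exists[OF kc r v(1) p h(1) g v(2)[symmetric]] by blast
    have f\<phi>: "f \<cdot> \<phi> = f'"
    proof (rule pushout_unique[OF kc r v(1) p ar_comp[OF \<phi>(1) f] R'(5)])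
      show "(f \<cdot> \<phi>) \<cdot> w = f' \<cdot> w" unfolding comp_assoc[OF p(2) \<phi>(1) f] \<phi>(2) fh p(4) ..
      show "(f \<cdot> \<phi>) \<cdot> g' = f' \<cdot> g'" unfolding comp_assoc[OF R'(4) \<phi>(1) f] \<phi>(3) ker(3) realizes_comp_zero[OF p(1)] ..
    qed
    have m: "monic C Y' Y \<phi>"
      unfolding monic_iff_zr[OF \<phi>(1)]
    proof (intro allI impI)
      fix T t assume t: "ar t T Y'" and z: "\<phi> \<cdot> t = zr T Y"
      note T = arD(1)[OF t]
      have "f' \<cdot> t = zr T X" unfolding f\<phi>[symmetric] comp_assoc[OF t \<phi>(1) f] z by (rule comp_zr[OF f T])
      then obtain s where s: "ar s T Z" "t = g' \<cdot> s" by (rule realizes_weak_kernel[OF p(1) t])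
      have "g \<cdot> s = g \<cdot> zr T Z"
        unfolding \<phi>(3)[symmetric] comp_assoc[OF s(1) R'(4) \<phi>(1)] s(2)[symmetric] z
          comp_assoc[OF ar_zr[OF T Z] R'(4) \<phi>(1)] comp_zr[OF R'(4) T] comp_zr[OF \<phi>(1) T] ..
      then have "s = zr T Z" by (rule ker(5)[OF s(1) ar_zr[OF T Z]])
      then show "t = zr T Y'" using s(2) comp_zr[OF R'(4) T] by simp
    qed
    have ep: "t = zr Y T" if t: "ar t Y T" and z: "t \<cdot> \<phi> = zr Y' T" for T t
    proof -
      note T = arD(2)[OF t]
      have "t \<cdot> g = zr Z T" unfolding \<phi>(3)[symmetric] comp_assoc[OF R'(4) \<phi>(1) t, symmetric] z by (rule zr_comp[OF R'(4) T])
      then obtain s where s: "ar s X T" "s \<cdot> f = t" using cok(4)[OF t] by blast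
      have "s \<cdot> f' = zr X T \<cdot> f'"
        unfolding f\<phi>[symmetric] comp_assoc[OF \<phi>(1) f s(1), symmetric] s(2) z
          comp_assoc[OF \<phi>(1) f ar_zr[OF X T], symmetric] zr_comp[OF f T] zr_comp[OF \<phi>(1) T] ..
      then have "s = zr X T" by (rule cokernelD(5)[OF conflations_exactD(2)[OF kc p(1)] s(1) ar_zr[OF X T]])
      then show ?thesis using s(2) zr_comp[OF f T] by simp
    qed
    \<comment> \<open>The monic \<open>\<phi>\<close> is a kernel of some \<open>q\<close>, and
      \<open>q\<close> is zero because \<open>\<phi>\<close> is epic. The identity of
      \<open>Y\<close> therefore factors through \<open>\<phi>\<close>.\<close>
    obtain T q where q: "is_kernel C Y' Y T \<phi> q" using mono[OF \<phi>(1) m] by blast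
    note kq = kernelD[OF q]
    have q0: "q = zr Y T" by (rule ep[OF kq(2,3)])
    have "q \<cdot> Ident C Y = zr Y T" using comp_id(1)[OF kq(2)] q0 by simp
    then obtain \<psi> where \<psi>: "ar \<psi> Y Y'" "\<phi> \<cdot> \<psi> = Ident C Y" using kq(4)[OF ar_id[OF Y]] by blast
    have "\<phi> \<cdot> (\<psi> \<cdot> \<phi>) = \<phi> \<cdot> Ident C Y'"
      unfolding comp_assoc[OF \<phi>(1) \<psi>(1) \<phi>(1), symmetric] \<psi>(2) comp_id(1)[OF \<phi>(1)] comp_id(2)[OF \<phi>(1)] ..
    then have \<psi>\<phi>: "\<psi> \<cdot> \<phi> = Ident C Y'" by (rule kq(5)[OF ar_comp[OF \<phi>(1) \<psi>(1)] ar_id[OF R'(6)]])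
    have "realizes X Z (EMap C (Ident C X) v \<delta>) Y g f"
      by (rule realizes_iso[OF p(1) \<phi>(1) \<psi>(1) \<psi>\<phi> \<psi>(2) _ f f\<phi>]) (simp add: \<phi>(3))
    then show ?thesis unfolding conflation_iff by blast
  qed
  then show ?thesis unfolding is_abelian_category_def using ab kc unfolding conflations_exact_def by blast
qed

section \<open>Abelian categories\<close>

text \<open>The presenting arrow is factored as \<open>r = i q\<close> through the kernel
  \<open>i\<close> of its cokernel \<open>c\<close>. Both \<open>c\<close> and \<open>q\<close> are
  deflations, so an arrow killed by \<open>c\<close> is locally a multiple of \<open>r\<close>, and
  an arrow into \<open>T\<close> locally lifts to \<open>X\<close>.\<close>

lemma abelian_presentation:
  assumes ab: "is_abelian_category C" and F: "fp F"
  obtains T \<gamma> where "T \<in> Obj C" "nt F (yo T) \<gamma>" "loc_inj F \<gamma>" "loc_surj F (yo T) \<gamma>"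
proof -
  have AB: "abelian_category C"
    and conf: "\<And>Z Y X g f. short_exact C Z Y X g f \<Longrightarrow> conflation C Z Y X g f"
    using ab unfolding is_abelian_category_def by simp_all
  have kernels: "\<exists>K k. is_kernel C K X Y k f" and cokernels: "\<exists>Q c. is_cokernel C X Y Q f c"
    and mono: "monic C X Y f \<Longrightarrow> \<exists>W h. is_kernel C X Y W f h" and epi: "epic C X Y f \<Longrightarrow> \<exists>W h. is_cokernel C W X Y h f"
    if "ar f X Y" for X Y f
    using AB that unfolding abelian_category_def ar_def by simp_all
  obtain X x R r where pF: "psh F" and g: "gen F X x" and a: "ann F X x R r" using F[unfolded fp_iff] by blast
  note x = genD(1)[OF g] and r = annD(1)[OF a]
  have X: "X \<in> Obj C" and R: "R \<in> Obj C" using r by (auto simp: ar_def)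
  obtain T c where c: "is_cokernel C R X T r c" using cokernels[OF r] by blast
  note cok = cokernelD[OF c]
  have T: "T \<in> Obj C" using arD(2)[OF cok(2)] .
  obtain I i where i: "is_kernel C I X T i c" using kernels[OF cok(2)] by blast
  note ker = kernelD[OF i]
  have I: "I \<in> Obj C" using arD(1)[OF ker(1)] .
  obtain q where q: "ar q R I" "i \<cdot> q = r" using ker(4)[OF r cok(3)] by blast
  \<comment> \<open>\<open>r\<close> factors through \<open>i\<close> and \<open>c\<close> kills
    \<open>i\<close>, so the cokernel \<open>c\<close> of \<open>r\<close> is one of
    \<open>i\<close> as well.\<close>
  have "is_cokernel C I X T i c"
  proof (rule cokernelI[OF ker(1,2,3)])
    fix S t assume t: "ar t X S" and z: "t \<cdot> i = zr I S"
    have "t \<cdot> r = zr R S" unfolding q(2)[symmetric] comp_assoc[OF q(1) ker(1) t, symmetric] z by (rule zr_comp[OF q(1) arD(2)[OF t]])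
    then show "\<exists>u. ar u T S \<and> u \<cdot> c = t" by (rule cok(4)[OF t])
  next
    fix S u assume u: "ar u T S" and z: "u \<cdot> c = zr X S"
    have "u \<cdot> c = zr T S \<cdot> c" using z zr_comp[OF cok(2) arD(2)[OF u]] by simp
    then show "u = zr T S" by (rule cok(5)[OF u ar_zr[OF T arD(2)[OF u]]])
  qed
  then have "conflation C I X T i c" using conf i unfolding short_exact_def by blast
  then have dc: "defl c X T" unfolding conflation_iff defl_def by blast
  \<comment> \<open>If \<open>v q = 0\<close>, then \<open>r\<close> factors through the monic
    \<open>i k\<close>, where \<open>k\<close> is a kernel of \<open>v\<close>. This monic is a
    kernel of some \<open>w\<close>. Now \<open>w\<close> kills \<open>r\<close>, so it factors
    through \<open>c\<close> and kills \<open>i\<close>. Consequently \<open>i\<close> factors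
    through \<open>i k\<close>, whence \<open>k\<close> has a right inverse and
    \<open>v = 0\<close>.\<close>
  have ep: "epic C R I q"
    unfolding epic_iff_zr[OF q(1)]
  proof (intro allI impI)
    fix S v assume v: "ar v I S" and vq: "v \<cdot> q = zr R S"
    obtain K k where k: "is_kernel C K I S k v" using kernels[OF v] by blast
    note kk = kernelD[OF k]
    have K: "K \<in> Obj C" using arD(1)[OF kk(1)] .
    obtain q' where q': "ar q' R K" "k \<cdot> q' = q" using kk(4)[OF q(1) vq] by blast
    note ik = ar_comp[OF kk(1) ker(1)]
    have "monic C K X (i \<cdot> k)"
      unfolding monic_iff_zr[OF ik]
    proof (intro allI impI)
      fix U t assume t: "ar t U K" and z: "(i \<cdot> k) \<cdot> t = zr U X"
      note U = arD(1)[OF t] and kt = ar_comp[OF t kk(1)]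
      have "i \<cdot> (k \<cdot> t) = i \<cdot> zr U I"
        unfolding comp_assoc[OF t kk(1) ker(1), symmetric] z comp_zr[OF ker(1) U] ..
      then have "k \<cdot> t = zr U I" by (rule ker(5)[OF kt ar_zr[OF U I]])
      then have "k \<cdot> t = k \<cdot> zr U K" using comp_zr[OF kk(1) U] by simp
      then show "t = zr U K" by (rule kk(5)[OF t ar_zr[OF U K]])
    qed
    then obtain W w where "is_kernel C K X W (i \<cdot> k) w" using mono[OF ik] by blast
    note ww = kernelD[OF this]
    have W: "W \<in> Obj C" using arD(2)[OF ww(2)] .
    have "w \<cdot> r = (w \<cdot> (i \<cdot> k)) \<cdot> q'"
      unfolding q(2)[symmetric] q'(2)[symmetric] comp_assoc[OF q'(1) kk(1) ker(1), symmetric] comp_assoc[OF q'(1) ik ww(2)] ..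
    then have "w \<cdot> r = zr R W" unfolding ww(3) zr_comp[OF q'(1) W] .
    then obtain w' where w': "ar w' T W" "w' \<cdot> c = w" using cok(4)[OF ww(2)] by blast
    have "w \<cdot> i = zr I W"
      unfolding w'(2)[symmetric] comp_assoc[OF ker(1,2) w'(1)] ker(3) by (rule comp_zr[OF w'(1) I])
    then obtain m where m: "ar m I K" "(i \<cdot> k) \<cdot> m = i" using ww(4)[OF ker(1)] by blast
    have "i \<cdot> (k \<cdot> m) = i \<cdot> Ident C I"
      unfolding comp_assoc[OF m(1) kk(1) ker(1), symmetric] m(2) comp_id(1)[OF ker(1)] ..
    then have km: "k \<cdot> m = Ident C I" by (rule ker(5)[OF ar_comp[OF m(1) kk(1)] ar_id[OF I]])
    have "v = v \<cdot> (k \<cdot> m)" unfolding km comp_id(1)[OF v] ..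
    also have "\<dots> = zr I S" unfolding comp_assoc[OF m(1) kk(1) v, symmetric] kk(3) by (rule zr_comp[OF m(1) arD(2)[OF v]])
    finally show "v = zr I S" .
  qed
  obtain L l where l: "is_kernel C L R I l q" using kernels[OF q(1)] by blast
  note ll = kernelD[OF l]
  obtain W h where "is_cokernel C W R I h q" using epi[OF q(1) ep] by blast
  note hh = cokernelD[OF this]
  obtain h' where h': "ar h' W L" "l \<cdot> h' = h" using ll(4)[OF hh(1,3)] by blast
  \<comment> \<open>The epic \<open>q\<close> is a cokernel of some \<open>h\<close>, and
    \<open>h\<close> factors through the kernel \<open>l\<close> of \<open>q\<close>; so an arrow
    that kills \<open>l\<close> kills \<open>h\<close>.\<close>
  have "is_cokernel C L R I l q"
  proof (rule cokernelI[OF ll(1,2,3)])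
    fix S t assume t: "ar t R S" and z: "t \<cdot> l = zr L S"
    have "t \<cdot> h = zr W S" unfolding h'(2)[symmetric] comp_assoc[OF h'(1) ll(1) t, symmetric] z by (rule zr_comp[OF h'(1) arD(2)[OF t]])
    then show "\<exists>u. ar u I S \<and> u \<cdot> q = t" by (rule hh(4)[OF t])
  next
    fix S u assume u: "ar u I S" and "u \<cdot> q = zr R S"
    then show "u = zr I S" using ep unfolding epic_iff_zr[OF q(1)] by blast
  qed
  then have "conflation C L R I l q" using conf l unfolding short_exact_def by blast
  then have dq: "defl q R I" unfolding conflation_iff defl_def by blast
  have "FAr (yo T) r {c} = zero_at (yo T) R" by (simp add: yo_act yo_zero cok(3))
  then obtain \<gamma> where \<gamma>: "nt F (yo T) \<gamma>" "\<And>W h. ar h W X \<Longrightarrow> \<gamma> W (FAr F h x) = FAr (yo T) h {c}"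
    by (rule fp_hom[OF pF psh_yo[OF T] g a el_yoI[OF cok(2)]]) (rule that; assumption)
  note pT = psh_yo[OF T]
  have "loc_inj F \<gamma>"
    unfolding loc_inj_def
  proof (intro allI impI)
    fix W y y' assume y: "el F W y" and y': "el F W y'" and e: "\<gamma> W y = \<gamma> W y'"
    let ?d = "plus_at F W y (inv_at F W y')"
    have d: "el F W ?d" using el_plus[OF pF y el_inv[OF pF y']] .
    have z: "\<gamma> W ?d = zero_at (yo T) W"
      unfolding nt_sub[OF \<gamma>(1) pF pT y y'] sub_zero_iff[OF pT nt_el[OF \<gamma>(1) y] nt_el[OF \<gamma>(1) y']] by (rule e)
    obtain h where h: "ar h W X" "?d = FAr F h x" using genD(2)[OF g d] by blast
    have "c \<cdot> h = zr W T" using z \<gamma>(2)[OF h(1)] h(2) by (simp add: yo_act yo_zero)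
    \<comment> \<open>The coefficient \<open>h\<close> of the difference factors through
      \<open>i\<close>. Lifting along the deflation \<open>q\<close> makes it locally a multiple of
      \<open>r\<close>, which kills the generator.\<close>
    then obtain h1 where h1: "ar h1 W I" "i \<cdot> h1 = h" using ker(4)[OF h(1)] by blast
    obtain V e h2 where e: "defl e V W" "ar h2 V R" "h1 \<cdot> e = q \<cdot> h2" using defl_pull[OF dq h1(1)] by blast
    note e0 = defl_ar[OF e(1)]
    have "h \<cdot> e = r \<cdot> h2"
      unfolding h1(2)[symmetric] comp_assoc[OF e0 h1(1) ker(1)] e(3) comp_assoc[OF e(2) q(1) ker(1), symmetric] q(2) ..
    then have "FAr F e ?d = zero_at F V"
      using act_comp[OF pF e0 h(1) x] h(2) ann_zero[OF pF a x e(2)] by simp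
    then have "loc_eq F W ?d (zero_at F W)" by (intro loc_eqI[OF e(1)]) (simp add: act_zero[OF pF e0])
    then show "loc_eq F W y y'" unfolding loc_eq_sub_zero[OF pF y y'] .
  qed
  moreover have "loc_surj F (yo T) \<gamma>"
    unfolding loc_surj_def
  proof (intro allI impI)
    fix W b assume b: "el (yo T) W b"
    obtain u where u: "ar u W T" "b = {u}" using iffD1[OF el_yo[OF T] b] by blast
    obtain V e h' where e: "defl e V W" "ar h' V X" "u \<cdot> e = c \<cdot> h'" using defl_pull[OF dc u(1)] by blast
    have "\<gamma> V (FAr F h' x) = FAr (yo T) e b" by (simp add: \<gamma>(2)[OF e(2)] u(2) yo_act e(3))
    then show "\<exists>V e a. defl e V W \<and> el F V a \<and> \<gamma> V a = FAr (yo T) e b"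
      using e(1) el_act[OF pF e(2) x] by blast
  qed
  ultimately show thesis by (rule that[OF T \<gamma>(1)])
qed

lemma abelian_ess:
  assumes ab: "is_abelian_category C"
  shows "EF.ess"
  unfolding EF.ess_def E_simps(1) D_simps(1)
proof
  fix F assume F: "F \<in> MO"
  obtain T \<gamma> where g: "T \<in> Obj C" "nt F (yo T) \<gamma>" "loc_inj F \<gamma>" "loc_surj F (yo T) \<gamma>"
    using abelian_presentation[OF ab mod_fp[OF F]] .
  obtain i where "iso_arr D (yo T) F i" using iso_arr_sym[OF Q_iso[OF F yo_mod[OF g(1)] g(2-4)]] by blast
  then show "\<exists>X\<in>Obj C. \<exists>i. iso_arr D (yo X) F i" using g(1) by blast
qed

section \<open>The equivalence with the left exact functors\<close>

lemma abelian_conflations_exact: "is_abelian_category C \<Longrightarrow> conflations_exact"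
  unfolding is_abelian_category_def conflations_exact_def by blast

lemma lex_mod: "F \<in> lex_objects C \<Longrightarrow> F \<in> MO"
  by (simp add: lex_objects_def)

text \<open>For \<open>C(-,T)\<close> left exactness on a conflation is the universal property of
  its deflation as a cokernel.\<close>

lemma yo_lex:
  assumes kc: conflations_exact and T: "T \<in> Obj C"
  shows "yo T \<in> lex_objects C"
proof -
  have "inj_on (FAr (yo T) f) (carrier (FOb (yo T) X)) \<and>
     FAr (yo T) f ` carrier (FOb (yo T) X) = kernel (FOb (yo T) Y) (FOb (yo T) Z) (FAr (yo T) g)"
    if cf: "conflation C Z Y X g f" for Z Y X g f
  proof -
    obtain \<delta> where r: "realizes X Z \<delta> Y g f" using cf unfolding conflation_iff by blast
    note R = realizesD[OF r]
    note cok = cokernelD[OF conflations_exactD(2)[OF kc r]]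
    have car: "carrier (FOb (yo T) W) = {{h} |h. ar h W T}" if "W \<in> Obj C" for W
      using that T by (auto simp: yoneda_ob_def ar_def)
    have "inj_on (FAr (yo T) f) (carrier (FOb (yo T) X))"
    proof (rule inj_onI)
      fix a b assume "a \<in> carrier (FOb (yo T) X)" "b \<in> carrier (FOb (yo T) X)" and e: "FAr (yo T) f a = FAr (yo T) f b"
      then obtain h k where h: "ar h X T" "a = {h}" and k: "ar k X T" "b = {k}" unfolding car[OF R(1)] by blast
      show "a = b" using cok(5)[OF h(1) k(1)] e by (simp add: h(2) k(2) yo_act)
    qed
    moreover have "FAr (yo T) f ` carrier (FOb (yo T) X) = kernel (FOb (yo T) Y) (FOb (yo T) Z) (FAr (yo T) g)"
    proof
      show "FAr (yo T) f ` carrier (FOb (yo T) X) \<subseteq> kernel (FOb (yo T) Y) (FOb (yo T) Z) (FAr (yo T) g)"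
      proof
        fix a assume "a \<in> FAr (yo T) f ` carrier (FOb (yo T) X)"
        then obtain h where h: "ar h X T" "a = {h \<cdot> f}" unfolding car[OF R(1)] by (auto simp: yo_act)
        have "(h \<cdot> f) \<cdot> g = zr Z T" unfolding comp_assoc[OF R(4,5) h(1)] cok(3) by (rule comp_zr[OF h(1) R(2)])
        then show "a \<in> kernel (FOb (yo T) Y) (FOb (yo T) Z) (FAr (yo T) g)"
          unfolding kernel_def car[OF R(6)] using ar_comp[OF R(5) h(1)] h(2) by (auto simp: yo_act yo_zero)
      qed
      show "kernel (FOb (yo T) Y) (FOb (yo T) Z) (FAr (yo T) g) \<subseteq> FAr (yo T) f ` carrier (FOb (yo T) X)"
      proof
        fix a assume "a \<in> kernel (FOb (yo T) Y) (FOb (yo T) Z) (FAr (yo T) g)"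
        then obtain h where h: "ar h Y T" "a = {h}" "h \<cdot> g = zr Z T"
          unfolding kernel_def car[OF R(6)] by (auto simp: yo_act yo_zero)
        obtain u where u: "ar u X T" "u \<cdot> f = h" using cok(4)[OF h(1,3)] by blast
        have "a = FAr (yo T) f {u}" by (simp add: yo_act u(2) h(2))
        then show "a \<in> FAr (yo T) f ` carrier (FOb (yo T) X)" unfolding car[OF R(1)] using u(1) by blast
      qed
    qed
    ultimately show ?thesis by blast
  qed
  then show ?thesis unfolding lex_objects_def using yo_mod[OF T] by simp
qed

text \<open>Restriction along a deflation is injective for a left exact functor, so such functors
  are separated.\<close>

lemma lex_locally_equal:
  assumes F: "F \<in> lex_objects C" and a: "el F W a" and b: "el F W b" and l: "loc_eq F W a b"
  shows "a = b"
proof -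
  obtain e V where e: "defl e V W" "FAr F e a = FAr F e b" using loc_eqE[OF l] .
  obtain Z \<delta> g where "realizes W Z \<delta> V g e" using e(1) unfolding defl_def by blast
  then have "conflation C Z V W g e" unfolding conflation_iff by blast
  then have "inj_on (FAr F e) (carrier (FOb F W))" using F unfolding lex_objects_def by blast
  then show ?thesis using e(2) elD(2)[OF a] elD(2)[OF b] by (simp add: inj_on_eq_iff)
qed

lemma abelian_lex:
  assumes ab: "is_abelian_category C"
  shows "equivalent_categories C (lex_cat C)"
proof -
  note kc = abelian_conflations_exact[OF ab]
  let ?L = "lex_cat C"
  have L: "Obj ?L = lex_objects C"
    "m \<in> arr ?L F G \<longleftrightarrow> (\<exists>\<eta>. m = (F, \<eta>, G) \<and> nt F G \<eta>)"
    "Ident ?L F = (F, nat_mk F (\<lambda>W a. a), F)"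
    "(G', \<theta>, H) \<cdot>\<^bsub>?L\<^esub> (F, \<eta>, G) = (F, nat_mk F (\<lambda>W a. \<theta> W (\<eta> W a)), H)"
    "(F', \<eta>, G') \<otimes>\<^bsub>Hom ?L F G\<^esub> (F'', \<theta>, G'') = (F, nat_mk F (\<lambda>W a. plus_at G W (\<eta> W a) (\<theta> W a)), G)"
    for F G H F' G' F'' G'' \<eta> \<theta> m
    by (auto simp: lex_cat_def presheaf_cat_def nat_mk_def)
  interpret L: lincat ?L
    unfolding lex_cat_def by (rule lincat_presheaf_cat[OF preadditive mod_psh[OF lex_mod]])
  have Y: "FOb (yoneda C) X = yo X" "ar f X Y \<Longrightarrow> FAr (yoneda C) f = (yo X, ymap f, yo Y)" for X Y f
    by (simp_all add: yoneda_def ymap_def ar_dom ar_cod)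
  have add: "additive_functor C ?L (yoneda C)"
    unfolding additive_functor_def
  proof (intro conjI ballI)
    fix X assume X: "X \<in> Obj C"
    show "FOb (yoneda C) X \<in> Obj ?L" using yo_lex[OF kc X] by (simp add: Y L)
    show "FAr (yoneda C) (Ident C X) = Ident ?L (FOb (yoneda C) X)"
      by (simp add: Y(1) Y(2)[OF ar_id[OF X]] L ymap_id[OF X])
    fix X' assume X': "X' \<in> Obj C"
    show "FAr (yoneda C) \<in> hom (Hom C X X') (Hom ?L (FOb (yoneda C) X) (FOb (yoneda C) X'))"
    proof (rule homI)
      fix f assume "f \<in> arr C X X'"
      then have f: "ar f X X'" using X X' by (simp add: ar_def)
      show "FAr (yoneda C) f \<in> arr ?L (FOb (yoneda C) X) (FOb (yoneda C) X')"
        by (simp add: Y(1) Y(2)[OF f] L nt_ymap[OF f])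
      fix g assume "g \<in> arr C X X'"
      then have g: "ar g X X'" using X X' by (simp add: ar_def)
      show "FAr (yoneda C) (add X X' f g) =
          FAr (yoneda C) f \<otimes>\<^bsub>Hom ?L (FOb (yoneda C) X) (FOb (yoneda C) X')\<^esub> FAr (yoneda C) g"
        by (simp add: Y(1) Y(2)[OF f] Y(2)[OF g] Y(2)[OF ar_add[OF f g]] L ymap_add[OF f g])
    qed
    fix X'' f g assume X'': "X'' \<in> Obj C" and "f \<in> arr C X X'" "g \<in> arr C X' X''"
    then have f: "ar f X X'" and g: "ar g X' X''" using X X' by (simp_all add: ar_def)
    show "FAr (yoneda C) (g \<cdot> f) = FAr (yoneda C) g \<cdot>\<^bsub>?L\<^esub> FAr (yoneda C) f"
      by (simp add: Y(2)[OF f] Y(2)[OF g] Y(2)[OF ar_comp[OF f g]] L ymap_comp[OF f g])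
  qed
  interpret YF: functor_pair C ?L "yoneda C" by unfold_locales (rule add)
  have ff: "fully_faithful C ?L (yoneda C)"
    unfolding fully_faithful_def
  proof (intro conjI add ballI)
    fix X X' assume X: "X \<in> Obj C" and X': "X' \<in> Obj C"
    have "inj_on (FAr (yoneda C)) (arr C X X')"
    proof (rule inj_onI)
      fix f g assume "f \<in> arr C X X'" "g \<in> arr C X X'" and e: "FAr (yoneda C) f = FAr (yoneda C) g"
      then have f: "ar f X X'" and g: "ar g X X'" using X X' by (simp_all add: ar_def)
      show "f = g" using ymap_inj[OF f g] e by (simp add: Y(2)[OF f] Y(2)[OF g])
    qed
    moreover have "\<exists>f. f \<in> arr C X X' \<and> FAr (yoneda C) f = m" if m: "m \<in> arr ?L (yo X) (yo X')" for m
    proof -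
      obtain \<eta> where \<eta>: "m = (yo X, \<eta>, yo X')" "nt (yo X) (yo X') \<eta>" using m by (auto simp: L(2))
      obtain f where "ar f X X'" "\<eta> = ymap f" using yo_fullE[OF X X' \<eta>(2)] .
      then show ?thesis using \<eta>(1) Y(2) by (auto simp: ar_def)
    qed
    moreover have "FAr (yoneda C) f \<in> arr ?L (yo X) (yo X')" if "f \<in> arr C X X'" for f
      using YF.E_ar[of f X X'] that X X' by (simp add: ar_def Y(1))
    ultimately show "bij_betw (FAr (yoneda C)) (arr C X X') (arr ?L (FOb (yoneda C) X) (FOb (yoneda C) X'))"
      unfolding bij_betw_def Y(1) by blast
  qed
  have "YF.ess"
    unfolding YF.ess_def L(1) Y(1)
  proof
    fix F assume F: "F \<in> lex_objects C"
    note FM = lex_mod[OF F] and pF = mod_psh[OF lex_mod[OF F]]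
    obtain T \<gamma> where T: "T \<in> Obj C" and \<gamma>: "nt F (yo T) \<gamma>" "loc_inj F \<gamma>" "loc_surj F (yo T) \<gamma>"
      using abelian_presentation[OF ab mod_fp[OF FM]] .
    note pT = psh_yo[OF T] and yl = yo_lex[OF kc T]
    have inj: "a = b" if "el F W a" "el F W b" "\<gamma> W a = \<gamma> W b" for W a b
      using lex_locally_equal[OF F that(1,2) loc_injD[OF \<gamma>(2) that]] .
    \<comment> \<open>A preimage exists on a deflation \<open>e\<close>. It vanishes on
      \<open>Z\<close>, because its image there is a multiple of \<open>e z = 0\<close> and the
      components of \<open>\<gamma>\<close> are injective. Left exactness of \<open>F\<close> then
      descends it to \<open>W\<close>.\<close>
    have sur: "\<exists>a. el F W a \<and> \<gamma> W a = b" if b: "el (yo T) W b" for W b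
    proof -
      obtain e V a where e: "defl e V W" and a: "el F V a" and ga: "\<gamma> V a = FAr (yo T) e b" using loc_surjE[OF \<gamma>(3) b] .
      note e0 = defl_ar[OF e]
      obtain Z \<delta> z where r: "realizes W Z \<delta> V z e" using e unfolding defl_def by blast
      note R = realizesD[OF r]
      note az = el_act[OF pF R(4) a]
      have "\<gamma> Z (FAr F z a) = FAr (yo T) (e \<cdot> z) b"
        unfolding nt_nat[OF \<gamma>(1) R(4) a] ga act_comp[OF pT R(4) e0 b] ..
      also have "\<dots> = \<gamma> Z (zero_at F Z)"
        unfolding realizes_comp_zero[OF r] act_zr[OF pT R(2) b] nt_zero[OF \<gamma>(1) pF pT R(2)] ..
      finally have "FAr F z a = zero_at F Z" by (rule inj[OF az el_zero[OF pF R(2)]])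
      then have "a \<in> kernel (FOb F V) (FOb F Z) (FAr F z)" using a by (simp add: kernel_def el_def)
      moreover have "conflation C Z V W z e" unfolding conflation_iff using r by blast
      ultimately have "a \<in> FAr F e ` carrier (FOb F W)" using F unfolding lex_objects_def by auto
      then obtain d where d: "el F W d" "a = FAr F e d" using R(1) by (auto simp: el_def)
      have "FAr (yo T) e (\<gamma> W d) = FAr (yo T) e b"
        unfolding ga[symmetric] d(2) by (rule nt_nat[OF \<gamma>(1) e0 d(1), symmetric])
      then have "\<gamma> W d = b" by (intro lex_locally_equal[OF yl nt_el[OF \<gamma>(1) d(1)] b] loc_eqI[OF e])
      then show ?thesis using d(1) by blast
    qed
    note iT = nt_id[OF pT]
    have ex: "\<exists>a. el F W a \<and> \<gamma> W a = nat_mk (yo T) (\<lambda>W a. a) W b" if "el (yo T) W b" for W b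
      using sur[OF that] that by (simp add: nat_mk_app)
    obtain u where u: "nt (yo T) F u" "\<And>W b. el (yo T) W b \<Longrightarrow> \<gamma> W (u W b) = nat_mk (yo T) (\<lambda>W a. a) W b"
      by (rule factor_mono[OF pT pF iT \<gamma>(1)]) (erule (2) inj, erule ex, (rule that; assumption))
    have u1: "\<gamma> W (u W b) = b" if "el (yo T) W b" for W b using u(2)[OF that] that by (simp add: nat_mk_app)
    have u2: "u W (\<gamma> W a) = a" if a: "el F W a" for W a
      by (rule inj[OF nt_el[OF u(1) nt_el[OF \<gamma>(1) a]] a u1[OF nt_el[OF \<gamma>(1) a]]])
    have "iso_arr ?L (yo T) F (yo T, u, F)"
      unfolding iso_arr_def
    proof (intro conjI bexI[of _ "(F, \<gamma>, yo T)"])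
      show "(yo T, u, F) \<in> arr ?L (yo T) F" "(F, \<gamma>, yo T) \<in> arr ?L F (yo T)" using u(1) \<gamma>(1) by (simp_all add: L)
      show "(F, \<gamma>, yo T) \<cdot>\<^bsub>?L\<^esub> (yo T, u, F) = Ident ?L (yo T)" by (simp add: L nat_mk_comp_eq_iff u1)
      show "(yo T, u, F) \<cdot>\<^bsub>?L\<^esub> (F, \<gamma>, yo T) = Ident ?L F" by (simp add: L nat_mk_comp_eq_iff u2)
    qed
    then show "\<exists>X\<in>Obj C. \<exists>i. iso_arr ?L (yo X) F i" using T by blast
  qed
  then show ?thesis unfolding equivalent_categories_def using YF.equivalence_if[OF ff] by blast
qed

section \<open>The two characterizations\<close>

lemma exact_iff: "exact_functor C D E \<and> fully_faithful C D E \<longleftrightarrow> is_exact_category C"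
proof
  assume "exact_functor C D E \<and> fully_faithful C D E"
  then show "is_exact_category C" unfolding is_exact_category_def using quillen_of_conflations_exact conflations_exact_of_exact_ff by blast
next
  assume "is_exact_category C"
  then have conflations_exact unfolding is_exact_category_def quillen_exact_def conflations_exact_def by (elim conjE)
  then show "exact_functor C D E \<and> fully_faithful C D E" using E_exact E_ff by blast
qed

lemma abelian_iff: "exact_equivalence C D E \<longleftrightarrow> is_abelian_category C"
proof
  assume "exact_equivalence C D E"
  then have eq: "is_equivalence C D E" and ex: "exact_functor C D E" unfolding exact_equivalence_def by auto
  note ff = EF.equivalenceD[OF eq]
  show "is_abelian_category C" by (rule abelian_of_equivalence[OF conflations_exact_of_exact_ff[OF ex ff(1)] ff])
next
  assume ab: "is_abelian_category C"
  note kc = abelian_conflations_exact[OF ab]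
  show "exact_equivalence C D E"
    unfolding exact_equivalence_def using EF.equivalence_if[OF E_ff[OF kc] abelian_ess[OF ab]] E_exact[OF kc] by blast
qed

end

theorem theorem1:
  fixes C :: "('o, 'm, 'e) extri"
  assumes "extriangulated C"
    and "has_weak_kernels C"
  shows "(exact_functor C (mod_quotient C) (E_functor C) \<and>
            fully_faithful C (mod_quotient C) (E_functor C)
          \<longleftrightarrow> is_exact_category C) \<and>
         (exact_equivalence C (mod_quotient C) (E_functor C) \<longleftrightarrow> is_abelian_category C) \<and>
         (is_abelian_category C \<longrightarrow> equivalent_categories C (lex_cat C))"
proof -
  have "additive_category C" using assms(1) by (simp add: extriangulated_def)
  moreover then have "preadditive C" by (simp add: additive_category_def)
  ultimately interpret ext_wk C by unfold_locales (use assms in simp_all)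
  show ?thesis unfolding mod_quotient_eq using exact_iff abelian_iff abelian_lex by blast
qed

end
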